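(* Let $G$ be a compact Hausdorff group. Every invariant algebra on $G$ is self-adjoint if and only if the centre of $G$ is profinite.
   Context: $C(G)$ is the Banach algebra of continuous complex functions on $G$ with the sup-norm. An invariant algebra on $G$ is a closed subalgebra of $C(G)$ that contains the constants and is invariant under all left and right translations. It is self-adjoint if it is closed under complex conjugation of functions. A compact Hausdorff group is profinite if every neighbourhood of its identity contains a normal subgroup of finite index. *)

theory Defs
  imports "HOL-Analysis.Analysis" "HOL-Algebra.Coset"
begin

locale compact_hausdorff_group = group G for G (structure) +
  fixes T :: "'a topology"
  assumes topspace_eq_carrier: "topspace T = carrier G"
    and continuous_mult: "continuous_map (prod_topology T T) T (\<lambda>(x, y). x \<otimes> y)"
    and continuous_inv: "continuous_map T T (\<lambda>x. inv x)"
    and compact: "compact_space T"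
    and hausdorff: "Hausdorff_space T"

locale profinite_group = compact_hausdorff_group +
  assumes small_normal_subgroups:
    "\<one> \<in> T interior_of U \<Longrightarrow> \<exists>N. N \<lhd> G \<and> finite (rcosets N) \<and> N \<subseteq> U"

definition centre :: "('a, 'b) monoid_scheme \<Rightarrow> 'a set" where
  "centre G = {z \<in> carrier G. \<forall>x \<in> carrier G. z \<otimes>\<^bsub>G\<^esub> x = x \<otimes>\<^bsub>G\<^esub> z}"

text \<open>
  The space \<open>C(X)\<close>: its points are the bounded continuous functions on \<open>X\<close>, made
  \<open>undefined\<close> outside \<open>topspace X\<close>, and its distance is the supremum distance. On a
  compact space boundedness is no restriction. The restricted abstractions below
  represent the pointwise operations on such functions.
\<close>

abbreviation complex_cfunspace :: "'a topology \<Rightarrow> ('a \<Rightarrow> complex) metric" where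
  "complex_cfunspace X \<equiv> cfunspace X euclidean_metric"

definition closed_unital_subalgebra :: "'a topology \<Rightarrow> ('a \<Rightarrow> complex) set \<Rightarrow> bool" where
  "closed_unital_subalgebra X A \<longleftrightarrow>
     closedin (mtopology_of (complex_cfunspace X)) A \<and>
     (\<forall>c. (\<lambda>x\<in>topspace X. c) \<in> A) \<and>
     (\<forall>f\<in>A. \<forall>g\<in>A. (\<lambda>x\<in>topspace X. f x + g x) \<in> A) \<and>
     (\<forall>f\<in>A. \<forall>g\<in>A. (\<lambda>x\<in>topspace X. f x * g x) \<in> A) \<and>
     (\<forall>c. \<forall>f\<in>A. (\<lambda>x\<in>topspace X. c * f x) \<in> A)"

definition invariant_algebra ::
  "('a, 'b) monoid_scheme \<Rightarrow> 'a topology \<Rightarrow> ('a \<Rightarrow> complex) set \<Rightarrow> bool" where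
  "invariant_algebra G T A \<longleftrightarrow>
     closed_unital_subalgebra T A \<and>
     (\<forall>a\<in>carrier G. \<forall>f\<in>A. (\<lambda>x\<in>carrier G. f (a \<otimes>\<^bsub>G\<^esub> x)) \<in> A) \<and>
     (\<forall>a\<in>carrier G. \<forall>f\<in>A. (\<lambda>x\<in>carrier G. f (x \<otimes>\<^bsub>G\<^esub> a)) \<in> A)"

definition self_adjoint :: "'a topology \<Rightarrow> ('a \<Rightarrow> complex) set \<Rightarrow> bool" where
  "self_adjoint X A \<longleftrightarrow> (\<forall>f\<in>A. (\<lambda>x\<in>topspace X. cnj (f x)) \<in> A)"

end

theory Submission
  imports Defs "Jordan_Normal_Form.Spectral_Radius"
begin

text \<open>
  Both conditions are equivalent to every character of \<open>G\<close> being of finite order.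

  If \<open>\<gamma>\<close> is a character of infinite order, the closure of the polynomials in \<open>\<gamma>\<close> is an invariant
  algebra; it does not contain \<open>cnj \<gamma>\<close>, because all positive powers of \<open>\<gamma>\<close> have mean zero.
  Conversely, an invariant algebra \<open>A\<close> is the closed span of finite-dimensional bi-invariant spaces, and
  for the representation \<open>\<rho>\<close> by translations on such a space both the entries of \<open>\<rho>\<close> and the character
  \<open>det \<rho>\<close> lie in \<open>A\<close>. If \<open>det \<rho>\<close> has finite order, its inverse is a power of it, so by Cramer's rule the
  conjugates of the entries of the unitary matrix \<open>\<rho>\<close> lie in \<open>A\<close> as well.

  The spaces can be chosen such that the centre acts on each of them by a scalar, and a power of this
  scalar is \<open>det \<rho>\<close>. If all characters have finite order, only finitely many scalars occur, and the
  common stabilisers of finitely many spaces are small subgroups of finite index in the centre.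

  A profinite group has only finite images under characters. So it remains to see that a
  character \<open>\<gamma>\<close> of \<open>G\<close> of infinite order is infinite on the centre. In a finite-dimensional
  bi-invariant space, measure the length of \<open>g\<close> by the distance of the translation by \<open>g\<close> from the identity; an
  element of minimal length in a coset of \<open>ker \<gamma>\<close> close to \<open>1\<close> almost commutes with everything, and has a
  power that moves \<open>\<gamma>\<close> by a prescribed amount. By compactness there are exactly central elements
  \<open>z\<close> with \<open>\<gamma> z\<close> arbitrarily close to \<open>1\<close> and different from \<open>1\<close>.
\<close>

section \<open>Continuous functions on a compact group\<close>

text \<open>The hardest step has an infinitesimal model. On the Lie algebra of a compact Lie group
  the derivative of \<gamma> is invariant under conjugation, so for an invariant inner product the
  orthogonal complement of its kernel is a line fixed by all conjugations, and it exponentiates into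
  the centre. For general G only finitely many coordinates are visible at a time and no exponential
  map is at hand. Hence the complement is replaced by a shortest element of a coset, uniqueness of
  the nearest point by the parallelogram law, and one-parameter subgroups by powers with
  second-order errors.

  The analysis stays inside C(G), with a mean obtained from finite averages of translates. C(G) is
  in general not complete for the L2 norm; whenever a limit is needed, convolution with a continuous
  kernel turns L2 estimates into uniform ones. The kernels are class functions, so their eigenspaces
  are invariant from both sides. These spaces may be reducible: scalar action of the centre is
  reached by shrinking them, not by Schur's lemma.\<close>

lemma cmod_sum_diff_le:
  fixes u v :: "'b \<Rightarrow> complex"
  assumes "\<And>x y. x \<in> S \<Longrightarrow> y \<in> S' \<Longrightarrow> cmod (u x - v y) \<le> D" "card S = card S'" "finite S" "finite S'"
  shows "cmod (sum u S - sum v S') \<le> real (card S) * D"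
proof -
  obtain h where h: "bij_betw h S S'"
    using finite_same_card_bij[OF assms(3,4,2)] by blast
  have "sum v S' = (\<Sum>x\<in>S. v (h x))"
    using sum.reindex_bij_betw[OF h, of v] by simp
  then have "cmod (sum u S - sum v S') \<le> (\<Sum>x\<in>S. cmod (u x - v (h x)))"
    by (simp add: sum_subtractf[symmetric] norm_sum)
  also have "\<dots> \<le> (\<Sum>x\<in>S. D)"
    using h by (intro sum_mono assms) (auto simp: bij_betw_def)
  finally show ?thesis by simp
qed

context compact_hausdorff_group
begin

text \<open>Functions are total and arbitrary off the carrier, so pointwise operations and
  translations are plain lambda terms. In return, equality of functions is mostly replaced by
  agreement on the carrier.\<close>

definition C_G :: "('a \<Rightarrow> complex) set" where
  "C_G = {f. continuous_map T euclidean f}"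

lemma C_G_localI:
  assumes "\<And>x e. x \<in> carrier G \<Longrightarrow> e > 0 \<Longrightarrow>
    \<exists>U. openin T U \<and> x \<in> U \<and> (\<forall>y\<in>U. cmod (f y - f x) < e)"
  shows "f \<in> C_G"
  unfolding C_G_def continuous_map_def mem_Collect_eq
proof (intro conjI allI impI)
  fix V :: "complex set"
  assume "openin euclidean V"
  then have V: "open V" by simp
  show "openin T {x \<in> topspace T. f x \<in> V}"
    unfolding openin_subopen[of T "{x \<in> topspace T. f x \<in> V}"]
  proof safe
    fix x assume x: "x \<in> topspace T" "f x \<in> V"
    then obtain e where e: "e > 0" "\<And>z. dist z (f x) < e \<Longrightarrow> z \<in> V"
      using V by (auto simp: open_dist)
    from x obtain U where "openin T U" "x \<in> U" "\<forall>y\<in>U. cmod (f y - f x) < e"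
      using assms e(1) topspace_eq_carrier by metis
    then show "\<exists>U. openin T U \<and> x \<in> U \<and> U \<subseteq> {x \<in> topspace T. f x \<in> V}"
      using e(2) openin_subset[of T U] by (intro exI[of _ U]) (auto simp: dist_norm)
  qed
qed auto

lemma C_G_localD:
  assumes "f \<in> C_G" "x \<in> carrier G" "e > 0"
  shows "\<exists>U. openin T U \<and> x \<in> U \<and> (\<forall>y\<in>U. cmod (f y - f x) < e)"
proof -
  have "openin T {y \<in> topspace T. f y \<in> ball (f x) e}"
    using assms(1) unfolding C_G_def by (intro openin_continuous_map_preimage[of T euclidean]) auto
  moreover have "x \<in> {y \<in> topspace T. f y \<in> ball (f x) e}"
    using assms topspace_eq_carrier by auto
  ultimately show ?thesis
    by (intro exI[of _ "{y \<in> topspace T. f y \<in> ball (f x) e}"])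
      (auto simp: dist_norm norm_minus_commute)
qed

lemma C_G_cong:
  assumes "f \<in> C_G" "\<And>x. x \<in> carrier G \<Longrightarrow> f x = g x"
  shows "g \<in> C_G"
  using assms topspace_eq_carrier unfolding C_G_def by (auto intro: continuous_map_eq)

section \<open>Closure of \<open>C_G\<close> under pointwise operations, translations and
  inversion\<close>

lemma continuous_map_group_mult:
  assumes "continuous_map X T p" "continuous_map X T q"
  shows "continuous_map X T (\<lambda>z. p z \<otimes> q z)"
proof -
  have "continuous_map X (prod_topology T T) (\<lambda>z. (p z, q z))"
    using assms by (simp add: continuous_map_pairedI)
  from continuous_map_compose[OF this continuous_mult] show ?thesis
    by (simp add: o_def)
qed

lemma continuous_map_group_inv:
  assumes "continuous_map X T p"
  shows "continuous_map X T (\<lambda>z. inv (p z))"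
  using continuous_map_compose[OF assms continuous_inv] by (simp add: o_def)

lemma continuous_map_C_G:
  assumes "f \<in> C_G" "continuous_map X T p"
  shows "continuous_map X euclidean (\<lambda>z. f (p z))"
  using continuous_map_compose[OF assms(2)] assms(1) unfolding C_G_def by (auto simp: o_def)

lemma continuous_map_group_const: "a \<in> carrier G \<Longrightarrow> continuous_map X T (\<lambda>z. a)"
  by (simp add: topspace_eq_carrier)

lemma continuous_map_complex_mult:
  fixes f g :: "'z \<Rightarrow> complex"
  assumes "continuous_map X euclidean f" "continuous_map X euclidean g"
  shows "continuous_map X euclidean (\<lambda>x. f x * g x)"
proof -
  have "continuous_map X (prod_topology euclidean euclidean) (\<lambda>z. (f z, g z))"
    by (intro continuous_map_pairedI assms)
  then have 1: "continuous_map X euclidean (\<lambda>z. (f z, g z))"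
    by (simp only: prod_topology_euclidean)
  have "continuous_map euclidean euclidean (\<lambda>p::complex\<times>complex. fst p * snd p)"
    by (auto intro!: continuous_intros)
  from continuous_map_compose[OF 1 this] show ?thesis by (simp add: o_def)
qed

lemma continuous_map_complex_cnj:
  assumes "continuous_map X euclidean f"
  shows "continuous_map X euclidean (\<lambda>x. cnj (f x))"
proof -
  have "continuous_map euclidean euclidean cnj"
    by (auto intro!: continuous_intros)
  from continuous_map_compose[OF assms this] show ?thesis by (simp add: o_def)
qed

lemma continuous_map_fst_comp:
  "continuous_map X (prod_topology Y Z) p \<Longrightarrow> continuous_map X Y (\<lambda>z. fst (p z))"
  using continuous_map_compose[of X "prod_topology Y Z" p _ fst] by (simp add: o_def continuous_map_fst)

lemma continuous_map_snd_comp: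
  "continuous_map X (prod_topology Y Z) p \<Longrightarrow> continuous_map X Z (\<lambda>z. snd (p z))"
  using continuous_map_compose[of X "prod_topology Y Z" p _ snd] by (simp add: o_def continuous_map_snd)

lemmas group_continuous_intros =
  continuous_map_group_mult continuous_map_group_inv continuous_map_group_const
  continuous_map_complex_mult continuous_map_complex_cnj
  continuous_map_id[unfolded id_def] continuous_map_fst_comp continuous_map_snd_comp

lemma C_G_const [simp]: "(\<lambda>x. c) \<in> C_G"
  by (simp add: C_G_def)

lemma C_G_add: "f \<in> C_G \<Longrightarrow> g \<in> C_G \<Longrightarrow> (\<lambda>x. f x + g x) \<in> C_G"
  unfolding C_G_def by (auto intro!: continuous_map_add)

lemma C_G_diff: "f \<in> C_G \<Longrightarrow> g \<in> C_G \<Longrightarrow> (\<lambda>x. f x - g x) \<in> C_G"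
  unfolding C_G_def by (auto intro!: continuous_map_diff)

lemma C_G_mult: "f \<in> C_G \<Longrightarrow> g \<in> C_G \<Longrightarrow> (\<lambda>x. f x * g x) \<in> C_G"
  unfolding C_G_def by (auto intro!: continuous_map_complex_mult)

lemma C_G_cnj: "f \<in> C_G \<Longrightarrow> (\<lambda>x. cnj (f x)) \<in> C_G"
  unfolding C_G_def by (auto intro!: continuous_map_complex_cnj)

lemma C_G_sum: "finite S \<Longrightarrow> (\<And>i. i \<in> S \<Longrightarrow> f i \<in> C_G) \<Longrightarrow> (\<lambda>x. \<Sum>i\<in>S. f i x) \<in> C_G"
  by (induction S rule: finite_induct) (auto intro: C_G_add)

lemma C_G_power: "f \<in> C_G \<Longrightarrow> (\<lambda>x. f x ^ n) \<in> C_G"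
  by (induction n) (auto intro: C_G_mult)

lemma C_G_left:
  assumes "f \<in> C_G" "a \<in> carrier G"
  shows "(\<lambda>x. f (a \<otimes> x)) \<in> C_G"
proof -
  have "continuous_map T T (\<lambda>x. a \<otimes> x)"
    by (intro group_continuous_intros assms)
  from continuous_map_C_G[OF assms(1) this] show ?thesis by (simp add: C_G_def)
qed

lemma C_G_right:
  assumes "f \<in> C_G" "a \<in> carrier G"
  shows "(\<lambda>x. f (x \<otimes> a)) \<in> C_G"
proof -
  have "continuous_map T T (\<lambda>x. x \<otimes> a)"
    by (intro group_continuous_intros assms)
  from continuous_map_C_G[OF assms(1) this] show ?thesis by (simp add: C_G_def)
qed

lemma C_G_inv:
  assumes "f \<in> C_G"
  shows "(\<lambda>x. f (inv x)) \<in> C_G"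
proof -
  have "continuous_map T T (\<lambda>x. inv x)"
    by (intro group_continuous_intros assms)
  from continuous_map_C_G[OF assms(1) this] show ?thesis by (simp add: C_G_def)
qed

lemma C_G_bounded:
  assumes "f \<in> C_G"
  obtains B where "B > 0" "\<And>x. x \<in> carrier G \<Longrightarrow> cmod (f x) \<le> B"
proof -
  have "compactin euclidean (f ` topspace T)"
    using image_compactin[of T "topspace T" euclidean f] compact assms
    unfolding compact_space_def C_G_def by auto
  then have "bounded (f ` carrier G)"
    using compact_imp_bounded topspace_eq_carrier by auto
  then show ?thesis
    using that unfolding bounded_pos by blast
qed

section \<open>Uniform continuity and finite nets from compactness\<close>

text \<open>Tube lemma: the points where \<open>F x' y\<close> is close to \<open>F x y\<close> form
  an open neighbourhood of the slice over \<open>x\<close>, and compactness of the second factor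
  puts a whole tube inside it.\<close>

lemma jointly_continuous_local:
  fixes F :: "'a \<Rightarrow> 'y \<Rightarrow> complex"
  assumes F: "continuous_map (prod_topology T Y) euclidean (\<lambda>(x, y). F x y)"
    and Y: "compact_space Y" and x: "x \<in> carrier G" and e: "e > 0"
  shows "\<exists>U. openin T U \<and> x \<in> U \<and> (\<forall>x'\<in>U. \<forall>y\<in>topspace Y. cmod (F x' y - F x y) < e)"
proof -
  have "continuous_map (prod_topology T Y) (prod_topology T Y) (\<lambda>(x', y). (x, y))"
    using x topspace_eq_carrier
    by (auto simp: case_prod_unfold continuous_map_snd intro!: continuous_map_pairedI)
  from continuous_map_compose[OF this F]
  have "continuous_map (prod_topology T Y) euclidean (\<lambda>(x', y). F x y)"
    by (simp add: o_def case_prod_unfold)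
  from continuous_map_diff[OF F this]
  have "continuous_map (prod_topology T Y) euclidean (\<lambda>p. F (fst p) (snd p) - F x (snd p))"
    by (simp add: case_prod_unfold)
  from openin_continuous_map_preimage[OF this, of "ball 0 e"]
  have W: "openin (prod_topology T Y)
      {p \<in> topspace (prod_topology T Y). F (fst p) (snd p) - F x (snd p) \<in> ball 0 e}" (is "openin _ ?W")
    by simp
  have C: "compactin Y (topspace Y)" using Y by (simp add: compact_space_def)
  have x': "x \<in> topspace T" using x topspace_eq_carrier by simp
  have "{x} \<times> topspace Y \<subseteq> ?W"
    using x' e by auto
  from tube_lemma_right[OF W C x' this]
  obtain U V where UV: "openin T U" "x \<in> U" "topspace Y \<subseteq> V" "U \<times> V \<subseteq> ?W"
    by blast
  have "cmod (F x' y - F x y) < e" if "x' \<in> U" "y \<in> topspace Y" for x' y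
  proof -
    have "(x', y) \<in> ?W" using UV(3,4) that by blast
    then show ?thesis by simp
  qed
  then show ?thesis using UV(1,2) by blast
qed

lemma compact_finite_net:
  assumes "\<And>x. x \<in> carrier G \<Longrightarrow> \<exists>U. openin T U \<and> x \<in> U \<and> (\<forall>x'\<in>U. P x x')"
  obtains Y where "finite Y" "Y \<subseteq> carrier G" "\<forall>x\<in>carrier G. \<exists>y\<in>Y. P y x"
proof -
  obtain U where U: "\<And>x. x \<in> carrier G \<Longrightarrow> openin T (U x) \<and> x \<in> U x \<and> (\<forall>x'\<in>U x. P x x')"
    using assms by metis
  have "\<forall>V\<in>U ` carrier G. openin T V" "topspace T \<subseteq> \<Union>(U ` carrier G)"
    using U topspace_eq_carrier by auto
  then obtain \<F> where "finite \<F>" "\<F> \<subseteq> U ` carrier G" "topspace T \<subseteq> \<Union>\<F>"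
    using compact unfolding compact_space_alt by meson
  then obtain Y where Y: "finite Y" "Y \<subseteq> carrier G" "topspace T \<subseteq> \<Union>(U ` Y)"
    by (metis finite_subset_image)
  show ?thesis
  proof (rule that[OF Y(1,2)], rule ballI)
    fix x assume "x \<in> carrier G"
    then obtain y where "y \<in> Y" "x \<in> U y"
      using Y topspace_eq_carrier by auto
    then show "\<exists>y\<in>Y. P y x" using U Y(2) by blast
  qed
qed

lemma compact_space_square: "compact_space (prod_topology T T)"
  using compact by (simp add: compact_space_prod_topology)

text \<open>The pair \<open>(a, b)\<close> is one parameter in the compact space of pairs.
  Uniformity in both at once lets a single net survive right averaging and controls two-sided
  translates in \<open>displacement\<close>.\<close>

lemma translation_local:
  assumes f: "f \<in> C_G" and x: "x \<in> carrier G" and e: "e > 0"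
  shows "\<exists>U. openin T U \<and> x \<in> U \<and> (\<forall>x'\<in>U. \<forall>a\<in>carrier G. \<forall>b\<in>carrier G.
    cmod (f (a \<otimes> x' \<otimes> b) - f (a \<otimes> x \<otimes> b)) < e)"
proof -
  let ?X = "prod_topology T (prod_topology T T)"
  have "continuous_map ?X (prod_topology T T) snd" by (rule continuous_map_snd)
  then have 1: "continuous_map ?X T (\<lambda>p. fst (snd p))" and 2: "continuous_map ?X T (\<lambda>p. snd (snd p))"
    by (rule continuous_map_fst_comp, rule continuous_map_snd_comp)
  have 3: "continuous_map ?X T fst" by (rule continuous_map_fst)
  have "continuous_map ?X euclidean (\<lambda>p. f (fst (snd p) \<otimes> fst p \<otimes> snd (snd p)))"
    by (rule continuous_map_C_G[OF f continuous_map_group_mult[OF continuous_map_group_mult[OF 1 3] 2]])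
  then have "continuous_map ?X euclidean (\<lambda>(x, y). f (fst y \<otimes> x \<otimes> snd y))"
    by (simp only: case_prod_unfold)
  note * = jointly_continuous_local[of "prod_topology T T" "\<lambda>x y. f (fst y \<otimes> x \<otimes> snd y)",
      OF this compact_space_square x e]
  obtain U where "openin T U" "x \<in> U" and U: "\<forall>x'\<in>U. \<forall>y\<in>carrier G \<times> carrier G.
      cmod (f (fst y \<otimes> x' \<otimes> snd y) - f (fst y \<otimes> x \<otimes> snd y)) < e"
    using * unfolding topspace_prod_topology topspace_eq_carrier by (elim exE conjE)
  show ?thesis
  proof (intro exI[of _ U] conjI ballI)
    fix x' a b assume "x' \<in> U" "a \<in> carrier G" "b \<in> carrier G"
    then show "cmod (f (a \<otimes> x' \<otimes> b) - f (a \<otimes> x \<otimes> b)) < e"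
      using bspec[OF bspec[OF U], of x' "(a, b)"] by simp
  qed fact+
qed

lemma translation_net:
  assumes f: "f \<in> C_G" and e: "e > 0"
  obtains Y where "finite Y" "Y \<subseteq> carrier G"
    "\<forall>x\<in>carrier G. \<exists>y\<in>Y. \<forall>a\<in>carrier G. \<forall>b\<in>carrier G.
      cmod (f (a \<otimes> x \<otimes> b) - f (a \<otimes> y \<otimes> b)) < e"
  by (rule compact_finite_net[of "\<lambda>y x. \<forall>a\<in>carrier G. \<forall>b\<in>carrier G.
    cmod (f (a \<otimes> x \<otimes> b) - f (a \<otimes> y \<otimes> b)) < e", OF translation_local[OF f _ e]])

end

section \<open>The invariant mean\<close>

text \<open>Lists instead of finite sets: repetitions act as weights, and \<open>list_times\<close>
  merges two successive averages into one.\<close>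

definition avg :: "'b list \<Rightarrow> ('b \<Rightarrow> complex) \<Rightarrow> complex" where
  "avg A u = (\<Sum>a\<leftarrow>A. u a) / of_nat (length A)"

lemma avg_const: "A \<noteq> [] \<Longrightarrow> avg A (\<lambda>a. c) = c"
  by (simp add: avg_def sum_list_triv)

lemma avg_add: "avg A (\<lambda>a. u a + v a) = avg A u + avg A v"
  by (simp add: avg_def sum_list_addf add_divide_distrib)

lemma avg_diff: "avg A (\<lambda>a. u a - v a) = avg A u - avg A v"
  by (simp add: avg_def sum_list_subtractf diff_divide_distrib)

lemma avg_mult: "avg A (\<lambda>a. c * u a) = c * avg A u"
  by (simp add: avg_def sum_list_const_mult)

lemma avg_cnj: "avg A (\<lambda>a. cnj (u a)) = cnj (avg A u)"
proof -
  have "(\<Sum>a\<leftarrow>A. cnj (u a)) = cnj (\<Sum>a\<leftarrow>A. u a)" by (induction A) auto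
  then show ?thesis by (simp add: avg_def)
qed

lemma avg_cong: "(\<And>a. a \<in> set A \<Longrightarrow> u a = v a) \<Longrightarrow> avg A u = avg A v"
  unfolding avg_def by (metis map_cong)

lemma avg_norm_le:
  assumes "A \<noteq> []" "\<And>a. a \<in> set A \<Longrightarrow> cmod (u a) \<le> e"
  shows "cmod (avg A u) \<le> e"
proof -
  have "cmod (\<Sum>a\<leftarrow>A. u a) \<le> real (length A) * e"
    using assms(2)
  proof (induction A)
    case (Cons a A)
    then have "cmod (\<Sum>a\<leftarrow>A. u a) \<le> real (length A) * e" "cmod (u a) \<le> e" by auto
    then show ?case using norm_triangle_ineq[of "u a" "\<Sum>a\<leftarrow>A. u a"]
      by (simp add: algebra_simps)
  qed auto
  then show ?thesis using assms(1)
    by (simp add: avg_def norm_divide divide_le_eq mult.commute)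
qed

lemma avg_near:
  assumes "A \<noteq> []" "\<And>a. a \<in> set A \<Longrightarrow> cmod (u a - v a) \<le> e"
  shows "cmod (avg A u - avg A v) \<le> e"
  using avg_norm_le[of A "\<lambda>a. u a - v a" e] assms by (simp add: avg_diff)

lemma avg_near_const:
  assumes "A \<noteq> []" "\<And>a. a \<in> set A \<Longrightarrow> cmod (u a - c) \<le> e"
  shows "cmod (avg A u - c) \<le> e"
  using avg_near[of A u "\<lambda>_. c" e] assms by (simp add: avg_const)

lemma sum_list_divide: "(\<Sum>x\<leftarrow>X. f x / c) = (\<Sum>x\<leftarrow>X. f x) / (c :: complex)"
  by (induction X) (auto simp: add_divide_distrib)

lemma avg_swap: "avg A (\<lambda>a. avg B (u a)) = avg B (\<lambda>b. avg A (\<lambda>a. u a b))"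
proof -
  have "(\<Sum>a\<leftarrow>A. \<Sum>b\<leftarrow>B. u a b) = (\<Sum>b\<leftarrow>B. \<Sum>a\<leftarrow>A. u a b)"
    by (induction A) (auto simp: sum_list_addf)
  then show ?thesis by (simp add: avg_def sum_list_divide mult.commute)
qed

definition list_times :: "('b \<Rightarrow> 'b \<Rightarrow> 'b) \<Rightarrow> 'b list \<Rightarrow> 'b list \<Rightarrow> 'b list" where
  "list_times m B A = concat (map (\<lambda>b. map (m b) A) B)"

lemma avg_list_times: "avg (list_times m B A) u = avg B (\<lambda>b. avg A (\<lambda>a. u (m b a)))"
proof -
  have 1: "(\<Sum>c\<leftarrow>list_times m B A. u c) = (\<Sum>b\<leftarrow>B. \<Sum>a\<leftarrow>A. u (m b a))"
    by (induction B) (auto simp: list_times_def o_def)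
  have 2: "length (list_times m B A) = length B * length A"
    by (induction B) (auto simp: list_times_def)
  show ?thesis by (simp add: avg_def sum_list_divide 1 2 mult.commute)
qed

lemma set_list_times: "set (list_times m B A) = (\<lambda>(b, a). m b a) ` (set B \<times> set A)"
  by (auto simp: list_times_def)

lemma list_times_Nil_iff: "list_times m B A = [] \<longleftrightarrow> B = [] \<or> A = []"
  by (auto simp: list_times_def)

lemma avg_map: "avg (map h A) u = avg A (\<lambda>a. u (h a))"
  by (simp add: avg_def o_def)

context compact_hausdorff_group
begin

definition glist :: "'a list \<Rightarrow> bool" where
  "glist A \<longleftrightarrow> A \<noteq> [] \<and> set A \<subseteq> carrier G"

lemma glistD: "glist A \<Longrightarrow> A \<noteq> []" "glist A \<Longrightarrow> a \<in> set A \<Longrightarrow> a \<in> carrier G"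
  by (auto simp: glist_def)

lemma glist_times: "glist A \<Longrightarrow> glist B \<Longrightarrow> glist (list_times (\<otimes>) A B)"
  by (auto simp: glist_def set_list_times list_times_Nil_iff)

lemma C_G_avg:
  assumes "\<And>a. a \<in> set A \<Longrightarrow> (\<lambda>x. u x a) \<in> C_G"
  shows "(\<lambda>x. avg A (u x)) \<in> C_G"
proof -
  have "(\<lambda>x. \<Sum>a\<leftarrow>A. u x a) \<in> C_G"
    using assms by (induction A) (auto intro: C_G_add)
  then have "(\<lambda>x. (1 / of_nat (length A)) * (\<Sum>a\<leftarrow>A. u x a)) \<in> C_G"
    by (intro C_G_mult) auto
  then show ?thesis by (simp add: avg_def)
qed

definition ravg :: "'a list \<Rightarrow> ('a \<Rightarrow> complex) \<Rightarrow> 'a \<Rightarrow> complex" where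
  "ravg A f x = avg A (\<lambda>a. f (x \<otimes> a))"

definition ravg_near :: "('a \<Rightarrow> complex) \<Rightarrow> complex \<Rightarrow> real \<Rightarrow> 'a list \<Rightarrow> bool" where
  "ravg_near f c e A \<longleftrightarrow> glist A \<and> (\<forall>x\<in>carrier G. cmod (ravg A f x - c) \<le> e)"

definition lavg :: "'a list \<Rightarrow> ('a \<Rightarrow> complex) \<Rightarrow> 'a \<Rightarrow> complex" where
  "lavg A f x = avg A (\<lambda>a. f (a \<otimes> x))"

definition lavg_near :: "('a \<Rightarrow> complex) \<Rightarrow> complex \<Rightarrow> real \<Rightarrow> 'a list \<Rightarrow> bool" where
  "lavg_near f c e A \<longleftrightarrow> glist A \<and> (\<forall>x\<in>carrier G. cmod (lavg A f x - c) \<le> e)"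

lemma C_G_ravg: "f \<in> C_G \<Longrightarrow> glist A \<Longrightarrow> ravg A f \<in> C_G"
  unfolding ravg_def[abs_def] by (intro C_G_avg C_G_right) (auto simp: glist_def subset_iff)

lemma ravg_times:
  assumes "glist A" "glist B" "x \<in> carrier G"
  shows "ravg (list_times (\<otimes>) B A) f x = ravg B (ravg A f) x"
  unfolding ravg_def avg_list_times
  using assms by (intro avg_cong) (auto simp: m_assoc simp: glist_def subset_iff)

text \<open>Two summands always nearly cancel: \<open>x \<otimes> y1\<close> equals
  \<open>x' \<otimes> z\<close>, and the net has a point \<open>y2\<close> close to
  \<open>z\<close>. The remaining \<open>card Y - 1\<close> summands, paired in any way, differ by
  at most \<open>D\<close> each. So the oscillation shrinks by a fixed factor, up to a small
  error.\<close>

lemma ravg_contraction: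
  assumes Y: "finite Y" "Y \<subseteq> carrier G"
    and net: "\<And>x. x \<in> carrier G \<Longrightarrow> \<exists>y\<in>Y. \<forall>a\<in>carrier G. cmod (g (a \<otimes> x) - g (a \<otimes> y)) \<le> e"
    and D: "\<And>x y. x \<in> carrier G \<Longrightarrow> y \<in> carrier G \<Longrightarrow> cmod (g x - g y) \<le> D"
    and ys: "set ys = Y" "distinct ys"
    and x: "x \<in> carrier G" "x' \<in> carrier G"
  shows "cmod (ravg ys g x - ravg ys g x') \<le> (1 - 1 / card Y) * D + e / card Y"
proof -
  obtain y1 where y1: "y1 \<in> Y" "y1 \<in> carrier G" using net[OF one_closed] Y by auto
  define z where "z = inv x' \<otimes> (x \<otimes> y1)"
  have z: "z \<in> carrier G" "x' \<otimes> z = x \<otimes> y1"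
    using x y1 by (auto simp: z_def m_assoc[symmetric])
  obtain y2 where y2: "y2 \<in> Y" "y2 \<in> carrier G" "cmod (g (x \<otimes> y1) - g (x' \<otimes> y2)) \<le> e"
    using net[OF z(1)] z(2) x Y by (metis subsetD)
  have c0: "card Y > 0" using y1 Y card_gt_0_iff by blast
  have "cmod ((\<Sum>y\<in>Y - {y1}. g (x \<otimes> y)) - (\<Sum>y\<in>Y - {y2}. g (x' \<otimes> y))) \<le> real (card (Y - {y1})) * D"
    using Y x y1 y2 by (intro cmod_sum_diff_le D) auto
  then have 1: "cmod ((\<Sum>y\<in>Y - {y1}. g (x \<otimes> y)) - (\<Sum>y\<in>Y - {y2}. g (x' \<otimes> y))) \<le> (card Y - 1) * D"
    using Y y1 by simp
  have "(\<Sum>y\<in>Y. g (x \<otimes> y)) - (\<Sum>y\<in>Y. g (x' \<otimes> y)) =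
      (g (x \<otimes> y1) - g (x' \<otimes> y2)) + ((\<Sum>y\<in>Y - {y1}. g (x \<otimes> y)) - (\<Sum>y\<in>Y - {y2}. g (x' \<otimes> y)))"
    by (subst sum.remove[OF Y(1) y1(1)], subst sum.remove[OF Y(1) y2(1), of "\<lambda>y. g (x' \<otimes> y)"]) simp
  then have "cmod ((\<Sum>y\<in>Y. g (x \<otimes> y)) - (\<Sum>y\<in>Y. g (x' \<otimes> y))) \<le> e + (card Y - 1) * D"
    using 1 y2(3) by (metis add_mono norm_triangle_le)
  then have "cmod (((\<Sum>y\<in>Y. g (x \<otimes> y)) - (\<Sum>y\<in>Y. g (x' \<otimes> y))) / card Y) \<le> (e + (card Y - 1) * D) / card Y"
    by (simp add: norm_divide divide_right_mono)
  also have "(e + (card Y - 1) * D) / card Y = (1 - 1 / card Y) * D + e / card Y"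
    using c0 by (simp add: field_simps of_nat_diff)
  finally show ?thesis
    using ys by (simp add: ravg_def avg_def sum_list_distinct_conv_sum_set distinct_card[symmetric] diff_divide_distrib)
qed

lemma ravg_nearly_constant:
  assumes f: "f \<in> C_G" and e: "e > 0"
  shows "\<exists>A c. ravg_near f c e A"
proof -
  define e' where "e' = e / 2"
  have e': "e' > 0" using e by (simp add: e'_def)
  obtain Y where Y: "finite Y" "Y \<subseteq> carrier G"
    and net0: "\<forall>x\<in>carrier G. \<exists>y\<in>Y. \<forall>a\<in>carrier G. \<forall>b\<in>carrier G.
      cmod (f (a \<otimes> x \<otimes> b) - f (a \<otimes> y \<otimes> b)) < e'"
    by (rule translation_net[OF f e'])
  note net = bspec[OF net0]
  have Y0: "Y \<noteq> {}" using net[OF one_closed] by auto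
  define N where "N = real (card Y)"
  have N: "N \<ge> 1" using Y Y0 card_gt_0_iff[of Y] by (simp add: N_def Suc_leI)
  define q where "q = 1 - 1 / N"
  have q: "0 \<le> q" "q < 1" using N by (auto simp: q_def)
  obtain ys where ys: "set ys = Y" "distinct ys" using finite_distinct_list[OF Y(1)] by blast
  have gys: "glist ys" using ys Y Y0 by (auto simp: glist_def)
  obtain B where B: "B > 0" "\<And>x. x \<in> carrier G \<Longrightarrow> cmod (f x) \<le> B" using C_G_bounded[OF f] by blast
  have step: "\<exists>A. glist A \<and> (\<forall>x\<in>carrier G. \<forall>y\<in>carrier G.
      cmod (ravg A f x - ravg A f y) \<le> q ^ k * (2 * B) + e')" for k
  proof (induction k)
    case 0
    have "cmod (f x - f y) \<le> 2 * B + e'" if "x \<in> carrier G" "y \<in> carrier G" for x y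
      using norm_triangle_ineq4[of "f x" "f y"] B(2)[OF that(1)] B(2)[OF that(2)] e' by linarith
    then show ?case by (intro exI[of _ "[\<one>]"]) (auto simp: glist_def ravg_def avg_def)
  next
    case (Suc k)
    then obtain A where A: "glist A" "\<And>x y. x\<in>carrier G \<Longrightarrow> y\<in>carrier G \<Longrightarrow>
      cmod (ravg A f x - ravg A f y) \<le> q ^ k * (2 * B) + e'" by blast
    \<comment> \<open>The net of \<open>f\<close> serves every right average of \<open>f\<close>,
      because it is uniform in the factor on the right. Hence the contraction factor is the same in
      every round.\<close>
    have net': "\<exists>y\<in>Y. \<forall>a\<in>carrier G. cmod (ravg A f (a \<otimes> x) - ravg A f (a \<otimes> y)) \<le> e'"
      if x: "x \<in> carrier G" for x
    proof -
      obtain y where "y \<in> Y" and y: "\<And>a b. a\<in>carrier G \<Longrightarrow> b\<in>carrier G \<Longrightarrow>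
        cmod (f (a \<otimes> x \<otimes> b) - f (a \<otimes> y \<otimes> b)) < e'"
        using net[OF x] by blast
      moreover have "cmod (ravg A f (a \<otimes> x) - ravg A f (a \<otimes> y)) \<le> e'" if "a \<in> carrier G" for a
        unfolding ravg_def using A(1) y x that by (intro avg_near) (auto simp: glist_def subset_iff intro: less_imp_le)
      ultimately show ?thesis by blast
    qed
    have "cmod (ravg (list_times (\<otimes>) ys A) f x - ravg (list_times (\<otimes>) ys A) f y) \<le> q ^ Suc k * (2 * B) + e'"
      if "x \<in> carrier G" "y \<in> carrier G" for x y
    proof -
      have "cmod (ravg ys (ravg A f) x - ravg ys (ravg A f) y) \<le>
          (1 - 1 / card Y) * (q ^ k * (2 * B) + e') + e' / card Y"
        by (rule ravg_contraction[OF Y net' A(2) ys that])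
      \<comment> \<open>The error \<open>e'\<close> is the fixed point of
        \<open>D \<mapsto> q * D + (1 - q) * e'\<close>, so it does not accumulate.\<close>
      also have "\<dots> = q ^ Suc k * (2 * B) + e'"
        using N by (simp add: q_def N_def field_simps)
      finally show ?thesis using that A(1) gys by (simp add: ravg_times)
    qed
    then show ?case using glist_times[OF gys A(1)] by blast
  qed
  obtain k where k: "q ^ k < e' / (2 * B)"
    using real_arch_pow_inv[of "e' / (2 * B)" q] q e' B by auto
  obtain A where A: "glist A" "\<And>x y. x\<in>carrier G \<Longrightarrow> y\<in>carrier G \<Longrightarrow>
      cmod (ravg A f x - ravg A f y) \<le> q ^ k * (2 * B) + e'" using step[of k] by blast
  have "q ^ k * (2 * B) \<le> e'"
    using k B by (simp add: field_simps)
  then have "cmod (ravg A f x - ravg A f \<one>) \<le> e" if "x \<in> carrier G" for x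
    using A(2)[OF that one_closed] unfolding e'_def by linarith
  then have "ravg_near f (ravg A f \<one>) e A" using A(1) by (simp add: ravg_near_def)
  then show ?thesis by (intro exI)
qed

text \<open>Inversion exchanges left and right averages.\<close>

lemma lavg_nearly_constant:
  assumes f: "f \<in> C_G" and e: "e > 0"
  shows "\<exists>A c. lavg_near f c e A"
proof -
  obtain A c where A: "ravg_near (\<lambda>x. f (inv x)) c e A"
    using ravg_nearly_constant[OF C_G_inv[OF f] e] by blast
  then have gA: "glist A" by (simp add: ravg_near_def)
  have "lavg (map (m_inv G) A) f x = ravg A (\<lambda>x. f (inv x)) (inv x)" if "x \<in> carrier G" for x
    unfolding lavg_def ravg_def avg_map using gA that
    by (intro avg_cong) (auto simp: inv_mult_group glist_def subset_iff)
  moreover have "glist (map (m_inv G) A)" using gA by (auto simp: glist_def)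
  ultimately have "lavg_near f c e (map (m_inv G) A)"
    using A by (simp add: lavg_near_def ravg_near_def)
  then show ?thesis by blast
qed

text \<open>The double average of \<open>f (b \<otimes> a)\<close> over both lists is near
  \<open>c\<close> when the inner average is over \<open>A\<close>, and near \<open>d\<close> when
  it is over \<open>B\<close>.\<close>

lemma avg_constants_agree:
  assumes A: "ravg_near f c e A" and B: "lavg_near f d e' B"
  shows "cmod (c - d) \<le> e + e'"
proof -
  have gl: "glist A" "glist B" using A B by (auto simp: ravg_near_def lavg_near_def)
  have "cmod (avg B (\<lambda>b. ravg A f b) - c) \<le> e"
    using A gl by (intro avg_near_const) (auto simp: ravg_near_def glist_def subset_iff)
  moreover have "cmod (avg A (\<lambda>a. lavg B f a) - d) \<le> e'"
    using B gl by (intro avg_near_const) (auto simp: lavg_near_def glist_def subset_iff)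
  moreover have "avg B (\<lambda>b. ravg A f b) = avg A (\<lambda>a. lavg B f a)"
    unfolding ravg_def lavg_def by (rule avg_swap)
  ultimately show ?thesis
    using norm_triangle_ineq4[of "avg A (\<lambda>a. lavg B f a) - d" "avg A (\<lambda>a. lavg B f a) - c"] by simp
qed

text \<open>Right and left averages commute, so the almost constant values of both kinds agree;
  this gives uniqueness and bi-invariance of the mean at once.\<close>

lemma ravg_constants_agree:
  assumes f: "f \<in> C_G" and A: "ravg_near f c e A" and A': "ravg_near f c' e' A'"
  shows "cmod (c - c') \<le> e + e'"
proof (rule field_le_epsilon)
  fix r :: real assume r: "r > 0"
  obtain B d where B: "lavg_near f d (r/2) B"
    using lavg_nearly_constant[OF f, of "r/2"] r by (meson half_gt_zero)
  show "cmod (c - c') \<le> e + e' + r"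
    using avg_constants_agree[OF A B] avg_constants_agree[OF A' B]
      norm_triangle_ineq4[of "c - d" "c' - d"] by simp
qed

lemma ravg_near_mono:
  assumes "ravg_near f c e A" "e + cmod (c - c') \<le> e'"
  shows "ravg_near f c' e' A"
  unfolding ravg_near_def
proof (intro conjI ballI)
  show "glist A" using assms(1) by (simp add: ravg_near_def)
  fix x assume "x \<in> carrier G"
  then have "cmod (ravg A f x - c) \<le> e" using assms(1) by (simp add: ravg_near_def)
  then show "cmod (ravg A f x - c') \<le> e'"
    using assms(2) norm_triangle_ineq[of "ravg A f x - c" "c - c'"] by simp
qed

lemma lavg_near_mono:
  assumes "lavg_near f c e A" "e + cmod (c - c') \<le> e'"
  shows "lavg_near f c' e' A"
  unfolding lavg_near_def
proof (intro conjI ballI)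
  show "glist A" using assms(1) by (simp add: lavg_near_def)
  fix x assume "x \<in> carrier G"
  then have "cmod (lavg A f x - c) \<le> e" using assms(1) by (simp add: lavg_near_def)
  then show "cmod (lavg A f x - c') \<le> e'"
    using assms(2) norm_triangle_ineq[of "lavg A f x - c" "c - c'"] by simp
qed

text \<open>The number approximated by right averages; \<open>mean_ex1\<close> justifies the
  description. Left averages lead to the same number by \<open>mean_eqI_left\<close>. Left
  invariance is then read off from right averages and right invariance from left averages.\<close>

definition mean :: "('a \<Rightarrow> complex) \<Rightarrow> complex" where
  "mean f = (THE c. \<forall>e>0. \<exists>A. ravg_near f c e A)"

lemma mean_ex1:
  assumes f: "f \<in> C_G"
  shows "\<exists>!c. \<forall>e>0. \<exists>A. ravg_near f c e A"
proof (rule ex_ex1I)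
  define r where "r n = inverse (real (Suc n))" for n
  have r: "r n > 0" for n by (simp add: r_def)
  have r_mono: "r n \<le> r m" if "m \<le> n" for m n
    using that by (auto intro!: le_imp_inverse_le simp: r_def)
  have "\<forall>n. \<exists>A c. ravg_near f c (r n) A"
    using ravg_nearly_constant[OF f r] by blast
  then obtain A c where A: "\<And>n. ravg_near f (c n) (r n) (A n)"
    by metis
  have cc: "cmod (c n - c m) \<le> r n + r m" for n m
    by (rule ravg_constants_agree[OF f A A])
  have "Cauchy c"
  proof (rule CauchyI)
    fix e :: real assume e: "e > 0"
    obtain M where M: "r M < e / 2" using reals_Archimedean[of "e/2"] e by (auto simp: r_def)
    have "cmod (c m - c n) < e" if "m \<ge> M" "n \<ge> M" for m n
      using cc[of m n] M r_mono[OF that(1)] r_mono[OF that(2)] by linarith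
    then show "\<exists>M. \<forall>m\<ge>M. \<forall>n\<ge>M. cmod (c m - c n) < e" by (intro exI[of _ M] allI impI)
  qed
  then obtain l where l: "c \<longlonglongrightarrow> l" unfolding Cauchy_convergent_iff convergent_def by (elim exE)
  have "\<exists>A. ravg_near f l e A" if e: "e > 0" for e
  proof -
    obtain M where M: "r M < e / 2" using reals_Archimedean[of "e/2"] e by (auto simp: r_def)
    obtain M' where M': "\<forall>n\<ge>M'. cmod (c n - l) < e / 2"
      using LIMSEQ_D[OF l, of "e / 2"] e by auto
    have "r (max M M') < e/2" "cmod (c (max M M') - l) < e / 2"
      using M r_mono[of M "max M M'"] M' by auto
    then have "ravg_near f l e (A (max M M'))"
      by (intro ravg_near_mono[OF A]) simp
    then show ?thesis ..
  qed
  then show "\<exists>c. \<forall>e>0. \<exists>A. ravg_near f c e A" by (intro exI[of _ l] allI impI)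
next
  fix c c'
  assume c: "\<forall>e>0. \<exists>A. ravg_near f c e A" and c': "\<forall>e>0. \<exists>A. ravg_near f c' e A"
  have "cmod (c - c') \<le> 0 + e" if e: "e > 0" for e
  proof -
    have "e / 2 > 0" using e by simp
    then obtain A A' where A: "ravg_near f c (e/2) A" "ravg_near f c' (e/2) A'"
      using c c' by (elim allE impE exE) blast+
    show ?thesis using ravg_constants_agree[OF f A] by simp
  qed
  then show "c = c'" using field_le_epsilon[of "cmod (c - c')" 0] by simp
qed

lemma mean_ravg:
  assumes "f \<in> C_G" "e > 0"
  obtains A where "ravg_near f (mean f) e A"
  using theI'[OF mean_ex1[OF assms(1)]] assms(2) unfolding mean_def by (elim allE impE exE)

lemma mean_eqI_right:
  assumes f: "f \<in> C_G" and c: "\<And>e. e > 0 \<Longrightarrow> \<exists>A. ravg_near f c e A"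
  shows "mean f = c"
  unfolding mean_def using mean_ex1[OF f] c by (intro the1_equality) auto

lemma mean_eqI_left:
  assumes f: "f \<in> C_G" and c: "\<And>e. e > 0 \<Longrightarrow> \<exists>A. lavg_near f c e A"
  shows "mean f = c"
proof -
  have "cmod (mean f - c) \<le> 0 + e" if e: "e > 0" for e
  proof -
    have e2: "e / 2 > 0" using e by simp
    obtain A where A: "ravg_near f (mean f) (e / 2) A" by (rule mean_ravg[OF f e2])
    obtain B where B: "lavg_near f c (e / 2) B" using c[OF e2] ..
    show ?thesis using avg_constants_agree[OF A B] by simp
  qed
  then show ?thesis using field_le_epsilon[of "cmod (mean f - c)" 0] by simp
qed

lemma mean_lavg:
  assumes f: "f \<in> C_G" and e: "e > 0"
  obtains A where "lavg_near f (mean f) e A"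
proof -
  have e4: "e / 4 > 0" using e by simp
  obtain B c where B: "lavg_near f c (e / 4) B"
    using lavg_nearly_constant[OF f e4] by blast
  obtain A where A: "ravg_near f (mean f) (e / 4) A" by (rule mean_ravg[OF f e4])
  have "cmod (mean f - c) \<le> e / 4 + e / 4" using avg_constants_agree[OF A B] .
  then have "lavg_near f (mean f) e B"
    using e by (intro lavg_near_mono[OF B]) (simp add: norm_minus_commute)
  then show ?thesis by (rule that)
qed

text \<open>Left and right averages commute, so a list making the left averages of \<open>f\<close>
  nearly constant does the same for \<open>ravg A f\<close>, with the same constant.\<close>

lemma mean_of_ravg:
  assumes f: "f \<in> C_G" and A: "glist A"
  shows "mean (ravg A f) = mean f"
proof (rule mean_eqI_left[OF C_G_ravg[OF f A]])
  fix e :: real assume "e > 0"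
  then obtain B where B: "lavg_near f (mean f) e B"
    by (rule mean_lavg[OF f])
  then have gB: "glist B" by (simp add: lavg_near_def)
  have "cmod (lavg B (ravg A f) x - mean f) \<le> e" if x: "x \<in> carrier G" for x
  proof -
    have "lavg B (ravg A f) x = avg B (\<lambda>b. avg A (\<lambda>a. f (b \<otimes> (x \<otimes> a))))"
      unfolding lavg_def ravg_def
      using x A gB by (intro avg_cong) (auto simp: m_assoc glist_def subset_iff)
    also have "\<dots> = avg A (\<lambda>a. lavg B f (x \<otimes> a))"
      unfolding lavg_def by (rule avg_swap)
    finally have *: "lavg B (ravg A f) x = avg A (\<lambda>a. lavg B f (x \<otimes> a))" .
    show ?thesis unfolding *
      using B A x by (intro avg_near_const) (auto simp: lavg_near_def glist_def subset_iff)
  qed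
  then have "lavg_near (ravg A f) (mean f) e B" using gB by (simp add: lavg_near_def)
  then show "\<exists>A'. lavg_near (ravg A f) (mean f) e A'" ..
qed

text \<open>The functions are treated one after the other: a further average keeps those already
  nearly constant as they are, and by \<open>mean_of_ravg\<close> the constant of the new one is
  still its own mean.\<close>

lemma mean_ravg_finite:
  assumes "finite F" "F \<subseteq> C_G" and e: "e > 0"
  obtains A where "glist A" "\<forall>f\<in>F. ravg_near f (mean f) e A"
proof -
  have "\<exists>A. glist A \<and> (\<forall>f\<in>F. ravg_near f (mean f) e A)"
    using assms(1,2)
  proof (induction F rule: finite_induct)
    case empty
    have "glist [\<one>]" by (simp add: glist_def)
    then show ?case by auto
  next
    case (insert f F)
    then obtain A where A: "glist A" "\<forall>f\<in>F. ravg_near f (mean f) e A" by auto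
    have f: "f \<in> C_G" using insert by auto
    obtain B where B: "ravg_near (ravg A f) (mean (ravg A f)) e B"
      by (rule mean_ravg[OF C_G_ravg[OF f A(1)] e])
    then have gB: "glist B" by (simp add: ravg_near_def)
    have "cmod (ravg B (ravg A g) x - mean g) \<le> e" if "g \<in> insert f F" "x \<in> carrier G" for g x
    proof (cases "g = f")
      case True
      then show ?thesis using B that mean_of_ravg[OF f A(1)] by (simp add: ravg_near_def)
    next
      case False
      then show ?thesis using that A gB unfolding ravg_def[of B]
        by (intro avg_near_const) (auto simp: ravg_near_def glist_def subset_iff)
    qed
    then have "\<forall>f\<in>insert f F. ravg_near f (mean f) e (list_times (\<otimes>) B A)"
      using A(1) gB by (simp add: ravg_times ravg_near_def glist_times)
    then show ?case using glist_times[OF gB A(1)] by (intro exI[of _ "list_times (\<otimes>) B A"] conjI)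
  qed
  then show ?thesis by (elim exE conjE) (rule that)
qed

text \<open>Evaluation of the common list at the identity. Additivity and bounds of the mean are
  then inherited from finite averages.\<close>

lemma mean_avg_finite:
  assumes "finite F" "F \<subseteq> C_G" and e: "e > 0"
  obtains A where "glist A" "\<forall>f\<in>F. cmod (avg A f - mean f) \<le> e"
proof (rule mean_ravg_finite[OF assms])
  fix A assume A: "glist A" "\<forall>f\<in>F. ravg_near f (mean f) e A"
  have "ravg A f \<one> = avg A f" for f
    unfolding ravg_def using A(1) by (intro avg_cong) (auto simp: glist_def subset_iff)
  then have "cmod (avg A f - mean f) \<le> e" if "f \<in> F" for f
    using bspec[OF A(2) that] unfolding ravg_near_def by (metis one_closed)
  then show ?thesis using A(1) by (intro that ballI)
qed

section \<open>Linearity, invariance and positivity of the mean\<close>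

lemma mean_cong:
  assumes "\<And>x. x \<in> carrier G \<Longrightarrow> f x = g x"
  shows "mean f = mean g"
proof -
  have "ravg A f x = ravg A g x" if "glist A" "x \<in> carrier G" for A x
    unfolding ravg_def using assms that by (intro avg_cong) (auto simp: glist_def subset_iff)
  then have "ravg_near f = ravg_near g"
    by (intro ext) (auto simp: ravg_near_def)
  then show ?thesis unfolding mean_def by simp
qed

lemma mean_const [simp]: "mean (\<lambda>x. c) = c"
proof (rule mean_eqI_right)
  fix e :: real assume "e > 0"
  then show "\<exists>A. ravg_near (\<lambda>x. c) c e A"
    by (intro exI[of _ "[\<one>]"]) (simp add: ravg_near_def glist_def ravg_def avg_const)
qed auto

lemma mean_norm_le:
  assumes "f \<in> C_G" "\<And>x. x \<in> carrier G \<Longrightarrow> cmod (f x) \<le> B"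
  shows "cmod (mean f) \<le> B"
proof (rule field_le_epsilon)
  fix e :: real assume "e > 0"
  then obtain A where A: "glist A" "cmod (avg A f - mean f) \<le> e"
    using mean_avg_finite[of "{f}" e] assms(1) by blast
  moreover have "cmod (avg A f) \<le> B"
    using A(1) assms(2) by (intro avg_norm_le) (auto simp: glist_def subset_iff)
  ultimately show "cmod (mean f) \<le> B + e"
    using norm_triangle_ineq4[of "avg A f" "avg A f - mean f"] by simp
qed

lemma mean_add:
  assumes "f \<in> C_G" "g \<in> C_G"
  shows "mean (\<lambda>x. f x + g x) = mean f + mean g"
proof -
  have "cmod (mean (\<lambda>x. f x + g x) - (mean f + mean g)) \<le> 0 + e" if e: "e > 0" for e
  proof -
    obtain A where A: "cmod (avg A f - mean f) \<le> e/3" "cmod (avg A g - mean g) \<le> e/3"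
      "cmod (avg A (\<lambda>x. f x + g x) - mean (\<lambda>x. f x + g x)) \<le> e/3"
      by (rule mean_avg_finite[of "{f, g, \<lambda>x. f x + g x}" "e/3"]) (use e assms C_G_add[OF assms] in auto)
    have "mean (\<lambda>x. f x + g x) - (mean f + mean g) = (avg A f - mean f) + (avg A g - mean g) -
       (avg A (\<lambda>x. f x + g x) - mean (\<lambda>x. f x + g x))" by (simp add: avg_add)
    then have "cmod (mean (\<lambda>x. f x + g x) - (mean f + mean g)) = cmod ((avg A f - mean f) + (avg A g - mean g) -
       (avg A (\<lambda>x. f x + g x) - mean (\<lambda>x. f x + g x)))" by (simp only:)
    then show ?thesis
      using A norm_triangle_ineq4[of "(avg A f - mean f) + (avg A g - mean g)" "avg A (\<lambda>x. f x + g x) - mean (\<lambda>x. f x + g x)"]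
        norm_triangle_ineq[of "avg A f - mean f" "avg A g - mean g"] by linarith
  qed
  then show ?thesis using field_le_epsilon[of "cmod (mean (\<lambda>x. f x + g x) - (mean f + mean g))" 0] by simp
qed

lemma mean_cnj:
  assumes "f \<in> C_G"
  shows "mean (\<lambda>x. cnj (f x)) = cnj (mean f)"
proof (rule mean_eqI_right[OF C_G_cnj[OF assms]])
  fix e :: real assume "e > 0"
  then obtain A where A: "ravg_near f (mean f) e A"
    by (rule mean_ravg[OF assms])
  have "ravg A (\<lambda>x. cnj (f x)) x - cnj (mean f) = cnj (ravg A f x - mean f)" for x
    by (simp add: ravg_def avg_cnj)
  then have "cmod (ravg A (\<lambda>x. cnj (f x)) x - cnj (mean f)) = cmod (ravg A f x - mean f)" for x
    by (simp only: complex_mod_cnj)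
  then have "ravg_near (\<lambda>x. cnj (f x)) (cnj (mean f)) e A"
    using A by (simp only: ravg_near_def) blast
  then show "\<exists>A. ravg_near (\<lambda>x. cnj (f x)) (cnj (mean f)) e A" ..
qed

lemma mean_mult_const:
  assumes "f \<in> C_G"
  shows "mean (\<lambda>x. c * f x) = c * mean f"
proof (rule mean_eqI_right)
  show "(\<lambda>x. c * f x) \<in> C_G" using assms by (intro C_G_mult) auto
  fix e :: real assume e: "e > 0"
  then have "e / (cmod c + 1) > 0" by (simp add: add_nonneg_pos)
  then obtain A where "ravg_near f (mean f) (e / (cmod c + 1)) A"
    by (rule mean_ravg[OF assms])
  then have A: "glist A" "\<forall>x\<in>carrier G. cmod (ravg A f x - mean f) \<le> e / (cmod c + 1)"
    by (auto simp: ravg_near_def)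
  have "cmod (ravg A (\<lambda>x. c * f x) x - c * mean f) \<le> e" if "x \<in> carrier G" for x
  proof -
    have "ravg A (\<lambda>x. c * f x) x - c * mean f = c * (ravg A f x - mean f)"
      by (simp add: ravg_def avg_mult algebra_simps)
    then have "cmod (ravg A (\<lambda>x. c * f x) x - c * mean f) \<le> cmod c * (e / (cmod c + 1))"
      unfolding norm_mult using mult_left_mono[OF bspec[OF A(2) that], of "cmod c"] by (simp only: norm_mult norm_ge_zero)
    also have "\<dots> \<le> e"
      using e by (simp add: add_nonneg_pos divide_le_eq mult.commute[of "cmod c"] distrib_left)
    finally show ?thesis .
  qed
  then have "ravg_near (\<lambda>x. c * f x) (c * mean f) e A" using A(1) by (simp add: ravg_near_def)
  then show "\<exists>A. ravg_near (\<lambda>x. c * f x) (c * mean f) e A" ..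
qed

lemma mean_diff:
  assumes "f \<in> C_G" "g \<in> C_G"
  shows "mean (\<lambda>x. f x - g x) = mean f - mean g"
  using mean_add[OF assms(1), of "\<lambda>x. -1 * g x"] mean_mult_const[OF assms(2), of "-1"]
    C_G_mult[OF C_G_const[of "-1"] assms(2)] by simp

lemma mean_sum:
  assumes "finite S" "\<And>i. i \<in> S \<Longrightarrow> f i \<in> C_G"
  shows "mean (\<lambda>x. \<Sum>i\<in>S. f i x) = (\<Sum>i\<in>S. mean (f i))"
  using assms by (induction S rule: finite_induct) (auto simp: mean_add C_G_sum)

lemma mean_of_avg:
  assumes "\<And>a. a \<in> set A \<Longrightarrow> (\<lambda>x. u x a) \<in> C_G"
  shows "mean (\<lambda>x. avg A (u x)) = avg A (\<lambda>a. mean (\<lambda>x. u x a))"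
proof -
  have "(\<lambda>x. \<Sum>a\<leftarrow>A. u x a) \<in> C_G \<and> mean (\<lambda>x. \<Sum>a\<leftarrow>A. u x a) = (\<Sum>a\<leftarrow>A. mean (\<lambda>x. u x a))"
    using assms by (induction A) (auto simp: mean_add C_G_add)
  then show ?thesis
    unfolding avg_def using mean_mult_const[of "\<lambda>x. \<Sum>a\<leftarrow>A. u x a" "1 / of_nat (length A)"] by simp
qed

lemma mean_left:
  assumes f: "f \<in> C_G" and a: "a \<in> carrier G"
  shows "mean (\<lambda>x. f (a \<otimes> x)) = mean f"
proof (rule mean_eqI_right[OF C_G_left[OF f a]])
  fix e :: real assume "e > 0"
  then obtain A where "ravg_near f (mean f) e A"
    by (rule mean_ravg[OF f])
  then have A: "glist A" "\<forall>x\<in>carrier G. cmod (ravg A f x - mean f) \<le> e"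
    by (auto simp: ravg_near_def)
  have "ravg A (\<lambda>x. f (a \<otimes> x)) x = ravg A f (a \<otimes> x)" if "x \<in> carrier G" for x
    unfolding ravg_def using A(1) a that by (intro avg_cong) (auto simp: m_assoc simp: glist_def subset_iff)
  then have "ravg_near (\<lambda>x. f (a \<otimes> x)) (mean f) e A" using A a by (simp add: ravg_near_def)
  then show "\<exists>A. ravg_near (\<lambda>x. f (a \<otimes> x)) (mean f) e A" ..
qed

lemma mean_right:
  assumes f: "f \<in> C_G" and a: "a \<in> carrier G"
  shows "mean (\<lambda>x. f (x \<otimes> a)) = mean f"
proof (rule mean_eqI_left[OF C_G_right[OF f a]])
  fix e :: real assume "e > 0"
  then obtain A where "lavg_near f (mean f) e A"
    by (rule mean_lavg[OF f])
  then have A: "glist A" "\<forall>x\<in>carrier G. cmod (lavg A f x - mean f) \<le> e"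
    by (auto simp: lavg_near_def)
  have "lavg A (\<lambda>x. f (x \<otimes> a)) x = lavg A f (x \<otimes> a)" if "x \<in> carrier G" for x
    unfolding lavg_def using A(1) a that by (intro avg_cong) (auto simp: m_assoc simp: glist_def subset_iff)
  then have "lavg_near (\<lambda>x. f (x \<otimes> a)) (mean f) e A" using A a by (simp add: lavg_near_def)
  then show "\<exists>A. lavg_near (\<lambda>x. f (x \<otimes> a)) (mean f) e A" ..
qed

lemma mean_Re_ge:
  assumes "f \<in> C_G" "\<And>x. x \<in> carrier G \<Longrightarrow> Re (f x) \<ge> s"
  shows "Re (mean f) \<ge> s"
proof (rule field_le_epsilon)
  fix e :: real assume "e > 0"
  then obtain A where A: "glist A" "cmod (avg A f - mean f) \<le> e"
    using mean_avg_finite[of "{f}" e] assms(1) by blast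
  have "\<forall>a\<in>set A. Re (f a) \<ge> s" using A(1) assms(2) by (auto simp: glist_def subset_iff)
  then have "Re (\<Sum>a\<leftarrow>A. f a) \<ge> real (length A) * s"
    by (induction A) (auto simp: algebra_simps)
  then have "Re (avg A f) \<ge> s"
    using glistD(1)[OF A(1)] by (simp add: avg_def le_divide_eq mult.commute)
  moreover have "\<bar>Re (avg A f - mean f)\<bar> \<le> e" using A(2) abs_Re_le_cmod order_trans by blast
  ultimately show "s \<le> Re (mean f) + e" by simp
qed

text \<open>Every \<open>x\<close> can be moved by some \<open>y\<close> of a finite net to a point
  where \<open>f\<close> is close to \<open>f x0\<close>. So the average over the net is bounded
  below by a positive constant everywhere, and averaging does not change the mean. This makes
  \<open>ip\<close> definite.\<close>

lemma mean_Re_pos: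
  assumes f: "f \<in> C_G" and nn: "\<And>x. x \<in> carrier G \<Longrightarrow> Re (f x) \<ge> 0"
    and x0: "x0 \<in> carrier G" "Re (f x0) > 0"
  shows "Re (mean f) > 0"
proof -
  define s where "s = Re (f x0) / 2"
  have s: "s > 0" using x0 by (simp add: s_def)
  obtain Y where Y: "finite Y" "Y \<subseteq> carrier G"
    and net0: "\<forall>x\<in>carrier G. \<exists>y\<in>Y. \<forall>a\<in>carrier G. \<forall>b\<in>carrier G.
      cmod (f (a \<otimes> x \<otimes> b) - f (a \<otimes> y \<otimes> b)) < s"
    by (rule translation_net[OF f s])
  note net = bspec[OF net0]
  obtain ys where ys: "set ys = Y" "distinct ys" using finite_distinct_list[OF Y(1)] by blast
  have Y0: "Y \<noteq> {}" using net[OF one_closed] by auto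
  have gys: "glist ys" using ys Y Y0 by (auto simp: glist_def)
  have "Re (ravg ys f x) \<ge> s / card Y" if x: "x \<in> carrier G" for x
  proof -
    have "inv x \<otimes> x0 \<in> carrier G" using x x0 by simp
    from net[OF this] obtain y where y: "y \<in> Y" "cmod (f (x \<otimes> (inv x \<otimes> x0) \<otimes> \<one>) - f (x \<otimes> y \<otimes> \<one>)) < s"
      using x by (elim bexE) simp
    have "x \<otimes> (inv x \<otimes> x0) = x0" using x x0 by (simp add: m_assoc[symmetric])
    then have "cmod (f x0 - f (x \<otimes> y)) < s" using y x x0 Y by (auto simp: subset_iff)
    then have "Re (f (x \<otimes> y)) \<ge> s"
      using abs_Re_le_cmod[of "f x0 - f (x \<otimes> y)"] by (simp add: s_def)
    also have "Re (f (x \<otimes> y)) \<le> (\<Sum>y\<in>Y. Re (f (x \<otimes> y)))"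
      using y Y x nn by (intro member_le_sum) auto
    finally have "s / card Y \<le> (\<Sum>y\<in>Y. Re (f (x \<otimes> y))) / card Y"
      by (simp add: divide_right_mono)
    then show ?thesis
      using ys by (simp add: ravg_def avg_def sum_list_distinct_conv_sum_set distinct_card[symmetric])
  qed
  then have "Re (mean (ravg ys f)) \<ge> s / card Y"
    using C_G_ravg[OF f gys] by (intro mean_Re_ge)
  moreover have "s / card Y > 0" using s Y Y0 by (simp add: card_gt_0_iff)
  ultimately show ?thesis using mean_of_ravg[OF f gys] by simp
qed

section \<open>Means depending on a parameter, and exchange of means\<close>

definition jcont :: "('a \<Rightarrow> 'a \<Rightarrow> complex) \<Rightarrow> bool" where
  "jcont F \<longleftrightarrow> continuous_map (prod_topology T T) euclidean (\<lambda>p. F (fst p) (snd p))"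

lemma jcont_local:
  assumes "jcont F" "x \<in> carrier G" "e > 0"
  shows "\<exists>U. openin T U \<and> x \<in> U \<and> (\<forall>x'\<in>U. \<forall>y\<in>carrier G. cmod (F x' y - F x y) < e)"
  using jointly_continuous_local[of T F x e] assms compact topspace_eq_carrier
  by (simp add: jcont_def case_prod_unfold)

lemma jcont_swap: "jcont F \<Longrightarrow> jcont (\<lambda>y x. F x y)"
proof -
  assume "jcont F"
  then have F: "continuous_map (prod_topology T T) euclidean (\<lambda>p. F (fst p) (snd p))" by (simp add: jcont_def)
  have "continuous_map (prod_topology T T) (prod_topology T T) (\<lambda>p. (snd p, fst p))"
    by (intro continuous_map_pairedI continuous_map_fst continuous_map_snd)
  from continuous_map_compose[OF this F] show ?thesis by (simp add: jcont_def o_def)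
qed

lemma jcont_section:
  assumes "jcont F" "x \<in> carrier G"
  shows "F x \<in> C_G"
proof -
  have "continuous_map T (prod_topology T T) (\<lambda>y. (x, y))"
    using assms(2) by (intro continuous_map_pairedI group_continuous_intros)
  from continuous_map_compose[OF this] assms(1) show ?thesis
    unfolding jcont_def C_G_def by (force simp: o_def)
qed

lemma jcont_section2: "jcont F \<Longrightarrow> y \<in> carrier G \<Longrightarrow> (\<lambda>x. F x y) \<in> C_G"
  using jcont_section[OF jcont_swap] .

lemma mean_near:
  assumes "f \<in> C_G" "g \<in> C_G" "\<And>x. x \<in> carrier G \<Longrightarrow> cmod (f x - g x) \<le> e"
  shows "cmod (mean f - mean g) \<le> e"
  using mean_norm_le[OF C_G_diff[OF assms(1,2)] assms(3)] mean_diff[OF assms(1,2)] by simp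

text \<open>The sections \<open>F x\<close> have a finite net in the sup norm; a list that averages
  the net well averages all sections well. The set \<open>S\<close> holds further functions that the
  same list has to treat.\<close>

lemma mean_param_avg:
  assumes F: "jcont F" and S: "finite S" "S \<subseteq> C_G" and e: "e > 0"
  obtains A where "glist A" "\<forall>x\<in>carrier G. cmod (avg A (F x) - mean (F x)) \<le> e"
    "\<forall>g\<in>S. cmod (avg A g - mean g) \<le> e"
proof -
  have e3: "e / 3 > 0" using e by simp
  obtain X where X: "finite X" "X \<subseteq> carrier G"
    and net: "\<forall>x\<in>carrier G. \<exists>x'\<in>X. \<forall>y\<in>carrier G. cmod (F x y - F x' y) < e / 3"
    by (rule compact_finite_net[of "\<lambda>x' x. \<forall>y\<in>carrier G. cmod (F x y - F x' y) < e / 3"])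
      (rule jcont_local[OF F _ e3])
  have fin: "finite (F ` X \<union> S)" and sub: "F ` X \<union> S \<subseteq> C_G"
    using X S jcont_section[OF F] by auto
  obtain A where A: "glist A" "\<forall>f\<in>F ` X \<union> S. cmod (avg A f - mean f) \<le> e / 3"
    by (rule mean_avg_finite[OF fin sub e3])
  have "cmod (avg A (F x) - mean (F x)) \<le> e" if x: "x \<in> carrier G" for x
  proof -
    obtain x' where x': "x' \<in> X" "\<forall>y\<in>carrier G. cmod (F x y - F x' y) < e / 3"
      using bspec[OF net x] by (elim bexE)
    have xG: "x' \<in> carrier G" using x' X by auto
    have near: "cmod (F x y - F x' y) \<le> e / 3" if "y \<in> carrier G" for y
      using bspec[OF x'(2) that] by simp
    have 1: "cmod (avg A (F x) - avg A (F x')) \<le> e / 3"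
      using A(1) by (intro avg_near near) (auto simp: glist_def)
    have 2: "cmod (mean (F x) - mean (F x')) \<le> e / 3"
      by (rule mean_near[OF jcont_section[OF F x] jcont_section[OF F xG] near])
    have 3: "cmod (avg A (F x') - mean (F x')) \<le> e / 3" using bspec[OF A(2), of "F x'"] x' by simp
    have "avg A (F x) - mean (F x) = (avg A (F x) - avg A (F x')) + (avg A (F x') - mean (F x')) - (mean (F x) - mean (F x'))"
      by simp
    then have "cmod (avg A (F x) - mean (F x)) = cmod ((avg A (F x) - avg A (F x')) + (avg A (F x') - mean (F x')) - (mean (F x) - mean (F x')))"
      by (simp only:)
    then show ?thesis using 1 2 3
      norm_triangle_ineq4[of "(avg A (F x) - avg A (F x')) + (avg A (F x') - mean (F x'))" "mean (F x) - mean (F x')"]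
      norm_triangle_ineq[of "avg A (F x) - avg A (F x')" "avg A (F x') - mean (F x')"] by linarith
  qed
  moreover have "cmod (avg A g - mean g) \<le> e" if "g \<in> S" for g
    using bspec[OF A(2), of g] that e by simp
  ultimately show ?thesis by (intro that[OF A(1)] ballI)
qed

lemma C_G_mean_param:
  assumes F: "jcont F"
  shows "(\<lambda>x. mean (F x)) \<in> C_G"
proof (rule C_G_localI)
  fix x and e :: real assume x: "x \<in> carrier G" and e: "e > 0"
  then have e2: "e / 2 > 0" by simp
  obtain U where U: "openin T U" "x \<in> U" "\<forall>x'\<in>U. \<forall>y\<in>carrier G. cmod (F x' y - F x y) < e/2"
    using jcont_local[OF F x e2] by (elim exE conjE)
  have "cmod (mean (F y) - mean (F x)) < e" if y: "y \<in> U" for y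
  proof -
    have yG: "y \<in> carrier G" using y U(1) openin_subset topspace_eq_carrier by blast
    have "cmod (F y z - F x z) \<le> e / 2" if "z \<in> carrier G" for z
      using bspec[OF bspec[OF U(3) y] that] by simp
    then have "cmod (mean (F y) - mean (F x)) \<le> e / 2"
      by (rule mean_near[OF jcont_section[OF F yG] jcont_section[OF F x]])
    then show ?thesis using e by simp
  qed
  then show "\<exists>U. openin T U \<and> x \<in> U \<and> (\<forall>y\<in>U. cmod (mean (F y) - mean (F x)) < e)"
    using U by (intro exI[of _ U] conjI ballI)
qed

text \<open>One mean is replaced, uniformly in the other variable, by a finite average, and this
  passes through the other mean by linearity.\<close>

lemma mean_fubini:
  assumes F: "jcont F"
  shows "mean (\<lambda>x. mean (F x)) = mean (\<lambda>y. mean (\<lambda>x. F x y))" (is "?l = mean ?g")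
proof -
  have g: "?g \<in> C_G" using C_G_mean_param[OF jcont_swap[OF F]] .
  have "cmod (?l - mean ?g) \<le> 0 + e" if e: "e > 0" for e
  proof -
    have e2: "e / 2 > 0" using e by simp
    have gs: "finite {?g}" "{?g} \<subseteq> C_G" using g by auto
    obtain A where A: "glist A" "\<forall>x\<in>carrier G. cmod (avg A (F x) - mean (F x)) \<le> e / 2"
      and Ag: "\<forall>g\<in>{?g}. cmod (avg A g - mean g) \<le> e / 2"
      by (rule mean_param_avg[OF F gs e2])
    have AG: "a \<in> carrier G" if "a \<in> set A" for a using A(1) that by (auto simp: glist_def)
    have C: "(\<lambda>x. avg A (F x)) \<in> C_G" by (intro C_G_avg jcont_section2[OF F] AG)
    have "mean (\<lambda>x. avg A (F x)) = avg A ?g"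
      by (intro mean_of_avg jcont_section2[OF F] AG)
    moreover have "cmod (mean (\<lambda>x. avg A (F x)) - ?l) \<le> e / 2"
      by (rule mean_near[OF C C_G_mean_param[OF F] bspec[OF A(2)]])
    moreover have "cmod (avg A ?g - mean ?g) \<le> e / 2" by (rule bspec[OF Ag]) simp
    ultimately show ?thesis
      using norm_triangle_ineq4[of "avg A ?g - mean ?g" "avg A ?g - ?l"] by simp
  qed
  then show ?thesis using field_le_epsilon[of "cmod (?l - mean ?g)" 0] by simp
qed

section \<open>Closed bi-invariant subspaces of C(G)\<close>

text \<open>Approximation is asked on the carrier only. Such a set is therefore also closed under
  changing its members off the carrier, see \<open>sup_closed_cong\<close>.\<close>

definition sup_closed :: "('a \<Rightarrow> complex) set \<Rightarrow> bool" where
  "sup_closed A \<longleftrightarrow> (\<forall>f. (\<forall>e>0. \<exists>g\<in>A. \<forall>x\<in>carrier G. cmod (f x - g x) \<le> e) \<longrightarrow> f \<in> A)"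

definition translation_space :: "('a \<Rightarrow> complex) set \<Rightarrow> bool" where
  "translation_space A \<longleftrightarrow> A \<subseteq> C_G \<and> (\<lambda>x. 0) \<in> A \<and> sup_closed A \<and>
    (\<forall>f\<in>A. \<forall>g\<in>A. (\<lambda>x. f x + g x) \<in> A) \<and> (\<forall>c. \<forall>f\<in>A. (\<lambda>x. c * f x) \<in> A) \<and>
    (\<forall>a\<in>carrier G. \<forall>f\<in>A. (\<lambda>x. f (a \<otimes> x)) \<in> A) \<and> (\<forall>a\<in>carrier G. \<forall>f\<in>A. (\<lambda>x. f (x \<otimes> a)) \<in> A)"

lemma translation_spaceD:
  assumes "translation_space A"
  shows "f \<in> A \<Longrightarrow> f \<in> C_G" "(\<lambda>x. 0) \<in> A" "sup_closed A"
    "f \<in> A \<Longrightarrow> g \<in> A \<Longrightarrow> (\<lambda>x. f x + g x) \<in> A" "f \<in> A \<Longrightarrow> (\<lambda>x. c * f x) \<in> A"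
    "a \<in> carrier G \<Longrightarrow> f \<in> A \<Longrightarrow> (\<lambda>x. f (a \<otimes> x)) \<in> A"
    "a \<in> carrier G \<Longrightarrow> f \<in> A \<Longrightarrow> (\<lambda>x. f (x \<otimes> a)) \<in> A"
  using assms unfolding translation_space_def by auto

lemma sup_closedD:
  assumes "sup_closed A" "\<And>e. e > 0 \<Longrightarrow> \<exists>g\<in>A. \<forall>x\<in>carrier G. cmod (f x - g x) \<le> e"
  shows "f \<in> A"
  using assms unfolding sup_closed_def by blast

lemma sup_closed_cong:
  assumes "sup_closed A" "g \<in> A" "\<And>x. x \<in> carrier G \<Longrightarrow> f x = g x"
  shows "f \<in> A"
  using assms by (intro sup_closedD[OF assms(1)]) (auto intro!: bexI[of _ g])

lemma translation_space_sum:
  assumes A: "translation_space A" and "finite S" "\<And>i. i \<in> S \<Longrightarrow> f i \<in> A"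
  shows "(\<lambda>x. \<Sum>i\<in>S. f i x) \<in> A"
  using assms(2,3) by (induction S rule: finite_induct) (auto intro: translation_spaceD[OF A])

lemma translation_space_diff:
  assumes A: "translation_space A" "f \<in> A" "g \<in> A"
  shows "(\<lambda>x. f x - g x) \<in> A"
  using translation_spaceD(4)[OF A(1,2) translation_spaceD(5)[OF A(1,3), of "-1"]] by simp

lemma translation_space_avg:
  assumes A: "translation_space A" and "\<And>a. a \<in> set L \<Longrightarrow> (\<lambda>x. u x a) \<in> A"
  shows "(\<lambda>x. avg L (u x)) \<in> A"
proof -
  have "(\<lambda>x. \<Sum>a\<leftarrow>L. u x a) \<in> A"
    using assms(2) by (induction L) (auto intro: translation_spaceD[OF A])
  from translation_spaceD(5)[OF A this, of "1 / of_nat (length L)"] show ?thesis by (simp add: avg_def)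
qed

lemma translation_space_C_G: "translation_space C_G"
proof -
  have "sup_closed C_G"
    unfolding sup_closed_def
  proof (intro allI impI)
    fix f assume f: "\<forall>e>0. \<exists>g\<in>C_G. \<forall>x\<in>carrier G. cmod (f x - g x) \<le> e"
    show "f \<in> C_G"
    proof (rule C_G_localI)
      fix x and e :: real assume x: "x \<in> carrier G" and e: "e > 0"
      obtain g where g: "g \<in> C_G" "\<forall>x\<in>carrier G. cmod (f x - g x) \<le> e / 3"
        using f[rule_format, of "e/3"] e by auto
      obtain U where U: "openin T U" "x \<in> U" "\<forall>y\<in>U. cmod (g y - g x) < e/3"
        using C_G_localD[OF g(1) x, of "e/3"] e by auto
      have "cmod (f y - f x) < e" if y: "y \<in> U" for y
      proof -
        have "y \<in> carrier G" using y U(1) openin_subset topspace_eq_carrier by blast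
        then have "cmod (f y - g y) \<le> e/3" "cmod (f x - g x) \<le> e/3" "cmod (g y - g x) < e/3" using g U x y by auto
        moreover have "f y - f x = (f y - g y) + (g y - g x) - (f x - g x)" by simp
        ultimately have "cmod (f y - f x) = cmod ((f y - g y) + (g y - g x) - (f x - g x))"
          "cmod (f y - g y) \<le> e/3" "cmod (f x - g x) \<le> e/3" "cmod (g y - g x) < e/3"
          by (simp_all only:)
        then show ?thesis
          using norm_triangle_ineq4[of "(f y - g y) + (g y - g x)" "f x - g x"]
            norm_triangle_ineq[of "f y - g y" "g y - g x"] by linarith
      qed
      then show "\<exists>U. openin T U \<and> x \<in> U \<and> (\<forall>y\<in>U. cmod (f y - f x) < e)"
        using U by (intro exI[of _ U] conjI ballI)
    qed
  qed
  then show ?thesis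
    unfolding translation_space_def by (auto intro: C_G_add C_G_mult C_G_left C_G_right)
qed

lemma jcont_mult: "jcont F \<Longrightarrow> jcont H \<Longrightarrow> jcont (\<lambda>x y. F x y * H x y)"
  unfolding jcont_def by (rule continuous_map_complex_mult)

lemma jcont_compose:
  assumes "f \<in> C_G" "continuous_map (prod_topology T T) T (\<lambda>p. h (fst p) (snd p))"
  shows "jcont (\<lambda>x y. f (h x y))"
  unfolding jcont_def using continuous_map_C_G[OF assms] .

lemma jcont_fst: "f \<in> C_G \<Longrightarrow> jcont (\<lambda>x y. f x)"
  by (rule jcont_compose, assumption, rule continuous_map_fst)

lemma jcont_snd: "f \<in> C_G \<Longrightarrow> jcont (\<lambda>x y. f y)"
  by (rule jcont_compose, assumption, rule continuous_map_snd)

lemma jcont_mult_left_translate: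
  assumes "f \<in> C_G" "w \<in> C_G"
  shows "jcont (\<lambda>x y. w y * f (y \<otimes> x))"
  by (intro jcont_mult jcont_snd[OF assms(2)] jcont_compose[OF assms(1)]
      continuous_map_group_mult continuous_map_fst continuous_map_snd)

text \<open>By \<open>mean_param_avg\<close> the weighted mean is a uniform limit of finite
  combinations of left translates of \<open>f\<close>. Convolutions and matrix coefficients enter
  \<open>A\<close> through this lemma.\<close>

lemma mean_left_translates_mem:
  assumes A: "translation_space A" and f: "f \<in> A" and w: "w \<in> C_G"
  shows "(\<lambda>x. mean (\<lambda>y. w y * f (y \<otimes> x))) \<in> A"
proof (rule sup_closedD[OF translation_spaceD(3)[OF A]])
  fix e :: real assume e: "e > 0"
  note F = jcont_mult_left_translate[OF translation_spaceD(1)[OF A f] w]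
  obtain L where L: "glist L"
    "\<forall>x\<in>carrier G. cmod (avg L (\<lambda>y. w y * f (y \<otimes> x)) - mean (\<lambda>y. w y * f (y \<otimes> x))) \<le> e"
    by (rule mean_param_avg[OF F _ _ e, of "{}"]) simp_all
  have "(\<lambda>x. avg L (\<lambda>y. w y * f (y \<otimes> x))) \<in> A"
    using L(1) f by (intro translation_space_avg[OF A] translation_spaceD[OF A]) (auto simp: glist_def subset_iff)
  then show "\<exists>g\<in>A. \<forall>x\<in>carrier G. cmod (mean (\<lambda>y. w y * f (y \<otimes> x)) - g x) \<le> e"
    using L(2) by (intro bexI) (simp_all add: norm_minus_commute)
qed

section \<open>The inner product\<close>

text \<open>The L2 inner product, antilinear in the second argument, on a space that is in general
  not complete for it.\<close>

definition ip :: "('a \<Rightarrow> complex) \<Rightarrow> ('a \<Rightarrow> complex) \<Rightarrow> complex" where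
  "ip f g = mean (\<lambda>x. f x * cnj (g x))"

definition sq :: "('a \<Rightarrow> complex) \<Rightarrow> real" where
  "sq f = Re (ip f f)"

lemma ip_integrand: "f \<in> C_G \<Longrightarrow> g \<in> C_G \<Longrightarrow> (\<lambda>x. f x * cnj (g x)) \<in> C_G"
  by (intro C_G_mult C_G_cnj)

lemma ip_cong:
  "(\<And>x. x \<in> carrier G \<Longrightarrow> f x = f' x) \<Longrightarrow> (\<And>x. x \<in> carrier G \<Longrightarrow> g x = g' x) \<Longrightarrow> ip f g = ip f' g'"
  unfolding ip_def by (intro mean_cong) simp

lemma sq_cong: "(\<And>x. x \<in> carrier G \<Longrightarrow> f x = f' x) \<Longrightarrow> sq f = sq f'"
  unfolding sq_def using ip_cong[of f f' f f'] by simp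

lemma ip_commute: "f \<in> C_G \<Longrightarrow> g \<in> C_G \<Longrightarrow> ip g f = cnj (ip f g)"
  unfolding ip_def using mean_cnj[OF ip_integrand[of f g]] by (simp add: mult.commute)

lemma ip_add_left:
  "f \<in> C_G \<Longrightarrow> g \<in> C_G \<Longrightarrow> h \<in> C_G \<Longrightarrow> ip (\<lambda>x. f x + g x) h = ip f h + ip g h"
  unfolding ip_def using mean_add[OF ip_integrand[of f h] ip_integrand[of g h]] by (simp add: distrib_right)

lemma ip_diff_left:
  "f \<in> C_G \<Longrightarrow> g \<in> C_G \<Longrightarrow> h \<in> C_G \<Longrightarrow> ip (\<lambda>x. f x - g x) h = ip f h - ip g h"
  unfolding ip_def using mean_diff[OF ip_integrand[of f h] ip_integrand[of g h]] by (simp add: left_diff_distrib)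

lemma ip_mult_left:
  "f \<in> C_G \<Longrightarrow> h \<in> C_G \<Longrightarrow> ip (\<lambda>x. c * f x) h = c * ip f h"
  unfolding ip_def using mean_mult_const[OF ip_integrand[of f h]] by (simp add: mult.assoc)

lemma C_G_mult_const: "f \<in> C_G \<Longrightarrow> (\<lambda>x. c * f x) \<in> C_G"
  by (intro C_G_mult) auto

lemma ip_add_right:
  assumes "f \<in> C_G" "g \<in> C_G" "h \<in> C_G"
  shows "ip h (\<lambda>x. f x + g x) = ip h f + ip h g"
  using assms ip_add_left[OF assms] by (simp add: ip_commute[of _ h] C_G_add)

lemma ip_diff_right:
  assumes "f \<in> C_G" "g \<in> C_G" "h \<in> C_G"
  shows "ip h (\<lambda>x. f x - g x) = ip h f - ip h g"
  using assms ip_diff_left[OF assms] by (simp add: ip_commute[of _ h] C_G_diff)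

lemma ip_mult_right:
  assumes "f \<in> C_G" "h \<in> C_G"
  shows "ip h (\<lambda>x. c * f x) = cnj c * ip h f"
  using assms ip_mult_left[OF assms] by (simp add: ip_commute[of _ h] C_G_mult_const)

lemma C_G_lincomb: "finite B \<Longrightarrow> B \<subseteq> C_G \<Longrightarrow> (\<lambda>x. \<Sum>e\<in>B. c e * e x) \<in> C_G"
  by (intro C_G_sum C_G_mult_const) auto

lemma ip_lincomb_left:
  assumes "finite B" "B \<subseteq> C_G" "h \<in> C_G"
  shows "ip (\<lambda>x. \<Sum>e\<in>B. c e * e x) h = (\<Sum>e\<in>B. c e * ip e h)"
  using assms(1,2)
proof (induction B rule: finite_induct)
  case (insert e B)
  then show ?case
    using ip_add_left[of "\<lambda>x. c e * e x" "\<lambda>x. \<Sum>e\<in>B. c e * e x" h] assms(3)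
    by (simp add: C_G_mult_const C_G_lincomb ip_mult_left)
qed (simp add: ip_def)

lemma ip_lincomb_right:
  assumes "finite B" "B \<subseteq> C_G" "h \<in> C_G"
  shows "ip h (\<lambda>x. \<Sum>e\<in>B. c e * e x) = (\<Sum>e\<in>B. cnj (c e) * ip h e)"
proof -
  have "ip h (\<lambda>x. \<Sum>e\<in>B. c e * e x) = cnj (\<Sum>e\<in>B. c e * ip e h)"
    using ip_commute[OF C_G_lincomb[OF assms(1,2)] assms(3)] ip_lincomb_left[OF assms] by simp
  also have "\<dots> = (\<Sum>e\<in>B. cnj (c e) * ip h e)"
    unfolding cnj_sum by (intro sum.cong refl) (use assms ip_commute[OF _ assms(3)] in auto)
  finally show ?thesis .
qed

lemma ip_left:
  assumes "f \<in> C_G" "g \<in> C_G" "a \<in> carrier G"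
  shows "ip (\<lambda>x. f (a \<otimes> x)) (\<lambda>x. g (a \<otimes> x)) = ip f g"
  unfolding ip_def using mean_left[OF ip_integrand[OF assms(1,2)] assms(3)] .

lemma ip_right:
  assumes "f \<in> C_G" "g \<in> C_G" "a \<in> carrier G"
  shows "ip (\<lambda>x. f (x \<otimes> a)) (\<lambda>x. g (x \<otimes> a)) = ip f g"
  unfolding ip_def using mean_right[OF ip_integrand[OF assms(1,2)] assms(3)] .

lemma ip_self: "f \<in> C_G \<Longrightarrow> ip f f = of_real (sq f)"
  using ip_commute[of f f] unfolding sq_def by (metis Reals_cnj_iff of_real_Re)

lemma sq_nonneg: "f \<in> C_G \<Longrightarrow> sq f \<ge> 0"
  unfolding sq_def ip_def by (intro mean_Re_ge ip_integrand) (auto simp: complex_mult_cnj)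

lemma sq_eq_0:
  assumes f: "f \<in> C_G" and "sq f = 0" and x: "x \<in> carrier G"
  shows "f x = 0"
proof (rule ccontr)
  assume "f x \<noteq> 0"
  then have "Re (f x * cnj (f x)) > 0"
    by (simp add: complex_mult_cnj complex_neq_0)
  then have "Re (mean (\<lambda>x. f x * cnj (f x))) > 0"
    by (intro mean_Re_pos[OF ip_integrand[OF f f] _ x]) (auto simp: complex_mult_cnj)
  then show False using assms(2) by (simp add: sq_def ip_def)
qed

lemma sq_le:
  assumes "f \<in> C_G" "\<And>x. x \<in> carrier G \<Longrightarrow> cmod (f x) \<le> B"
  shows "sq f \<le> B^2"
proof -
  have "cmod (mean (\<lambda>x. f x * cnj (f x))) \<le> B^2"
    using assms by (intro mean_norm_le ip_integrand) (auto simp: norm_mult power2_eq_square intro!: mult_mono order_trans[OF norm_ge_zero])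
  then show ?thesis unfolding sq_def ip_def using complex_Re_le_cmod order_trans by blast
qed

lemma sq_mult:
  assumes "f \<in> C_G"
  shows "sq (\<lambda>x. c * f x) = (cmod c)^2 * sq f"
proof -
  have "ip (\<lambda>x. c * f x) (\<lambda>x. c * f x) = (c * cnj c) * ip f f"
    using assms by (simp add: ip_mult_left ip_mult_right C_G_mult_const)
  also have "\<dots> = of_real ((cmod c)^2 * sq f)"
    unfolding ip_self[OF assms] of_real_mult complex_norm_square ..
  finally show ?thesis unfolding sq_def[of "\<lambda>x. c * f x"] by (metis Re_complex_of_real)
qed

lemma sq_diff:
  assumes "f \<in> C_G" "g \<in> C_G"
  shows "sq (\<lambda>x. f x - g x) = sq f - 2 * Re (ip f g) + sq g"
proof -
  have "ip (\<lambda>x. f x - g x) (\<lambda>x. f x - g x) = ip f f - ip f g - (cnj (ip f g) - ip g g)"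
    using assms by (simp add: ip_diff_left ip_diff_right C_G_diff ip_commute[of f g])
  then show ?thesis by (simp add: sq_def)
qed

lemma sq_add:
  assumes "f \<in> C_G" "g \<in> C_G"
  shows "sq (\<lambda>x. f x + g x) = sq f + 2 * Re (ip f g) + sq g"
proof -
  have "ip (\<lambda>x. f x + g x) (\<lambda>x. f x + g x) = ip f f + ip f g + (cnj (ip f g) + ip g g)"
    using assms by (simp add: ip_add_left ip_add_right C_G_add ip_commute[of f g])
  then show ?thesis by (simp add: sq_def)
qed

section \<open>Orthonormal systems and finite spans\<close>

definition orthonormal :: "('a \<Rightarrow> complex) set \<Rightarrow> bool" where
  "orthonormal B \<longleftrightarrow> finite B \<and> B \<subseteq> C_G \<and> (\<forall>e\<in>B. \<forall>f\<in>B. ip e f = (if e = f then 1 else 0))"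

lemma orthonormalD:
  assumes "orthonormal B"
  shows "finite B" "B \<subseteq> C_G" "e \<in> B \<Longrightarrow> e \<in> C_G"
    "e \<in> B \<Longrightarrow> f \<in> B \<Longrightarrow> ip e f = (if e = f then 1 else 0)"
  using assms unfolding orthonormal_def by auto

definition fspan :: "('a \<Rightarrow> complex) set \<Rightarrow> ('a \<Rightarrow> complex) set" where
  "fspan B = {f. \<exists>c. \<forall>x\<in>carrier G. f x = (\<Sum>e\<in>B. c e * e x)}"

lemma fspanI: "(\<And>x. x \<in> carrier G \<Longrightarrow> f x = (\<Sum>e\<in>B. c e * e x)) \<Longrightarrow> f \<in> fspan B"
  unfolding fspan_def by blast

lemma fspanE:
  assumes "f \<in> fspan B"
  obtains c where "\<And>x. x \<in> carrier G \<Longrightarrow> f x = (\<Sum>e\<in>B. c e * e x)"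
  using assms unfolding fspan_def by blast

lemma fspan_C_G: "finite B \<Longrightarrow> B \<subseteq> C_G \<Longrightarrow> f \<in> fspan B \<Longrightarrow> f \<in> C_G"
proof -
  assume B: "finite B" "B \<subseteq> C_G" "f \<in> fspan B"
  then obtain c where c: "\<And>x. x \<in> carrier G \<Longrightarrow> f x = (\<Sum>e\<in>B. c e * e x)"
    using fspanE by blast
  show ?thesis by (rule C_G_cong[OF C_G_lincomb[OF B(1,2), of c]]) (simp add: c)
qed

lemma fspan_cong: "f \<in> fspan B \<Longrightarrow> (\<And>x. x \<in> carrier G \<Longrightarrow> g x = f x) \<Longrightarrow> g \<in> fspan B"
  by (erule fspanE, rule fspanI) auto

lemma fspan_add: "f \<in> fspan B \<Longrightarrow> g \<in> fspan B \<Longrightarrow> (\<lambda>x. f x + g x) \<in> fspan B"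
proof -
  assume "f \<in> fspan B" "g \<in> fspan B"
  then obtain c d where "\<And>x. x \<in> carrier G \<Longrightarrow> f x = (\<Sum>e\<in>B. c e * e x)"
    "\<And>x. x \<in> carrier G \<Longrightarrow> g x = (\<Sum>e\<in>B. d e * e x)"
    by (elim fspanE) blast
  then show ?thesis by (intro fspanI[where c = "\<lambda>e. c e + d e"]) (simp add: distrib_right sum.distrib)
qed

lemma fspan_mult: "f \<in> fspan B \<Longrightarrow> (\<lambda>x. c * f x) \<in> fspan B"
proof -
  assume "f \<in> fspan B"
  then obtain d where "\<And>x. x \<in> carrier G \<Longrightarrow> f x = (\<Sum>e\<in>B. d e * e x)" by (elim fspanE) blast
  then show ?thesis by (intro fspanI[where c = "\<lambda>e. c * d e"]) (simp add: sum_distrib_left mult.assoc)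
qed

lemma fspan_zero: "(\<lambda>x. 0) \<in> fspan B"
  by (rule fspanI[where c = "\<lambda>e. 0"]) simp

lemma fspan_sum: "finite S \<Longrightarrow> (\<And>i. i \<in> S \<Longrightarrow> f i \<in> fspan B) \<Longrightarrow> (\<lambda>x. \<Sum>i\<in>S. f i x) \<in> fspan B"
  by (induction S rule: finite_induct) (auto intro: fspan_add fspan_zero)

lemma fspan_base: "finite B \<Longrightarrow> e \<in> B \<Longrightarrow> e \<in> fspan B"
  by (rule fspanI[where c = "\<lambda>f. if f = e then 1 else 0"]) (simp add: if_distrib[of "\<lambda>c. c * _"] cong: if_cong)

lemma fspan_subset:
  assumes "finite B" "B \<subseteq> fspan B'"
  shows "fspan B \<subseteq> fspan B'"
proof
  fix f assume "f \<in> fspan B"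
  then obtain c where c: "\<And>x. x \<in> carrier G \<Longrightarrow> f x = (\<Sum>e\<in>B. c e * e x)" by (elim fspanE) blast
  have "(\<lambda>x. \<Sum>e\<in>B. c e * e x) \<in> fspan B'"
    using assms by (intro fspan_sum fspan_mult) auto
  then show "f \<in> fspan B'" by (rule fspan_cong) (rule c)
qed

lemma fspan_mono: "finite B' \<Longrightarrow> B \<subseteq> B' \<Longrightarrow> fspan B \<subseteq> fspan B'"
  using fspan_subset[of B B'] fspan_base[of B'] by (meson finite_subset subsetD subsetI)

lemma lincomb_unique:
  assumes B: "orthonormal B" and c: "\<And>x. x \<in> carrier G \<Longrightarrow> f x = (\<Sum>e\<in>B. c e * e x)" and e: "e \<in> B"
  shows "c e = ip f e"
proof -
  note B' = orthonormalD[OF B]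
  have "ip f e = ip (\<lambda>x. \<Sum>e\<in>B. c e * e x) e" using c by (intro ip_cong) auto
  also have "\<dots> = (\<Sum>e'\<in>B. c e' * ip e' e)" by (rule ip_lincomb_left[OF B'(1,2) B'(3)[OF e]])
  also have "\<dots> = (\<Sum>e'\<in>B. if e' = e then c e' else 0)"
    using B'(4) e by (intro sum.cong) auto
  also have "\<dots> = c e" using B'(1) e by simp
  finally show ?thesis by simp
qed

lemma orthonormal_expand:
  assumes B: "orthonormal B" and f: "f \<in> fspan B" and x: "x \<in> carrier G"
  shows "f x = (\<Sum>e\<in>B. ip f e * e x)"
proof -
  obtain c where c: "\<And>x. x \<in> carrier G \<Longrightarrow> f x = (\<Sum>e\<in>B. c e * e x)" using f by (elim fspanE) blast
  show ?thesis using c[OF x] lincomb_unique[OF B c] by simp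
qed

lemma ip_parseval:
  assumes B: "orthonormal B" and f: "f \<in> fspan B" and g: "g \<in> C_G"
  shows "ip f g = (\<Sum>e\<in>B. ip f e * cnj (ip g e))"
proof -
  note B' = orthonormalD[OF B]
  have "ip f g = ip (\<lambda>x. \<Sum>e\<in>B. ip f e * e x) g"
    using orthonormal_expand[OF B f] by (intro ip_cong) auto
  also have "\<dots> = (\<Sum>e\<in>B. ip f e * ip e g)" by (rule ip_lincomb_left[OF B'(1,2) g])
  also have "\<dots> = (\<Sum>e\<in>B. ip f e * cnj (ip g e))"
    by (intro sum.cong refl) (simp add: ip_commute[OF g B'(3)])
  finally show ?thesis .
qed

lemma sq_parseval:
  assumes B: "orthonormal B" and f: "f \<in> fspan B"
  shows "sq f = (\<Sum>e\<in>B. (cmod (ip f e))^2)"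
proof -
  have "f \<in> C_G" using fspan_C_G[OF orthonormalD(1,2)[OF B] f] .
  from ip_parseval[OF B f this] have "ip f f = of_real (\<Sum>e\<in>B. (cmod (ip f e))^2)"
    unfolding of_real_sum complex_norm_square .
  then show ?thesis unfolding sq_def by (metis Re_complex_of_real)
qed

text \<open>The component of \<open>f\<close> orthogonal to the span of an orthonormal
  \<open>B\<close>.\<close>

definition resid :: "('a \<Rightarrow> complex) set \<Rightarrow> ('a \<Rightarrow> complex) \<Rightarrow> 'a \<Rightarrow> complex" where
  "resid B f x = f x - (\<Sum>e\<in>B. ip f e * e x)"

lemma C_G_resid: "orthonormal B \<Longrightarrow> f \<in> C_G \<Longrightarrow> resid B f \<in> C_G"
  unfolding resid_def[abs_def] by (intro C_G_diff C_G_lincomb) (auto dest: orthonormalD(1,2))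

lemma ip_resid:
  assumes B: "orthonormal B" and f: "f \<in> C_G" and e: "e \<in> B"
  shows "ip (resid B f) e = 0"
proof -
  note B' = orthonormalD[OF B]
  have "ip (\<lambda>x. \<Sum>e\<in>B. ip f e * e x) e = ip f e"
    using lincomb_unique[OF B _ e, of "\<lambda>x. \<Sum>e\<in>B. ip f e * e x" "\<lambda>e. ip f e"] by simp
  then show ?thesis
    unfolding resid_def[abs_def]
    using ip_diff_left[OF f C_G_lincomb[OF B'(1,2), of "\<lambda>e. ip f e"] B'(3)[OF e]] by simp
qed

lemma sq_resid:
  assumes B: "orthonormal B" and f: "f \<in> C_G"
  shows "sq (resid B f) = sq f - (\<Sum>e\<in>B. (cmod (ip f e))^2)"
proof -
  note B' = orthonormalD[OF B]
  let ?p = "\<lambda>x. \<Sum>e\<in>B. ip f e * e x"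
  have p: "?p \<in> C_G" by (rule C_G_lincomb[OF B'(1,2)])
  have pe: "ip ?p e = ip f e" if "e \<in> B" for e
    using lincomb_unique[OF B _ that, of ?p "\<lambda>e. ip f e"] by simp
  have "?p \<in> fspan B" by (rule fspanI) simp
  then have sp: "sq ?p = (\<Sum>e\<in>B. (cmod (ip f e))^2)"
    using sq_parseval[OF B] pe by simp
  have "ip f ?p = (\<Sum>e\<in>B. cnj (ip f e) * ip f e)" by (rule ip_lincomb_right[OF B'(1,2) f])
  also have "\<dots> = of_real (\<Sum>e\<in>B. (cmod (ip f e))^2)"
    unfolding of_real_sum complex_norm_square by (simp only: mult.commute)
  finally have "Re (ip f ?p) = (\<Sum>e\<in>B. (cmod (ip f e))^2)" by (metis Re_complex_of_real)
  then show ?thesis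
    unfolding resid_def[abs_def] using sq_diff[OF f p] sp by simp
qed

lemma bessel:
  assumes "orthonormal B" "f \<in> C_G"
  shows "(\<Sum>e\<in>B. (cmod (ip f e))^2) \<le> sq f"
  using sq_resid[OF assms] sq_nonneg[OF C_G_resid[OF assms]] by simp

text \<open>The last conclusion keeps the new vector in every subspace that contains
  \<open>f\<close> and \<open>B\<close>, so bases can be built inside a prescribed space.\<close>

lemma gram_schmidt_step:
  assumes B: "orthonormal B" and f: "f \<in> C_G" "f \<notin> fspan B"
  obtains e where "e \<notin> B" "orthonormal (insert e B)" "f \<in> fspan (insert e B)" "e \<in> fspan (insert f B)"
proof -
  note B' = orthonormalD[OF B]
  have r: "resid B f \<in> C_G" by (rule C_G_resid[OF B f(1)])
  have "sq (resid B f) \<noteq> 0"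
  proof
    assume "sq (resid B f) = 0"
    then have "\<And>x. x \<in> carrier G \<Longrightarrow> resid B f x = 0" using sq_eq_0[OF r] by blast
    then show False using f(2) fspanI[of f "\<lambda>e. ip f e" B] by (simp add: resid_def)
  qed
  then have pos: "sq (resid B f) > 0" using sq_nonneg[OF r] by simp
  define s where "s = sqrt (sq (resid B f))"
  have s: "s > 0" "s^2 = sq (resid B f)" using pos by (auto simp: s_def)
  define e where "e = (\<lambda>x. of_real (1/s) * resid B f x)"
  have e: "e \<in> C_G" unfolding e_def by (rule C_G_mult_const[OF r])
  have "sq e = 1" unfolding e_def sq_mult[OF r] using s pos by (simp add: norm_divide power_divide)
  then have ee: "ip e e = 1" using ip_self[OF e] by simp
  have eb: "ip e b = 0" if "b \<in> B" for b
    unfolding e_def ip_mult_left[OF r B'(3)[OF that]] ip_resid[OF B f(1) that] by simp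
  have be: "ip b e = 0" if "b \<in> B" for b
    using ip_commute[OF e B'(3)[OF that]] eb[OF that] by simp
  have nin: "e \<notin> B" using eb ee by fastforce
  have "ip a b = (if a = b then 1 else 0)" if "a \<in> insert e B" "b \<in> insert e B" for a b
    using that ee eb be B'(4)[of a b] nin by (cases "a = e"; cases "b = e") auto
  then have "orthonormal (insert e B)" using B' e unfolding orthonormal_def by auto
  moreover have "f \<in> fspan (insert e B)"
    by (rule fspanI[where c = "\<lambda>b. if b = e then of_real s else ip f b"])
      (use B'(1) nin s in \<open>auto simp: e_def resid_def if_distrib cong: if_cong intro!: sum.cong\<close>)
  moreover have "e \<in> fspan (insert f B)"
  proof -
    have "(\<lambda>x. \<Sum>b\<in>B. ip f b * b x) \<in> fspan (insert f B)"
      using B'(1) by (intro fspan_sum fspan_mult fspan_base) auto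
    moreover have "f \<in> fspan (insert f B)" using B'(1) by (intro fspan_base) auto
    ultimately have "(\<lambda>x. f x + (-1) * (\<Sum>b\<in>B. ip f b * b x)) \<in> fspan (insert f B)"
      by (intro fspan_add fspan_mult)
    then have "(\<lambda>x. of_real (1/s) * (f x + (-1) * (\<Sum>b\<in>B. ip f b * b x))) \<in> fspan (insert f B)"
      by (rule fspan_mult)
    then show ?thesis by (simp add: e_def resid_def)
  qed
  ultimately show ?thesis using that nin by blast
qed

lemma orthonormal_empty: "orthonormal {}"
  by (simp add: orthonormal_def)

lemma gram_schmidt:
  assumes "finite S" "S \<subseteq> C_G"
  shows "\<exists>B. orthonormal B \<and> fspan B = fspan S"
  using assms
proof (induction S rule: finite_induct)
  case empty
  then show ?case using orthonormal_empty by blast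
next
  case (insert f S)
  then obtain B where B: "orthonormal B" "fspan B = fspan S" by auto
  have f: "f \<in> C_G" using insert by simp
  have fin: "finite B" "finite (insert f S)" "finite (insert f B)" using B insert orthonormalD(1) by auto
  have SB: "S \<subseteq> fspan B" using fspan_base[OF insert(1)] B(2) by auto
  have BS: "B \<subseteq> fspan (insert f S)"
    using fspan_base[OF fin(1)] B(2) fspan_mono[OF fin(2), of S] by auto
  have 1: "fspan (insert f B) \<subseteq> fspan (insert f S)"
    using fspan_subset[OF fin(3)] BS fspan_base[OF fin(2), of f] by simp
  show ?case
  proof (cases "f \<in> fspan B")
    case True
    then have "fspan (insert f S) \<subseteq> fspan B" using SB fin by (intro fspan_subset) auto
    moreover have "fspan B \<subseteq> fspan (insert f S)" using BS fin by (intro fspan_subset)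
    ultimately show ?thesis using B(1) by blast
  next
    case False
    obtain e where e: "e \<notin> B" "orthonormal (insert e B)" "f \<in> fspan (insert e B)" "e \<in> fspan (insert f B)"
      by (rule gram_schmidt_step[OF B(1) f False])
    have fe: "finite (insert e B)" using fin by simp
    have "fspan (insert e B) \<subseteq> fspan (insert f S)"
      using e(4) 1 BS fe by (intro fspan_subset) auto
    moreover have "S \<subseteq> fspan (insert e B)" using SB fspan_mono[OF fe, of B] by auto
    then have "fspan (insert f S) \<subseteq> fspan (insert e B)"
      using e(3) fin by (intro fspan_subset) auto
    ultimately show ?thesis using e(2) by blast
  qed
qed

text \<open>The sum of all \<open>(cmod (ip f e))^2\<close> is evaluated twice: Parseval in
  \<open>fspan B\<close> makes it \<open>card B'\<close>, Bessel for \<open>B'\<close> bounds it by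
  \<open>card B\<close>.\<close>

lemma orthonormal_card_le:
  assumes B: "orthonormal B" and B': "orthonormal B'" "B' \<subseteq> fspan B"
  shows "card B' \<le> card B"
proof -
  note D = orthonormalD[OF B] and D' = orthonormalD[OF B'(1)]
  have one: "sq e = 1" if "orthonormal X" "e \<in> X" for X e
    using orthonormalD(4)[OF that(1) that(2) that(2)] by (simp add: sq_def)
  have "real (card B') = (\<Sum>f\<in>B'. sq f)" using one[OF B'(1)] by simp
  also have "\<dots> = (\<Sum>f\<in>B'. \<Sum>e\<in>B. (cmod (ip f e))^2)"
    using B'(2) by (intro sum.cong refl sq_parseval[OF B]) auto
  also have "\<dots> = (\<Sum>e\<in>B. \<Sum>f\<in>B'. (cmod (ip e f))^2)"
    by (subst sum.swap) (intro sum.cong refl, metis D(3) D'(3) ip_commute complex_mod_cnj)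
  also have "\<dots> \<le> (\<Sum>e\<in>B. sq e)"
    using D(3) by (intro sum_mono bessel[OF B'(1)])
  also have "\<dots> = real (card B)" using one[OF B] by simp
  finally show ?thesis by simp
qed

lemma fspan_eq_if_card_ge:
  assumes B: "orthonormal B" and B': "orthonormal B'" "B' \<subseteq> fspan B" and c: "card B \<le> card B'"
  shows "fspan B' = fspan B"
proof (rule antisym)
  show "fspan B' \<subseteq> fspan B" using fspan_subset[OF orthonormalD(1)[OF B'(1)] B'(2)] .
  show "fspan B \<subseteq> fspan B'"
  proof (rule ccontr)
    assume "\<not> fspan B \<subseteq> fspan B'"
    then obtain f where f: "f \<in> fspan B" "f \<notin> fspan B'" by blast
    have fC: "f \<in> C_G" by (rule fspan_C_G[OF orthonormalD(1,2)[OF B] f(1)])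
    obtain e where e: "e \<notin> B'" "orthonormal (insert e B')" "e \<in> fspan (insert f B')"
      by (rule gram_schmidt_step[OF B'(1) fC f(2)])
    have "fspan (insert f B') \<subseteq> fspan B"
      using f(1) B'(2) orthonormalD(1)[OF B'(1)] by (intro fspan_subset) auto
    then have "insert e B' \<subseteq> fspan B" using e(3) B'(2) by auto
    from orthonormal_card_le[OF B e(2) this] show False
      using c e(1) orthonormalD(1)[OF B'(1)] by simp
  qed
qed

text \<open>An orthonormal subset of largest size spans \<open>E\<close>, since otherwise
  \<open>gram_schmidt_step\<close> would enlarge it. Finite dimension is always established in this
  form, by bounding orthonormal subsets.\<close>

lemma orthonormal_basis_exists:
  assumes E: "E \<subseteq> C_G" "\<And>B. finite B \<Longrightarrow> B \<subseteq> E \<Longrightarrow> fspan B \<subseteq> E"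
    and N: "\<And>B. orthonormal B \<Longrightarrow> B \<subseteq> E \<Longrightarrow> card B \<le> N"
  obtains B where "orthonormal B" "fspan B = E"
proof -
  define P where "P n \<longleftrightarrow> (\<exists>B. orthonormal B \<and> B \<subseteq> E \<and> card B = n)" for n
  have "P 0" unfolding P_def using orthonormal_empty by (intro exI[of _ "{}"]) auto
  moreover have "\<forall>n. P n \<longrightarrow> n \<le> N" unfolding P_def using N by blast
  ultimately obtain n where n: "P n" "\<And>m. P m \<Longrightarrow> m \<le> n"
    by (metis GreatestI_nat Greatest_le_nat)
  then obtain B where B: "orthonormal B" "B \<subseteq> E" "card B = n" unfolding P_def by blast
  have "E \<subseteq> fspan B"
  proof (rule ccontr)
    assume "\<not> E \<subseteq> fspan B"
    then obtain f where f: "f \<in> E" "f \<notin> fspan B" by blast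
    have fC: "f \<in> C_G" using f(1) E(1) by blast
    obtain e where e: "e \<notin> B" "orthonormal (insert e B)" "e \<in> fspan (insert f B)"
      by (rule gram_schmidt_step[OF B(1) fC f(2)])
    have "fspan (insert f B) \<subseteq> E" using f(1) B orthonormalD(1)[OF B(1)] by (intro E(2)) auto
    then have "insert e B \<subseteq> E" using e(3) B(2) by auto
    then have "P (card (insert e B))" unfolding P_def using e(2) by blast
    then show False using n(2)[of "card (insert e B)"] B(3) e(1) orthonormalD(1)[OF B(1)] by simp
  qed
  moreover have "fspan B \<subseteq> E" by (rule E(2)[OF orthonormalD(1)[OF B(1)] B(2)])
  ultimately show ?thesis using that[OF B(1)] by blast
qed

lemma cauchy_schwarz:
  assumes f: "f \<in> C_G" and g: "g \<in> C_G"
  shows "(cmod (ip f g))^2 \<le> sq f * sq g"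
proof (cases "sq g = 0")
  case True
  then have "\<And>x. x \<in> carrier G \<Longrightarrow> g x = 0" using sq_eq_0[OF g] by blast
  then have "ip f g = ip f (\<lambda>x. 0)" by (intro ip_cong) auto
  then show ?thesis using True by (simp add: ip_def)
next
  case False
  then have pos: "sq g > 0" using sq_nonneg[OF g] by simp
  define e where "e = (\<lambda>x. of_real (1 / sqrt (sq g)) * g x)"
  have e: "e \<in> C_G" unfolding e_def by (rule C_G_mult_const[OF g])
  have "sq e = 1" unfolding e_def sq_mult[OF g] using pos by (simp add: norm_divide power_divide)
  then have "ip e e = 1" using ip_self[OF e] by simp
  then have "orthonormal {e}" using e by (simp add: orthonormal_def)
  from bessel[OF this f] have "(cmod (ip f e))^2 \<le> sq f" by simp
  moreover have "(cmod (ip f e))^2 = (cmod (ip f g))^2 / sq g"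
    unfolding e_def ip_mult_right[OF g f] using pos by (simp add: norm_mult norm_divide power_divide)
  ultimately show ?thesis using pos by (simp add: field_simps)
qed

end

section \<open>Central convolution operators\<close>

text \<open>Real and imaginary parts are rounded to a grid of mesh \<open>d / 2\<close>; boundedness
  leaves finitely many patterns on \<open>X\<close>. Equal codes mean an error of at most
  \<open>d / 2\<close> in each part, hence at most \<open>d\<close> in modulus. This is the
  pigeonhole form of compactness of a polydisc.\<close>

lemma finite_code:
  fixes g :: "nat \<Rightarrow> 'x \<Rightarrow> complex"
  assumes X: "finite X" and B: "\<And>n x. x \<in> X \<Longrightarrow> cmod (g n x) \<le> B" and d: "d > 0"
  obtains code :: "nat \<Rightarrow> 'x \<Rightarrow> int \<times> int" where "finite (range code)"
    "\<forall>m n. code m = code n \<longrightarrow> (\<forall>x\<in>X. cmod (g m x - g n x) \<le> d)"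
proof -
  define q where "q z = (\<lfloor>2 * Re z / d\<rfloor>, \<lfloor>2 * Im z / d\<rfloor>)" for z
  define code where "code n = (\<lambda>x\<in>X. q (g n x))" for n
  define N where "N = \<lceil>2 * B / d\<rceil> + 1"
  have fl: "\<lfloor>2 * t / d\<rfloor> \<in> {-N..N}" if "\<bar>t\<bar> \<le> B" for t :: real
  proof -
    have "\<bar>2 * t / d\<bar> \<le> 2 * B / d" using that d by (simp add: divide_right_mono)
    then have "2 * t / d \<le> 2 * B / d" "- (2 * B / d) \<le> 2 * t / d" by linarith+
    then show ?thesis unfolding N_def by simp linarith
  qed
  have "q (g n x) \<in> {-N..N} \<times> {-N..N}" if "x \<in> X" for n x
    unfolding q_def using fl[of "Re (g n x)"] fl[of "Im (g n x)"] B[OF that, of n]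
      abs_Re_le_cmod[of "g n x"] abs_Im_le_cmod[of "g n x"] by auto
  then have "range code \<subseteq> X \<rightarrow>\<^sub>E {-N..N} \<times> {-N..N}"
    unfolding code_def by auto
  moreover have "finite (X \<rightarrow>\<^sub>E {-N..N} \<times> {-N..N})" using X by (intro finite_PiE) auto
  ultimately have fin: "finite (range code)" by (rule finite_subset)
  have near: "\<bar>s - t\<bar> \<le> d / 2" if "\<lfloor>2 * s / d\<rfloor> = \<lfloor>2 * t / d\<rfloor>" for s t :: real
  proof -
    have "2 * s / d - 2 * t / d < 1" "2 * t / d - 2 * s / d < 1" using that by linarith+
    then have "(2 * s - 2 * t) / d < 1" "(2 * t - 2 * s) / d < 1" by (simp_all only: diff_divide_distrib)
    then have "2 * s - 2 * t < d" "2 * t - 2 * s < d" using d by (simp_all add: pos_divide_less_eq)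
    then show ?thesis by linarith
  qed
  have "cmod (g m x - g n x) \<le> d" if c: "code m = code n" and x: "x \<in> X" for m n x
  proof -
    have "q (g m x) = q (g n x)" using fun_cong[OF c, of x] x by (simp add: code_def)
    then have fl: "\<lfloor>2 * Re (g m x) / d\<rfloor> = \<lfloor>2 * Re (g n x) / d\<rfloor>"
      "\<lfloor>2 * Im (g m x) / d\<rfloor> = \<lfloor>2 * Im (g n x) / d\<rfloor>" unfolding q_def by simp_all
    have "\<bar>Re (g m x) - Re (g n x)\<bar> \<le> d / 2" "\<bar>Im (g m x) - Im (g n x)\<bar> \<le> d / 2"
      by (rule near[OF fl(1)], rule near[OF fl(2)])
    then show ?thesis using cmod_le[of "g m x - g n x"] unfolding minus_complex.sel by linarith
  qed
  then show ?thesis by (intro that[OF fin] allI impI ballI)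
qed

text \<open>Total boundedness yields a Cauchy subsequence: infinite index sets with a common code
  for the tolerances \<open>inverse (Suc k)\<close> are nested, and \<open>r\<close> runs through
  them diagonally.\<close>

lemma Cauchy_subsequence_of_codes:
  fixes Q :: "real \<Rightarrow> nat \<Rightarrow> nat \<Rightarrow> bool"
  assumes code: "\<And>e. e > 0 \<Longrightarrow> \<exists>code :: nat \<Rightarrow> 'c. finite (range code) \<and> (\<forall>m n. code m = code n \<longrightarrow> Q e m n)"
    and mono: "\<And>e e' m n. Q e m n \<Longrightarrow> e \<le> e' \<Longrightarrow> Q e' m n"
  obtains r :: "nat \<Rightarrow> nat" where "strict_mono r" "\<forall>e>0. \<exists>N. \<forall>m\<ge>N. \<forall>n\<ge>N. Q e (r m) (r n)"
proof -
  define ee where "ee k = inverse (real (Suc k))" for k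
  have ee: "ee k > 0" for k by (simp add: ee_def)
  have step: "\<exists>J'. infinite J' \<and> J' \<subseteq> J \<and> (\<forall>m\<in>J'. \<forall>n\<in>J'. Q (ee k) m n)" if J: "infinite J" for J k
  proof -
    obtain c :: "nat \<Rightarrow> 'c" where c: "finite (range c)" "\<forall>m n. c m = c n \<longrightarrow> Q (ee k) m n"
      using code[OF ee[of k]] by (elim exE conjE)
    have "finite (c ` J)" using c(1) by (rule finite_subset[rotated]) auto
    from pigeonhole_infinite[OF J this] obtain j where j: "infinite {a \<in> J. c a = c j}" by (elim bexE)
    show ?thesis
      by (intro exI[of _ "{a \<in> J. c a = c j}"] conjI j) (use c(2) in auto)
  qed
  have "\<exists>J. \<forall>k. infinite (J k) \<and> (J (Suc k) \<subseteq> J k \<and> (\<forall>m\<in>J (Suc k). \<forall>n\<in>J (Suc k). Q (ee k) m n))"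
  proof (rule dependent_nat_choice)
    show "\<exists>x :: nat set. infinite x" using infinite_UNIV_nat ..
    show "\<exists>y. infinite y \<and> y \<subseteq> x \<and> (\<forall>m\<in>y. \<forall>n\<in>y. Q (ee k) m n)" if "infinite x" for x k
      by (rule step[OF that])
  qed
  then obtain J where J': "\<forall>k. infinite (J k) \<and> (J (Suc k) \<subseteq> J k \<and> (\<forall>m\<in>J (Suc k). \<forall>n\<in>J (Suc k). Q (ee k) m n))" ..
  then have J: "\<And>k. infinite (J k)" "\<And>k. J (Suc k) \<subseteq> J k"
    "\<And>k m n. m \<in> J (Suc k) \<Longrightarrow> n \<in> J (Suc k) \<Longrightarrow> Q (ee k) m n" by simp_all
  have dec: "J n \<subseteq> J m" if "m \<le> n" for m n
    using that J(2) by (rule lift_Suc_antimono_le[rotated])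
  have "\<exists>r. \<forall>k. r k \<in> J k \<and> r k < r (Suc k)"
  proof (rule dependent_nat_choice)
    show "\<exists>x. x \<in> J 0" using infinite_imp_nonempty[OF J(1)[of 0]] by (simp add: ex_in_conv)
    show "\<exists>y. y \<in> J (Suc n) \<and> x < y" for x n
      using J(1)[of "Suc n"] unfolding infinite_nat_iff_unbounded by (elim allE exE conjE) (intro exI conjI)
  qed
  then obtain r where "\<forall>k. r k \<in> J k \<and> r k < r (Suc k)" ..
  then have r: "\<And>k. r k \<in> J k" "\<And>k. r k < r (Suc k)" by simp_all
  have "strict_mono r" using r(2) by (simp add: strict_mono_Suc_iff)
  moreover have "\<exists>N. \<forall>m\<ge>N. \<forall>n\<ge>N. Q e (r m) (r n)" if e: "e > 0" for e
  proof -
    obtain k where k: "ee k < e" using reals_Archimedean[OF e] by (auto simp: ee_def)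
    have "Q e (r m) (r n)" if "m \<ge> Suc k" "n \<ge> Suc k" for m n
      using J(3)[of "r m" k "r n"] r(1)[of m] r(1)[of n] dec[OF that(1)] dec[OF that(2)] k
      by (intro mono[of "ee k" _ _ e]) auto
    then show ?thesis by (intro exI[of _ "Suc k"]) simp
  qed
  ultimately show ?thesis using that[of r] by simp
qed

context compact_hausdorff_group
begin

lemma uniform_limit_mem:
  fixes h :: "nat \<Rightarrow> 'a \<Rightarrow> complex"
  assumes A: "sup_closed A" and h: "\<And>n. h n \<in> A"
    and C: "\<forall>e>0. \<exists>N. \<forall>m\<ge>N. \<forall>n\<ge>N. \<forall>x\<in>carrier G. cmod (h m x - h n x) \<le> e"
  obtains g where "g \<in> A" "\<forall>e>0. \<exists>N. \<forall>n\<ge>N. \<forall>x\<in>carrier G. cmod (h n x - g x) \<le> e"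
proof -
  define g where "g x = lim (\<lambda>n. h n x)" for x
  have "Cauchy (\<lambda>n. h n x)" if x: "x \<in> carrier G" for x
  proof (rule CauchyI)
    fix e :: real assume "e > 0"
    then obtain N where N: "\<forall>m\<ge>N. \<forall>n\<ge>N. \<forall>x\<in>carrier G. cmod (h m x - h n x) \<le> e / 2"
      using C[rule_format, of "e/2"] by auto
    show "\<exists>M. \<forall>m\<ge>M. \<forall>n\<ge>M. cmod (h m x - h n x) < e"
    proof (intro exI[of _ N] allI impI)
      fix m n assume "m \<ge> N" "n \<ge> N"
      then have "cmod (h m x - h n x) \<le> e / 2" using N x by simp
      then show "cmod (h m x - h n x) < e" using \<open>e > 0\<close> by simp
    qed
  qed
  then have lim: "(\<lambda>n. h n x) \<longlonglongrightarrow> g x" if "x \<in> carrier G" for x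
    using that unfolding g_def by (simp add: Cauchy_convergent_iff convergent_LIMSEQ_iff)
  have unif: "\<forall>e>0. \<exists>N. \<forall>n\<ge>N. \<forall>x\<in>carrier G. cmod (h n x - g x) \<le> e"
  proof (intro allI impI)
    fix e :: real assume "e > 0"
    then obtain N where N: "\<forall>m\<ge>N. \<forall>n\<ge>N. \<forall>x\<in>carrier G. cmod (h m x - h n x) \<le> e"
      using C by blast
    show "\<exists>N. \<forall>n\<ge>N. \<forall>x\<in>carrier G. cmod (h n x - g x) \<le> e"
    proof (intro exI[of _ N] allI impI ballI)
      fix n x assume n: "n \<ge> N" and x: "x \<in> carrier G"
      have "(\<lambda>m. cmod (h n x - h m x)) \<longlonglongrightarrow> cmod (h n x - g x)"
        by (intro tendsto_intros lim[OF x])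
      then show "cmod (h n x - g x) \<le> e"
        by (rule LIMSEQ_le_const2) (use N n x in auto)
    qed
  qed
  have "g \<in> A"
  proof (rule sup_closedD[OF A])
    fix e :: real assume "e > 0"
    then obtain N where "\<forall>n\<ge>N. \<forall>x\<in>carrier G. cmod (h n x - g x) \<le> e" using unif by blast
    then have "\<forall>x\<in>carrier G. cmod (g x - h N x) \<le> e" by (simp add: norm_minus_commute)
    then show "\<exists>f\<in>A. \<forall>x\<in>carrier G. cmod (g x - f x) \<le> e" using h by blast
  qed
  then show ?thesis using that unif by simp
qed

lemma mean_norm_le_mean:
  assumes "g \<in> C_G" "h \<in> C_G" "\<And>x. x \<in> carrier G \<Longrightarrow> cmod (g x) \<le> Re (h x)"
  shows "cmod (mean g) \<le> Re (mean h)"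
proof (rule field_le_epsilon)
  fix e :: real assume e: "e > 0"
  then have e2: "e / 2 > 0" by simp
  have gh: "finite {g, h}" "{g, h} \<subseteq> C_G" using assms by auto
  obtain A where A: "glist A" "\<forall>f\<in>{g, h}. cmod (avg A f - mean f) \<le> e / 2"
    by (rule mean_avg_finite[OF gh e2])
  have Ag: "cmod (avg A g - mean g) \<le> e / 2" and Ah: "cmod (avg A h - mean h) \<le> e / 2" using A(2) by auto
  have "\<forall>a\<in>set A. cmod (g a) \<le> Re (h a)" using A(1) assms(3) by (auto simp: glist_def)
  then have "cmod (\<Sum>a\<leftarrow>A. g a) \<le> Re (\<Sum>a\<leftarrow>A. h a)"
  proof (induction A)
    case (Cons a A)
    then show ?case using norm_triangle_ineq[of "g a" "\<Sum>a\<leftarrow>A. g a"] by simp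
  qed simp
  then have "cmod (avg A g) \<le> Re (avg A h)"
    by (simp add: avg_def norm_divide divide_right_mono)
  moreover have "\<bar>Re (avg A h - mean h)\<bar> \<le> e / 2" using Ah abs_Re_le_cmod order_trans by blast
  ultimately show "cmod (mean g) \<le> Re (mean h) + e"
    using Ag norm_triangle_sub[of "mean g" "avg A g"]
    unfolding minus_complex.sel norm_minus_commute[of "mean g"] by linarith
qed

text \<open>Convolution with such a function is self-adjoint and commutes with all left and right
  translations.\<close>

definition kernel :: "('a \<Rightarrow> complex) \<Rightarrow> bool" where
  "kernel k \<longleftrightarrow> k \<in> C_G \<and> (\<forall>x\<in>carrier G. k (inv x) = k x \<and> cnj (k x) = k x) \<and>
    (\<forall>x\<in>carrier G. \<forall>y\<in>carrier G. k (x \<otimes> y) = k (y \<otimes> x))"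

lemma kernelD:
  assumes "kernel k"
  shows "k \<in> C_G" "x \<in> carrier G \<Longrightarrow> k (inv x) = k x" "x \<in> carrier G \<Longrightarrow> cnj (k x) = k x"
    "x \<in> carrier G \<Longrightarrow> y \<in> carrier G \<Longrightarrow> k (x \<otimes> y) = k (y \<otimes> x)"
  using assms unfolding kernel_def by auto

text \<open>The supremum over all two-sided translates makes this invariant under inversion and
  under exchanging the factors of a product, hence a class function. Functions of it are therefore
  candidates for a \<open>kernel\<close>.\<close>

definition displacement :: "('a \<Rightarrow> complex) \<Rightarrow> 'a \<Rightarrow> real" where
  "displacement f x = (SUP p\<in>carrier G \<times> carrier G. cmod (f (fst p \<otimes> x \<otimes> snd p) - f (fst p \<otimes> snd p)))"

lemma displacement_upper:
  assumes f: "f \<in> C_G" and "x \<in> carrier G" "a \<in> carrier G" "b \<in> carrier G"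
  shows "cmod (f (a \<otimes> x \<otimes> b) - f (a \<otimes> b)) \<le> displacement f x"
proof -
  obtain B where B: "B > 0" "\<And>x. x \<in> carrier G \<Longrightarrow> cmod (f x) \<le> B" using C_G_bounded[OF f] by blast
  have "cmod (f (fst p \<otimes> x \<otimes> snd p) - f (fst p \<otimes> snd p)) \<le> B + B" if "p \<in> carrier G \<times> carrier G" for p
    using that assms(2) B(2)[of "fst p \<otimes> x \<otimes> snd p"] B(2)[of "fst p \<otimes> snd p"]
      norm_triangle_ineq4[of "f (fst p \<otimes> x \<otimes> snd p)" "f (fst p \<otimes> snd p)"] by (auto simp: mem_Times_iff)
  then have "bdd_above ((\<lambda>p. cmod (f (fst p \<otimes> x \<otimes> snd p) - f (fst p \<otimes> snd p))) ` (carrier G \<times> carrier G))"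
    by (intro bdd_aboveI2)
  from cSUP_upper[OF _ this, of "(a, b)"] show ?thesis using assms by (simp add: displacement_def)
qed

lemma displacement_least:
  assumes "\<And>a b. a \<in> carrier G \<Longrightarrow> b \<in> carrier G \<Longrightarrow> cmod (f (a \<otimes> x \<otimes> b) - f (a \<otimes> b)) \<le> M"
  shows "displacement f x \<le> M"
proof -
  have "carrier G \<times> carrier G \<noteq> {}" by auto
  then show ?thesis unfolding displacement_def
    by (rule cSUP_least) (use assms in auto)
qed

lemma displacement_inv_le:
  assumes f: "f \<in> C_G" and x: "x \<in> carrier G"
  shows "displacement f (inv x) \<le> displacement f x"
proof (rule displacement_least)
  fix a b assume ab: "a \<in> carrier G" "b \<in> carrier G"
  have "a \<otimes> inv x \<otimes> x = a" using ab x by (simp add: m_assoc)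
  then show "cmod (f (a \<otimes> inv x \<otimes> b) - f (a \<otimes> b)) \<le> displacement f x"
    using displacement_upper[OF f x, of "a \<otimes> inv x" b] ab x by (simp add: norm_minus_commute)
qed

text \<open>Inside the supremum \<open>a\<close> is replaced by \<open>a \<otimes> inv x\<close> and
  \<open>b\<close> by \<open>x \<otimes> b\<close>.\<close>

lemma displacement_swap_le:
  assumes f: "f \<in> C_G" and x: "x \<in> carrier G" and y: "y \<in> carrier G"
  shows "displacement f (y \<otimes> x) \<le> displacement f (x \<otimes> y)"
proof (rule displacement_least)
  fix a b assume ab: "a \<in> carrier G" "b \<in> carrier G"
  have "(a \<otimes> inv x) \<otimes> (x \<otimes> y) \<otimes> (x \<otimes> b) = a \<otimes> (y \<otimes> x) \<otimes> b" "(a \<otimes> inv x) \<otimes> (x \<otimes> b) = a \<otimes> b"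
    using ab x y by (simp_all add: m_assoc inv_solve_left) (simp_all add: m_assoc[symmetric])
  then show "cmod (f (a \<otimes> (y \<otimes> x) \<otimes> b) - f (a \<otimes> b)) \<le> displacement f (x \<otimes> y)"
    using displacement_upper[OF f m_closed[OF x y], of "a \<otimes> inv x" "x \<otimes> b"] ab x y by simp
qed

text \<open>The convolution operator with the kernel \<open>max 0 (e - displacement f)\<close> moves \<open>f\<close> by a relative
  amount of at most \<open>e\<close>, because the kernel vanishes where translation moves \<open>f\<close> too much.\<close>

lemma kernel_exists:
  assumes f: "f \<in> C_G" and e: "e > 0"
  obtains k where "kernel k" "\<forall>x\<in>carrier G. Re (k x) \<ge> 0" "Re (k \<one>) > 0"
    "\<forall>x\<in>carrier G. \<forall>y\<in>carrier G. k x \<noteq> 0 \<longrightarrow> cmod (f (x \<otimes> y) - f y) \<le> e"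
proof -
  define k where "k x = complex_of_real (max 0 (e - displacement f x))" for x
  have inv: "displacement f (inv x) = displacement f x" if "x \<in> carrier G" for x
    using displacement_inv_le[OF f that] displacement_inv_le[OF f inv_closed[OF that]] that by simp
  have swap: "displacement f (x \<otimes> y) = displacement f (y \<otimes> x)" if "x \<in> carrier G" "y \<in> carrier G" for x y
    using displacement_swap_le[OF f] that by (intro antisym) auto
  have kC: "k \<in> C_G"
  proof (rule C_G_localI)
    fix x and r :: real assume x: "x \<in> carrier G" and r: "r > 0"
    then have r2: "r / 2 > 0" by simp
    obtain U where U: "openin T U" "x \<in> U" and near: "\<forall>x'\<in>U. \<forall>a\<in>carrier G. \<forall>b\<in>carrier G.
        cmod (f (a \<otimes> x' \<otimes> b) - f (a \<otimes> x \<otimes> b)) < r / 2"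
      using translation_local[OF f x r2] by (elim exE conjE)
    have "cmod (k x' - k x) < r" if x': "x' \<in> U" for x'
    proof -
      have xG: "x' \<in> carrier G" using x' U(1) openin_subset topspace_eq_carrier by blast
      have n: "cmod (f (a \<otimes> x' \<otimes> b) - f (a \<otimes> x \<otimes> b)) < r / 2" if "a \<in> carrier G" "b \<in> carrier G" for a b
        using near x' that by simp
      have "displacement f x' \<le> displacement f x + r / 2"
      proof (rule displacement_least)
        fix a b assume ab: "a \<in> carrier G" "b \<in> carrier G"
        show "cmod (f (a \<otimes> x' \<otimes> b) - f (a \<otimes> b)) \<le> displacement f x + r / 2"
          using n[OF ab] displacement_upper[OF f x ab]
            norm_triangle_ineq[of "f (a \<otimes> x' \<otimes> b) - f (a \<otimes> x \<otimes> b)" "f (a \<otimes> x \<otimes> b) - f (a \<otimes> b)"] by simp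
      qed
      moreover have "displacement f x \<le> displacement f x' + r / 2"
      proof (rule displacement_least)
        fix a b assume ab: "a \<in> carrier G" "b \<in> carrier G"
        show "cmod (f (a \<otimes> x \<otimes> b) - f (a \<otimes> b)) \<le> displacement f x' + r / 2"
          using n[OF ab] displacement_upper[OF f xG ab]
            norm_triangle_ineq4[of "f (a \<otimes> x' \<otimes> b) - f (a \<otimes> b)" "f (a \<otimes> x' \<otimes> b) - f (a \<otimes> x \<otimes> b)"] by simp
      qed
      ultimately have "\<bar>max 0 (e - displacement f x') - max 0 (e - displacement f x)\<bar> < r"
        using r by linarith
      then show ?thesis unfolding k_def by (simp only: of_real_diff[symmetric] norm_of_real)
    qed
    then show "\<exists>U. openin T U \<and> x \<in> U \<and> (\<forall>y\<in>U. cmod (k y - k x) < r)"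
      using U by (intro exI[of _ U] conjI ballI)
  qed
  have "displacement f \<one> \<le> 0" by (rule displacement_least) simp
  then have 1: "Re (k \<one>) > 0" using e by (simp add: k_def)
  have "kernel k" unfolding kernel_def using kC inv swap by (simp add: k_def)
  moreover have "cmod (f (x \<otimes> y) - f y) \<le> e" if "x \<in> carrier G" "y \<in> carrier G" "k x \<noteq> 0" for x y
  proof -
    have "displacement f x < e" using that(3) by (auto simp: k_def max_def split: if_splits)
    then show ?thesis using displacement_upper[OF f that(1) one_closed that(2)] that by simp
  qed
  ultimately show ?thesis using that[of k] 1 by (simp add: k_def)
qed

section \<open>Convolution operators and their smoothing property\<close>

definition conv :: "('a \<Rightarrow> complex) \<Rightarrow> ('a \<Rightarrow> complex) \<Rightarrow> 'a \<Rightarrow> complex" where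
  "conv k f x = mean (\<lambda>y. k (x \<otimes> inv y) * f y)"

lemma jcont_conv:
  assumes "k \<in> C_G" "f \<in> C_G"
  shows "jcont (\<lambda>x y. k (x \<otimes> inv y) * f y)"
  by (intro jcont_mult jcont_snd[OF assms(2)] jcont_compose[OF assms(1)]
      continuous_map_group_mult continuous_map_group_inv continuous_map_fst continuous_map_snd)

lemma C_G_conv: "k \<in> C_G \<Longrightarrow> f \<in> C_G \<Longrightarrow> conv k f \<in> C_G"
  unfolding conv_def[abs_def] by (rule C_G_mean_param[OF jcont_conv])

lemma C_G_kernel_section: "k \<in> C_G \<Longrightarrow> x \<in> carrier G \<Longrightarrow> (\<lambda>y. k (x \<otimes> inv y)) \<in> C_G"
  using C_G_inv[OF C_G_left[of k x]] by simp

lemma conv_cong: "(\<And>y. y \<in> carrier G \<Longrightarrow> f y = g y) \<Longrightarrow> conv k f x = conv k g x"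
  unfolding conv_def by (intro mean_cong) simp

text \<open>The substitution of \<open>y \<otimes> x\<close> for \<open>y\<close> exhibits the
  convolution as a weighted mean of left translates of \<open>f\<close>, the shape required by
  \<open>mean_left_translates_mem\<close>.\<close>

lemma conv_alt:
  assumes k: "k \<in> C_G" and f: "f \<in> C_G" and x: "x \<in> carrier G"
  shows "conv k f x = mean (\<lambda>y. k (inv y) * f (y \<otimes> x))"
proof -
  have "(\<lambda>y. k (x \<otimes> inv y) * f y) \<in> C_G" by (intro C_G_mult C_G_kernel_section k f x)
  from mean_right[OF this x]
  have "conv k f x = mean (\<lambda>y. k (x \<otimes> inv (y \<otimes> x)) * f (y \<otimes> x))" by (simp add: conv_def)
  also have "\<dots> = mean (\<lambda>y. k (inv y) * f (y \<otimes> x))"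
    using x by (intro mean_cong) (simp add: inv_mult_group m_assoc[symmetric])
  finally show ?thesis .
qed

lemma conv_mem:
  assumes A: "translation_space A" and k: "k \<in> C_G" and f: "f \<in> A"
  shows "conv k f \<in> A"
  using sup_closed_cong[OF translation_spaceD(3)[OF A] mean_left_translates_mem[OF A f C_G_inv[OF k]]]
    conv_alt[OF k translation_spaceD(1)[OF A f]] by blast

text \<open>Translation from the left conjugates the argument of \<open>k\<close> by
  \<open>a\<close>, and \<open>k\<close> is a class function.\<close>

lemma conv_left:
  assumes k: "kernel k" and f: "f \<in> C_G" and a: "a \<in> carrier G" and x: "x \<in> carrier G"
  shows "conv k (\<lambda>x. f (a \<otimes> x)) x = conv k f (a \<otimes> x)"
proof -
  note kC = kernelD(1)[OF k]
  have "(\<lambda>y. k (a \<otimes> x \<otimes> inv y) * f y) \<in> C_G" using a x by (intro C_G_mult C_G_kernel_section kC f) auto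
  from mean_left[OF this a]
  have "conv k f (a \<otimes> x) = mean (\<lambda>y. k (a \<otimes> x \<otimes> inv (a \<otimes> y)) * f (a \<otimes> y))" by (simp add: conv_def)
  also have "\<dots> = mean (\<lambda>y. k (x \<otimes> inv y) * f (a \<otimes> y))"
  proof (intro mean_cong)
    fix y assume y: "y \<in> carrier G"
    have "k (a \<otimes> x \<otimes> inv (a \<otimes> y)) = k (a \<otimes> (x \<otimes> inv y \<otimes> inv a))"
      using a x y by (simp add: inv_mult_group m_assoc)
    also have "\<dots> = k ((x \<otimes> inv y \<otimes> inv a) \<otimes> a)" using a x y by (intro kernelD(4)[OF k]) auto
    also have "(x \<otimes> inv y \<otimes> inv a) \<otimes> a = x \<otimes> inv y" using a x y by (simp add: m_assoc)
    finally show "k (a \<otimes> x \<otimes> inv (a \<otimes> y)) * f (a \<otimes> y) = k (x \<otimes> inv y) * f (a \<otimes> y)" by simp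
  qed
  finally show ?thesis by (simp add: conv_def)
qed

lemma conv_right:
  assumes k: "kernel k" and f: "f \<in> C_G" and a: "a \<in> carrier G" and x: "x \<in> carrier G"
  shows "conv k (\<lambda>x. f (x \<otimes> a)) x = conv k f (x \<otimes> a)"
proof -
  note kC = kernelD(1)[OF k]
  have "(\<lambda>y. k (x \<otimes> a \<otimes> inv y) * f y) \<in> C_G" using a x by (intro C_G_mult C_G_kernel_section kC f) auto
  from mean_right[OF this a]
  have "conv k f (x \<otimes> a) = mean (\<lambda>y. k (x \<otimes> a \<otimes> inv (y \<otimes> a)) * f (y \<otimes> a))" by (simp add: conv_def)
  also have "\<dots> = mean (\<lambda>y. k (x \<otimes> inv y) * f (y \<otimes> a))"
  proof (intro mean_cong)
    fix y assume y: "y \<in> carrier G"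
    have "x \<otimes> a \<otimes> inv (y \<otimes> a) = x \<otimes> (a \<otimes> inv a) \<otimes> inv y"
      using a x y by (simp only: inv_mult_group m_assoc inv_closed m_closed)
    also have "\<dots> = x \<otimes> inv y" using a x y by simp
    finally show "k (x \<otimes> a \<otimes> inv (y \<otimes> a)) * f (y \<otimes> a) = k (x \<otimes> inv y) * f (y \<otimes> a)" by simp
  qed
  finally show ?thesis by (simp add: conv_def)
qed

text \<open>Since \<open>k\<close> is real, conjugating it changes nothing. In this form linearity
  and the Cauchy-Schwarz inequality apply directly.\<close>

lemma conv_ip:
  assumes k: "kernel k" and x: "x \<in> carrier G"
  shows "conv k f x = ip f (\<lambda>y. k (x \<otimes> inv y))"
  unfolding conv_def ip_def
  by (intro mean_cong) (simp add: kernelD(3)[OF k] x mult.commute)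

lemma conv_diff:
  assumes k: "kernel k" and "f \<in> C_G" "g \<in> C_G" "x \<in> carrier G"
  shows "conv k (\<lambda>x. f x - g x) x = conv k f x - conv k g x"
  using assms by (simp add: conv_ip ip_diff_left C_G_kernel_section kernelD(1))

lemma conv_mult:
  assumes k: "kernel k" and "f \<in> C_G" "x \<in> carrier G"
  shows "conv k (\<lambda>x. c * f x) x = c * conv k f x"
  using assms by (simp add: conv_ip ip_mult_left C_G_kernel_section kernelD(1))

lemma conv_lincomb:
  assumes k: "kernel k" and "finite B" "B \<subseteq> C_G" "x \<in> carrier G"
  shows "conv k (\<lambda>x. \<Sum>e\<in>B. c e * e x) x = (\<Sum>e\<in>B. c e * conv k e x)"
  using assms by (simp add: conv_ip ip_lincomb_left C_G_kernel_section kernelD(1))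

text \<open>Fubini, together with the symmetry of a real kernel under inversion, which exchanges the
  roles of \<open>x\<close> and \<open>y\<close>.\<close>

lemma conv_self_adjoint:
  assumes k: "kernel k" and u: "u \<in> C_G" and v: "v \<in> C_G"
  shows "ip (conv k u) v = ip u (conv k v)"
proof -
  note kC = kernelD(1)[OF k]
  let ?F = "\<lambda>x y. k (x \<otimes> inv y) * u y * cnj (v x)"
  have F: "jcont ?F"
    by (intro jcont_mult jcont_conv[OF kC u] jcont_fst C_G_cnj v)
  have "ip (conv k u) v = mean (\<lambda>x. mean (?F x))"
    unfolding ip_def
  proof (intro mean_cong)
    fix x assume x: "x \<in> carrier G"
    have "(\<lambda>y. k (x \<otimes> inv y) * u y) \<in> C_G" by (intro C_G_mult C_G_kernel_section kC u x)
    from mean_mult_const[OF this, of "cnj (v x)"]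
    show "conv k u x * cnj (v x) = mean (?F x)" by (simp add: conv_def mult_ac)
  qed
  also have "\<dots> = mean (\<lambda>y. mean (\<lambda>x. ?F x y))" by (rule mean_fubini[OF F])
  also have "\<dots> = ip u (conv k v)"
    unfolding ip_def
  proof (intro mean_cong)
    fix y assume y: "y \<in> carrier G"
    have c: "(\<lambda>x. k (y \<otimes> inv x) * v x) \<in> C_G" by (intro C_G_mult C_G_kernel_section kC v y)
    have "u y * cnj (conv k v y) = u y * mean (\<lambda>x. cnj (k (y \<otimes> inv x) * v x))"
      unfolding conv_def mean_cnj[OF c] ..
    also have "\<dots> = mean (\<lambda>x. u y * cnj (k (y \<otimes> inv x) * v x))"
      by (rule mean_mult_const[OF C_G_cnj[OF c], symmetric])
    also have "\<dots> = mean (\<lambda>x. ?F x y)"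
    proof (intro mean_cong)
      fix x assume x: "x \<in> carrier G"
      have "cnj (k (y \<otimes> inv x)) = k (inv (y \<otimes> inv x))"
        using kernelD(2,3)[OF k, of "y \<otimes> inv x"] x y by simp
      also have "inv (y \<otimes> inv x) = x \<otimes> inv y" using x y by (simp add: inv_mult_group)
      finally show "u y * cnj (k (y \<otimes> inv x) * v x) = ?F x y" by simp
    qed
    finally show "mean (\<lambda>x. ?F x y) = u y * cnj (conv k v y)" by simp
  qed
  finally show ?thesis .
qed

text \<open>Cauchy-Schwarz against a section of the kernel bounds the sup norm of the convolution by
  the L2 norm of \<open>u\<close>. This is the substitute for completeness: L2 Cauchy sequences
  become uniformly Cauchy.\<close>

lemma conv_sup_le:
  assumes k: "kernel k" and B: "\<And>x. x \<in> carrier G \<Longrightarrow> cmod (k x) \<le> B" and u: "u \<in> C_G" and x: "x \<in> carrier G"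
  shows "(cmod (conv k u x))^2 \<le> B^2 * sq u"
proof -
  note kx = C_G_kernel_section[OF kernelD(1)[OF k] x]
  have "sq (\<lambda>y. k (x \<otimes> inv y)) \<le> B^2" using x by (intro sq_le[OF kx] B) auto
  then have "sq u * sq (\<lambda>y. k (x \<otimes> inv y)) \<le> sq u * B^2" using sq_nonneg[OF u] by (rule mult_left_mono)
  then show ?thesis using cauchy_schwarz[OF u kx] conv_ip[OF k x, of u] by (simp add: mult.commute)
qed

text \<open>The difference is the mean of \<open>k y * (f (y \<otimes> x) - f x)\<close>, and the
  bracket is at most \<open>e\<close> wherever \<open>k y\<close> does not vanish.\<close>

lemma conv_approx:
  assumes k: "kernel k" "\<forall>x\<in>carrier G. Re (k x) \<ge> 0" and f: "f \<in> C_G" and x: "x \<in> carrier G"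
    and near: "\<forall>x\<in>carrier G. \<forall>y\<in>carrier G. k x \<noteq> 0 \<longrightarrow> cmod (f (x \<otimes> y) - f y) \<le> e"
  shows "cmod (conv k f x - mean k * f x) \<le> e * Re (mean k)"
proof -
  note kC = kernelD(1)[OF k(1)]
  have eq1: "conv k f x = mean (\<lambda>y. k y * f (y \<otimes> x))"
    unfolding conv_alt[OF kC f x] by (intro mean_cong) (simp add: kernelD(2)[OF k(1)])
  have eq2: "mean k * f x = mean (\<lambda>y. k y * f x)"
    using mean_mult_const[OF kC, of "f x"] by (simp add: mult.commute)
  have C: "(\<lambda>y. k y * f (y \<otimes> x)) \<in> C_G" "(\<lambda>y. k y * f x) \<in> C_G"
    by (rule C_G_mult[OF kC C_G_right[OF f x]], rule C_G_mult[OF kC C_G_const])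
  have eq3: "conv k f x - mean k * f x = mean (\<lambda>y. k y * f (y \<otimes> x) - k y * f x)"
    by (simp only: eq1 eq2 mean_diff[OF C])
  have "cmod (mean (\<lambda>y. k y * f (y \<otimes> x) - k y * f x)) \<le> Re (mean (\<lambda>y. of_real e * k y))"
  proof (rule mean_norm_le_mean[OF C_G_diff[OF C] C_G_mult_const[OF kC]])
    fix y assume y: "y \<in> carrier G"
    have "k y \<in> \<real>" using kernelD(3)[OF k(1) y] by (simp add: Reals_cnj_iff)
    then have re: "of_real (Re (k y)) = k y" by simp
    have "cmod (of_real (Re (k y))) = Re (k y)" using k(2) y by simp
    then have nk: "cmod (k y) = Re (k y)" by (simp only: re)
    have "cmod (k y * (f (y \<otimes> x) - f x)) \<le> e * Re (k y)"
    proof (cases "k y = 0")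
      case False
      then have "cmod (f (y \<otimes> x) - f x) \<le> e" using bspec[OF bspec[OF near y] x] by blast
      then show ?thesis unfolding norm_mult nk mult.commute[of e]
        by (rule mult_left_mono) (use k(2) y in simp)
    qed simp
    then show "cmod (k y * f (y \<otimes> x) - k y * f x) \<le> Re (of_real e * k y)"
      by (simp add: right_diff_distrib)
  qed
  then show ?thesis unfolding eq3 mean_mult_const[OF kC, of "of_real e"] by simp
qed

definition uniformly_to :: "(nat \<Rightarrow> 'a \<Rightarrow> complex) \<Rightarrow> ('a \<Rightarrow> complex) \<Rightarrow> bool" where
  "uniformly_to h g \<longleftrightarrow> (\<forall>e>0. \<exists>N. \<forall>n\<ge>N. \<forall>x\<in>carrier G. cmod (h n x - g x) \<le> e)"

lemma uniformly_toE:
  assumes "uniformly_to h g" "e > 0"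
  obtains N where "\<forall>n\<ge>N. \<forall>x\<in>carrier G. cmod (h n x - g x) \<le> e"
proof -
  have "\<exists>N. \<forall>n\<ge>N. \<forall>x\<in>carrier G. cmod (h n x - g x) \<le> e"
    using assms unfolding uniformly_to_def by simp
  then show ?thesis by (elim exE) (rule that)
qed

lemma uniformly_to_pointwise:
  assumes "uniformly_to h g" "x \<in> carrier G"
  shows "(\<lambda>n. h n x) \<longlonglongrightarrow> g x"
proof (rule LIMSEQ_I)
  fix e :: real assume "e > 0"
  then have "e / 2 > 0" by simp
  then obtain N where N: "\<forall>n\<ge>N. \<forall>x\<in>carrier G. cmod (h n x - g x) \<le> e / 2"
    by (rule uniformly_toE[OF assms(1)])
  show "\<exists>N. \<forall>n\<ge>N. cmod (h n x - g x) < e"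
  proof (intro exI[of _ N] allI impI)
    fix n assume "n \<ge> N"
    then have "cmod (h n x - g x) \<le> e / 2" using N assms(2) by simp
    then show "cmod (h n x - g x) < e" using \<open>e > 0\<close> by simp
  qed
qed

lemma uniformly_to_sq:
  assumes "uniformly_to h g" and h: "\<And>n. h n \<in> C_G" and g: "g \<in> C_G"
  shows "(\<lambda>n. sq (\<lambda>x. h n x - g x)) \<longlonglongrightarrow> 0"
proof (rule LIMSEQ_I)
  fix e :: real assume e: "e > 0"
  then have e1: "sqrt (e / 2) > 0" by simp
  obtain N where N: "\<forall>n\<ge>N. \<forall>x\<in>carrier G. cmod (h n x - g x) \<le> sqrt (e / 2)"
    by (rule uniformly_toE[OF assms(1) e1])
  show "\<exists>N. \<forall>n\<ge>N. norm (sq (\<lambda>x. h n x - g x) - 0) < e"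
  proof (intro exI[of _ N] allI impI)
    fix n assume "n \<ge> N"
    then have "sq (\<lambda>x. h n x - g x) \<le> (sqrt (e / 2))^2"
      using N by (intro sq_le C_G_diff[OF h g]) simp
    then show "norm (sq (\<lambda>x. h n x - g x) - 0) < e"
      using e sq_nonneg[OF C_G_diff[OF h g]] by simp
  qed
qed

lemma conv_sup_bound:
  assumes k: "kernel k" and B: "\<And>x. x \<in> carrier G \<Longrightarrow> cmod (k x) \<le> B" and B0: "B \<ge> 0"
    and u: "u \<in> C_G" and c: "sq u \<le> c^2" "c \<ge> 0" and x: "x \<in> carrier G"
  shows "cmod (conv k u x) \<le> B * c"
proof -
  have "(cmod (conv k u x))^2 \<le> B^2 * sq u" by (rule conv_sup_le[OF k B u x])
  also have "\<dots> \<le> B^2 * c^2" by (rule mult_left_mono[OF c(1)]) simp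
  also have "\<dots> = (B * c)^2" by (simp add: power_mult_distrib)
  finally show ?thesis by (rule power2_le_imp_le) (simp add: B0 c(2))
qed

lemma uniformly_to_conv:
  assumes "uniformly_to h g" and h: "\<And>n. h n \<in> C_G" and g: "g \<in> C_G" and k: "kernel k"
  shows "uniformly_to (\<lambda>n. conv k (h n)) (conv k g)"
  unfolding uniformly_to_def
proof (intro allI impI)
  fix e :: real assume e: "e > 0"
  obtain B where B: "B > 0" "\<And>x. x \<in> carrier G \<Longrightarrow> cmod (k x) \<le> B"
    using C_G_bounded[OF kernelD(1)[OF k]] by blast
  have eB: "e / B > 0" using e B(1) by simp
  obtain N where N: "\<forall>n\<ge>N. \<forall>x\<in>carrier G. cmod (h n x - g x) \<le> e / B"
    by (rule uniformly_toE[OF assms(1) eB])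
  show "\<exists>N. \<forall>n\<ge>N. \<forall>x\<in>carrier G. cmod (conv k (h n) x - conv k g x) \<le> e"
  proof (intro exI[of _ N] allI impI ballI)
    fix n x assume n: "n \<ge> N" and x: "x \<in> carrier G"
    have d: "(\<lambda>x. h n x - g x) \<in> C_G" by (rule C_G_diff[OF h g])
    have s: "sq (\<lambda>x. h n x - g x) \<le> (e / B)^2" using N n by (intro sq_le[OF d]) simp
    have "cmod (conv k (\<lambda>x. h n x - g x) x) \<le> B * (e / B)"
      by (rule conv_sup_bound[OF k B(2) _ d s _ x]) (use B(1) eB in simp_all)
    then show "cmod (conv k (h n) x - conv k g x) \<le> e"
      using B(1) by (simp add: conv_diff[OF k h g x])
  qed
qed

section \<open>Finite-dimensional bi-invariant eigenspaces\<close>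

text \<open>A finite-dimensional bi-invariant subspace is carried by an orthonormal basis, because
  matrix entries and lengths are taken with respect to it.\<close>

definition invariant_basis :: "('a \<Rightarrow> complex) set \<Rightarrow> bool" where
  "invariant_basis B \<longleftrightarrow> orthonormal B \<and>
    (\<forall>e\<in>B. \<forall>a\<in>carrier G. (\<lambda>x. e (a \<otimes> x)) \<in> fspan B \<and> (\<lambda>x. e (x \<otimes> a)) \<in> fspan B)"

lemma invariant_basisD:
  assumes "invariant_basis B"
  shows "orthonormal B" "finite B" "B \<subseteq> C_G"
    "e \<in> B \<Longrightarrow> a \<in> carrier G \<Longrightarrow> (\<lambda>x. e (a \<otimes> x)) \<in> fspan B"
    "e \<in> B \<Longrightarrow> a \<in> carrier G \<Longrightarrow> (\<lambda>x. e (x \<otimes> a)) \<in> fspan B"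
  using assms unfolding invariant_basis_def orthonormal_def by auto

lemma translation_space_fspan_subset:
  assumes A: "translation_space A" and B: "finite B" "B \<subseteq> A"
  shows "fspan B \<subseteq> A"
proof
  fix f assume "f \<in> fspan B"
  then obtain c where c: "\<And>x. x \<in> carrier G \<Longrightarrow> f x = (\<Sum>e\<in>B. c e * e x)" by (elim fspanE) blast
  have "(\<lambda>x. \<Sum>e\<in>B. c e * e x) \<in> A"
    using B by (intro translation_space_sum[OF A] translation_spaceD(5)[OF A]) auto
  then show "f \<in> A" by (rule sup_closed_cong[OF translation_spaceD(3)[OF A]]) (rule c)
qed

text \<open>The mean of a pointwise bound. It turns such bounds into bounds of dimensions
  (\<open>F e = e\<close>) and of Hilbert-Schmidt norms (\<open>F e\<close> a difference of
  translates of \<open>e\<close>).\<close>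

lemma sum_sq_le:
  assumes I: "finite I" "\<And>i. i \<in> I \<Longrightarrow> F i \<in> C_G"
    and C: "\<And>x. x \<in> carrier G \<Longrightarrow> (\<Sum>i\<in>I. (cmod (F i x))^2) \<le> C"
  shows "(\<Sum>i\<in>I. sq (F i)) \<le> C"
proof -
  have i: "(\<lambda>x. F i x * cnj (F i x)) \<in> C_G" if "i \<in> I" for i
    by (rule ip_integrand[OF I(2)[OF that] I(2)[OF that]])
  have S: "(\<lambda>x. \<Sum>i\<in>I. F i x * cnj (F i x)) \<in> C_G" by (rule C_G_sum[OF I(1) i])
  have "cmod (mean (\<lambda>x. \<Sum>i\<in>I. F i x * cnj (F i x))) \<le> C"
  proof (rule mean_norm_le[OF S])
    fix x assume x: "x \<in> carrier G"
    have "cmod (\<Sum>i\<in>I. F i x * cnj (F i x)) \<le> (\<Sum>i\<in>I. cmod (F i x * cnj (F i x)))" by (rule norm_sum)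
    also have "\<dots> = (\<Sum>i\<in>I. (cmod (F i x))^2)" by (simp add: norm_mult power2_eq_square)
    finally show "cmod (\<Sum>i\<in>I. F i x * cnj (F i x)) \<le> C" using C[OF x] by simp
  qed
  moreover have "mean (\<lambda>x. \<Sum>i\<in>I. F i x * cnj (F i x)) = (\<Sum>i\<in>I. ip (F i) (F i))"
    unfolding ip_def by (rule mean_sum[OF I(1) i])
  moreover have "Re (\<Sum>i\<in>I. ip (F i) (F i)) = (\<Sum>i\<in>I. sq (F i))" by (simp add: sq_def)
  ultimately show ?thesis using complex_Re_le_cmod[of "\<Sum>i\<in>I. ip (F i) (F i)"] by simp
qed

text \<open>Arzela-Ascoli: the convolutions are uniformly bounded, and Cauchy-Schwarz against a
  difference of two kernel sections makes them equicontinuous with a modulus independent of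
  \<open>u\<close>. Values on a finite net of \<open>k\<close>, rounded by
  \<open>finite_code\<close>, then determine them up to \<open>e\<close>.\<close>

lemma conv_precompact:
  assumes k: "kernel k" and u: "\<And>n. u n \<in> C_G" "\<And>n. sq (u n) \<le> 1"
  obtains r :: "nat \<Rightarrow> nat" where "strict_mono r"
    "\<forall>e>0. \<exists>N. \<forall>m\<ge>N. \<forall>n\<ge>N. \<forall>x\<in>carrier G. cmod (conv k (u (r m)) x - conv k (u (r n)) x) \<le> e"
proof -
  note kC = kernelD(1)[OF k]
  obtain b where b: "b > 0" "\<And>x. x \<in> carrier G \<Longrightarrow> cmod (k x) \<le> b"
    using C_G_bounded[OF kC] by blast
  have bound: "cmod (conv k (u n) x) \<le> b" if "x \<in> carrier G" for n x
    using conv_sup_bound[OF k b(2) _ u(1)[of n] _ _ that, where c = 1] b(1) u(2)[of n] by simp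
  define Q where "Q e m n \<longleftrightarrow> (\<forall>x\<in>carrier G. cmod (conv k (u m) x - conv k (u n) x) \<le> e)" for e m n
  have "\<exists>code :: nat \<Rightarrow> 'a \<Rightarrow> int \<times> int. finite (range code) \<and> (\<forall>m n. code m = code n \<longrightarrow> Q e m n)"
    if e: "e > 0" for e
  proof -
    have e3: "e / 3 > 0" using e by simp
    obtain X where X: "finite X" "X \<subseteq> carrier G"
      and net: "\<forall>x\<in>carrier G. \<exists>y\<in>X. \<forall>a\<in>carrier G. \<forall>b\<in>carrier G.
        cmod (k (a \<otimes> x \<otimes> b) - k (a \<otimes> y \<otimes> b)) < e / 3"
      by (rule translation_net[OF kC e3])
    have bX: "cmod (conv k (u n) x) \<le> b" if "x \<in> X" for n x using bound that X(2) by blast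
    obtain code :: "nat \<Rightarrow> 'a \<Rightarrow> int \<times> int" where code: "finite (range code)"
      "\<forall>m n. code m = code n \<longrightarrow> (\<forall>x\<in>X. cmod (conv k (u m) x - conv k (u n) x) \<le> e / 3)"
      by (rule finite_code[OF X(1) bX e3])
    have eq: "cmod (conv k (u n) x - conv k (u n) y) \<le> e / 3"
      if x: "x \<in> carrier G" and y: "y \<in> X"
        and xy: "\<forall>a\<in>carrier G. \<forall>b\<in>carrier G. cmod (k (a \<otimes> x \<otimes> b) - k (a \<otimes> y \<otimes> b)) < e / 3" for n x y
    proof -
      have yG: "y \<in> carrier G" using y X(2) by blast
      note kx = C_G_kernel_section[OF kC x] and ky = C_G_kernel_section[OF kC yG]
      have le: "cmod (k (x \<otimes> inv z) - k (y \<otimes> inv z)) \<le> e / 3" if z: "z \<in> carrier G" for z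
        using bspec[OF bspec[OF xy one_closed] inv_closed[OF z]] x yG by simp
      have "conv k (u n) x - conv k (u n) y = ip (u n) (\<lambda>z. k (x \<otimes> inv z) - k (y \<otimes> inv z))"
        unfolding ip_diff_right[OF kx ky u(1)] conv_ip[OF k x] conv_ip[OF k yG] by (rule refl)
      then have "(cmod (conv k (u n) x - conv k (u n) y))^2 \<le>
          sq (u n) * sq (\<lambda>z. k (x \<otimes> inv z) - k (y \<otimes> inv z))"
        using cauchy_schwarz[OF u(1) C_G_diff[OF kx ky]] by simp
      also have "\<dots> \<le> 1 * (e / 3)^2"
        by (intro mult_mono u(2) sq_le[OF C_G_diff[OF kx ky] le] sq_nonneg[OF C_G_diff[OF kx ky]]) auto
      finally have "(cmod (conv k (u n) x - conv k (u n) y))^2 \<le> (e / 3)^2" by simp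
      then show ?thesis by (rule power2_le_imp_le) (use e in simp)
    qed
    have "Q e m n" if c: "code m = code n" for m n
      unfolding Q_def
    proof
      fix x assume x: "x \<in> carrier G"
      obtain y where y: "y \<in> X"
        and xy: "\<forall>a\<in>carrier G. \<forall>b\<in>carrier G. cmod (k (a \<otimes> x \<otimes> b) - k (a \<otimes> y \<otimes> b)) < e / 3"
        using bspec[OF net x] by (elim bexE)
      have 1: "cmod (conv k (u m) y - conv k (u n) y) \<le> e / 3" using code(2) c y by simp
      have 2: "cmod (conv k (u m) x - conv k (u m) y) \<le> e / 3"
        and 3: "cmod (conv k (u n) x - conv k (u n) y) \<le> e / 3" by (rule eq[OF x y xy])+
      have "conv k (u m) x - conv k (u n) x = (conv k (u m) x - conv k (u m) y) +
        (conv k (u m) y - conv k (u n) y) - (conv k (u n) x - conv k (u n) y)" by simp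
      then have "cmod (conv k (u m) x - conv k (u n) x) = cmod ((conv k (u m) x - conv k (u m) y) +
        (conv k (u m) y - conv k (u n) y) - (conv k (u n) x - conv k (u n) y))" by (simp only:)
      then show "cmod (conv k (u m) x - conv k (u n) x) \<le> e"
        using 1 2 3 norm_triangle_ineq4[of "(conv k (u m) x - conv k (u m) y) +
            (conv k (u m) y - conv k (u n) y)" "conv k (u n) x - conv k (u n) y"]
          norm_triangle_ineq[of "conv k (u m) x - conv k (u m) y" "conv k (u m) y - conv k (u n) y"]
        by linarith
    qed
    then show ?thesis using code(1) by (intro exI[of _ code]) simp
  qed
  moreover have "Q e' m n" if "Q e m n" "e \<le> e'" for e e' m n
    using that unfolding Q_def by fastforce
  ultimately obtain r :: "nat \<Rightarrow> nat" where r: "strict_mono r" "\<forall>e>0. \<exists>N. \<forall>m\<ge>N. \<forall>n\<ge>N. Q e (r m) (r n)"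
    by (rule Cauchy_subsequence_of_codes)
  show ?thesis by (rule that[OF r(1)]) (use r(2) in \<open>simp only: Q_def\<close>)
qed

text \<open>Write K for the convolution and \<open>L\<close> for the supremum of
  \<open>sq (K u)\<close> over the unit ball of \<open>A\<close>. For a maximising sequence
  \<open>w\<close> the functions K K w - L w tend to 0 in L2 while a subsequence of K w converges
  uniformly; the limit is the eigenvector. Working with the square of K avoids deciding between the
  two signs of the square root of \<open>L\<close>.\<close>

lemma conv_eigenvector:
  assumes A: "translation_space A" and k: "kernel k"
    and u0: "u0 \<in> A" and x0: "x0 \<in> carrier G" "conv k u0 x0 \<noteq> 0"
  obtains L v where "L > 0" "v \<in> A" "\<exists>x\<in>carrier G. v x \<noteq> 0"
    "\<forall>x\<in>carrier G. conv k (conv k v) x = of_real L * v x"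
proof -
  note kC = kernelD(1)[OF k] and AC = translation_spaceD(1)[OF A]
  obtain b where b: "b > 0" "\<And>x. x \<in> carrier G \<Longrightarrow> cmod (k x) \<le> b"
    using C_G_bounded[OF kC] by blast
  define S where "S = (\<lambda>u. sq (conv k u)) ` {u \<in> A. sq u \<le> 1}"
  have bound: "sq (conv k u) \<le> b^2" if "u \<in> A" "sq u \<le> 1" for u
    using conv_sup_bound[OF k b(2) _ AC[OF that(1)], of 1] b(1) that(2)
    by (intro sq_le C_G_conv kC AC that(1)) simp
  have bdd: "bdd_above S" unfolding S_def by (rule bdd_aboveI2[of _ _ "b^2"]) (use bound in simp)
  have "sq (\<lambda>x. 0) = 0" by (simp add: sq_def ip_def)
  then have "(\<lambda>x. 0) \<in> {u \<in> A. sq u \<le> 1}" using translation_spaceD(2)[OF A] by simp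
  then have ne: "S \<noteq> {}" unfolding S_def by blast
  define L where "L = Sup S"
  have hom: "sq (conv k u) \<le> L * sq u" if u: "u \<in> A" for u
  proof (cases "sq u = 0")
    case True
    have "cmod (conv k u x) \<le> 0" if "x \<in> carrier G" for x
      using conv_sup_bound[OF k b(2) _ AC[OF u] _ _ that, of 0] b(1) True by simp
    then have "sq (conv k u) \<le> 0^2" by (intro sq_le C_G_conv kC AC u)
    then show ?thesis using True by simp
  next
    case False
    then have pos: "sq u > 0" using sq_nonneg[OF AC[OF u]] by simp
    define t where "t = 1 / sqrt (sq u)"
    have t2: "t^2 = 1 / sq u" using pos by (simp add: t_def power_divide)
    have v: "(\<lambda>x. of_real t * u x) \<in> A" by (rule translation_spaceD(5)[OF A u])
    have "sq (\<lambda>x. of_real t * u x) = 1" unfolding sq_mult[OF AC[OF u]] using t2 pos by simp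
    then have "sq (conv k (\<lambda>x. of_real t * u x)) \<in> S" using v unfolding S_def by (intro imageI) simp
    then have le: "sq (conv k (\<lambda>x. of_real t * u x)) \<le> L" unfolding L_def by (rule cSup_upper[OF _ bdd])
    have "sq (conv k (\<lambda>x. of_real t * u x)) = sq (\<lambda>x. of_real t * conv k u x)"
      by (rule sq_cong) (rule conv_mult[OF k AC[OF u]])
    also have "\<dots> = t^2 * sq (conv k u)" unfolding sq_mult[OF C_G_conv[OF kC AC[OF u]]] by simp
    finally have "sq (conv k u) / sq u \<le> L" using le t2 by simp
    then show ?thesis using pos by (simp add: divide_le_eq)
  qed
  have "sq (conv k u0) \<noteq> 0" using sq_eq_0[OF C_G_conv[OF kC AC[OF u0]] _ x0(1)] x0(2) by blast
  then have "0 < L * sq u0" using hom[OF u0] sq_nonneg[OF C_G_conv[OF kC AC[OF u0]]] by linarith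
  then have L: "L > 0" using sq_nonneg[OF AC[OF u0]] by (simp add: zero_less_mult_iff)
  have "\<exists>u. u \<in> A \<and> sq u \<le> 1 \<and> L - inverse (real (Suc n)) < sq (conv k u)" for n
  proof -
    have "L - inverse (real (Suc n)) < Sup S" by (simp add: L_def)
    from less_cSupD[OF ne this] show ?thesis unfolding S_def by auto
  qed
  then obtain u where u: "\<And>n. u n \<in> A" "\<And>n. sq (u n) \<le> 1"
    "\<And>n. L - inverse (real (Suc n)) < sq (conv k (u n))" by metis
  obtain r :: "nat \<Rightarrow> nat" where r: "strict_mono r"
    "\<forall>e>0. \<exists>N. \<forall>m\<ge>N. \<forall>n\<ge>N. \<forall>x\<in>carrier G. cmod (conv k (u (r m)) x - conv k (u (r n)) x) \<le> e"
    by (rule conv_precompact[OF k AC[OF u(1)] u(2)])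
  define w where "w n = u (r n)" for n
  define h where "h n = conv k (w n)" for n
  have w: "w n \<in> A" "sq (w n) \<le> 1" for n using u by (auto simp: w_def)
  have h: "h n \<in> A" for n unfolding h_def by (rule conv_mem[OF A kC w(1)])
  note wC = AC[OF w(1)] and hC = AC[OF h]
  have sh: "L - inverse (real (Suc n)) \<le> sq (h n)" for n
  proof -
    have "inverse (real (Suc (r n))) \<le> inverse (real (Suc n))"
      using seq_suble[OF r(1), of n] by (intro le_imp_inverse_le) auto
    then show ?thesis using u(3)[of "r n"] unfolding h_def w_def by linarith
  qed
  obtain v where v: "v \<in> A" and "\<forall>e>0. \<exists>N. \<forall>n\<ge>N. \<forall>x\<in>carrier G. cmod (h n x - v x) \<le> e"
    by (rule uniform_limit_mem[OF translation_spaceD(3)[OF A] h]) (use r(2) in \<open>simp only: h_def w_def\<close>)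
  then have hv: "uniformly_to h v" unfolding uniformly_to_def by simp
  note vC = AC[OF v]
  \<comment> \<open>With h = K w, self-adjointness turns the mixed term into
    \<open>L * sq (h n)\<close>. The square is then at most L sq h - 2 L sq h + L^2 = L (L - sq h),
    which is small by the choice of \<open>w\<close>.\<close>
  have near: "sq (\<lambda>x. conv k (h n) x - of_real L * w n x) \<le> L * inverse (real (Suc n))" for n
  proof -
    note c = C_G_conv[OF kC hC[of n]]
    have "ip (conv k (h n)) (\<lambda>x. of_real L * w n x) = of_real L * ip (h n) (h n)"
      unfolding ip_mult_right[OF wC c] conv_self_adjoint[OF k hC wC] by (simp add: h_def)
    then have 1: "Re (ip (conv k (h n)) (\<lambda>x. of_real L * w n x)) = L * sq (h n)" by (simp add: sq_def)
    have "sq (\<lambda>x. of_real L * w n x) = L^2 * sq (w n)" unfolding sq_mult[OF wC] by simp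
    also have "\<dots> \<le> L^2 * 1" by (rule mult_left_mono[OF w(2)]) simp
    finally have 2: "sq (\<lambda>x. of_real L * w n x) \<le> L * L" by (simp add: power2_eq_square)
    have 3: "sq (conv k (h n)) \<le> L * sq (h n)" by (rule hom[OF h])
    have 4: "L * (L - inverse (real (Suc n))) \<le> L * sq (h n)" using sh[of n] L by (intro mult_left_mono) auto
    show ?thesis unfolding sq_diff[OF c C_G_mult_const[OF wC]] 1
      using 2 3 4 by (simp only: right_diff_distrib)
  qed
  have eig: "conv k (conv k v) x = of_real L * v x" if x: "x \<in> carrier G" for x
  proof -
    have "uniformly_to (\<lambda>n. conv k (conv k (h n))) (conv k (conv k v))"
      by (rule uniformly_to_conv[OF uniformly_to_conv[OF hv hC vC k] C_G_conv[OF kC hC] C_G_conv[OF kC vC] k])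
    from uniformly_to_pointwise[OF this x] have l1: "(\<lambda>n. conv k (conv k (h n)) x) \<longlonglongrightarrow> conv k (conv k v) x" .
    have l2: "(\<lambda>n. h n x) \<longlonglongrightarrow> v x" by (rule uniformly_to_pointwise[OF hv x])
    have lim: "(\<lambda>n. (cmod (conv k (conv k (h n)) x - of_real L * h n x))^2) \<longlonglongrightarrow>
        (cmod (conv k (conv k v) x - of_real L * v x))^2"
      by (intro tendsto_intros l1 l2)
    \<comment> \<open>One more convolution upgrades the L2 estimate \<open>near\<close> to a
      pointwise one and replaces L w by L h, which converges.\<close>
    have le: "(cmod (conv k (conv k (h n)) x - of_real L * h n x))^2 \<le> b^2 * (L * inverse (real (Suc n)))" for n
    proof -
      note c = C_G_conv[OF kC hC[of n]]
      have "conv k (\<lambda>x. conv k (h n) x - of_real L * w n x) x = conv k (conv k (h n)) x - of_real L * h n x"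
        unfolding conv_diff[OF k c C_G_mult_const[OF wC] x] conv_mult[OF k wC x] by (simp only: h_def)
      then have "(cmod (conv k (conv k (h n)) x - of_real L * h n x))^2 \<le>
          b^2 * sq (\<lambda>x. conv k (h n) x - of_real L * w n x)"
        using conv_sup_le[OF k b(2) C_G_diff[OF c C_G_mult_const[OF wC]] x, of "of_real L" n] by simp
      also have "\<dots> \<le> b^2 * (L * inverse (real (Suc n)))" by (rule mult_left_mono[OF near]) simp
      finally show ?thesis .
    qed
    have "(\<lambda>n. b^2 * (L * inverse (real (Suc n)))) \<longlonglongrightarrow> b^2 * (L * 0)"
      by (intro tendsto_intros LIMSEQ_inverse_real_of_nat)
    then have "(cmod (conv k (conv k v) x - of_real L * v x))^2 \<le> b^2 * (L * 0)"
      by (rule LIMSEQ_le[OF lim]) (use le in blast)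
    then show ?thesis by simp
  qed
  have nz: "\<exists>x\<in>carrier G. v x \<noteq> 0"
  proof (rule ccontr)
    assume "\<not> (\<exists>x\<in>carrier G. v x \<noteq> 0)"
    then have "sq (\<lambda>x. h n x - v x) = sq (h n)" for n by (intro sq_cong) simp
    then have l1: "(\<lambda>n. sq (h n)) \<longlonglongrightarrow> 0" using uniformly_to_sq[OF hv hC vC] by simp
    have l2: "(\<lambda>n. L - inverse (real (Suc n))) \<longlonglongrightarrow> L - 0"
      by (intro tendsto_intros LIMSEQ_inverse_real_of_nat)
    have "L - 0 \<le> 0" by (rule LIMSEQ_le[OF l2 l1]) (use sh in blast)
    then show False using L by simp
  qed
  show ?thesis by (rule that[OF L v nz]) (use eig in blast)
qed

text \<open>Convolution with \<open>k\<close> commutes with translations from both sides, so the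
  eigenspace given by \<open>conv_eigenvector\<close> is bi-invariant. What remains is that a
  nonzero eigenvalue has finite multiplicity.\<close>

lemma invariant_basis_exists:
  assumes A: "translation_space A" and k: "kernel k"
    and u0: "u0 \<in> A" and x0: "x0 \<in> carrier G" "conv k u0 x0 \<noteq> 0"
  obtains B where "invariant_basis B" "B \<noteq> {}" "fspan B \<subseteq> A"
proof -
  note kC = kernelD(1)[OF k] and AC = translation_spaceD(1)[OF A]
  obtain b where b: "b > 0" "\<And>x. x \<in> carrier G \<Longrightarrow> cmod (k x) \<le> b"
    using C_G_bounded[OF kC] by blast
  obtain L v where L: "L > 0" and v: "v \<in> A" "\<exists>x\<in>carrier G. v x \<noteq> 0"
    "\<forall>x\<in>carrier G. conv k (conv k v) x = of_real L * v x"
    by (rule conv_eigenvector[OF A k u0 x0])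
  define E where "E = {f \<in> A. \<forall>x\<in>carrier G. conv k (conv k f) x = of_real L * f x}"
  have EI: "f \<in> E" if "f \<in> A" "\<And>x. x \<in> carrier G \<Longrightarrow> conv k (conv k f) x = of_real L * f x" for f
    using that by (simp add: E_def)
  have ED: "f \<in> A" "x \<in> carrier G \<Longrightarrow> conv k (conv k f) x = of_real L * f x" if "f \<in> E" for f x
    using that by (simp_all add: E_def)
  have EC: "E \<subseteq> C_G" using AC unfolding E_def by blast
  have lin: "fspan B \<subseteq> E" if B: "finite B" "B \<subseteq> E" for B
  proof
    fix f assume f: "f \<in> fspan B"
    have BA: "B \<subseteq> A" and BC: "B \<subseteq> C_G" using B(2) ED(1) EC by blast+
    have fA: "f \<in> A" using translation_space_fspan_subset[OF A B(1) BA] f by blast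
    obtain c where c: "\<And>x. x \<in> carrier G \<Longrightarrow> f x = (\<Sum>e\<in>B. c e * e x)" using f by (elim fspanE) blast
    have 1: "conv k f y = (\<Sum>e\<in>B. c e * conv k e y)" if y: "y \<in> carrier G" for y
      using conv_cong[of f "\<lambda>x. \<Sum>e\<in>B. c e * e x" k y, OF c] conv_lincomb[OF k B(1) BC y, of c] by simp
    have "conv k (conv k f) x = of_real L * f x" if x: "x \<in> carrier G" for x
    proof -
      have "conv k (conv k f) x = conv k (\<lambda>y. \<Sum>e\<in>B. c e * conv k e y) x" by (rule conv_cong[OF 1])
      also have "\<dots> = ip (\<lambda>y. \<Sum>e\<in>B. c e * conv k e y) (\<lambda>y. k (x \<otimes> inv y))" by (rule conv_ip[OF k x])
      also have "\<dots> = (\<Sum>e\<in>B. ip (\<lambda>y. c e * conv k e y) (\<lambda>y. k (x \<otimes> inv y)))"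
        unfolding ip_def sum_distrib_right
        using BC by (intro mean_sum[OF B(1)] ip_integrand[OF C_G_mult_const[OF C_G_conv[OF kC]] C_G_kernel_section[OF kC x]]) auto
      also have "\<dots> = (\<Sum>e\<in>B. c e * conv k (conv k e) x)"
      proof (rule sum.cong[OF refl])
        fix e assume "e \<in> B"
        then have "conv k e \<in> C_G" using BC by (intro C_G_conv[OF kC]) auto
        then show "ip (\<lambda>y. c e * conv k e y) (\<lambda>y. k (x \<otimes> inv y)) = c e * conv k (conv k e) x"
          by (simp only: ip_mult_left[OF _ C_G_kernel_section[OF kC x]] conv_ip[OF k x])
      qed
      also have "\<dots> = (\<Sum>e\<in>B. of_real L * (c e * e x))"
        using B(2) ED(2)[OF _ x] by (intro sum.cong refl) auto
      also have "\<dots> = of_real L * f x" unfolding c[OF x] sum_distrib_left by (rule refl)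
      finally show ?thesis .
    qed
    then show "f \<in> E" by (rule EI[OF fA])
  qed
  \<comment> \<open>For \<open>e\<close> in the eigenspace, \<open>L * e x\<close> is the inner
    product of \<open>e\<close> with the convolution of the kernel section at \<open>x\<close>.
    Bessel bounds the sum of \<open>(cmod (e x))^2\<close> over the system uniformly in
    \<open>x\<close>, and the mean over \<open>x\<close> is \<open>card B\<close>.\<close>
  have Nb: "card B \<le> nat \<lceil>((b * b) / L)^2\<rceil>" if B: "orthonormal B" "B \<subseteq> E" for B
  proof -
    note D = orthonormalD[OF B(1)]
    have "(\<Sum>e\<in>B. (cmod (e x))^2) \<le> ((b * b) / L)^2" if x: "x \<in> carrier G" for x
    proof -
      note kx = C_G_kernel_section[OF kC x]
      have "of_real L * e x = ip e (conv k (\<lambda>y. k (x \<otimes> inv y)))" if e: "e \<in> B" for e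
      proof -
        have "of_real L * e x = conv k (conv k e) x" using ED(2)[OF _ x] e B(2) by auto
        also have "\<dots> = ip (conv k e) (\<lambda>y. k (x \<otimes> inv y))" by (rule conv_ip[OF k x])
        finally show ?thesis unfolding conv_self_adjoint[OF k D(3)[OF e] kx] .
      qed
      then have "cmod (of_real L * e x) = cmod (ip (conv k (\<lambda>y. k (x \<otimes> inv y))) e)" if e: "e \<in> B" for e
        using ip_commute[OF C_G_conv[OF kC kx] D(3)[OF e]] e by simp
      then have c: "(cmod (ip (conv k (\<lambda>y. k (x \<otimes> inv y))) e))^2 = L^2 * (cmod (e x))^2" if e: "e \<in> B" for e
        using e by (simp add: norm_mult power_mult_distrib flip: \<open>\<And>e. e \<in> B \<Longrightarrow> cmod (of_real L * e x) = _\<close>)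
      have s: "sq (\<lambda>y. k (x \<otimes> inv y)) \<le> b^2" using x by (intro sq_le[OF kx] b(2)) auto
      have "cmod (conv k (\<lambda>y. k (x \<otimes> inv y)) z) \<le> b * b" if "z \<in> carrier G" for z
        by (rule conv_sup_bound[OF k b(2) _ kx s _ that]) (use b(1) in simp_all)
      then have "sq (conv k (\<lambda>y. k (x \<otimes> inv y))) \<le> (b * b)^2" by (rule sq_le[OF C_G_conv[OF kC kx]])
      then have "(\<Sum>e\<in>B. L^2 * (cmod (e x))^2) \<le> (b * b)^2"
        using bessel[OF B(1) C_G_conv[OF kC kx]] c by simp
      then have "L^2 * (\<Sum>e\<in>B. (cmod (e x))^2) \<le> (b * b)^2" by (simp only: sum_distrib_left)
      then show ?thesis using L by (simp add: power_divide pos_le_divide_eq mult.commute)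
    qed
    then have "(\<Sum>e\<in>B. sq e) \<le> ((b * b) / L)^2" by (rule sum_sq_le[where F = "\<lambda>e. e", OF D(1) D(3), rotated])
    moreover have "sq e = 1" if "e \<in> B" for e using D(4)[OF that that] by (simp add: sq_def)
    ultimately have "real (card B) \<le> ((b * b) / L)^2" by simp
    then show ?thesis by linarith
  qed
  obtain B where B: "orthonormal B" "fspan B = E"
    by (rule orthonormal_basis_exists[OF EC lin Nb])
  note D = orthonormalD[OF B(1)]
  have BE: "e \<in> E" if "e \<in> B" for e using fspan_base[OF D(1) that] B(2) by simp
  have "(\<lambda>x. e (a \<otimes> x)) \<in> E \<and> (\<lambda>x. e (x \<otimes> a)) \<in> E" if e: "e \<in> B" and a: "a \<in> carrier G" for e a
  proof
    note eE = BE[OF e] and eC = D(3)[OF e]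
    note cC = C_G_conv[OF kC eC]
    show "(\<lambda>x. e (a \<otimes> x)) \<in> E"
    proof (rule EI[OF translation_spaceD(6)[OF A a ED(1)[OF eE]]])
      fix x assume x: "x \<in> carrier G"
      have "conv k (conv k (\<lambda>x. e (a \<otimes> x))) x = conv k (\<lambda>y. conv k e (a \<otimes> y)) x"
        by (rule conv_cong[OF conv_left[OF k eC a]])
      then show "conv k (conv k (\<lambda>x. e (a \<otimes> x))) x = of_real L * e (a \<otimes> x)"
        unfolding conv_left[OF k cC a x] ED(2)[OF eE m_closed[OF a x]] .
    qed
    show "(\<lambda>x. e (x \<otimes> a)) \<in> E"
    proof (rule EI[OF translation_spaceD(7)[OF A a ED(1)[OF eE]]])
      fix x assume x: "x \<in> carrier G"
      have "conv k (conv k (\<lambda>x. e (x \<otimes> a))) x = conv k (\<lambda>y. conv k e (y \<otimes> a)) x"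
        by (rule conv_cong[OF conv_right[OF k eC a]])
      then show "conv k (conv k (\<lambda>x. e (x \<otimes> a))) x = of_real L * e (x \<otimes> a)"
        unfolding conv_right[OF k cC a x] ED(2)[OF eE m_closed[OF x a]] .
    qed
  qed
  then have ib: "invariant_basis B" unfolding invariant_basis_def B(2) using B(1) by blast
  have ne: "B \<noteq> {}"
  proof
    assume "B = {}"
    moreover have "v \<in> E" using v by (simp add: E_def)
    ultimately have "v \<in> fspan {}" using B(2) by simp
    then obtain c where "\<And>x. x \<in> carrier G \<Longrightarrow> v x = (\<Sum>e\<in>{}. c e * e x)" by (elim fspanE) blast
    then show False using v(2) by auto
  qed
  show ?thesis by (rule that[OF ib ne]) (use B(2) ED(1) in blast)
qed

end

section \<open>Blocks\<close>

text \<open>A complex square matrix has nonempty spectrum; the index set \<open>B\<close> is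
  enumerated to reach the matrix type.\<close>

lemma eigenvector_exists:
  fixes a :: "'b \<Rightarrow> 'b \<Rightarrow> complex"
  assumes B: "finite B" "B \<noteq> {}"
  obtains l v where "\<exists>e\<in>B. v e \<noteq> 0" "\<forall>i\<in>B. (\<Sum>j\<in>B. a i j * v j) = l * v i"
proof -
  obtain h where h: "bij_betw h {0..<card B} B" using ex_bij_betw_nat_finite[OF B(1)] by blast
  define n where "n = card B"
  define A where "A = Matrix.mat n n (\<lambda>(i, j). a (h i) (h j))"
  have A: "A \<in> carrier_mat n n" by (simp add: A_def)
  have n: "n > 0" using B by (simp add: n_def card_gt_0_iff)
  obtain l where "l \<in> spectrum A" using spectrum_non_empty[OF A n] by blast
  then obtain w where "eigenvector A w l" unfolding spectrum_def eigenvalue_def by blast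
  then have w: "w \<in> carrier_vec n" "w \<noteq> 0\<^sub>v n" "A *\<^sub>v w = l \<cdot>\<^sub>v w"
    using A unfolding eigenvector_def by auto
  define g where "g = inv_into {0..<n} h"
  have gh: "g (h i) = i" if "i < n" for i
    using h that unfolding g_def n_def bij_betw_def by (simp add: inv_into_f_f)
  have hB: "h i \<in> B" if "i < n" for i using h that unfolding n_def bij_betw_def by auto
  have Bh: "\<exists>i<n. e = h i" if "e \<in> B" for e
    using h that unfolding n_def bij_betw_def by fastforce
  define v where "v e = vec_index w (g e)" for e
  have "\<exists>i<n. vec_index w i \<noteq> 0"
  proof (rule ccontr)
    assume "\<not> (\<exists>i<n. vec_index w i \<noteq> 0)"
    then have "w = 0\<^sub>v n" using w(1) by (intro eq_vecI) auto
    then show False using w(2) by simp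
  qed
  then obtain i where "i < n" "vec_index w i \<noteq> 0" by blast
  then have 1: "\<exists>e\<in>B. v e \<noteq> 0" using hB[of i] gh[of i] unfolding v_def by (intro bexI[of _ "h i"]) auto
  have 2: "(\<Sum>j\<in>B. a i j * v j) = l * v i" if i: "i \<in> B" for i
  proof -
    obtain i' where i': "i' < n" "i = h i'" using Bh[OF i] by blast
    have "(\<Sum>j\<in>B. a i j * v j) = (\<Sum>j\<in>{0..<n}. a (h i') (h j) * v (h j))"
      using sum.reindex_bij_betw[OF h, of "\<lambda>j. a i j * v j"] i' by (simp add: n_def)
    also have "\<dots> = (\<Sum>j\<in>{0..<n}. a (h i') (h j) * vec_index w j)"
      by (intro sum.cong refl) (simp add: v_def gh)
    also have "\<dots> = vec_index (A *\<^sub>v w) i'"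
      using i'(1) w(1) by (simp add: A_def scalar_prod_def)
    also have "\<dots> = l * v i" using w i' by (simp add: v_def gh)
    finally show ?thesis .
  qed
  show ?thesis by (rule that[OF 1]) (use 2 in blast)
qed

context compact_hausdorff_group
begin

lemma fspan_translate:
  assumes B: "invariant_basis B" and f: "f \<in> fspan B" and a: "a \<in> carrier G"
  shows "(\<lambda>x. f (a \<otimes> x)) \<in> fspan B" "(\<lambda>x. f (x \<otimes> a)) \<in> fspan B"
proof -
  obtain c where c: "\<And>x. x \<in> carrier G \<Longrightarrow> f x = (\<Sum>e\<in>B. c e * e x)" using f by (elim fspanE) blast
  have L: "(\<lambda>x. \<Sum>e\<in>B. c e * e (a \<otimes> x)) \<in> fspan B" and R: "(\<lambda>x. \<Sum>e\<in>B. c e * e (x \<otimes> a)) \<in> fspan B"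
    by (intro fspan_sum[OF invariant_basisD(2)[OF B]] fspan_mult, erule invariant_basisD(4)[OF B _ a])
      (intro fspan_sum[OF invariant_basisD(2)[OF B]] fspan_mult, erule invariant_basisD(5)[OF B _ a])
  show "(\<lambda>x. f (a \<otimes> x)) \<in> fspan B" by (rule fspan_cong[OF L]) (simp add: c a)
  show "(\<lambda>x. f (x \<otimes> a)) \<in> fspan B" by (rule fspan_cong[OF R]) (simp add: c a)
qed

lemma resid_fspan:
  assumes "orthonormal B" "g \<in> fspan B" "x \<in> carrier G"
  shows "resid B g x = 0"
  using orthonormal_expand[OF assms] by (simp add: resid_def)

text \<open>\<open>resid B\<close> ignores members of the span and does not increase
  \<open>sq\<close>. So a function approximable by the span has residual 0.\<close>

lemma sup_closed_fspan:
  assumes B: "orthonormal B"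
  shows "sup_closed (fspan B)"
  unfolding sup_closed_def
proof (intro allI impI)
  fix f assume f: "\<forall>e>0. \<exists>g\<in>fspan B. \<forall>x\<in>carrier G. cmod (f x - g x) \<le> e"
  note D = orthonormalD[OF B]
  have fC: "f \<in> C_G"
  proof (rule sup_closedD[OF translation_spaceD(3)[OF translation_space_C_G]])
    fix e :: real assume "e > 0"
    then obtain g where "g \<in> fspan B" "\<forall>x\<in>carrier G. cmod (f x - g x) \<le> e" using f by blast
    then show "\<exists>g\<in>C_G. \<forall>x\<in>carrier G. cmod (f x - g x) \<le> e"
      using fspan_C_G[OF D(1,2)] by (intro bexI[of _ g])
  qed
  have "sq (resid B f) \<le> 0 + e" if e: "e > 0" for e
  proof -
    have "sqrt e > 0" using e by simp
    then obtain g where g: "g \<in> fspan B" "\<forall>x\<in>carrier G. cmod (f x - g x) \<le> sqrt e" using f by blast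
    have gC: "g \<in> C_G" by (rule fspan_C_G[OF D(1,2) g(1)])
    have dC: "(\<lambda>x. f x - g x) \<in> C_G" by (rule C_G_diff[OF fC gC])
    have "resid B (\<lambda>x. f x - g x) x = resid B f x" if x: "x \<in> carrier G" for x
    proof -
      have "resid B (\<lambda>x. f x - g x) x = f x - g x - (\<Sum>e\<in>B. (ip f e - ip g e) * e x)"
        unfolding resid_def by (simp add: ip_diff_left[OF fC gC D(3)])
      also have "\<dots> = resid B f x - resid B g x"
        unfolding resid_def by (simp add: left_diff_distrib sum_subtractf)
      finally show ?thesis using resid_fspan[OF B g(1) x] by simp
    qed
    then have "sq (resid B f) = sq (resid B (\<lambda>x. f x - g x))" by (intro sq_cong) simp
    also have "\<dots> \<le> sq (\<lambda>x. f x - g x)" unfolding sq_resid[OF B dC] by (simp add: sum_nonneg)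
    also have "\<dots> \<le> (sqrt e)^2" by (rule sq_le[OF dC]) (use g(2) in simp)
    finally show ?thesis using e by simp
  qed
  then have "sq (resid B f) \<le> 0" by (rule field_le_epsilon)
  then have "sq (resid B f) = 0" using sq_nonneg[OF C_G_resid[OF B fC]] by simp
  then have "resid B f x = 0" if "x \<in> carrier G" for x using sq_eq_0[OF C_G_resid[OF B fC]] that by blast
  then show "f \<in> fspan B" by (intro fspanI[where c = "ip f"]) (simp add: resid_def)
qed

lemma translation_space_fspan:
  assumes B: "invariant_basis B"
  shows "translation_space (fspan B)"
  unfolding translation_space_def
proof (intro conjI ballI allI subsetI)
  show "sup_closed (fspan B)" by (rule sup_closed_fspan[OF invariant_basisD(1)[OF B]])
  show "(\<lambda>x. 0) \<in> fspan B" by (rule fspan_zero)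
next
  fix f assume "f \<in> fspan B"
  then show "f \<in> C_G" by (rule fspan_C_G[OF invariant_basisD(2,3)[OF B]])
next
  fix f g assume "f \<in> fspan B" "g \<in> fspan B"
  then show "(\<lambda>x. f x + g x) \<in> fspan B" by (rule fspan_add)
next
  fix c f assume "f \<in> fspan B"
  then show "(\<lambda>x. c * f x) \<in> fspan B" by (rule fspan_mult)
next
  fix a f assume a: "a \<in> carrier G" and f: "f \<in> fspan B"
  show "(\<lambda>x. f (a \<otimes> x)) \<in> fspan B" by (rule fspan_translate(1)[OF B f a])
next
  fix a f assume a: "a \<in> carrier G" and f: "f \<in> fspan B"
  show "(\<lambda>x. f (x \<otimes> a)) \<in> fspan B" by (rule fspan_translate(2)[OF B f a])
qed

text \<open>\<open>\<psi>\<close> is what representation theory calls the central character of the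
  space.\<close>

definition central_scalars :: "('a \<Rightarrow> complex) set \<Rightarrow> ('a \<Rightarrow> complex) \<Rightarrow> bool" where
  "central_scalars B \<psi> \<longleftrightarrow> (\<forall>z\<in>centre G. \<forall>e\<in>B. \<forall>x\<in>carrier G. e (z \<otimes> x) = \<psi> z * e x)"

lemma centreD:
  assumes "z \<in> centre G"
  shows "z \<in> carrier G" "x \<in> carrier G \<Longrightarrow> z \<otimes> x = x \<otimes> z"
  using assms unfolding centre_def by auto

text \<open>Translation by a central \<open>z\<close> commutes with all left and right translations,
  so each of its eigenspaces in \<open>fspan B\<close> is again bi-invariant.\<close>

lemma central_eigenspace:
  assumes B: "invariant_basis B" "B \<noteq> {}" and z: "z \<in> centre G"
  obtains l B' where "invariant_basis B'" "B' \<noteq> {}" "B' \<subseteq> fspan B"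
    "\<forall>f\<in>fspan B'. \<forall>x\<in>carrier G. f (z \<otimes> x) = l * f x"
proof -
  note D = invariant_basisD[OF B(1)] and O = orthonormalD[OF invariant_basisD(1)[OF B(1)]]
  note zG = centreD(1)[OF z] and zc = centreD(2)[OF z]
  obtain l v where v: "\<exists>e\<in>B. v e \<noteq> 0"
    "\<forall>i\<in>B. (\<Sum>j\<in>B. ip (\<lambda>x. j (z \<otimes> x)) i * v j) = l * v i"
    by (rule eigenvector_exists[OF D(2) B(2), of "\<lambda>i j. ip (\<lambda>x. j (z \<otimes> x)) i"])
  define f where "f x = (\<Sum>e\<in>B. v e * e x)" for x
  have fB: "f \<in> fspan B" by (rule fspanI[where c = v]) (simp add: f_def)
  have feig: "f (z \<otimes> x) = l * f x" if x: "x \<in> carrier G" for x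
  proof -
    have "f (z \<otimes> x) = (\<Sum>j\<in>B. v j * (\<Sum>i\<in>B. ip (\<lambda>x. j (z \<otimes> x)) i * i x))"
      unfolding f_def by (intro sum.cong refl arg_cong[where f = "\<lambda>t. _ * t"]
        orthonormal_expand[OF D(1) D(4)[OF _ zG] x]; assumption)
    also have "\<dots> = (\<Sum>i\<in>B. \<Sum>j\<in>B. v j * (ip (\<lambda>x. j (z \<otimes> x)) i * i x))"
      unfolding sum_distrib_left by (rule sum.swap)
    also have "\<dots> = (\<Sum>i\<in>B. (\<Sum>j\<in>B. ip (\<lambda>x. j (z \<otimes> x)) i * v j) * i x)"
      unfolding sum_distrib_right by (intro sum.cong refl) (simp only: mult_ac)
    also have "\<dots> = (\<Sum>i\<in>B. l * (v i * i x))" using v(2) by (intro sum.cong refl) (simp only: mult.assoc)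
    also have "\<dots> = l * f x" unfolding f_def sum_distrib_left by (rule refl)
    finally show ?thesis .
  qed
  define E where "E = {f \<in> fspan B. \<forall>x\<in>carrier G. f (z \<otimes> x) = l * f x}"
  have EI: "f \<in> E" if "f \<in> fspan B" "\<And>x. x \<in> carrier G \<Longrightarrow> f (z \<otimes> x) = l * f x" for f
    using that by (simp add: E_def)
  have ED: "f \<in> fspan B" "x \<in> carrier G \<Longrightarrow> f (z \<otimes> x) = l * f x" if "f \<in> E" for f x
    using that by (simp_all add: E_def)
  have EC: "E \<subseteq> C_G" using fspan_C_G[OF D(2,3)] ED(1) by blast
  have lin: "fspan S \<subseteq> E" if S: "finite S" "S \<subseteq> E" for S
  proof
    fix g assume g: "g \<in> fspan S"
    have "S \<subseteq> fspan B" using S(2) ED(1) by blast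
    then have gB: "g \<in> fspan B" using fspan_subset[OF S(1)] g by blast
    obtain c where c: "\<And>x. x \<in> carrier G \<Longrightarrow> g x = (\<Sum>e\<in>S. c e * e x)" using g by (elim fspanE) blast
    show "g \<in> E"
    proof (rule EI[OF gB])
      fix x assume x: "x \<in> carrier G"
      have "g (z \<otimes> x) = (\<Sum>e\<in>S. c e * e (z \<otimes> x))" using c x zG by simp
      also have "\<dots> = (\<Sum>e\<in>S. l * (c e * e x))"
        using S(2) ED(2)[OF _ x] by (intro sum.cong refl) auto
      also have "\<dots> = l * g x" unfolding c[OF x] sum_distrib_left by (rule refl)
      finally show "g (z \<otimes> x) = l * g x" .
    qed
  qed
  have Nb: "card S \<le> card B" if "orthonormal S" "S \<subseteq> E" for S
    using orthonormal_card_le[OF D(1) that(1)] that(2) ED(1) by blast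
  obtain B' where B': "orthonormal B'" "fspan B' = E"
    by (rule orthonormal_basis_exists[OF EC lin Nb])
  note O' = orthonormalD[OF B'(1)]
  have BE: "e \<in> E" if "e \<in> B'" for e using fspan_base[OF O'(1) that] B'(2) by simp
  have "(\<lambda>x. e (a \<otimes> x)) \<in> E \<and> (\<lambda>x. e (x \<otimes> a)) \<in> E" if e: "e \<in> B'" and a: "a \<in> carrier G" for e a
  proof
    note eE = BE[OF e]
    show "(\<lambda>x. e (a \<otimes> x)) \<in> E"
    proof (rule EI[OF fspan_translate(1)[OF B(1) ED(1)[OF eE] a]])
      fix x assume x: "x \<in> carrier G"
      have "a \<otimes> (z \<otimes> x) = z \<otimes> (a \<otimes> x)"
        using zc[OF a] a x zG by (simp add: m_assoc[symmetric])
      then show "e (a \<otimes> (z \<otimes> x)) = l * e (a \<otimes> x)" using ED(2)[OF eE m_closed[OF a x]] by simp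
    qed
    show "(\<lambda>x. e (x \<otimes> a)) \<in> E"
    proof (rule EI[OF fspan_translate(2)[OF B(1) ED(1)[OF eE] a]])
      fix x assume x: "x \<in> carrier G"
      have "z \<otimes> x \<otimes> a = z \<otimes> (x \<otimes> a)" using a x zG by (simp add: m_assoc)
      then show "e (z \<otimes> x \<otimes> a) = l * e (x \<otimes> a)" using ED(2)[OF eE m_closed[OF x a]] by simp
    qed
  qed
  then have ib: "invariant_basis B'" unfolding invariant_basis_def B'(2) using B'(1) by blast
  have ne: "B' \<noteq> {}"
  proof
    assume "B' = {}"
    moreover have "f \<in> E" by (rule EI[OF fB feig])
    ultimately have "f \<in> fspan {}" using B'(2) by simp
    then obtain c where "\<And>x. x \<in> carrier G \<Longrightarrow> f x = (\<Sum>e\<in>{}. c e * e x)" by (elim fspanE) blast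
    then have "ip f e = ip (\<lambda>x. 0) e" for e by (intro ip_cong) auto
    then have "ip f e = 0" for e by (simp add: ip_def)
    moreover obtain e where e: "e \<in> B" "v e \<noteq> 0" using v(1) by blast
    moreover have "v e = ip f e" by (rule lincomb_unique[OF D(1) _ e(1)]) (simp add: f_def)
    ultimately show False by simp
  qed
  show ?thesis
  proof (rule that[OF ib ne])
    show "B' \<subseteq> fspan B" using BE ED(1) by blast
    show "\<forall>f\<in>fspan B'. \<forall>x\<in>carrier G. f (z \<otimes> x) = l * f x" unfolding B'(2) using ED(2) by blast
  qed
qed

text \<open>Descent on the dimension: as long as some central \<open>z\<close> is not scalar on
  \<open>fspan B\<close>, an eigenspace of \<open>z\<close> is properly smaller. The result may
  still be reducible.\<close>

lemma central_scalars_exists: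
  assumes "invariant_basis B" "B \<noteq> {}"
  shows "\<exists>B' \<psi>. invariant_basis B' \<and> B' \<noteq> {} \<and> B' \<subseteq> fspan B \<and> central_scalars B' \<psi>"
  using assms
proof (induction "card B" arbitrary: B rule: less_induct)
  case less
  note D = invariant_basisD[OF less(2)]
  show ?case
  proof (cases "\<forall>z\<in>centre G. \<exists>l. \<forall>f\<in>fspan B. \<forall>x\<in>carrier G. f (z \<otimes> x) = l * f x")
    case True
    then obtain \<psi> where \<psi>: "\<forall>z\<in>centre G. \<forall>f\<in>fspan B. \<forall>x\<in>carrier G. f (z \<otimes> x) = \<psi> z * f x" by metis
    have BB: "B \<subseteq> fspan B" using fspan_base[OF D(2)] by blast
    then have "central_scalars B \<psi>" using \<psi> unfolding central_scalars_def by blast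
    then show ?thesis using less(2,3) BB by blast
  next
    case False
    then obtain z where z: "z \<in> centre G" "\<not> (\<exists>l. \<forall>f\<in>fspan B. \<forall>x\<in>carrier G. f (z \<otimes> x) = l * f x)" by blast
    obtain l B' where B': "invariant_basis B'" "B' \<noteq> {}" "B' \<subseteq> fspan B"
      "\<forall>f\<in>fspan B'. \<forall>x\<in>carrier G. f (z \<otimes> x) = l * f x"
      by (rule central_eigenspace[OF less(2,3) z(1)])
    have "fspan B' \<noteq> fspan B" using B'(4) z(2) by metis
    then have "card B' < card B"
      using fspan_eq_if_card_ge[OF D(1) invariant_basisD(1)[OF B'(1)] B'(3)] by linarith
    from less(1)[OF this B'(1,2)] obtain B'' \<psi> where B'': "invariant_basis B''" "B'' \<noteq> {}" "B'' \<subseteq> fspan B'"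
      "central_scalars B'' \<psi>" by blast
    moreover have "B'' \<subseteq> fspan B"
      using B''(3) fspan_subset[OF invariant_basisD(2)[OF B'(1)] B'(3)] by blast
    ultimately show ?thesis by blast
  qed
qed

definition block :: "('a \<Rightarrow> complex) set \<Rightarrow> ('a \<Rightarrow> complex) set \<Rightarrow> bool" where
  "block A B \<longleftrightarrow> invariant_basis B \<and> B \<noteq> {} \<and> B \<subseteq> A \<and> (\<exists>\<psi>. central_scalars B \<psi>)"

definition block_functions :: "('a \<Rightarrow> complex) set \<Rightarrow> ('a \<Rightarrow> complex) set" where
  "block_functions A = {e. \<exists>B. block A B \<and> e \<in> B}"

definition block_span :: "('a \<Rightarrow> complex) set \<Rightarrow> ('a \<Rightarrow> complex) set" where
  "block_span A = {f. \<exists>S. finite S \<and> S \<subseteq> block_functions A \<and> f \<in> fspan S}"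

lemma block_spanI: "finite S \<Longrightarrow> S \<subseteq> block_functions A \<Longrightarrow> f \<in> fspan S \<Longrightarrow> f \<in> block_span A"
  unfolding block_span_def by blast

lemma block_spanE:
  assumes "f \<in> block_span A"
  obtains S where "finite S" "S \<subseteq> block_functions A" "f \<in> fspan S"
  using assms unfolding block_span_def by blast

lemma block_span_block:
  assumes "block A B" "f \<in> fspan B"
  shows "f \<in> block_span A"
proof (rule block_spanI[OF _ _ assms(2)])
  show "finite B" using assms(1) invariant_basisD(2) unfolding block_def by blast
  show "B \<subseteq> block_functions A" using assms(1) unfolding block_functions_def by blast
qed

lemma block_span_add:
  assumes "f \<in> block_span A" "g \<in> block_span A"
  shows "(\<lambda>x. f x + g x) \<in> block_span A"
proof -
  obtain S where S: "finite S" "S \<subseteq> block_functions A" "f \<in> fspan S" by (rule block_spanE[OF assms(1)])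
  obtain R where R: "finite R" "R \<subseteq> block_functions A" "g \<in> fspan R" by (rule block_spanE[OF assms(2)])
  have fin: "finite (S \<union> R)" using S R by simp
  have "f \<in> fspan (S \<union> R)" "g \<in> fspan (S \<union> R)"
    using S(3) R(3) fspan_mono[OF fin, of S] fspan_mono[OF fin, of R] by blast+
  then have "(\<lambda>x. f x + g x) \<in> fspan (S \<union> R)" by (rule fspan_add)
  from block_spanI[OF fin _ this] show ?thesis using S(2) R(2) by simp
qed

lemma block_span_mult: "f \<in> block_span A \<Longrightarrow> (\<lambda>x. c * f x) \<in> block_span A"
  by (erule block_spanE, rule block_spanI, assumption, assumption, erule fspan_mult)

lemma block_span_zero: "(\<lambda>x. 0) \<in> block_span A"
  by (rule block_spanI[of "{}"]) (simp_all add: fspan_zero)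

lemma block_span_sum: "finite S \<Longrightarrow> (\<And>i. i \<in> S \<Longrightarrow> f i \<in> block_span A) \<Longrightarrow> (\<lambda>x. \<Sum>i\<in>S. f i x) \<in> block_span A"
  by (induction S rule: finite_induct) (auto intro: block_span_add block_span_zero)

lemma block_span_cong: "f \<in> block_span A \<Longrightarrow> (\<And>x. x \<in> carrier G \<Longrightarrow> g x = f x) \<Longrightarrow> g \<in> block_span A"
  by (erule block_spanE, rule block_spanI, assumption, assumption, erule fspan_cong)

text \<open>An operator that maps every basis function into the span of its own block preserves the
  span of all blocks. It is applied to translations and to convolutions.\<close>

lemma block_span_map:
  assumes f: "f \<in> block_span A"
    and \<Phi>: "\<And>B e. block A B \<Longrightarrow> e \<in> B \<Longrightarrow> \<Phi> e \<in> fspan B"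
    and lin: "\<And>S c x. finite S \<Longrightarrow> S \<subseteq> block_functions A \<Longrightarrow> (\<And>x. x \<in> carrier G \<Longrightarrow> f x = (\<Sum>e\<in>S. c e * e x)) \<Longrightarrow>
      x \<in> carrier G \<Longrightarrow> g x = (\<Sum>e\<in>S. c e * \<Phi> e x)"
  shows "g \<in> block_span A"
proof -
  obtain S where S: "finite S" "S \<subseteq> block_functions A" "f \<in> fspan S" by (rule block_spanE[OF f])
  obtain c where c: "\<And>x. x \<in> carrier G \<Longrightarrow> f x = (\<Sum>e\<in>S. c e * e x)" using S(3) by (elim fspanE) blast
  have "\<Phi> e \<in> block_span A" if "e \<in> S" for e
  proof -
    obtain B where "block A B" "e \<in> B" using S(2) \<open>e \<in> S\<close> unfolding block_functions_def by blast
    then show ?thesis using block_span_block \<Phi> by blast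
  qed
  then have "(\<lambda>x. \<Sum>e\<in>S. c e * \<Phi> e x) \<in> block_span A"
    by (intro block_span_sum S(1) block_span_mult)
  then show ?thesis by (rule block_span_cong) (rule lin[OF S(1,2) c])
qed

lemma block_functions_C_G: "block_functions A \<subseteq> C_G"
  unfolding block_functions_def block_def using invariant_basisD(3) by blast

lemma block_span_C_G: "f \<in> block_span A \<Longrightarrow> f \<in> C_G"
proof -
  assume "f \<in> block_span A"
  then obtain S where S: "finite S" "S \<subseteq> block_functions A" "f \<in> fspan S" by (rule block_spanE)
  have "S \<subseteq> C_G" using S(2) block_functions_C_G by (rule subset_trans)
  from fspan_C_G[OF S(1) this S(3)] show ?thesis .
qed

lemma block_span_translate:
  assumes f: "f \<in> block_span A" and a: "a \<in> carrier G"
  shows "(\<lambda>x. f (a \<otimes> x)) \<in> block_span A" "(\<lambda>x. f (x \<otimes> a)) \<in> block_span A"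
proof -
  have ib: "invariant_basis B" if "block A B" for B using that unfolding block_def by blast
  show "(\<lambda>x. f (a \<otimes> x)) \<in> block_span A"
    by (rule block_span_map[OF f, of "\<lambda>e x. e (a \<otimes> x)"]) (rule invariant_basisD(4)[OF ib _ a], assumption+, simp add: a)
  show "(\<lambda>x. f (x \<otimes> a)) \<in> block_span A"
    by (rule block_span_map[OF f, of "\<lambda>e x. e (x \<otimes> a)"]) (rule invariant_basisD(5)[OF ib _ a], assumption+, simp add: a)
qed

lemma block_span_conv:
  assumes f: "f \<in> block_span A" and k: "kernel k"
  shows "conv k f \<in> block_span A"
proof (rule block_span_map[OF f, of "conv k"])
  fix B e assume B: "block A B" "e \<in> B"
  then have ib: "invariant_basis B" unfolding block_def by blast
  show "conv k e \<in> fspan B"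
    by (rule conv_mem[OF translation_space_fspan[OF ib] kernelD(1)[OF k] fspan_base[OF invariant_basisD(2)[OF ib] B(2)]])
next
  fix S c x assume S: "finite S" "S \<subseteq> block_functions A" and c: "\<And>x. x \<in> carrier G \<Longrightarrow> f x = (\<Sum>e\<in>S. c e * e x)"
    and x: "x \<in> carrier G"
  have "conv k f x = conv k (\<lambda>x. \<Sum>e\<in>S. c e * e x) x" by (rule conv_cong[OF c])
  also have "\<dots> = (\<Sum>e\<in>S. c e * conv k e x)"
    by (rule conv_lincomb[OF k S(1) _ x]) (use S(2) block_functions_C_G in blast)
  finally show "conv k f x = (\<Sum>e\<in>S. c e * conv k e x)" .
qed

text \<open>A translation in the first argument of \<open>ip\<close> moves to the second as the
  inverse translation, and \<open>R\<close> is invariant. Closedness comes from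
  Cauchy-Schwarz.\<close>

lemma translation_space_orthogonal:
  assumes A: "translation_space A" and R: "R \<subseteq> C_G"
    and RL: "\<And>r a. r \<in> R \<Longrightarrow> a \<in> carrier G \<Longrightarrow> (\<lambda>x. r (a \<otimes> x)) \<in> R"
    and RR: "\<And>r a. r \<in> R \<Longrightarrow> a \<in> carrier G \<Longrightarrow> (\<lambda>x. r (x \<otimes> a)) \<in> R"
  shows "translation_space {u \<in> A. \<forall>r\<in>R. ip u r = 0}"
proof -
  note AC = translation_spaceD(1)[OF A]
  have RC: "r \<in> C_G" if "r \<in> R" for r using that R by blast
  have sc: "sup_closed {u \<in> A. \<forall>r\<in>R. ip u r = 0}"
    unfolding sup_closed_def
  proof (intro allI impI)
    fix f assume f: "\<forall>e>0. \<exists>g\<in>{u \<in> A. \<forall>r\<in>R. ip u r = 0}. \<forall>x\<in>carrier G. cmod (f x - g x) \<le> e"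
    have fA: "f \<in> A"
      by (rule sup_closedD[OF translation_spaceD(3)[OF A]]) (use f in blast)
    have "ip f r = 0" if r: "r \<in> R" for r
    proof -
      have "(cmod (ip f r))^2 \<le> 0 + e" if e: "e > 0" for e
      proof -
        define d where "d = sqrt (e / (sq r + 1))"
        have s: "sq r \<ge> 0" by (rule sq_nonneg[OF RC[OF r]])
        have d: "d > 0" "d^2 = e / (sq r + 1)" using e s by (auto simp: d_def)
        then obtain g where g: "g \<in> A" "\<forall>r\<in>R. ip g r = 0" "\<forall>x\<in>carrier G. cmod (f x - g x) \<le> d" using f by blast
        note dC = C_G_diff[OF AC[OF fA] AC[OF g(1)]]
        have "ip (\<lambda>x. f x - g x) r = ip f r"
          using ip_diff_left[OF AC[OF fA] AC[OF g(1)] RC[OF r]] g(2) r by simp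
        then have "(cmod (ip f r))^2 \<le> sq (\<lambda>x. f x - g x) * sq r"
          using cauchy_schwarz[OF dC RC[OF r]] by simp
        also have "\<dots> \<le> d^2 * sq r" by (rule mult_right_mono[OF sq_le[OF dC] s]) (use g(3) in simp)
        also have "\<dots> \<le> e" unfolding d(2) using s e by (simp add: divide_le_eq distrib_left)
        finally show ?thesis by simp
      qed
      then have "(cmod (ip f r))^2 \<le> 0" by (rule field_le_epsilon)
      then show ?thesis by simp
    qed
    then show "f \<in> {u \<in> A. \<forall>r\<in>R. ip u r = 0}" using fA by simp
  qed
  have L: "ip (\<lambda>x. f (a \<otimes> x)) r = 0" if f: "f \<in> A" "\<forall>r\<in>R. ip f r = 0" and a: "a \<in> carrier G" and r: "r \<in> R" for f a r
  proof -
    have "ip (\<lambda>x. f (a \<otimes> x)) r = ip (\<lambda>x. f (a \<otimes> x)) (\<lambda>x. r (inv a \<otimes> (a \<otimes> x)))"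
      using a by (intro ip_cong) (simp_all add: m_assoc[symmetric])
    also have "\<dots> = ip f (\<lambda>x. r (inv a \<otimes> x))"
      by (rule ip_left[OF AC[OF f(1)] RC[OF RL[OF r inv_closed[OF a]]] a])
    finally show ?thesis using f(2) RL[OF r inv_closed[OF a]] by simp
  qed
  have Rt: "ip (\<lambda>x. f (x \<otimes> a)) r = 0" if f: "f \<in> A" "\<forall>r\<in>R. ip f r = 0" and a: "a \<in> carrier G" and r: "r \<in> R" for f a r
  proof -
    have "ip (\<lambda>x. f (x \<otimes> a)) r = ip (\<lambda>x. f (x \<otimes> a)) (\<lambda>x. r (x \<otimes> a \<otimes> inv a))"
      using a by (intro ip_cong) (simp_all add: m_assoc)
    also have "\<dots> = ip f (\<lambda>x. r (x \<otimes> inv a))"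
      by (rule ip_right[OF AC[OF f(1)] RC[OF RR[OF r inv_closed[OF a]]] a])
    finally show ?thesis using f(2) RR[OF r inv_closed[OF a]] by simp
  qed
  let ?P = "{u \<in> A. \<forall>r\<in>R. ip u r = 0}"
  show ?thesis
    unfolding translation_space_def
  proof (intro conjI ballI allI subsetI)
    show "sup_closed ?P" by (rule sc)
    show "(\<lambda>x. 0) \<in> ?P" using translation_spaceD(2)[OF A] by (simp add: ip_def)
  next
    fix f assume "f \<in> ?P"
    then show "f \<in> C_G" using AC by simp
  next
    fix f g assume fg: "f \<in> ?P" "g \<in> ?P"
    then have A': "f \<in> A" "g \<in> A" by simp_all
    have "ip (\<lambda>x. f x + g x) r = 0" if "r \<in> R" for r
      using ip_add_left[OF AC[OF A'(1)] AC[OF A'(2)] RC[OF that]] fg that by simp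
    then show "(\<lambda>x. f x + g x) \<in> ?P" using translation_spaceD(4)[OF A A'] by simp
  next
    fix c f assume f: "f \<in> ?P"
    then have A': "f \<in> A" by simp
    have "ip (\<lambda>x. c * f x) r = 0" if "r \<in> R" for r
      using ip_mult_left[OF AC[OF A'] RC[OF that]] f that by simp
    then show "(\<lambda>x. c * f x) \<in> ?P" using translation_spaceD(5)[OF A A'] by simp
  next
    fix a f assume a: "a \<in> carrier G" and f: "f \<in> ?P"
    then have A': "f \<in> A" "\<forall>r\<in>R. ip f r = 0" by simp_all
    show "(\<lambda>x. f (a \<otimes> x)) \<in> ?P" using translation_spaceD(6)[OF A a A'(1)] L[OF A' a] by simp
  next
    fix a f assume a: "a \<in> carrier G" and f: "f \<in> ?P"
    then have A': "f \<in> A" "\<forall>r\<in>R. ip f r = 0" by simp_all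
    show "(\<lambda>x. f (x \<otimes> a)) \<in> ?P" using translation_spaceD(7)[OF A a A'(1)] Rt[OF A' a] by simp
  qed
qed

text \<open>On the orthogonal complement of all blocks every convolution operator vanishes, since an
  invariant eigenspace would contain a further block. A minimising sequence for the distance of \<open>f\<close> to
  the span of the blocks is Cauchy, and convolution turns it into a uniformly convergent one.\<close>

theorem block_span_dense:
  assumes A: "translation_space A" and f: "f \<in> A" and e: "e > 0"
  obtains g where "g \<in> block_span A" "\<forall>x\<in>carrier G. cmod (f x - g x) \<le> e"
proof -
  note AC = translation_spaceD(1)[OF A]
  define A0 where "A0 = {u \<in> A. \<forall>r\<in>block_span A. ip u r = 0}"
  have A0: "translation_space A0"
    unfolding A0_def
  proof (rule translation_space_orthogonal[OF A subsetI])
    fix r a assume r: "r \<in> block_span A"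
    show "r \<in> C_G" by (rule block_span_C_G[OF r])
    assume a: "a \<in> carrier G"
    show "(\<lambda>x. r (a \<otimes> x)) \<in> block_span A" by (rule block_span_translate(1)[OF r a])
    show "(\<lambda>x. r (x \<otimes> a)) \<in> block_span A" by (rule block_span_translate(2)[OF r a])
  qed
  have vanish: "conv k u x = 0" if k: "kernel k" and u: "u \<in> A0" and x: "x \<in> carrier G" for k u x
  proof (rule ccontr)
    assume nz: "conv k u x \<noteq> 0"
    obtain B where B: "invariant_basis B" "B \<noteq> {}" "fspan B \<subseteq> A0"
      by (rule invariant_basis_exists[OF A0 k u x nz])
    obtain B' \<psi> where B': "invariant_basis B'" "B' \<noteq> {}" "B' \<subseteq> fspan B" "central_scalars B' \<psi>"
      using central_scalars_exists[OF B(1,2)] by blast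
    have sub: "B' \<subseteq> A0" using B'(3) B(3) by (rule subset_trans)
    then have "block A B'" using B' unfolding block_def A0_def by blast
    obtain b where b: "b \<in> B'" using B'(2) by blast
    have "b \<in> block_span A"
      by (rule block_span_block[OF \<open>block A B'\<close> fspan_base[OF invariant_basisD(2)[OF B'(1)] b]])
    then have "ip b b = 0" using sub b unfolding A0_def by blast
    then show False using orthonormalD(4)[OF invariant_basisD(1)[OF B'(1)] b b] by simp
  qed
  have e2: "e / 2 > 0" using e by simp
  obtain k where k: "kernel k" "\<forall>x\<in>carrier G. Re (k x) \<ge> 0" "Re (k \<one>) > 0"
    "\<forall>x\<in>carrier G. \<forall>y\<in>carrier G. k x \<noteq> 0 \<longrightarrow> cmod (f (x \<otimes> y) - f y) \<le> e / 2"
    by (rule kernel_exists[OF AC[OF f] e2])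
  note kC = kernelD(1)[OF k(1)]
  define c where "c = Re (mean k)"
  have c: "c > 0" unfolding c_def using mean_Re_pos[OF kC _ one_closed k(3)] k(2) by simp
  have "cnj (mean k) = mean k"
    unfolding mean_cnj[OF kC, symmetric] by (rule mean_cong) (rule kernelD(3)[OF k(1)])
  then have "mean k \<in> \<real>" by (simp add: Reals_cnj_iff)
  then have ck: "mean k = of_real c" unfolding c_def by simp
  define S where "S = (\<lambda>r. sq (\<lambda>x. f x - r x)) ` block_span A"
  have S0: "s \<ge> 0" if s: "s \<in> S" for s
    using s unfolding S_def
  proof (rule imageE)
    fix r assume r: "s = sq (\<lambda>x. f x - r x)" "r \<in> block_span A"
    show ?thesis unfolding r(1) by (rule sq_nonneg[OF C_G_diff[OF AC[OF f] block_span_C_G[OF r(2)]]])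
  qed
  have bdd: "bdd_below S" using S0 by (intro bdd_belowI[of _ 0])
  have ne: "S \<noteq> {}" unfolding S_def using block_span_zero by blast
  define D where "D = Inf S"
  have D: "D \<le> sq (\<lambda>x. f x - r x)" if "r \<in> block_span A" for r
    unfolding D_def by (rule cInf_lower[OF _ bdd]) (use that in \<open>simp add: S_def\<close>)
  have "\<exists>r. r \<in> block_span A \<and> sq (\<lambda>x. f x - r x) < D + inverse (real (Suc n))" for n
  proof -
    have "Inf S < D + inverse (real (Suc n))" by (simp add: D_def)
    from cInf_lessD[OF ne this] show ?thesis unfolding S_def by blast
  qed
  then obtain r where r: "\<And>n. r n \<in> block_span A" "\<And>n. sq (\<lambda>x. f x - r n x) < D + inverse (real (Suc n))" by metis
  define h where "h n x = f x - r n x" for n x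
  note rC = block_span_C_G[OF r(1)]
  have hC: "h n \<in> C_G" for n unfolding h_def[abs_def] by (rule C_G_diff[OF AC[OF f] rC])
  have rA: "g \<in> A" if "g \<in> block_span A" for g
  proof -
    obtain X where X: "finite X" "X \<subseteq> block_functions A" "g \<in> fspan X" by (rule block_spanE[OF \<open>g \<in> block_span A\<close>])
    have "X \<subseteq> A" using X(2) unfolding block_functions_def block_def by blast
    then show ?thesis using translation_space_fspan_subset[OF A X(1)] X(3) by blast
  qed
  have hA: "h n \<in> A" for n unfolding h_def[abs_def] by (rule translation_space_diff[OF A f rA[OF r(1)]])
  have h2: "sq (h n) < D + inverse (real (Suc n))" for n unfolding h_def[abs_def] by (rule r(2))
  \<comment> \<open>Parallelogram law: the midpoint of \<open>r m\<close> and \<open>r n\<close> is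
    again in the span, hence its squared distance to \<open>f\<close> is at least
    \<open>D\<close>.\<close>
  have small: "sq (\<lambda>x. h m x - h n x) \<le> 2 * inverse (real (Suc m)) + 2 * inverse (real (Suc n))" for m n
  proof -
    have "(\<lambda>x. (1/2) * (r m x + r n x)) \<in> block_span A" by (intro block_span_mult block_span_add r(1))
    from D[OF this] have "D \<le> sq (\<lambda>x. f x - (1/2) * (r m x + r n x))" .
    also have "\<dots> = sq (\<lambda>x. (1/2) * (h m x + h n x))"
      by (rule sq_cong) (simp add: h_def field_simps)
    also have "\<dots> = (1/4) * sq (\<lambda>x. h m x + h n x)"
      unfolding sq_mult[OF C_G_add[OF hC hC]] by (simp add: power2_eq_square)
    finally have "4 * D \<le> sq (\<lambda>x. h m x + h n x)" by simp
    then show ?thesis using h2[of m] h2[of n] unfolding sq_add[OF hC hC] sq_diff[OF hC hC] by linarith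
  qed
  obtain b where b: "b > 0" "\<And>x. x \<in> carrier G \<Longrightarrow> cmod (k x) \<le> b" using C_G_bounded[OF kC] by blast
  have Cau: "\<forall>e>0. \<exists>N. \<forall>m\<ge>N. \<forall>n\<ge>N. \<forall>x\<in>carrier G. cmod (conv k (h m) x - conv k (h n) x) \<le> e"
  proof (intro allI impI)
    fix d :: real assume d: "d > 0"
    then have "(d / b)^2 / 4 > 0" using b(1) by simp
    then obtain N where N: "inverse (real (Suc N)) < (d / b)^2 / 4" using reals_Archimedean by blast
    show "\<exists>N. \<forall>m\<ge>N. \<forall>n\<ge>N. \<forall>x\<in>carrier G. cmod (conv k (h m) x - conv k (h n) x) \<le> d"
    proof (intro exI[of _ N] allI impI ballI)
      fix m n x assume mn: "m \<ge> N" "n \<ge> N" and x: "x \<in> carrier G"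
      have "inverse (real (Suc m)) \<le> inverse (real (Suc N))" "inverse (real (Suc n)) \<le> inverse (real (Suc N))"
        using mn by (auto intro!: le_imp_inverse_le)
      then have s: "sq (\<lambda>x. h m x - h n x) \<le> (d / b)^2" using small[of m n] N by linarith
      have "cmod (conv k (\<lambda>x. h m x - h n x) x) \<le> b * (d / b)"
        by (rule conv_sup_bound[OF k(1) b(2) _ C_G_diff[OF hC hC] s _ x]) (use b(1) d in simp_all)
      then show "cmod (conv k (h m) x - conv k (h n) x) \<le> d"
        unfolding conv_diff[OF k(1) hC hC x] using b(1) by simp
    qed
  qed
  obtain g where g: "g \<in> A" "\<forall>e>0. \<exists>N. \<forall>n\<ge>N. \<forall>x\<in>carrier G. cmod (conv k (h n) x - g x) \<le> e"
    by (rule uniform_limit_mem[OF translation_spaceD(3)[OF A] conv_mem[OF A kC hA] Cau])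
  then have cg: "uniformly_to (\<lambda>n. conv k (h n)) g" unfolding uniformly_to_def by simp
  note gC = AC[OF g(1)] and cC = C_G_conv[OF kC hC]
  have ip_lim: "(\<lambda>n. ip (conv k (h n)) q) \<longlonglongrightarrow> ip g q" if q: "q \<in> C_G" for q
  proof -
    have l: "(\<lambda>n. sq (\<lambda>x. conv k (h n) x - g x) * sq q) \<longlonglongrightarrow> 0 * sq q"
      by (intro tendsto_intros uniformly_to_sq[OF cg cC gC])
    have "(\<lambda>n. (cmod (ip (conv k (h n)) q - ip g q))^2) \<longlonglongrightarrow> 0"
    proof (rule tendsto_sandwich[OF _ _ tendsto_const])
      show "(\<lambda>n. sq (\<lambda>x. conv k (h n) x - g x) * sq q) \<longlonglongrightarrow> 0" using l by simp
      show "\<forall>\<^sub>F n in sequentially. (cmod (ip (conv k (h n)) q - ip g q))^2 \<le> sq (\<lambda>x. conv k (h n) x - g x) * sq q"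
        using cauchy_schwarz[OF C_G_diff[OF cC gC] q] unfolding ip_diff_left[OF cC gC q] by simp
    qed simp
    then have "(\<lambda>n. cmod (ip (conv k (h n)) q - ip g q)) \<longlonglongrightarrow> 0" by (simp add: tendsto_null_power)
    then show ?thesis by (simp add: tendsto_norm_zero_iff LIM_zero_iff)
  qed
  \<comment> \<open>Self-adjointness moves the convolution to \<open>q\<close>, which stays in the
    span of the blocks; and \<open>h n\<close> is almost orthogonal to that span because it is
    almost of minimal length.\<close>
  have "ip g q = 0" if q: "q \<in> block_span A" for q
  proof -
    define p where "p = conv k q"
    have p: "p \<in> block_span A" unfolding p_def by (rule block_span_conv[OF q k(1)])
    note pC = block_span_C_G[OF p] and qC = block_span_C_G[OF q]
    have bnd: "(cmod (ip (conv k (h n)) q))^2 \<le> sq p * inverse (real (Suc n))" for n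
    proof -
      have eq: "ip (conv k (h n)) q = ip (h n) p" unfolding p_def by (rule conv_self_adjoint[OF k(1) hC qC])
      show ?thesis
      proof (cases "sq p = 0")
        case True
        then show ?thesis unfolding eq using cauchy_schwarz[OF hC pC, of n] by simp
      next
        case False
        then have pos: "sq p > 0" using sq_nonneg[OF pC] by simp
        \<comment> \<open>The coefficient of the projection of \<open>h n\<close> to
          \<open>p\<close>. Subtracting \<open>t * p\<close> lowers the squared norm by
          \<open>(cmod (ip (h n) p))^2 / sq p\<close>, but not below \<open>D\<close>.\<close>
        define t where "t = ip (h n) p / of_real (sq p)"
        have "(\<lambda>x. r n x + t * p x) \<in> block_span A" by (intro block_span_mult block_span_add r(1) p)
        from D[OF this] have "D \<le> sq (\<lambda>x. f x - (r n x + t * p x))" .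
        also have "\<dots> = sq (\<lambda>x. h n x - t * p x)" by (rule sq_cong) (simp add: h_def)
        also have "\<dots> = sq (h n) - 2 * Re (ip (h n) (\<lambda>x. t * p x)) + (cmod t)^2 * sq p"
          unfolding sq_diff[OF hC C_G_mult_const[OF pC]] sq_mult[OF pC] by (rule refl)
        also have "ip (h n) (\<lambda>x. t * p x) = of_real ((cmod (ip (h n) p))^2 / sq p)"
          unfolding ip_mult_right[OF pC hC] t_def of_real_divide complex_norm_square by simp
        also have "(cmod t)^2 * sq p = (cmod (ip (h n) p))^2 / sq p"
          unfolding t_def using pos by (simp add: norm_divide power_divide power2_eq_square)
        finally have "(cmod (ip (h n) p))^2 / sq p \<le> inverse (real (Suc n))"
          using h2[of n] by simp
        then show ?thesis unfolding eq using pos by (simp add: pos_divide_le_eq mult.commute)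
      qed
    qed
    have l: "(\<lambda>n. (cmod (ip (conv k (h n)) q))^2) \<longlonglongrightarrow> (cmod (ip g q))^2"
      by (intro tendsto_intros ip_lim qC)
    have "(\<lambda>n. sq p * inverse (real (Suc n))) \<longlonglongrightarrow> sq p * 0"
      by (intro tendsto_intros LIMSEQ_inverse_real_of_nat)
    from LIMSEQ_le[OF l this] have "(cmod (ip g q))^2 \<le> sq p * 0" using bnd by blast
    then show ?thesis by simp
  qed
  then have g0: "g \<in> A0" unfolding A0_def using g(1) by simp
  \<comment> \<open>\<open>g\<close> lies in the complement of the blocks, where convolution
    vanishes. By self-adjointness the functions converging to \<open>g\<close> are orthogonal to
    \<open>g\<close>, so \<open>g\<close> is 0.\<close>
  have "ip (conv k (h n)) g = 0" for n
  proof -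
    have "ip (conv k (h n)) g = ip (h n) (conv k g)" by (rule conv_self_adjoint[OF k(1) hC gC])
    also have "\<dots> = ip (h n) (\<lambda>x. 0)" by (rule ip_cong) (simp_all add: vanish[OF k(1) g0])
    finally show ?thesis by (simp add: ip_def)
  qed
  then have "ip g g = 0" using ip_lim[OF gC] LIMSEQ_unique[OF _ tendsto_const] by simp
  then have "sq g = 0" by (simp add: sq_def)
  then have gz: "g x = 0" if "x \<in> carrier G" for x using sq_eq_0[OF gC] that by blast
  have ce: "c * (e / 2) > 0" using c e by simp
  obtain N where N: "\<forall>n\<ge>N. \<forall>x\<in>carrier G. cmod (conv k (h n) x - g x) \<le> c * (e / 2)"
    by (rule uniformly_toE[OF cg ce])
  show ?thesis
  proof (rule that)
    \<comment> \<open>The approximation is not \<open>r N\<close>, which is close in L2 only, but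
      its normalised convolution: \<open>conv k f\<close> is near \<open>conv k (r N)\<close> since
      \<open>conv k (h N)\<close> is small, and near \<open>c * f\<close> by the choice of
      \<open>k\<close>. Each error costs \<open>c * e / 2\<close>.\<close>
    show "(\<lambda>x. of_real (1 / c) * conv k (r N) x) \<in> block_span A"
      by (intro block_span_mult block_span_conv r(1) k(1))
    show "\<forall>x\<in>carrier G. cmod (f x - of_real (1 / c) * conv k (r N) x) \<le> e"
    proof
      fix x assume x: "x \<in> carrier G"
      have 1: "cmod (conv k f x - mean k * f x) \<le> (e / 2) * Re (mean k)"
        by (rule conv_approx[OF k(1,2) AC[OF f] x k(4)])
      have "conv k (h N) x = conv k f x - conv k (r N) x"
        unfolding h_def[abs_def] by (rule conv_diff[OF k(1) AC[OF f] rC x])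
      then have 2: "cmod (conv k f x - conv k (r N) x) \<le> c * (e / 2)"
        using N x gz[OF x] by fastforce
      have "of_real c * (f x - of_real (1 / c) * conv k (r N) x) = of_real c * f x - conv k (r N) x"
        using c by (simp add: right_diff_distrib)
      then have "c * cmod (f x - of_real (1 / c) * conv k (r N) x) = cmod (of_real c * f x - conv k (r N) x)"
        using c by (metis norm_mult norm_of_real abs_of_pos)
      also have "\<dots> \<le> c * (e / 2) + c * (e / 2)"
        using 1 2 norm_triangle_ineq4[of "conv k f x - conv k (r N) x" "conv k f x - mean k * f x"]
        unfolding ck by (simp add: mult.commute)
      finally have "c * cmod (f x - of_real (1 / c) * conv k (r N) x) \<le> c * e" by simp
      then show "cmod (f x - of_real (1 / c) * conv k (r N) x) \<le> e" using c by simp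
    qed
  qed
qed

end

section \<open>Determinants and characters\<close>

text \<open>Entries are passed as a function of two indices. For entries depending on
  \<open>x\<close>, \<open>detf_expand\<close> then shows directly a polynomial in them, which stays
  in the algebra.\<close>

definition detf :: "nat \<Rightarrow> (nat \<Rightarrow> nat \<Rightarrow> complex) \<Rightarrow> complex" where
  "detf n a = Determinant.det (Matrix.mat n n (\<lambda>(i, j). a i j))"

lemma detf_expand:
  "detf n a = (\<Sum>p | p permutes {0..<n}. signof p * (\<Prod>i = 0..<n. a i (p i)))"
proof -
  have "detf n a = (\<Sum>p | p permutes {0..<n}. signof p *
      (\<Prod>i = 0..<n. Matrix.mat n n (\<lambda>(i, j). a i j) $$ (i, p i)))"
    unfolding detf_def by (rule det_def') simp
  also have "\<dots> = (\<Sum>p | p permutes {0..<n}. signof p * (\<Prod>i = 0..<n. a i (p i)))"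
    by (intro sum.cong refl arg_cong2[where f = "(*)"] prod.cong) (auto simp: permutes_def)
  finally show ?thesis .
qed

lemma detf_cong: "(\<And>i j. i < n \<Longrightarrow> j < n \<Longrightarrow> a i j = b i j) \<Longrightarrow> detf n a = detf n b"
  unfolding detf_def by (intro arg_cong[where f = Determinant.det] eq_matI) auto

lemma detf_mult: "detf n (\<lambda>i j. \<Sum>l<n. a i l * b l j) = detf n a * detf n b"
proof -
  let ?A = "Matrix.mat n n (\<lambda>(i, j). a i j)" and ?B = "Matrix.mat n n (\<lambda>(i, j). b i j)"
  have "?A * ?B = Matrix.mat n n (\<lambda>(i, j). \<Sum>l<n. a i l * b l j)"
    by (rule eq_matI) (auto simp: scalar_prod_def atLeast0LessThan)
  then show ?thesis
    using Determinant.det_mult[of ?A n ?B] by (simp add: detf_def)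
qed

lemma detf_scalar: "detf n (\<lambda>i j. if i = j then c else 0) = c ^ n"
proof -
  have "Matrix.mat n n (\<lambda>(i, j). if i = j then c else 0) = c \<cdot>\<^sub>m 1\<^sub>m n"
    by (rule eq_matI) auto
  then show ?thesis unfolding detf_def by simp
qed

definition minor :: "nat \<Rightarrow> nat \<Rightarrow> (nat \<Rightarrow> nat \<Rightarrow> complex) \<Rightarrow> nat \<Rightarrow> nat \<Rightarrow> complex" where
  "minor i j a r s = a (if r < i then r else Suc r) (if s < j then s else Suc s)"

text \<open>Entry of the adjugate: for a unitary matrix the inverse is the conjugate transpose.\<close>

lemma cnj_unitary_entry:
  assumes U: "\<And>i j. i < n \<Longrightarrow> j < n \<Longrightarrow> (\<Sum>l<n. cnj (a l i) * a l j) = (if i = j then 1 else 0)"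
    and i: "i < n" and j: "j < n"
  shows "detf n a * cnj (a i j) = (-1) ^ (i + j) * detf (n - 1) (minor i j a)"
proof -
  let ?A = "Matrix.mat n n (\<lambda>(i, j). a i j)" and ?H = "Matrix.mat n n (\<lambda>(i, j). cnj (a j i))"
  have A: "?A \<in> carrier_mat n n" and H: "?H \<in> carrier_mat n n" by auto
  have "?H * ?A = 1\<^sub>m n"
    using U by (intro eq_matI) (auto simp: scalar_prod_def atLeast0LessThan)
  then have AH: "?A * ?H = 1\<^sub>m n" using mat_mult_left_right_inverse[OF H A] by simp
  note adj = adj_mat[OF A]
  have "adj_mat ?A = adj_mat ?A * (?A * ?H)" using adj(1) AH by simp
  also have "\<dots> = (adj_mat ?A * ?A) * ?H" by (rule assoc_mult_mat[symmetric, OF adj(1) A H])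
  also have "\<dots> = Determinant.det ?A \<cdot>\<^sub>m ?H" unfolding adj(3) mult_smult_assoc_mat[OF one_carrier_mat H] left_mult_one_mat[OF H] by (rule refl)
  finally have "adj_mat ?A $$ (j, i) = (Determinant.det ?A \<cdot>\<^sub>m ?H) $$ (j, i)" by simp
  moreover have "(Determinant.det ?A \<cdot>\<^sub>m ?H) $$ (j, i) = detf n a * cnj (a i j)"
    using i j by (simp add: detf_def)
  moreover have "adj_mat ?A $$ (j, i) = cofactor ?A i j" using i j by (simp add: adj_mat_def)
  moreover have "mat_delete ?A i j = Matrix.mat (n - 1) (n - 1) (\<lambda>(r, s). minor i j a r s)"
    unfolding mat_delete_def using i j by (intro eq_matI) (auto simp: minor_def)
  ultimately show ?thesis by (simp add: cofactor_def detf_def)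
qed

context compact_hausdorff_group
begin

section \<open>Characters and matrix coefficients\<close>

text \<open>The notion of invariant algebra for total functions.\<close>

definition multiplicative_space :: "('a \<Rightarrow> complex) set \<Rightarrow> bool" where
  "multiplicative_space A \<longleftrightarrow> translation_space A \<and> (\<forall>c. (\<lambda>x. c) \<in> A) \<and>
    (\<forall>f\<in>A. \<forall>g\<in>A. (\<lambda>x. f x * g x) \<in> A)"

lemma multiplicative_spaceD:
  assumes "multiplicative_space A"
  shows "translation_space A" "(\<lambda>x. c) \<in> A" "f \<in> A \<Longrightarrow> g \<in> A \<Longrightarrow> (\<lambda>x. f x * g x) \<in> A"
  using assms unfolding multiplicative_space_def by auto

lemma multiplicative_space_power:
  assumes A: "multiplicative_space A" and f: "f \<in> A"
  shows "(\<lambda>x. f x ^ n) \<in> A"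
proof (induction n)
  case 0
  show ?case using multiplicative_spaceD(2)[OF A, of 1] by simp
next
  case (Suc n)
  show ?case using multiplicative_spaceD(3)[OF A f Suc] by simp
qed

lemma multiplicative_space_prod:
  assumes A: "multiplicative_space A" and S: "finite S" "\<And>i. i \<in> S \<Longrightarrow> f i \<in> A"
  shows "(\<lambda>x. \<Prod>i\<in>S. f i x) \<in> A"
  using S
proof (induction S rule: finite_induct)
  case empty
  show ?case using multiplicative_spaceD(2)[OF A, of 1] by simp
next
  case (insert i S)
  then have "f i \<in> A" "(\<lambda>x. \<Prod>i\<in>S. f i x) \<in> A" by auto
  from multiplicative_spaceD(3)[OF A this] show ?case using insert by simp
qed

lemma multiplicative_space_detf:
  assumes A: "multiplicative_space A" and f: "\<And>i j. i < n \<Longrightarrow> j < n \<Longrightarrow> f i j \<in> A"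
  shows "(\<lambda>x. detf n (\<lambda>i j. f i j x)) \<in> A"
  unfolding detf_expand
proof (rule translation_space_sum[OF multiplicative_spaceD(1)[OF A]])
  show "finite {p. p permutes {0..<n}}" by (rule finite_permutations) simp
  fix p assume p: "p \<in> {p. p permutes {0..<n}}"
  have "(\<lambda>x. \<Prod>i = 0..<n. f i (p i) x) \<in> A"
  proof (rule multiplicative_space_prod[OF A])
    fix i assume i: "i \<in> {0..<n}"
    then have "p i < n" using p permutes_in_image[of p "{0..<n}" i] by simp
    then show "f i (p i) \<in> A" using i by (intro f) auto
  qed simp
  then show "(\<lambda>x. signof p * (\<Prod>i = 0..<n. f i (p i) x)) \<in> A"
    by (rule translation_spaceD(5)[OF multiplicative_spaceD(1)[OF A]])
qed

lemma multiplicative_space_C_G: "multiplicative_space C_G"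
  unfolding multiplicative_space_def using translation_space_C_G C_G_mult by simp

definition character :: "('a \<Rightarrow> complex) \<Rightarrow> bool" where
  "character \<gamma> \<longleftrightarrow> \<gamma> \<in> C_G \<and> \<gamma> \<one> = 1 \<and> (\<forall>x\<in>carrier G. \<forall>y\<in>carrier G. \<gamma> (x \<otimes> y) = \<gamma> x * \<gamma> y)"

lemma characterD:
  assumes "character \<gamma>"
  shows "\<gamma> \<in> C_G" "\<gamma> \<one> = 1" "x \<in> carrier G \<Longrightarrow> y \<in> carrier G \<Longrightarrow> \<gamma> (x \<otimes> y) = \<gamma> x * \<gamma> y"
  using assms unfolding character_def by auto

text \<open>One exponent for all \<open>x\<close>: finite order in the group of characters.\<close>

definition torsion_character :: "('a \<Rightarrow> complex) \<Rightarrow> bool" where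
  "torsion_character \<gamma> \<longleftrightarrow> (\<exists>m>0. \<forall>x\<in>carrier G. \<gamma> x ^ m = 1)"

text \<open>Translation by \<open>a\<close> multiplies \<open>\<gamma>\<close> by the scalar
  \<open>\<gamma> a\<close> and preserves \<open>sq \<gamma>\<close>, which is not 0 because
  \<open>\<gamma> \<one> = 1\<close>.\<close>

lemma character_norm:
  assumes \<gamma>: "character \<gamma>" and a: "a \<in> carrier G"
  shows "cmod (\<gamma> a) = 1"
proof -
  note C = characterD(1)[OF \<gamma>]
  have "sq \<gamma> = sq (\<lambda>x. \<gamma> (a \<otimes> x))"
    unfolding sq_def ip_left[OF C C a] by (rule refl)
  also have "\<dots> = sq (\<lambda>x. \<gamma> a * \<gamma> x)" by (rule sq_cong) (rule characterD(3)[OF \<gamma> a])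
  also have "\<dots> = (cmod (\<gamma> a))^2 * sq \<gamma>" by (rule sq_mult[OF C])
  finally have "sq \<gamma> = (cmod (\<gamma> a))^2 * sq \<gamma>" .
  moreover have "sq \<gamma> \<noteq> 0" using sq_eq_0[OF C _ one_closed] characterD(2)[OF \<gamma>] by force
  ultimately have "(cmod (\<gamma> a))^2 = 1" by simp
  then show ?thesis by (simp add: power2_eq_1_iff) (smt (verit) norm_ge_zero)
qed

text \<open>The matrix of right translation by \<open>g\<close>: column \<open>j\<close> holds the
  coordinates of the translate of \<open>h j\<close>. With right translations the matrices multiply
  in the order of the group.\<close>

definition rep :: "(nat \<Rightarrow> 'a \<Rightarrow> complex) \<Rightarrow> nat \<Rightarrow> nat \<Rightarrow> 'a \<Rightarrow> complex" where
  "rep h i j g = ip (\<lambda>x. h j (x \<otimes> g)) (h i)"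

context
  fixes B :: "('a \<Rightarrow> complex) set" and h :: "nat \<Rightarrow> 'a \<Rightarrow> complex" and n :: nat
  assumes B: "invariant_basis B" and h: "bij_betw h {..<n} B"
begin

lemma rep_sum: "(\<Sum>e\<in>B. F e) = (\<Sum>i<n. F (h i))" for F :: "('a \<Rightarrow> complex) \<Rightarrow> complex"
  using sum.reindex_bij_betw[OF h, of F] by simp

lemma rep_mem: "i < n \<Longrightarrow> h i \<in> B"
  using h unfolding bij_betw_def by auto

lemma rep_inj: "i < n \<Longrightarrow> j < n \<Longrightarrow> h i = h j \<longleftrightarrow> i = j"
  using h unfolding bij_betw_def inj_on_def by auto

lemma rep_C_G: "i < n \<Longrightarrow> h i \<in> C_G"
  using rep_mem invariant_basisD(3)[OF B] by blast

lemma rep_expand: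
  assumes j: "j < n" and g: "g \<in> carrier G" and x: "x \<in> carrier G"
  shows "h j (x \<otimes> g) = (\<Sum>i<n. rep h i j g * h i x)"
  using orthonormal_expand[OF invariant_basisD(1)[OF B] invariant_basisD(5)[OF B rep_mem[OF j] g] x]
  unfolding rep_sum rep_def .

lemma rep_unique:
  assumes "\<And>x. x \<in> carrier G \<Longrightarrow> f x = (\<Sum>i<n. c i * h i x)" and i: "i < n"
  shows "ip f (h i) = c i"
proof -
  have inv: "inv_into {..<n} h (h i) = i" if "i < n" for i
    using h that unfolding bij_betw_def by (simp add: inv_into_f_f)
  have "c (inv_into {..<n} h (h i)) = ip f (h i)"
  proof (rule lincomb_unique[OF invariant_basisD(1)[OF B] _ rep_mem[OF i], where c = "\<lambda>e. c (inv_into {..<n} h e)"])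
    fix x assume "x \<in> carrier G"
    then show "f x = (\<Sum>e\<in>B. c (inv_into {..<n} h e) * e x)"
      unfolding rep_sum using assms(1) inv by simp
  qed
  then show ?thesis using inv[OF i] by simp
qed

lemma rep_mult:
  assumes g: "g \<in> carrier G" "g' \<in> carrier G" and ij: "i < n" "j < n"
  shows "rep h i j (g \<otimes> g') = (\<Sum>l<n. rep h i l g * rep h l j g')"
  unfolding rep_def[of h i j]
proof (rule rep_unique[OF _ ij(1)])
  fix x assume x: "x \<in> carrier G"
  have "h j (x \<otimes> (g \<otimes> g')) = h j ((x \<otimes> g) \<otimes> g')" using x g by (simp add: m_assoc)
  also have "\<dots> = (\<Sum>l<n. rep h l j g' * h l (x \<otimes> g))" by (rule rep_expand[OF ij(2) g(2) m_closed[OF x g(1)]])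
  also have "\<dots> = (\<Sum>l<n. rep h l j g' * (\<Sum>i<n. rep h i l g * h i x))"
    using rep_expand[OF _ g(1) x] by simp
  also have "\<dots> = (\<Sum>i<n. \<Sum>l<n. rep h l j g' * (rep h i l g * h i x))"
    unfolding sum_distrib_left by (rule sum.swap)
  also have "\<dots> = (\<Sum>i<n. (\<Sum>l<n. rep h i l g * rep h l j g') * h i x)"
    unfolding sum_distrib_right by (intro sum.cong refl) (simp only: mult_ac)
  finally show "h j (x \<otimes> (g \<otimes> g')) = (\<Sum>i<n. (\<Sum>l<n. rep h i l g * rep h l j g') * h i x)" .
qed

lemma rep_ip:
  assumes "i < n" "j < n"
  shows "ip (h i) (h j) = (if i = j then 1 else 0)"
  using orthonormalD(4)[OF invariant_basisD(1)[OF B] rep_mem[OF assms(1)] rep_mem[OF assms(2)]]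
    rep_inj[OF assms] by simp

lemma rep_one: "i < n \<Longrightarrow> j < n \<Longrightarrow> rep h i j \<one> = (if i = j then 1 else 0)"
proof -
  assume ij: "i < n" "j < n"
  have "rep h i j \<one> = ip (h j) (h i)" unfolding rep_def by (rule ip_cong) simp_all
  then show ?thesis using rep_ip[OF ij(2,1)] by auto
qed

text \<open>Right translation preserves \<open>ip\<close>; Parseval rewrites this as orthonormality
  of the columns.\<close>

lemma rep_unitary:
  assumes g: "g \<in> carrier G" and ij: "i < n" "j < n"
  shows "(\<Sum>l<n. cnj (rep h l i g) * rep h l j g) = (if i = j then 1 else 0)"
proof -
  have "(if j = i then 1 else 0) = ip (\<lambda>x. h j (x \<otimes> g)) (\<lambda>x. h i (x \<otimes> g))"
    unfolding ip_right[OF rep_C_G[OF ij(2)] rep_C_G[OF ij(1)] g] rep_ip[OF ij(2,1)] by (rule refl)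
  also have "\<dots> = (\<Sum>l<n. rep h l j g * cnj (rep h l i g))"
    unfolding rep_def
    using ip_parseval[OF invariant_basisD(1)[OF B] invariant_basisD(5)[OF B rep_mem[OF ij(2)] g]
      C_G_right[OF rep_C_G[OF ij(1)] g]] unfolding rep_sum .
  finally have *: "(if j = i then 1 else 0) = (\<Sum>l<n. rep h l j g * cnj (rep h l i g))" .
  have "(\<Sum>l<n. cnj (rep h l i g) * rep h l j g) = (\<Sum>l<n. rep h l j g * cnj (rep h l i g))"
    by (rule sum.cong[OF refl]) (rule mult.commute)
  also have "\<dots> = (if i = j then 1 else 0)" unfolding *[symmetric] by (cases "i = j") simp_all
  finally show ?thesis .
qed

text \<open>As a function of \<open>g\<close> the coefficient is a weighted mean of the left
  translates of \<open>h j\<close>.\<close>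

lemma rep_in_space:
  assumes A: "translation_space A" "B \<subseteq> A" and ij: "i < n" "j < n"
  shows "rep h i j \<in> A"
proof -
  have "(\<lambda>g. mean (\<lambda>x. cnj (h i x) * h j (x \<otimes> g))) \<in> A"
    by (rule mean_left_translates_mem[OF A(1) _ C_G_cnj[OF rep_C_G[OF ij(1)]]]) (use rep_mem[OF ij(2)] A(2) in blast)
  moreover have "rep h i j = (\<lambda>g. mean (\<lambda>x. cnj (h i x) * h j (x \<otimes> g)))"
    unfolding rep_def ip_def by (simp only: mult.commute)
  ultimately show ?thesis by simp
qed

definition det_rep :: "'a \<Rightarrow> complex" where
  "det_rep g = detf n (\<lambda>i j. rep h i j g)"

lemma det_rep_in_space:
  assumes "multiplicative_space A" "B \<subseteq> A"
  shows "det_rep \<in> A"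
  unfolding det_rep_def[abs_def]
  by (rule multiplicative_space_detf[OF assms(1) rep_in_space[OF multiplicative_spaceD(1)[OF assms(1)] assms(2)]])

lemma character_det_rep: "character det_rep"
  unfolding character_def
proof (intro conjI ballI)
  show "det_rep \<in> C_G" by (rule det_rep_in_space[OF multiplicative_space_C_G invariant_basisD(3)[OF B]])
  have "det_rep \<one> = detf n (\<lambda>i j. if i = j then 1 else 0)"
    unfolding det_rep_def by (rule detf_cong) (rule rep_one)
  then show "det_rep \<one> = 1" by (simp add: detf_scalar)
  fix x y assume xy: "x \<in> carrier G" "y \<in> carrier G"
  have "det_rep (x \<otimes> y) = detf n (\<lambda>i j. \<Sum>l<n. rep h i l x * rep h l j y)"
    unfolding det_rep_def by (rule detf_cong) (rule rep_mult[OF xy])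
  then show "det_rep (x \<otimes> y) = det_rep x * det_rep y" unfolding det_rep_def detf_mult .
qed

text \<open>\<open>F i\<close> is the conjugate of \<open>rep h i j\<close>, written by the cofactor
  formula with \<open>det_rep\<close> to the power \<open>m - 1\<close> as inverse of the
  determinant. The basis functions themselves are recovered from the entries by expanding the
  translate of \<open>h j\<close> at the identity: \<open>h j x\<close> is the sum of
  \<open>rep h i j x * h i \<one>\<close>.\<close>

lemma basis_cnj_mem:
  assumes A: "multiplicative_space A" "B \<subseteq> A" and m: "m > 0" "\<forall>x\<in>carrier G. det_rep x ^ m = 1" and j: "j < n"
  shows "(\<lambda>x. cnj (h j x)) \<in> A"
proof -
  note TA = multiplicative_spaceD(1)[OF A(1)]
  define F where "F i x = det_rep x ^ (m - 1) * ((-1) ^ (i + j) * detf (n - 1) (minor i j (\<lambda>i j. rep h i j x)))" for i x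
  have FA: "F i \<in> A" if i: "i < n" for i
  proof -
    have "(\<lambda>x. detf (n - 1) (\<lambda>r s. rep h (if r < i then r else Suc r) (if s < j then s else Suc s) x)) \<in> A"
      by (rule multiplicative_space_detf[OF A(1)], rule rep_in_space[OF TA A(2)]) (use i j in auto)
    then have "(\<lambda>x. (-1) ^ (i + j) * detf (n - 1) (minor i j (\<lambda>i j. rep h i j x))) \<in> A"
      unfolding minor_def[abs_def] by (rule translation_spaceD(5)[OF TA])
    from multiplicative_spaceD(3)[OF A(1) multiplicative_space_power[OF A(1) det_rep_in_space[OF A]] this]
    show ?thesis unfolding F_def[abs_def] .
  qed
  have Fx: "F i x = cnj (rep h i j x)" if i: "i < n" and x: "x \<in> carrier G" for i x
  proof -
    have "F i x = det_rep x ^ (m - 1) * (det_rep x * cnj (rep h i j x))"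
      unfolding F_def det_rep_def using cnj_unitary_entry[OF rep_unitary[OF x] i j] by simp
    also have "\<dots> = det_rep x ^ m * cnj (rep h i j x)"
      using m(1) by (simp add: power_eq_if)
    finally show ?thesis using m(2) x by simp
  qed
  have "(\<lambda>x. \<Sum>i<n. cnj (h i \<one>) * F i x) \<in> A"
    by (rule translation_space_sum[OF TA]) (use FA in \<open>auto intro: translation_spaceD(5)[OF TA]\<close>)
  then show ?thesis
  proof (rule sup_closed_cong[OF translation_spaceD(3)[OF TA]])
    fix x assume x: "x \<in> carrier G"
    have "h j x = (\<Sum>i<n. rep h i j x * h i \<one>)" using rep_expand[OF j x one_closed] x by simp
    then have "cnj (h j x) = (\<Sum>i<n. cnj (rep h i j x) * cnj (h i \<one>))" by simp
    also have "\<dots> = (\<Sum>i<n. cnj (h i \<one>) * F i x)"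
      using x by (intro sum.cong refl) (simp add: Fx)
    finally show "cnj (h j x) = (\<Sum>i<n. cnj (h i \<one>) * F i x)" .
  qed
qed

text \<open>For central \<open>z\<close> the right translation in \<open>rep\<close> is also the
  left translation in \<open>central_scalars\<close>, so the matrix is scalar.\<close>

lemma det_rep_central:
  assumes \<psi>: "central_scalars B \<psi>" and z: "z \<in> centre G"
  shows "det_rep z = \<psi> z ^ n"
proof -
  have "rep h i j z = (if i = j then \<psi> z else 0)" if ij: "i < n" "j < n" for i j
  proof -
    have "rep h i j z = ip (\<lambda>x. \<psi> z * h j x) (h i)"
      unfolding rep_def
    proof (rule ip_cong)
      fix x assume x: "x \<in> carrier G"
      have "h j (z \<otimes> x) = \<psi> z * h j x"
        using \<psi> z x rep_mem[OF ij(2)] unfolding central_scalars_def by simp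
      then show "h j (x \<otimes> z) = \<psi> z * h j x" unfolding centreD(2)[OF z x] .
    qed simp
    also have "\<dots> = \<psi> z * ip (h j) (h i)" by (rule ip_mult_left[OF rep_C_G[OF ij(2)] rep_C_G[OF ij(1)]])
    finally show ?thesis using rep_ip[OF ij(2,1)] by auto
  qed
  then have "det_rep z = detf n (\<lambda>i j. if i = j then \<psi> z else 0)"
    unfolding det_rep_def by (intro detf_cong)
  then show ?thesis by (simp add: detf_scalar)
qed

end

lemma basis_enumeration:
  assumes "invariant_basis B"
  obtains h where "bij_betw h {..<card B} B"
  using ex_bij_betw_nat_finite[OF invariant_basisD(2)[OF assms]] that by (auto simp: atLeast0LessThan)

text \<open>Conjugation is isometric for the sup norm, so \<open>block_span_dense\<close> reduces
  the claim to finite combinations of block functions.\<close>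

lemma self_adjoint_if_characters_torsion:
  assumes tors: "\<And>\<gamma>. character \<gamma> \<Longrightarrow> torsion_character \<gamma>"
    and A: "multiplicative_space A" and f: "f \<in> A"
  shows "(\<lambda>x. cnj (f x)) \<in> A"
proof (rule sup_closedD[OF translation_spaceD(3)[OF multiplicative_spaceD(1)[OF A]]])
  note TA = multiplicative_spaceD(1)[OF A]
  fix e :: real assume e: "e > 0"
  obtain g where g: "g \<in> block_span A" "\<forall>x\<in>carrier G. cmod (f x - g x) \<le> e"
    by (rule block_span_dense[OF TA f e])
  obtain S where S: "finite S" "S \<subseteq> block_functions A" "g \<in> fspan S" by (rule block_spanE[OF g(1)])
  obtain c where c: "\<And>x. x \<in> carrier G \<Longrightarrow> g x = (\<Sum>e\<in>S. c e * e x)" using S(3) by (elim fspanE) blast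
  have "(\<lambda>x. cnj (b x)) \<in> A" if "b \<in> S" for b
  proof -
    obtain B where B: "block A B" "b \<in> B" using S(2) \<open>b \<in> S\<close> unfolding block_functions_def by blast
    then have ib: "invariant_basis B" and BA: "B \<subseteq> A" unfolding block_def by blast+
    obtain h where h: "bij_betw h {..<card B} B" by (rule basis_enumeration[OF ib])
    obtain m where m: "m > 0" "\<forall>x\<in>carrier G. det_rep h (card B) x ^ m = 1"
      using tors[OF character_det_rep[OF ib h]] unfolding torsion_character_def by blast
    obtain j where j: "j < card B" "b = h j" using h B(2) unfolding bij_betw_def by auto
    show ?thesis unfolding j(2) by (rule basis_cnj_mem[OF ib h A BA m j(1)])
  qed
  then have "(\<lambda>x. \<Sum>b\<in>S. cnj (c b) * cnj (b x)) \<in> A"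
    by (intro translation_space_sum[OF TA S(1)] translation_spaceD(5)[OF TA])
  moreover have "cmod (cnj (f x) - (\<Sum>b\<in>S. cnj (c b) * cnj (b x))) \<le> e" if x: "x \<in> carrier G" for x
  proof -
    have "cnj (f x) - (\<Sum>b\<in>S. cnj (c b) * cnj (b x)) = cnj (f x - g x)" unfolding c[OF x] by simp
    then have "cmod (cnj (f x) - (\<Sum>b\<in>S. cnj (c b) * cnj (b x))) = cmod (f x - g x)"
      by (simp only: complex_mod_cnj)
    then show ?thesis using g(2) x by simp
  qed
  ultimately show "\<exists>g\<in>A. \<forall>x\<in>carrier G. cmod (cnj (f x) - g x) \<le> e" by (intro bexI ballI)
qed

lemma central_scalars_torsion:
  assumes tors: "\<And>\<gamma>. character \<gamma> \<Longrightarrow> torsion_character \<gamma>"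
    and B: "invariant_basis B" "B \<noteq> {}" and \<psi>: "central_scalars B \<psi>"
  shows "\<exists>m>0. \<forall>z\<in>centre G. \<psi> z ^ m = 1"
proof -
  obtain h where h: "bij_betw h {..<card B} B" by (rule basis_enumeration[OF B(1)])
  obtain m where m: "m > 0" "\<forall>x\<in>carrier G. det_rep h (card B) x ^ m = 1"
    using tors[OF character_det_rep[OF B(1) h]] unfolding torsion_character_def by blast
  have "\<psi> z ^ (card B * m) = 1" if z: "z \<in> centre G" for z
    unfolding power_mult det_rep_central[OF B(1) h \<psi> z, symmetric] using m(2) centreD(1)[OF z] by simp
  moreover have "card B * m > 0" using m(1) B(2) invariant_basisD(2)[OF B(1)] by (simp add: card_gt_0_iff)
  ultimately show ?thesis by blast
qed

end

section \<open>Length functions and almost central elements\<close>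

text \<open>The Euclidean norm of a vector indexed by the basis functions themselves. A group
  element \<open>x\<close> is viewed through the vector of values \<open>e x\<close>.\<close>

definition l2 :: "'b set \<Rightarrow> ('b \<Rightarrow> complex) \<Rightarrow> real" where
  "l2 B w = L2_set (\<lambda>e. cmod (w e)) B"

lemma l2_nonneg: "l2 B w \<ge> 0"
  by (simp add: l2_def L2_set_nonneg)

lemma l2_square: "(l2 B w)^2 = (\<Sum>e\<in>B. (cmod (w e))^2)"
  by (simp add: l2_def L2_set_def sum_nonneg)

lemma l2_cong: "(\<And>e. e \<in> B \<Longrightarrow> u e = w e) \<Longrightarrow> l2 B u = l2 B w"
  unfolding l2_def by (intro L2_set_cong) auto

lemma l2_add: "l2 B (\<lambda>e. u e + w e) \<le> l2 B u + l2 B w"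
proof -
  have "l2 B (\<lambda>e. u e + w e) \<le> L2_set (\<lambda>e. cmod (u e) + cmod (w e)) B"
    unfolding l2_def by (intro L2_set_mono norm_triangle_ineq) simp
  also have "\<dots> \<le> l2 B u + l2 B w" unfolding l2_def by (rule L2_set_triangle_ineq)
  finally show ?thesis .
qed

lemma l2_scale: "l2 B (\<lambda>e. c * w e) = cmod c * l2 B w"
  unfolding l2_def norm_mult by (rule L2_set_right_distrib[symmetric]) simp

lemma l2_minus: "l2 B (\<lambda>e. u e - w e) = l2 B (\<lambda>e. w e - u e)"
  unfolding l2_def by (simp add: norm_minus_commute)

lemma l2_member: "finite B \<Longrightarrow> e \<in> B \<Longrightarrow> cmod (w e) \<le> l2 B w"
  unfolding l2_def by (rule member_le_L2_set)

lemma l2_le_card: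
  fixes d :: real
  assumes "\<And>e. e \<in> B \<Longrightarrow> cmod (w e) \<le> d"
  shows "l2 B w \<le> card B * d"
proof -
  have "l2 B w \<le> (\<Sum>e\<in>B. cmod (w e))" unfolding l2_def by (intro L2_set_le_sum) simp
  also have "\<dots> \<le> card B * d" using sum_bounded_above[of B "\<lambda>e. cmod (w e)" d] assms by simp
  finally show ?thesis .
qed

text \<open>The parallelogram law, coordinatewise. Its negative last term is the strict convexity
  used in \<open>almost_central_element\<close>.\<close>

lemma l2_midpoint:
  "(l2 B (\<lambda>e. (u e + w e) / 2))^2 = (l2 B u)^2 / 2 + (l2 B w)^2 / 2 - (l2 B (\<lambda>e. u e - w e))^2 / 4"
proof -
  have "(cmod ((a + b) / 2))^2 = (cmod a)^2 / 2 + (cmod b)^2 / 2 - (cmod (a - b))^2 / 4" for a b :: complex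
    unfolding cmod_power2 by (simp add: power2_eq_square field_simps)
  then show ?thesis
    unfolding l2_square by (simp add: sum.distrib sum_subtractf sum_divide_distrib)
qed

text \<open>The step from \<open>p\<close> to \<open>Suc p\<close> adds
  \<open>(t ^ p - 1) * (t - 1)\<close>, of size at most \<open>p * (cmod (t - 1))^2\<close>. This is
  the scalar counterpart of \<open>pow_nearly_linear\<close>.\<close>

lemma power_minus_linear_le:
  fixes t :: complex
  assumes t: "cmod t = 1"
  shows "cmod (t ^ p - 1 - of_nat p * (t - 1)) \<le> (real p)^2 * (cmod (t - 1))^2"
proof (induction p)
  case (Suc p)
  have 1: "cmod (t ^ p - 1) \<le> real p * cmod (t - 1)"
    using norm_power_diff[of t 1 p] t by simp
  have "t ^ Suc p - 1 - of_nat (Suc p) * (t - 1) = (t ^ p - 1 - of_nat p * (t - 1)) + (t ^ p - 1) * (t - 1)"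
    by (simp add: algebra_simps)
  then have "cmod (t ^ Suc p - 1 - of_nat (Suc p) * (t - 1)) \<le>
      cmod (t ^ p - 1 - of_nat p * (t - 1)) + cmod (t ^ p - 1) * cmod (t - 1)"
    by (metis norm_mult norm_triangle_ineq)
  also have "\<dots> \<le> (real p)^2 * (cmod (t - 1))^2 + real p * cmod (t - 1) * cmod (t - 1)"
    by (intro add_mono Suc mult_right_mono 1) simp
  also have "\<dots> = ((real p)^2 + real p) * (cmod (t - 1))^2" by (simp add: power2_eq_square distrib_right)
  also have "\<dots> \<le> (real (Suc p))^2 * (cmod (t - 1))^2"
    by (intro mult_right_mono) (simp_all add: power2_eq_square algebra_simps)
  finally show ?case .
qed simp

context compact_hausdorff_group
begin

lemma closedin_C_G_preimage:
  assumes "f \<in> C_G" "closed S"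
  shows "closedin T {x \<in> carrier G. f x \<in> S}"
  using closedin_continuous_map_preimage[of T euclidean f S] assms topspace_eq_carrier
  unfolding C_G_def by simp

lemma attains_min:
  assumes f: "f \<in> C_G" and S: "closedin T S" "S \<noteq> {}"
  obtains m where "m \<in> S" "\<forall>x\<in>S. Re (f m) \<le> Re (f x)"
proof -
  have "compactin T S" using closedin_compact_space[OF compact S(1)] .
  then have "compactin euclidean (f ` S)"
    using image_compactin f unfolding C_G_def by blast
  then have c: "compact (f ` S)" by simp
  have "continuous_on (f ` S) Re" by (intro continuous_intros)
  then obtain y where y: "y \<in> f ` S" "\<forall>z\<in>f ` S. Re y \<le> Re z"
    using continuous_attains_inf[OF c] S(2) by blast
  then obtain m where "m \<in> S" "y = f m" by blast
  then show ?thesis using that[of m] y(2) by simp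
qed

section \<open>A bi-invariant pseudometric on the group\<close>

context
  fixes B :: "('a \<Rightarrow> complex) set"
  assumes B: "invariant_basis B"
begin

text \<open>Passing from the values at \<open>p t\<close> to those at \<open>\<theta> (p t)\<close>
  applies the transposed matrix of an isometry of \<open>fspan B\<close>. The proof is by duality:
  \<open>F\<close> has the conjugates of the new vector \<open>s\<close> as coefficients, its
  translate has coefficients \<open>q\<close> of the same norm, and the squared norm of
  \<open>s\<close> is the pairing of \<open>q\<close> with the old vector \<open>w\<close>.\<close>

lemma translate_l2_le:
  assumes \<theta>: "\<And>y. y \<in> carrier G \<Longrightarrow> \<theta> y \<in> carrier G"
    and sp: "\<And>e. e \<in> B \<Longrightarrow> (\<lambda>y. e (\<theta> y)) \<in> fspan B"
    and isom: "\<And>f. f \<in> C_G \<Longrightarrow> sq (\<lambda>y. f (\<theta> y)) = sq f"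
    and S: "finite S" and p: "\<And>t. t \<in> S \<Longrightarrow> p t \<in> carrier G"
  shows "l2 B (\<lambda>e. \<Sum>t\<in>S. c t * e (\<theta> (p t))) \<le> l2 B (\<lambda>e. \<Sum>t\<in>S. c t * e (p t))"
proof -
  note D = invariant_basisD[OF B]
  define w where "w e = (\<Sum>t\<in>S. c t * e (p t))" for e :: "'a \<Rightarrow> complex"
  define s where "s e = (\<Sum>t\<in>S. c t * e (\<theta> (p t)))" for e :: "'a \<Rightarrow> complex"
  define F where "F y = (\<Sum>e\<in>B. cnj (s e) * e y)" for y
  define q where "q e' = ip (\<lambda>y. F (\<theta> y)) e'" for e'
  have FC: "F \<in> C_G" unfolding F_def[abs_def] by (rule C_G_lincomb[OF D(2,3)])
  have FB: "F \<in> fspan B" by (rule fspanI[where c = "\<lambda>e. cnj (s e)"]) (simp add: F_def)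
  have F\<theta>: "(\<lambda>y. F (\<theta> y)) \<in> fspan B"
    unfolding F_def by (intro fspan_sum[OF D(2)] fspan_mult sp)
  have "sq F = (\<Sum>e\<in>B. (cmod (cnj (s e)))^2)"
    unfolding sq_parseval[OF D(1) FB]
    by (intro sum.cong refl arg_cong[where f = "\<lambda>z. (cmod z)^2"] lincomb_unique[OF D(1), symmetric])
      (simp_all add: F_def)
  then have sqF: "sq F = (l2 B s)^2" by (simp add: l2_square)
  have sqq: "(l2 B q)^2 = (l2 B s)^2"
    using sq_parseval[OF D(1) F\<theta>] isom[OF FC] sqF unfolding l2_square q_def by simp
  have lq: "l2 B q = l2 B s" using power2_eq_imp_eq[OF sqq l2_nonneg l2_nonneg] .
  have "of_real ((l2 B s)^2) = (\<Sum>e\<in>B. cnj (s e) * s e)"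
    unfolding l2_square of_real_sum complex_norm_square by (intro sum.cong refl mult.commute)
  also have "\<dots> = (\<Sum>t\<in>S. c t * F (\<theta> (p t)))"
    unfolding s_def[of "_ :: 'a \<Rightarrow> complex"] F_def sum_distrib_left
    by (subst sum.swap) (simp only: s_def mult_ac)
  also have "\<dots> = (\<Sum>t\<in>S. c t * (\<Sum>e'\<in>B. q e' * e' (p t)))"
    using orthonormal_expand[OF D(1) F\<theta> p] unfolding q_def by (intro sum.cong refl) simp
  also have "\<dots> = (\<Sum>e'\<in>B. q e' * w e')"
    unfolding w_def sum_distrib_left by (subst sum.swap) (simp only: mult_ac)
  finally have "(l2 B s)^2 = cmod (\<Sum>e'\<in>B. q e' * w e')"
    by (metis abs_of_nonneg norm_of_real zero_le_power2)
  also have "\<dots> \<le> (\<Sum>e'\<in>B. \<bar>cmod (q e')\<bar> * \<bar>cmod (w e')\<bar>)"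
    using norm_sum[of "\<lambda>e'. q e' * w e'" B] by (simp add: norm_mult)
  also have "\<dots> \<le> l2 B q * l2 B w" unfolding l2_def by (rule L2_set_mult_ineq)
  finally have "l2 B s * l2 B s \<le> l2 B s * l2 B w" unfolding lq by (simp only: power2_eq_square)
  then have "l2 B s \<le> l2 B w"
    using l2_nonneg[of B s] l2_nonneg[of B w] by (cases "l2 B s = 0") auto
  then show ?thesis unfolding s_def w_def .
qed

lemma left_l2_le:
  assumes "x \<in> carrier G" "finite S" "\<And>t. t \<in> S \<Longrightarrow> p t \<in> carrier G"
  shows "l2 B (\<lambda>e. \<Sum>t\<in>S. c t * e (x \<otimes> p t)) \<le> l2 B (\<lambda>e. \<Sum>t\<in>S. c t * e (p t))"
proof (rule translate_l2_le[where \<theta> = "\<lambda>y. x \<otimes> y", OF _ _ _ assms(2,3)])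
  show "sq (\<lambda>y. f (x \<otimes> y)) = sq f" if "f \<in> C_G" for f
    unfolding sq_def ip_left[OF that that assms(1)] by (rule refl)
qed (use assms(1) invariant_basisD(4)[OF B] in simp_all)

lemma right_l2_le:
  assumes "x \<in> carrier G" "finite S" "\<And>t. t \<in> S \<Longrightarrow> p t \<in> carrier G"
  shows "l2 B (\<lambda>e. \<Sum>t\<in>S. c t * e (p t \<otimes> x)) \<le> l2 B (\<lambda>e. \<Sum>t\<in>S. c t * e (p t))"
proof (rule translate_l2_le[where \<theta> = "\<lambda>y. y \<otimes> x", OF _ _ _ assms(2,3)])
  show "sq (\<lambda>y. f (y \<otimes> x)) = sq f" if "f \<in> C_G" for f
    unfolding sq_def ip_right[OF that that assms(1)] by (rule refl)
qed (use assms(1) invariant_basisD(5)[OF B] in simp_all)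

text \<open>Distance of the value vectors. It is invariant under multiplication from both sides, by
  \<open>gap_left\<close> and \<open>gap_right\<close>.\<close>

definition gap :: "'a \<Rightarrow> 'a \<Rightarrow> real" where
  "gap a b = l2 B (\<lambda>e. e a - e b)"

lemma gap_nonneg: "gap a b \<ge> 0"
  by (simp add: gap_def l2_nonneg)

lemma gap_commute: "gap a b = gap b a"
  unfolding gap_def by (rule l2_minus)

lemma gap_triangle: "gap a c \<le> gap a b + gap b c"
proof -
  have "gap a c = l2 B (\<lambda>e. (e a - e b) + (e b - e c))" by (simp add: gap_def)
  also have "\<dots> \<le> gap a b + gap b c" unfolding gap_def by (rule l2_add)
  finally show ?thesis .
qed

lemma gap_left_le:
  assumes "x \<in> carrier G" "a \<in> carrier G" "b \<in> carrier G"
  shows "gap (x \<otimes> a) (x \<otimes> b) \<le> gap a b"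
  using left_l2_le[OF assms(1), of "{False, True}" "\<lambda>t. if t then b else a" "\<lambda>t. if t then -1 else 1"] assms
  by (simp add: gap_def)

lemma gap_right_le:
  assumes "x \<in> carrier G" "a \<in> carrier G" "b \<in> carrier G"
  shows "gap (a \<otimes> x) (b \<otimes> x) \<le> gap a b"
  using right_l2_le[OF assms(1), of "{False, True}" "\<lambda>t. if t then b else a" "\<lambda>t. if t then -1 else 1"] assms
  by (simp add: gap_def)

lemma gap_left:
  assumes "x \<in> carrier G" "a \<in> carrier G" "b \<in> carrier G"
  shows "gap (x \<otimes> a) (x \<otimes> b) = gap a b"
proof (rule antisym)
  have "inv x \<otimes> (x \<otimes> a) = a" "inv x \<otimes> (x \<otimes> b) = b" using assms by (simp_all add: m_assoc[symmetric])
  then show "gap a b \<le> gap (x \<otimes> a) (x \<otimes> b)"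
    using gap_left_le[of "inv x" "x \<otimes> a" "x \<otimes> b"] assms by simp
qed (rule gap_left_le[OF assms])

lemma gap_right:
  assumes "x \<in> carrier G" "a \<in> carrier G" "b \<in> carrier G"
  shows "gap (a \<otimes> x) (b \<otimes> x) = gap a b"
proof (rule antisym)
  have "a \<otimes> x \<otimes> inv x = a" "b \<otimes> x \<otimes> inv x = b" using assms by (simp_all add: m_assoc)
  then show "gap a b \<le> gap (a \<otimes> x) (b \<otimes> x)"
    using gap_right_le[of "inv x" "a \<otimes> x" "b \<otimes> x"] assms by simp
qed (rule gap_right_le[OF assms])

text \<open>The Hilbert-Schmidt norm of right translation by \<open>b\<close> minus the identity equals the mean over \<open>y\<close> of
  the square of \<open>gap (y b) y\<close>, and this is constant in \<open>y\<close>.\<close>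

lemma second_difference_le:
  assumes a: "a \<in> carrier G" and b: "b \<in> carrier G"
  shows "l2 B (\<lambda>e. e (a \<otimes> b) - e a - e b + e \<one>) \<le> gap a \<one> * gap b \<one>"
proof -
  note D = invariant_basisD[OF B]
  define H where "H e y = e (y \<otimes> b) - e y" for e :: "'a \<Rightarrow> complex" and y
  have HB: "H e \<in> fspan B" if "e \<in> B" for e
  proof -
    have "(\<lambda>y. e (y \<otimes> b) + (-1) * e y) \<in> fspan B"
      by (intro fspan_add fspan_mult D(5) fspan_base D(2) that b)
    then show ?thesis by (simp add: H_def[abs_def])
  qed
  have HC: "H e \<in> C_G" if "e \<in> B" for e by (rule fspan_C_G[OF D(2,3) HB[OF that]])
  have "(\<Sum>e\<in>B. (cmod (H e y))^2) \<le> (gap b \<one>)^2" if y: "y \<in> carrier G" for y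
  proof -
    have "(\<Sum>e\<in>B. (cmod (H e y))^2) = (gap (y \<otimes> b) (y \<otimes> \<one>))^2"
      unfolding gap_def l2_square H_def using y by simp
    then show ?thesis unfolding gap_left[OF y b one_closed] by simp
  qed
  then have HS: "(\<Sum>e\<in>B. sq (H e)) \<le> (gap b \<one>)^2" by (rule sum_sq_le[OF D(2) HC, rotated])
  have "(cmod (e (a \<otimes> b) - e a - e b + e \<one>))^2 \<le> sq (H e) * (gap a \<one>)^2" if e: "e \<in> B" for e
  proof -
    have "e (a \<otimes> b) - e a - e b + e \<one> = H e a - H e \<one>" using b by (simp add: H_def)
    also have "\<dots> = (\<Sum>e'\<in>B. ip (H e) e' * (e' a - e' \<one>))"
      unfolding orthonormal_expand[OF D(1) HB[OF e] a] orthonormal_expand[OF D(1) HB[OF e] one_closed]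
      by (simp add: right_diff_distrib sum_subtractf)
    finally have "cmod (e (a \<otimes> b) - e a - e b + e \<one>) \<le> (\<Sum>e'\<in>B. \<bar>cmod (ip (H e) e')\<bar> * \<bar>cmod (e' a - e' \<one>)\<bar>)"
      using norm_sum[of "\<lambda>e'. ip (H e) e' * (e' a - e' \<one>)" B] by (simp add: norm_mult)
    also have "\<dots> \<le> l2 B (ip (H e)) * gap a \<one>" unfolding gap_def l2_def by (rule L2_set_mult_ineq)
    finally have "(cmod (e (a \<otimes> b) - e a - e b + e \<one>))^2 \<le> (l2 B (ip (H e)) * gap a \<one>)^2"
      by (rule power_mono) simp
    moreover have "(l2 B (ip (H e)))^2 = sq (H e)"
      unfolding l2_square sq_parseval[OF D(1) HB[OF e]] by (rule refl)
    ultimately show ?thesis by (simp add: power_mult_distrib)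
  qed
  then have "(\<Sum>e\<in>B. (cmod (e (a \<otimes> b) - e a - e b + e \<one>))^2) \<le> (\<Sum>e\<in>B. sq (H e) * (gap a \<one>)^2)"
    by (rule sum_mono)
  also have "\<dots> \<le> (gap b \<one>)^2 * (gap a \<one>)^2"
    unfolding sum_distrib_right[symmetric] by (rule mult_right_mono[OF HS]) simp
  finally have "(l2 B (\<lambda>e. e (a \<otimes> b) - e a - e b + e \<one>))^2 \<le> (gap a \<one> * gap b \<one>)^2"
    unfolding l2_square by (simp add: power_mult_distrib mult.commute)
  then show ?thesis by (rule power2_le_imp_le) (simp add: gap_nonneg)
qed

lemma gap_pow:
  assumes g: "g \<in> carrier G" "g' \<in> carrier G"
  shows "gap (g [^] (p::nat)) (g' [^] p) \<le> real p * gap g g'"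
proof (induction p)
  case 0
  show ?case by (simp add: gap_def l2_def L2_set_def)
next
  case (Suc p)
  have c: "g [^] p \<in> carrier G" "g' [^] p \<in> carrier G" using g by auto
  have "gap (g [^] Suc p) (g' [^] Suc p) \<le> gap (g [^] p \<otimes> g) (g' [^] p \<otimes> g) + gap (g' [^] p \<otimes> g) (g' [^] p \<otimes> g')"
    using gap_triangle by simp
  also have "\<dots> = gap (g [^] p) (g' [^] p) + gap g g'"
    unfolding gap_right[OF g(1) c] gap_left[OF c(2) g] by (rule refl)
  finally show ?case using Suc by (simp add: distrib_right)
qed

text \<open>Telescoping with \<open>second_difference_le\<close>: each further factor adds an error
  of at most \<open>p * (gap g \<one>)^2\<close>. Near the identity the \<open>p\<close>-th power
  thus acts like multiplication by \<open>p\<close>, up to second order.\<close>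

lemma pow_nearly_linear:
  assumes g: "g \<in> carrier G"
  shows "l2 B (\<lambda>e. e (g [^] (p::nat)) - e \<one> - of_nat p * (e g - e \<one>)) \<le> (real p * gap g \<one>)^2"
proof (induction p)
  case 0
  show ?case by (simp add: l2_def L2_set_def)
next
  case (Suc p)
  have c: "g [^] p \<in> carrier G" using g by auto
  have "l2 B (\<lambda>e. e (g [^] Suc p) - e \<one> - of_nat (Suc p) * (e g - e \<one>)) =
      l2 B (\<lambda>e. (e (g [^] p) - e \<one> - of_nat p * (e g - e \<one>)) + (e (g [^] p \<otimes> g) - e (g [^] p) - e g + e \<one>))"
    by (rule l2_cong) (simp add: algebra_simps)
  also have "\<dots> \<le> (real p * gap g \<one>)^2 + gap (g [^] p) \<one> * gap g \<one>"
    by (rule order_trans[OF l2_add add_mono[OF Suc second_difference_le[OF c g]]])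
  also have "\<dots> \<le> (real p * gap g \<one>)^2 + (real p * gap g \<one>) * gap g \<one>"
  proof -
    have "gap (g [^] p) \<one> \<le> real p * gap g \<one>" using gap_pow[OF g one_closed, of p] by simp
    then show ?thesis by (intro add_left_mono mult_right_mono gap_nonneg)
  qed
  also have "\<dots> = ((real p)^2 + real p) * (gap g \<one>)^2" by (simp add: power2_eq_square algebra_simps)
  also have "\<dots> \<le> (real (Suc p))^2 * (gap g \<one>)^2"
    by (intro mult_right_mono) (simp_all add: power2_eq_square algebra_simps)
  finally show ?case by (simp add: power_mult_distrib)
qed

lemma C_G_l2_square:
  assumes "\<And>e. e \<in> B \<Longrightarrow> F e \<in> C_G"
  shows "(\<lambda>x. of_real ((l2 B (\<lambda>e. F e x))^2)) \<in> C_G"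
  unfolding l2_square of_real_sum complex_norm_square
  by (rule C_G_sum[OF invariant_basisD(2)[OF B]]) (rule ip_integrand[OF assms assms])

end

section \<open>Small elements and the kernel of a character\<close>

lemma character_pow:
  assumes "character \<gamma>" "g \<in> carrier G"
  shows "\<gamma> (g [^] (p::nat)) = \<gamma> g ^ p"
proof (induction p)
  case 0
  show ?case using characterD(2)[OF assms(1)] by simp
next
  case (Suc p)
  then show ?case using characterD(3)[OF assms(1), of "g [^] p" g] assms(2) by (simp add: mult.commute)
qed

lemma character_inv:
  assumes \<gamma>: "character \<gamma>" and g: "g \<in> carrier G"
  shows "\<gamma> (inv g) * \<gamma> g = 1"
  using characterD(3)[OF \<gamma> inv_closed[OF g] g] characterD(2)[OF \<gamma>] g by simp

lemma character_diff:
  assumes \<gamma>: "character \<gamma>" and g: "g \<in> carrier G" and h: "h \<in> carrier G"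
  shows "cmod (\<gamma> (g \<otimes> inv h) - 1) = cmod (\<gamma> g - \<gamma> h)"
proof -
  have "(\<gamma> (g \<otimes> inv h) - 1) * \<gamma> h = \<gamma> g * (\<gamma> (inv h) * \<gamma> h) - \<gamma> h"
    using characterD(3)[OF \<gamma> g inv_closed[OF h]] by (simp add: left_diff_distrib mult.assoc)
  also have "\<dots> = \<gamma> g - \<gamma> h" unfolding character_inv[OF \<gamma> h] by simp
  finally have "cmod (\<gamma> (g \<otimes> inv h) - 1) * cmod (\<gamma> h) = cmod (\<gamma> g - \<gamma> h)" by (metis norm_mult)
  then show ?thesis using character_norm[OF \<gamma> h] by simp
qed

context
  fixes B :: "('a \<Rightarrow> complex) set" and \<gamma> :: "'a \<Rightarrow> complex"
  assumes B: "invariant_basis B" and \<gamma>: "character \<gamma>"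
begin

abbreviation len :: "'a \<Rightarrow> real" where
  "len g \<equiv> gap B g \<one>"

text \<open>Substitute for the exponential map of the Lie group \<open>ker \<gamma>\<close>: an element \<open>g\<close> close to \<open>1\<close> and
  almost in the kernel has a multiple by \<open>\<theta>\<close> in the kernel, up to a relative error \<open>e\<close>. Otherwise
  take bad elements \<open>g j \<longrightarrow> 1\<close> with almost equal directions; a power of a much smaller one of them
  approximates the required multiple of a larger one.\<close>

lemma radial_element:
  assumes e: "e > 0" and \<theta>: "0 \<le> \<theta>" "\<theta> \<le> (1::real)"
  obtains d where "d > 0" "\<forall>g\<in>carrier G. len g < d \<longrightarrow> cmod (\<gamma> g - 1) \<le> d * len g \<longrightarrow>
    (\<exists>m\<in>carrier G. \<gamma> m = 1 \<and> l2 B (\<lambda>b. b m - b \<one> - of_real \<theta> * (b g - b \<one>)) \<le> e * len g)"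
proof -
  note D = invariant_basisD[OF B]
  define good where "good g \<longleftrightarrow> (\<exists>m\<in>carrier G. \<gamma> m = 1 \<and>
    l2 B (\<lambda>b. b m - b \<one> - of_real \<theta> * (b g - b \<one>)) \<le> e * len g)" for g
  have "\<exists>d>0. \<forall>g\<in>carrier G. len g < d \<longrightarrow> cmod (\<gamma> g - 1) \<le> d * len g \<longrightarrow> good g"
  proof (rule ccontr)
    assume neg: "\<not> (\<exists>d>0. \<forall>g\<in>carrier G. len g < d \<longrightarrow> cmod (\<gamma> g - 1) \<le> d * len g \<longrightarrow> good g)"
    define \<delta> where "\<delta> j = inverse (real (Suc j))" for j
    have \<delta>: "\<delta> j > 0" "\<delta> j \<le> 1" for j by (simp_all add: \<delta>_def inverse_le_1_iff)
    have \<delta>_lim: "\<exists>N. \<forall>j\<ge>N. \<delta> j < t" if t: "t > 0" for t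
    proof -
      obtain N where N: "\<delta> N < t" using reals_Archimedean[OF t] by (auto simp: \<delta>_def)
      have "\<delta> j \<le> \<delta> N" if "j \<ge> N" for j using that unfolding \<delta>_def by (intro le_imp_inverse_le) auto
      then show ?thesis using N by (meson le_less_trans)
    qed
    have "\<exists>g. g \<in> carrier G \<and> len g < \<delta> j \<and> cmod (\<gamma> g - 1) \<le> \<delta> j * len g \<and> \<not> good g" for j
      using neg \<delta>(1)[of j] by blast
    then obtain g where g: "\<And>j. g j \<in> carrier G" "\<And>j. len (g j) < \<delta> j"
      "\<And>j. cmod (\<gamma> (g j) - 1) \<le> \<delta> j * len (g j)" "\<And>j. \<not> good (g j)" by metis
    define r where "r j = len (g j)" for j
    \<comment> \<open>For length zero the identity would witness that \<open>g j\<close> is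
      good.\<close>
    have r0: "r j > 0" for j
    proof (rule ccontr)
      assume "\<not> r j > 0"
      then have z: "len (g j) = 0" using gap_nonneg[OF B, of "g j" \<one>] by (simp add: r_def)
      have "l2 B (\<lambda>b. b \<one> - b \<one> - of_real \<theta> * (b (g j) - b \<one>)) = l2 B (\<lambda>b. (- of_real \<theta>) * (b (g j) - b \<one>))"
        by (rule l2_cong) simp
      also have "\<dots> = cmod (- of_real \<theta>) * len (g j)" unfolding l2_scale gap_def[OF B] by (rule refl)
      finally have "l2 B (\<lambda>b. b \<one> - b \<one> - of_real \<theta> * (b (g j) - b \<one>)) \<le> e * len (g j)" unfolding z by simp
      then have "good (g j)" unfolding good_def using characterD(2)[OF \<gamma>] by (intro bexI[of _ \<one>] conjI) auto
      then show False using g(4) by blast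
    qed
    define u where "u j b = (b (g j) - b \<one>) / of_real (r j)" for j and b :: "'a \<Rightarrow> complex"
    have ru: "of_real (r j) * u j b = b (g j) - b \<one>" for j b using r0[of j] by (simp add: u_def)
    have lu: "l2 B (u j) = 1" for j
    proof -
      have "r j * l2 B (u j) = l2 B (\<lambda>b. of_real (r j) * u j b)" unfolding l2_scale using r0[of j] by simp
      also have "\<dots> = len (g j)" unfolding ru gap_def[OF B] by (rule refl)
      also have "\<dots> = r j" unfolding r_def by (rule refl)
      finally show ?thesis using r0[of j] by simp
    qed
    have ub: "cmod (u j b) \<le> 1" if "b \<in> B" for j b using l2_member[OF D(2) that, of "u j"] lu[of j] by simp
    \<comment> \<open>Chosen such that \<open>card B * dd \<le> e / 4\<close>: equal codes then mean
      directions within \<open>e / 4\<close> in \<open>l2\<close>.\<close>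
    define dd where "dd = e / 4 / (card B + 1)"
    have dd: "dd > 0" using e by (simp add: dd_def)
    obtain code :: "nat \<Rightarrow> ('a \<Rightarrow> complex) \<Rightarrow> int \<times> int" where code: "finite (range code)"
      "\<forall>m n. code m = code n \<longrightarrow> (\<forall>x\<in>B. cmod (u m x - u n x) \<le> dd)"
      by (rule finite_code[OF D(2) ub dd])
    obtain j0 where j0: "infinite {j \<in> UNIV. code j = code j0}"
      using pigeonhole_infinite[OF infinite_UNIV_nat code(1)] by blast
    define J where "J = {j. code j = code j0}"
    have J: "infinite J" using j0 by (simp add: J_def)
    have J_large: "\<exists>j\<in>J. j \<ge> N" for N
      using J unfolding infinite_nat_iff_unbounded_le by blast
    have uJ: "l2 B (\<lambda>b. u j b - u i b) \<le> e / 4" if "i \<in> J" "j \<in> J" for i j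
    proof -
      have "code j = code i" using that by (simp add: J_def)
      then have "cmod (u j b - u i b) \<le> dd" if "b \<in> B" for b using code(2) that by blast
      then have "l2 B (\<lambda>b. u j b - u i b) \<le> card B * dd" by (rule l2_le_card)
      also have "\<dots> \<le> e / 4" unfolding dd_def using e by (simp add: divide_simps)
      finally show ?thesis .
    qed
    have e4: "e / 4 > 0" using e by simp
    obtain N where N: "\<forall>j\<ge>N. \<delta> j < e / 4" using \<delta>_lim[OF e4] by (elim exE)
    obtain i where i: "i \<in> J" "i \<ge> N" using J_large by blast
    \<comment> \<open>\<open>r i < e / 4\<close> makes the second-order error, at most
      \<open>(r i)^2\<close>, small relative to \<open>r i\<close>. The other bound keeps the effect
      on \<open>\<gamma>\<close> below \<open>\<delta> j\<close>.\<close>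
    have ri: "r i < e / 4" "r i \<le> 1" using N i(2) g(2)[of i] \<delta>(2)[of i] unfolding r_def by fastforce+
    define W where "W m = l2 B (\<lambda>b. b m - b \<one> - of_real \<theta> * (b (g i) - b \<one>))" for m
    have approx: "\<exists>m\<in>carrier G. cmod (\<gamma> m - 1) < t \<and> W m \<le> r i * e / 2 + t" if t: "t > 0" for t
    proof -
      obtain M where M: "\<forall>j\<ge>M. \<delta> j < t" using \<delta>_lim[OF t] by (elim exE)
      obtain j where j: "j \<in> J" "j \<ge> M" using J_large by blast
      have \<delta>j: "\<delta> j < t" using M j(2) by blast
      have rj: "r j < t" using g(2)[of j] \<delta>j unfolding r_def by linarith
      \<comment> \<open>The power for which \<open>p * r j\<close> is just below
        \<open>\<theta> * r i\<close>: then \<open>g j\<close> to the \<open>p\<close> has about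
        \<open>\<theta>\<close> times the displacement of \<open>g i\<close>, provided that the two
        directions agree.\<close>
      define p where "p = nat \<lfloor>\<theta> * r i / r j\<rfloor>"
      have q0: "\<theta> * r i / r j \<ge> 0" using \<theta> r0[of i] r0[of j] by simp
      have "real p \<le> \<theta> * r i / r j" "\<theta> * r i / r j < real p + 1"
        unfolding p_def using q0 by linarith+
      then have p: "real p * r j \<le> \<theta> * r i" "\<theta> * r i < real p * r j + r j"
        using r0[of j] by (simp_all add: pos_le_divide_eq pos_divide_less_eq distrib_right)
      have p1: "real p * r j \<le> r i" using p(1) mult_right_mono[OF \<theta>(2) less_imp_le[OF r0[of i]]] by simp
      define m where "m = g j [^] p"
      have mG: "m \<in> carrier G" using g(1) by (simp add: m_def)
      \<comment> \<open>Taking powers costs a factor \<open>p\<close> on \<open>\<gamma>\<close>,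
        but \<open>g j\<close> moves \<open>\<gamma>\<close> only by
        \<open>\<delta> j * r j\<close>, and \<open>p * r j\<close> is at most 1.\<close>
      have "cmod (\<gamma> m - 1) \<le> real p * cmod (\<gamma> (g j) - 1)"
        unfolding m_def character_pow[OF \<gamma> g(1)]
        using norm_power_diff[of "\<gamma> (g j)" 1 p] character_norm[OF \<gamma> g(1)] by simp
      also have "\<dots> \<le> real p * (\<delta> j * r j)" by (rule mult_left_mono) (use g(3) in \<open>simp_all add: r_def\<close>)
      also have "\<dots> = \<delta> j * (real p * r j)" by simp
      also have "\<dots> \<le> \<delta> j * 1" using p1 ri(2) \<delta>(1)[of j] by (intro mult_left_mono) auto
      finally have 1: "cmod (\<gamma> m - 1) < t" using \<delta>j by simp
      have A1: "l2 B (\<lambda>b. b m - b \<one> - of_nat p * (b (g j) - b \<one>)) \<le> r i * (e / 4)"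
      proof -
        have "l2 B (\<lambda>b. b m - b \<one> - of_nat p * (b (g j) - b \<one>)) \<le> (real p * r j)^2"
          unfolding m_def r_def by (rule pow_nearly_linear[OF B g(1)])
        also have "\<dots> \<le> (r i)^2" by (rule power_mono[OF p1]) (use r0[of j] in simp)
        also have "\<dots> \<le> r i * (e / 4)" unfolding power2_eq_square using ri r0[of i] by (intro mult_left_mono) auto
        finally show ?thesis .
      qed
      have A2: "l2 B (\<lambda>b. of_real (real p * r j - \<theta> * r i) * u j b) \<le> t"
        unfolding l2_scale lu norm_of_real using p rj by simp
      have A3: "l2 B (\<lambda>b. of_real (\<theta> * r i) * (u j b - u i b)) \<le> r i * (e / 4)"
      proof -
        have "l2 B (\<lambda>b. of_real (\<theta> * r i) * (u j b - u i b)) = (\<theta> * r i) * l2 B (\<lambda>b. u j b - u i b)"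
          unfolding l2_scale norm_of_real using \<theta>(1) r0[of i] by simp
        also have "\<dots> \<le> (1 * r i) * (e / 4)"
          using \<theta> r0[of i] uJ[OF i(1) j(1)] by (intro mult_mono l2_nonneg mult_right_mono) auto
        finally show ?thesis by simp
      qed
      \<comment> \<open>Three errors: nonlinearity of the power, rounding of \<open>p\<close>, and
        the difference between the directions of \<open>g j\<close> and \<open>g i\<close>.\<close>
      have "W m = l2 B (\<lambda>b. (b m - b \<one> - of_nat p * (b (g j) - b \<one>)) +
          (of_real (real p * r j - \<theta> * r i) * u j b + of_real (\<theta> * r i) * (u j b - u i b)))"
        unfolding W_def ru[symmetric] by (rule l2_cong) (simp add: algebra_simps)
      also have "\<dots> \<le> r i * (e / 4) + (t + r i * (e / 4))"
        by (rule order_trans[OF l2_add add_mono[OF A1 order_trans[OF l2_add add_mono[OF A2 A3]]]])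
      finally have "W m \<le> r i * (e / 4) + (t + r i * (e / 4))" .
      moreover have "r i * e / 2 = r i * (e / 4) + r i * (e / 4)" by simp
      ultimately have "W m \<le> r i * e / 2 + t" by linarith
      then show ?thesis using mG 1 by blast
    qed
    \<comment> \<open>Compactness makes the approximate kernel elements exact: on this closed set
      \<open>cmod (\<gamma> m - 1)\<close> has infimum 0, and the infimum is attained. Squares are
      used because \<open>(W m)^2\<close> is visibly continuous.\<close>
    define S where "S = {m \<in> carrier G. of_real ((W m)^2) \<in> {z. Re z \<le> (e * r i)^2}}"
    have WC: "(\<lambda>m. of_real ((W m)^2)) \<in> C_G"
      unfolding W_def by (rule C_G_l2_square[OF B]) (intro C_G_diff C_G_const, use D(3) in blast)
    have clS: "closedin T S" unfolding S_def
      by (rule closedin_C_G_preimage[OF WC]) (rule closed_halfspace_Re_le)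
    have er: "e * r i > 0" using e r0[of i] by simp
    have SI: "m \<in> S" if "m \<in> carrier G" "W m \<le> e * r i" for m
      using that power_mono[OF that(2), of 2] l2_nonneg[of B] by (simp add: S_def W_def)
    have SD: "m \<in> carrier G" "W m \<le> e * r i" if "m \<in> S" for m
      using that er power2_le_imp_le[of "W m" "e * r i"] by (auto simp: S_def)
    have inS: "\<exists>m\<in>S. cmod (\<gamma> m - 1) < t" if t: "t > 0" for t
    proof -
      define t' where "t' = min t (e * r i / 2)"
      have t': "t' > 0" using t er by (simp add: t'_def)
      obtain m where m: "m \<in> carrier G" "cmod (\<gamma> m - 1) < t'" "W m \<le> r i * e / 2 + t'"
        using approx[OF t'] by blast
      have "W m \<le> e * r i" using m(3) unfolding t'_def by (simp add: mult.commute min_def split: if_splits)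
      then show ?thesis using SI[OF m(1)] m(2) unfolding t'_def by (intro bexI[of _ m]) auto
    qed
    have ne: "S \<noteq> {}" using inS[of 1] by auto
    have \<gamma>C: "(\<lambda>m. (\<gamma> m - 1) * cnj (\<gamma> m - 1)) \<in> C_G"
      by (intro ip_integrand C_G_diff characterD(1)[OF \<gamma>] C_G_const)
    have Re: "Re ((\<gamma> m - 1) * cnj (\<gamma> m - 1)) = (cmod (\<gamma> m - 1))^2" for m
      unfolding complex_norm_square[symmetric] by simp
    obtain m where m: "m \<in> S" "\<forall>x\<in>S. Re ((\<gamma> m - 1) * cnj (\<gamma> m - 1)) \<le> Re ((\<gamma> x - 1) * cnj (\<gamma> x - 1))"
      by (rule attains_min[OF \<gamma>C clS ne])
    have "\<gamma> m = 1"
    proof (rule ccontr)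
      assume "\<gamma> m \<noteq> 1"
      then have "cmod (\<gamma> m - 1) > 0" by simp
      then obtain x where x: "x \<in> S" "cmod (\<gamma> x - 1) < cmod (\<gamma> m - 1)" using inS by blast
      have "(cmod (\<gamma> m - 1))^2 \<le> (cmod (\<gamma> x - 1))^2" using m(2) x(1) unfolding Re by blast
      then have "cmod (\<gamma> m - 1) \<le> cmod (\<gamma> x - 1)" by (rule power2_le_imp_le) simp
      then show False using x(2) by simp
    qed
    then have "good (g i)" using SD[OF m(1)] unfolding good_def W_def r_def by blast
    then show False using g(4) by blast
  qed
  then show ?thesis using that unfolding good_def by blast
qed

text \<open>Pigeonhole: among infinitely many elements with distinct values of
  \<open>\<gamma>\<close>, two have almost the same value vector. Their quotient is short by
  invariance of \<open>gap\<close>, and \<open>\<gamma>\<close> is near 1 but not 1 on it.\<close>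

lemma small_noncentral_element:
  assumes inf: "infinite (\<gamma> ` carrier G)" and d: "d > 0"
  obtains g where "g \<in> carrier G" "\<gamma> g \<noteq> 1" "cmod (\<gamma> g - 1) < d" "len g < d"
proof -
  note D = invariant_basisD[OF B]
  obtain y :: "nat \<Rightarrow> complex" where y: "inj y" "range y \<subseteq> \<gamma> ` carrier G"
    using infinite_countable_subset[OF inf] by blast
  have "\<exists>x. x \<in> carrier G \<and> \<gamma> x = y n" for n using y(2) by (metis imageE rangeI subsetD)
  then obtain x where x: "\<And>n. x n \<in> carrier G" "\<And>n. \<gamma> (x n) = y n" by metis
  \<comment> \<open>\<open>SOME\<close> picks a bound for each of the finitely many functions; the
    maximum serves all of them.\<close>
  define c where "c = Max (insert 1 ((\<lambda>f. SOME b. \<forall>x\<in>carrier G. cmod (f x) \<le> b) ` insert \<gamma> B))"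
  have X: "finite (insert \<gamma> B)" using D(2) by simp
  have bound: "cmod (f (x n)) \<le> c" if f: "f \<in> insert \<gamma> B" for f n
  proof -
    have "f \<in> C_G" using f D(3) characterD(1)[OF \<gamma>] by blast
    then obtain b where "\<And>x. x \<in> carrier G \<Longrightarrow> cmod (f x) \<le> b" using C_G_bounded by blast
    then have "\<exists>b. \<forall>x\<in>carrier G. cmod (f x) \<le> b" by blast
    then have "\<forall>x\<in>carrier G. cmod (f x) \<le> (SOME b. \<forall>x\<in>carrier G. cmod (f x) \<le> b)" by (rule someI_ex)
    moreover have "(SOME b. \<forall>x\<in>carrier G. cmod (f x) \<le> b) \<le> c"
      unfolding c_def using X f by (intro Max_ge) auto
    ultimately show ?thesis using x(1)[of n] by (meson order_trans)
  qed
  define t where "t = d / (2 * (card B + 1))"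
  have t: "t > 0" using d by (simp add: t_def)
  obtain code :: "nat \<Rightarrow> ('a \<Rightarrow> complex) \<Rightarrow> int \<times> int" where code: "finite (range code)"
    "\<forall>m n. code m = code n \<longrightarrow> (\<forall>f\<in>insert \<gamma> B. cmod (f (x m) - f (x n)) \<le> t)"
    by (rule finite_code[OF X bound t])
  have "\<not> inj code" using finite_imageD[OF code(1)] infinite_UNIV_nat by blast
  then obtain m n where mn: "m \<noteq> n" "code m = code n" unfolding inj_def by blast
  then have near: "\<forall>f\<in>insert \<gamma> B. cmod (f (x m) - f (x n)) \<le> t" using code(2) by blast
  define g where "g = x m \<otimes> inv (x n)"
  have g: "g \<in> carrier G" using x(1) by (simp add: g_def)
  have eq: "cmod (\<gamma> g - 1) = cmod (\<gamma> (x m) - \<gamma> (x n))" unfolding g_def by (rule character_diff[OF \<gamma> x(1) x(1)])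
  have "\<gamma> (x m) \<noteq> \<gamma> (x n)" unfolding x(2) using y(1) mn(1) by (simp add: inj_eq)
  then have "\<gamma> g \<noteq> 1" using eq by auto
  moreover have td: "t < d" unfolding t_def using d by (simp add: divide_less_eq)
  then have "cmod (\<gamma> g - 1) < d" unfolding eq using near by fastforce
  moreover have "len g < d"
  proof -
    have "g \<otimes> x n = x m" using x(1) by (simp add: g_def m_assoc)
    then have "len g = gap B (x m) (x n)" using gap_right[OF B x(1) g one_closed, of n] x(1) by simp
    also have "\<dots> \<le> card B * t" unfolding gap_def[OF B] by (rule l2_le_card) (use near in blast)
    also have "\<dots> < d" unfolding t_def using d by (simp add: divide_simps)
    finally show ?thesis .
  qed
  ultimately show ?thesis using that[OF g] by blast
qed

end

context
  fixes B :: "('a \<Rightarrow> complex) set" and \<gamma> :: "'a \<Rightarrow> complex"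
  assumes B: "invariant_basis B" and \<gamma>: "character \<gamma>"
begin

abbreviation len' :: "'a \<Rightarrow> real" where
  "len' g \<equiv> gap B g \<one>"

text \<open>An element \<open>h\<close> of a coset of \<open>ker \<gamma>\<close> of minimal length is almost central: its conjugates lie in the
  same coset and have the same length, and by the parallelogram law the approximate midpoint of \<open>h\<close> and a
  conjugate far from \<open>h\<close> would be shorter. Moreover the length of \<open>h\<close> is at most a constant times
  \<open>cmod (\<gamma> h - 1)\<close>, so a power of \<open>h\<close> which moves \<open>\<gamma>\<close> by a definite amount is still almost central.\<close>

lemma almost_central_element:
  assumes inf: "infinite (\<gamma> ` carrier G)" and s: "0 < s" "s \<le> 1/4" and \<eta>: "\<eta> > 0"
  obtains h where "h \<in> carrier G" "s / 2 \<le> cmod (\<gamma> h - 1)" "cmod (\<gamma> h - 1) \<le> 2 * s"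
    "\<forall>x\<in>carrier G. gap B (x \<otimes> h) (h \<otimes> x) \<le> \<eta>"
proof -
  note D = invariant_basisD[OF B]
  have half: "0 < (1/2::real)" "0 \<le> (1/2::real)" "1/2 \<le> (1::real)" and one: "0 \<le> (1::real)" "1 \<le> (1::real)" by simp_all
  \<comment> \<open>With \<theta> = 1: an element that is short and moves \<open>\<gamma>\<close>
    little compared with its length lies within half its length of the kernel, and so can be
    shortened inside its coset.\<close>
  obtain d1 where d1: "d1 > 0" "\<forall>g\<in>carrier G. len' g < d1 \<longrightarrow> cmod (\<gamma> g - 1) \<le> d1 * len' g \<longrightarrow>
    (\<exists>m\<in>carrier G. \<gamma> m = 1 \<and> l2 B (\<lambda>b. b m - b \<one> - of_real 1 * (b g - b \<one>)) \<le> 1/2 * len' g)"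
    by (rule radial_element[OF B \<gamma> half(1) one])
  \<comment> \<open>The final estimate is \<open>8 * \<epsilon> * (s / d1)\<close> with
    \<open>s \<le> 1/4\<close>, hence the bound \<open>\<eta> * d1 / 2\<close>. The bound
    \<open>1/2\<close> keeps \<open>r - \<epsilon> * q\<close> nonnegative before squaring.\<close>
  define \<epsilon> where "\<epsilon> = min (1/2) (\<eta> * d1 / 2)"
  have \<epsilon>: "\<epsilon> > 0" "\<epsilon> \<le> 1/2" "\<epsilon> \<le> \<eta> * d1 / 2" using \<eta> d1(1) by (auto simp: \<epsilon>_def)
  \<comment> \<open>With \<theta> = 1/2: approximate midpoints between the identity and a short
    kernel element.\<close>
  obtain d2 where d2: "d2 > 0" "\<forall>g\<in>carrier G. len' g < d2 \<longrightarrow> cmod (\<gamma> g - 1) \<le> d2 * len' g \<longrightarrow>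
    (\<exists>m\<in>carrier G. \<gamma> m = 1 \<and> l2 B (\<lambda>b. b m - b \<one> - of_real (1/2) * (b g - b \<one>)) \<le> \<epsilon> * len' g)"
    by (rule radial_element[OF B \<gamma> \<epsilon>(1) half(2,3)])
  \<comment> \<open>\<open>s / 4\<close> keeps the step \<open>t\<close> of the later power small
    compared with \<open>s\<close>; half of \<open>d2\<close> appears because the commutator
    \<open>k\<close> below may be twice as long as \<open>h\<close>.\<close>
  have "min (s / 4) (min d1 (d2 / 2)) > 0" using s d1(1) d2(1) by simp
  then obtain g where g: "g \<in> carrier G" "\<gamma> g \<noteq> 1" "cmod (\<gamma> g - 1) < min (s / 4) (min d1 (d2 / 2))"
    "len' g < min (s / 4) (min d1 (d2 / 2))"
    by (rule small_noncentral_element[OF B \<gamma> inf])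
  have conjg: "\<gamma> (a \<otimes> b) = \<gamma> a * \<gamma> b" if "a \<in> carrier G" "b \<in> carrier G" for a b
    by (rule characterD(3)[OF \<gamma> that])
  define S where "S = {x \<in> carrier G. \<gamma> x \<in> {\<gamma> g}}"
  have clS: "closedin T S" unfolding S_def by (rule closedin_C_G_preimage[OF characterD(1)[OF \<gamma>]]) simp
  have neS: "S \<noteq> {}" using g(1) by (auto simp: S_def)
  have lC: "(\<lambda>x. of_real ((l2 B (\<lambda>b. b x - b \<one>))^2)) \<in> C_G"
    by (rule C_G_l2_square[OF B]) (intro C_G_diff C_G_const, use D(3) in blast)
  obtain h where h: "h \<in> S" "\<forall>x\<in>S. Re (of_real ((l2 B (\<lambda>b. b h - b \<one>))^2)) \<le> Re (of_real ((l2 B (\<lambda>b. b x - b \<one>))^2))"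
    by (rule attains_min[OF lC clS neS])
  have hG: "h \<in> carrier G" and \<gamma>h: "\<gamma> h = \<gamma> g" using h(1) by (auto simp: S_def)
  have minimal: "len' h \<le> len' x" if "x \<in> carrier G" "\<gamma> x = \<gamma> g" for x
  proof -
    have "x \<in> S" using that by (simp add: S_def)
    then have "(len' h)^2 \<le> (len' x)^2" using h(2) unfolding gap_def[OF B] by simp
    then show ?thesis by (rule power2_le_imp_le) (rule gap_nonneg[OF B])
  qed
  define r where "r = len' h"
  define t where "t = cmod (\<gamma> h - 1)"
  have r: "0 \<le> r" "r < d1" "r < d2 / 2"
    using minimal[OF g(1) refl] g(4) gap_nonneg[OF B, of h \<one>] unfolding r_def by auto
  have t: "0 < t" "t \<le> s / 4" using g(2,3) unfolding t_def \<gamma>h by auto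
  \<comment> \<open>Otherwise some kernel element \<open>m\<close> is within \<open>r / 2\<close> of
    \<open>h\<close>, and \<open>h \<otimes> inv m\<close> would be a shorter element of the
    coset.\<close>
  have rt: "d1 * r \<le> t"
  proof (rule ccontr)
    assume "\<not> d1 * r \<le> t"
    then have lt: "t < d1 * r" by simp
    then have a: "cmod (\<gamma> h - 1) \<le> d1 * len' h" unfolding t_def r_def by simp
    have rpos: "r > 0"
    proof (rule ccontr)
      assume "\<not> r > 0"
      then have "r = 0" using r(1) by simp
      then show False using lt t(1) by simp
    qed
    obtain m where m: "m \<in> carrier G" "\<gamma> m = 1" "l2 B (\<lambda>b. b m - b \<one> - of_real 1 * (b h - b \<one>)) \<le> 1/2 * len' h"
      using d1(2)[rule_format, OF hG r(2)[unfolded r_def] a] by (elim bexE conjE)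
    have "gap B m h \<le> 1/2 * r" using m(3) unfolding gap_def[OF B] r_def by simp
    have c: "h \<otimes> inv m \<in> carrier G" using hG m(1) by simp
    have "\<gamma> (inv m) = 1" using character_inv[OF \<gamma> m(1)] m(2) by simp
    then have "\<gamma> (h \<otimes> inv m) = \<gamma> g" using conjg[OF hG inv_closed[OF m(1)]] \<gamma>h by simp
    then have "r \<le> len' (h \<otimes> inv m)" unfolding r_def by (rule minimal[OF c])
    also have "\<dots> = gap B (h \<otimes> inv m \<otimes> m) (\<one> \<otimes> m)" by (rule gap_right[OF B m(1) c one_closed, symmetric])
    also have "\<dots> = gap B m h" using hG m(1) by (simp add: m_assoc gap_commute[OF B])
    finally show False using \<open>gap B m h \<le> 1/2 * r\<close> rpos by simp
  qed
  have comm: "gap B (x \<otimes> h \<otimes> inv x) h \<le> 8 * \<epsilon> * r" if x: "x \<in> carrier G" for x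
  proof -
    define c where "c = x \<otimes> h \<otimes> inv x"
    \<comment> \<open>The commutator of \<open>h\<close> and \<open>x\<close> up to order of
      factors. It lies in the kernel and its length is the distance \<open>q\<close> from
      \<open>h\<close> to the conjugate \<open>c\<close>.\<close>
    define k where "k = inv h \<otimes> c"
    have cG: "c \<in> carrier G" and kG: "k \<in> carrier G" using x hG by (auto simp: c_def k_def)
    have hk: "h \<otimes> k = c" using hG cG by (simp add: k_def m_assoc[symmetric])
    have "\<gamma> c = \<gamma> h * (\<gamma> (inv x) * \<gamma> x)"
      unfolding c_def using conjg x hG by simp
    then have \<gamma>c: "\<gamma> c = \<gamma> h" unfolding character_inv[OF \<gamma> x] by simp
    have "\<gamma> k = \<gamma> (inv h) * \<gamma> h" unfolding k_def \<gamma>c[symmetric] by (rule conjg) (use hG cG in simp_all)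
    then have \<gamma>k: "\<gamma> k = 1" unfolding character_inv[OF \<gamma> hG] .
    define q where "q = gap B c h"
    have q: "len' k = q"
      using gap_left[OF B hG kG one_closed] hG unfolding hk q_def by simp
    have lc: "len' c = r"
    proof -
      have "len' c = gap B (x \<otimes> h \<otimes> inv x) (x \<otimes> inv x)" using x by (simp add: c_def)
      also have "\<dots> = gap B (x \<otimes> h) x" by (rule gap_right[OF B]) (use x hG in simp_all)
      also have "\<dots> = gap B (x \<otimes> h) (x \<otimes> \<one>)" using x by simp
      also have "\<dots> = len' h" by (rule gap_left[OF B x hG one_closed])
      finally show ?thesis by (simp add: r_def)
    qed
    have q2: "0 \<le> q" "q \<le> 2 * r"
      using gap_triangle[OF B, of c h \<one>] gap_nonneg[OF B, of c h] lc gap_commute[OF B, of \<one> h]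
      unfolding q_def r_def by simp_all
    have kd: "len' k < d2" using q q2 r(3) by simp
    have kk: "cmod (\<gamma> k - 1) \<le> d2 * len' k" using \<gamma>k q q2(1) d2(1) by simp
    obtain m where m: "m \<in> carrier G" "\<gamma> m = 1"
      "l2 B (\<lambda>b. b m - b \<one> - of_real (1/2) * (b k - b \<one>)) \<le> \<epsilon> * len' k"
      using d2(2)[rule_format, OF kG kd kk] by (elim bexE conjE)
    have hm: "h \<otimes> m \<in> carrier G" "\<gamma> (h \<otimes> m) = \<gamma> g" using hG m(1,2) conjg[OF hG m(1)] \<gamma>h by simp_all
    have mid: "l2 B (\<lambda>b. b (h \<otimes> m) - b h / 2 - b c / 2) \<le> \<epsilon> * q"
    proof -
      \<comment> \<open>Three points with weights 1, -1/2, -1/2: left multiplication by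
        \<open>h\<close> carries the approximate midpoint \<open>m\<close> of the identity and
        \<open>k\<close> to an approximate midpoint of \<open>h\<close> and \<open>c\<close>, with
        no larger error.\<close>
      define p where "p i = (if i = (0::nat) then m else if i = 1 then \<one> else k)" for i
      define w where "w i = (if i = (0::nat) then 1 else - 1 / 2 :: complex)" for i
      have "l2 B (\<lambda>b. \<Sum>i\<in>{0,1,2}. w i * b (h \<otimes> p i)) \<le> l2 B (\<lambda>b. \<Sum>i\<in>{0,1,2}. w i * b (p i))"
        by (rule left_l2_le[OF B hG]) (use m(1) kG in \<open>auto simp: p_def\<close>)
      also have "\<dots> = l2 B (\<lambda>b. b m - b \<one> - of_real (1/2) * (b k - b \<one>))"
        by (rule l2_cong) (simp add: w_def p_def field_simps)
      also have "\<dots> \<le> \<epsilon> * q" using m(3) unfolding q .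
      also have "l2 B (\<lambda>b. \<Sum>i\<in>{0,1,2}. w i * b (h \<otimes> p i)) = l2 B (\<lambda>b. b (h \<otimes> m) - b h / 2 - b c / 2)"
        by (rule l2_cong) (simp add: w_def p_def hk hG)
      finally show ?thesis .
    qed
    define M where "M = l2 B (\<lambda>b. ((b h - b \<one>) + (b c - b \<one>)) / 2)"
    have dif: "l2 B (\<lambda>b. (b h - b \<one>) - (b c - b \<one>)) = q"
      unfolding q_def gap_commute[OF B, of c h] unfolding gap_def[OF B] by (rule l2_cong) simp
    have lh: "l2 B (\<lambda>b. b h - b \<one>) = r" unfolding r_def gap_def[OF B] by (rule refl)
    have lc': "l2 B (\<lambda>b. b c - b \<one>) = r" using lc unfolding gap_def[OF B] .
    have M2: "M^2 = r^2 / 2 + r^2 / 2 - q^2 / 4" unfolding M_def l2_midpoint lh lc' dif by (rule refl)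
    have MM: "M * M = r * r - q * q / 4" using M2 by (simp add: power2_eq_square)
    have "r \<le> len' (h \<otimes> m)" unfolding r_def by (rule minimal[OF hm])
    also have "\<dots> = l2 B (\<lambda>b. (b (h \<otimes> m) - b h / 2 - b c / 2) + ((b h - b \<one>) + (b c - b \<one>)) / 2)"
      unfolding gap_def[OF B] by (rule l2_cong) (simp add: field_simps)
    also have "\<dots> \<le> \<epsilon> * q + M" unfolding M_def by (rule order_trans[OF l2_add add_right_mono[OF mid]])
    finally have "r - \<epsilon> * q \<le> M" by simp
    moreover have "\<epsilon> * q \<le> 1/2 * (2 * r)" using \<epsilon> q2 by (intro mult_mono) auto
    then have "0 \<le> r - \<epsilon> * q" by simp
    ultimately have "(r - \<epsilon> * q)^2 \<le> M^2" by (rule power_mono)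
    moreover have "(r - \<epsilon> * q)^2 = r * r - 2 * (r * (\<epsilon> * q)) + (\<epsilon> * q) * (\<epsilon> * q)"
      by (simp add: power2_eq_square algebra_simps)
    moreover have "0 \<le> (\<epsilon> * q) * (\<epsilon> * q)" by (rule zero_le_square)
    \<comment> \<open>Minimality gives \<open>r - \<epsilon> * q \<le> M\<close>, while
      \<open>M * M\<close> is \<open>r * r - q * q / 4\<close>. On squaring, \<open>r * r\<close>
      cancels.\<close>
    ultimately have "q * q \<le> 8 * (r * (\<epsilon> * q))" unfolding power2_eq_square MM by linarith
    also have "\<dots> = q * (8 * \<epsilon> * r)" by (simp only: mult_ac)
    finally have qq: "q * q \<le> q * (8 * \<epsilon> * r)" .
    have "q \<le> 8 * \<epsilon> * r"
    proof (cases "q = 0")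
      case True
      then show ?thesis using \<epsilon>(1) r(1) by simp
    next
      case False
      then have "q > 0" using q2(1) by simp
      then show ?thesis by (rule mult_left_le_imp_le[OF qq])
    qed
    then show ?thesis unfolding q_def c_def .
  qed
  \<comment> \<open>\<open>p * t\<close> lies between \<open>s - t\<close>, at least
    \<open>3 * s / 4\<close>, and \<open>s\<close>; the second-order error is at most
    \<open>s^2\<close>, hence at most \<open>s / 4\<close>. So this power moves
    \<open>\<gamma>\<close> by at least \<open>s / 2\<close> and at most
    \<open>5 * s / 4\<close>.\<close>
  define p where "p = nat \<lfloor>s / t\<rfloor>"
  have "s / t \<ge> 0" using s t by simp
  then have "real p \<le> s / t" "s / t < real p + 1" unfolding p_def by linarith+
  then have p: "real p * t \<le> s" "s < real p * t + t"
    using t(1) by (simp_all add: pos_le_divide_eq pos_divide_less_eq distrib_right)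
  have hpG: "h [^] p \<in> carrier G" using hG by simp
  have lin: "cmod (\<gamma> h ^ p - 1 - of_nat p * (\<gamma> h - 1)) \<le> s / 4"
  proof -
    have "cmod (\<gamma> h ^ p - 1 - of_nat p * (\<gamma> h - 1)) \<le> (real p)^2 * t^2"
      unfolding t_def by (rule power_minus_linear_le[OF character_norm[OF \<gamma> hG]])
    also have "\<dots> = (real p * t) * (real p * t)" by (simp add: power2_eq_square)
    also have "\<dots> \<le> s * (1/4)" using p(1) s t by (intro mult_mono) auto
    finally show ?thesis by simp
  qed
  have pt: "cmod (of_nat p * (\<gamma> h - 1)) = real p * t" by (simp add: norm_mult t_def)
  show ?thesis
  proof (rule that[OF hpG])
    show "s / 2 \<le> cmod (\<gamma> (h [^] p) - 1)"
      using lin pt p t norm_triangle_ineq4[of "\<gamma> h ^ p - 1" "\<gamma> h ^ p - 1 - of_nat p * (\<gamma> h - 1)"]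
      unfolding character_pow[OF \<gamma> hG] by simp
    show "cmod (\<gamma> (h [^] p) - 1) \<le> 2 * s"
      using lin pt p s norm_triangle_ineq[of "\<gamma> h ^ p - 1 - of_nat p * (\<gamma> h - 1)" "of_nat p * (\<gamma> h - 1)"]
      unfolding character_pow[OF \<gamma> hG] by simp
    show "\<forall>x\<in>carrier G. gap B (x \<otimes> h [^] p) (h [^] p \<otimes> x) \<le> \<eta>"
    proof
      fix x assume x: "x \<in> carrier G"
      define c where "c = x \<otimes> h \<otimes> inv x"
      have cG: "c \<in> carrier G" using x hG by (simp add: c_def)
      have "c [^] n \<otimes> x = x \<otimes> h [^] n" for n :: nat
      proof (induction n)
        case (Suc n)
        have "c [^] Suc n \<otimes> x = c [^] n \<otimes> (c \<otimes> x)" using cG x by (simp add: m_assoc)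
        also have "c \<otimes> x = x \<otimes> h" using x hG by (simp add: c_def m_assoc)
        also have "c [^] n \<otimes> (x \<otimes> h) = (c [^] n \<otimes> x) \<otimes> h" using cG x hG by (simp add: m_assoc)
        finally show ?case unfolding Suc using x hG by (simp add: m_assoc)
      qed (use x in simp)
      then have "gap B (x \<otimes> h [^] p) (h [^] p \<otimes> x) = gap B (c [^] p \<otimes> x) (h [^] p \<otimes> x)" by simp
      also have "\<dots> = gap B (c [^] p) (h [^] p)" by (rule gap_right[OF B x]) (use cG hG in simp_all)
      also have "\<dots> \<le> real p * gap B c h" by (rule gap_pow[OF B cG hG])
      also have "\<dots> \<le> real p * (8 * \<epsilon> * r)" unfolding c_def by (rule mult_left_mono[OF comm[OF x]]) simp
      also have "\<dots> = 8 * \<epsilon> * (real p * r)" by simp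
      also have "\<dots> \<le> 8 * \<epsilon> * (s / d1)"
      proof (rule mult_left_mono)
        have "real p * (d1 * r) \<le> real p * t" by (rule mult_left_mono[OF rt]) simp
        then have "real p * r * d1 \<le> s" using p(1) by (simp add: mult_ac)
        then show "real p * r \<le> s / d1" using d1(1) by (simp add: pos_le_divide_eq)
      qed (use \<epsilon>(1) in simp)
      also have "\<dots> \<le> 8 * (\<eta> * d1 / 2) * ((1/4) / d1)"
        using \<epsilon> s d1(1) \<eta> by (intro mult_mono divide_right_mono) auto
      also have "\<dots> = \<eta>" using d1(1) by simp
      finally show "gap B (x \<otimes> h [^] p) (h [^] p \<otimes> x) \<le> \<eta>" .
    qed
  qed
qed

end

section \<open>Characters of infinite order on the centre\<close>

lemma separating_function:
  assumes S: "closedin T S" and a: "a \<in> carrier G" "a \<notin> S"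
  obtains f where "f \<in> C_G" "f a = 0" "\<forall>x\<in>S. f x = 1"
proof -
  have n: "normal_space T" using compact_Hausdorff_or_regular_imp_normal_space compact hausdorff by blast
  have c: "closedin T {a}" using closedin_Hausdorff_singleton[OF hausdorff] a(1) topspace_eq_carrier by simp
  obtain f where f: "continuous_map T euclideanreal f" "f ` {a} \<subseteq> {0}" "f ` S \<subseteq> {1}"
    by (rule Urysohn_lemma_alt[OF n c S, of 0 1]) (use a(2) in \<open>auto simp: disjnt_def\<close>)
  have "continuous_map euclideanreal euclidean complex_of_real"
    by (auto intro!: continuous_intros)
  from continuous_map_compose[OF f(1) this] have "(\<lambda>x. complex_of_real (f x)) \<in> C_G"
    by (simp add: C_G_def o_def)
  then show ?thesis by (rule that) (use f(2,3) in auto)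
qed

text \<open>A finite sum of bi-invariant spaces is bi-invariant; Gram-Schmidt absorbs overlaps of
  the blocks.\<close>

lemma block_functions_common_basis:
  assumes S: "finite S" "S \<subseteq> block_functions A"
  obtains B where "invariant_basis B" "S \<subseteq> fspan B"
proof -
  have "\<exists>B. invariant_basis B \<and> b \<in> B" if "b \<in> S" for b
    using S(2) that unfolding block_functions_def block_def by blast
  then obtain C where C: "\<And>b. b \<in> S \<Longrightarrow> invariant_basis (C b) \<and> b \<in> C b" by metis
  define U where "U = (\<Union>b\<in>S. C b)"
  have U: "finite U" "U \<subseteq> C_G" unfolding U_def using S(1) C invariant_basisD(2,3) by blast+
  obtain B where B: "orthonormal B" "fspan B = fspan U" using gram_schmidt[OF U] by blast
  have UB: "U \<subseteq> fspan B" unfolding B(2) using fspan_base[OF U(1)] by blast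
  have tr: "(\<lambda>x. u (a \<otimes> x)) \<in> fspan U" "(\<lambda>x. u (x \<otimes> a)) \<in> fspan U" if u: "u \<in> U" and a: "a \<in> carrier G" for u a
  proof -
    obtain b where b: "b \<in> S" "u \<in> C b" using u unfolding U_def by blast
    have "fspan (C b) \<subseteq> fspan U" by (rule fspan_mono[OF U(1)]) (use b(1) in \<open>auto simp: U_def\<close>)
    then show "(\<lambda>x. u (a \<otimes> x)) \<in> fspan U" "(\<lambda>x. u (x \<otimes> a)) \<in> fspan U"
      using invariant_basisD(4,5)[OF _ b(2) a] C[OF b(1)] by blast+
  qed
  have trB: "(\<lambda>x. e (a \<otimes> x)) \<in> fspan B \<and> (\<lambda>x. e (x \<otimes> a)) \<in> fspan B" if e: "e \<in> B" and a: "a \<in> carrier G" for e a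
  proof -
    have "e \<in> fspan U" using fspan_base[OF orthonormalD(1)[OF B(1)] e] B(2) by simp
    then obtain c where c: "\<And>x. x \<in> carrier G \<Longrightarrow> e x = (\<Sum>u\<in>U. c u * u x)" by (elim fspanE) blast
    have L: "(\<lambda>x. \<Sum>u\<in>U. c u * u (a \<otimes> x)) \<in> fspan U"
      by (intro fspan_sum[OF U(1)] fspan_mult, erule tr(1)[OF _ a])
    have R: "(\<lambda>x. \<Sum>u\<in>U. c u * u (x \<otimes> a)) \<in> fspan U"
      by (intro fspan_sum[OF U(1)] fspan_mult, erule tr(2)[OF _ a])
    show ?thesis unfolding B(2)
      by (intro conjI; rule fspan_cong[OF L] fspan_cong[OF R]; simp add: c a)
  qed
  have "invariant_basis B" unfolding invariant_basis_def using B(1) trB by blast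
  then show ?thesis by (rule that[OF _ subset_trans[OF _ UB]]) (use C in \<open>auto simp: U_def\<close>)
qed

text \<open>Among the powers with exponents 0 to \<open>N\<close>, where \<open>N\<close> is the
  size of the image, two coincide. Their difference divides \<open>fact N\<close>, which gives one
  exponent for all \<open>x\<close>.\<close>

lemma finite_image_torsion:
  assumes \<gamma>: "character \<gamma>" and fin: "finite (\<gamma> ` carrier G)"
  shows "torsion_character \<gamma>"
proof -
  define N where "N = card (\<gamma> ` carrier G)"
  have "\<gamma> x ^ fact N = 1" if x: "x \<in> carrier G" for x
  proof -
    have "(\<lambda>k. \<gamma> x ^ k) ` {0..N} \<subseteq> \<gamma> ` carrier G"
    proof
      fix y assume "y \<in> (\<lambda>k. \<gamma> x ^ k) ` {0..N}"
      then obtain k where "y = \<gamma> x ^ k" by blast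
      then have "y = \<gamma> (x [^] k)" using character_pow[OF \<gamma> x] by simp
      then show "y \<in> \<gamma> ` carrier G" using x by simp
    qed
    from card_mono[OF fin this] have "\<not> inj_on (\<lambda>k. \<gamma> x ^ k) {0..N}"
      using card_image[of "\<lambda>k. \<gamma> x ^ k" "{0..N}"] unfolding N_def by fastforce
    then obtain i j where "i \<in> {0..N}" "j \<in> {0..N}" "i \<noteq> j" "\<gamma> x ^ i = \<gamma> x ^ j" unfolding inj_on_def by blast
    then obtain i j where ij: "i < j" "j \<le> N" "\<gamma> x ^ i = \<gamma> x ^ j"
      by (cases "i < j") (auto simp: not_less le_less)
    have "\<gamma> x ^ i * \<gamma> x ^ (j - i) = \<gamma> x ^ (i + (j - i))" by (rule power_add[symmetric])
    also have "i + (j - i) = j" using ij(1) by simp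
    also have "\<gamma> x ^ j = \<gamma> x ^ i * 1" using ij(3) by simp
    finally have "\<gamma> x ^ i * \<gamma> x ^ (j - i) = \<gamma> x ^ i * 1" .
    moreover have "\<gamma> x \<noteq> 0" using character_norm[OF \<gamma> x] by auto
    ultimately have one: "\<gamma> x ^ (j - i) = 1" by simp
    have "(j - i) dvd fact N" using ij by (intro dvd_fact) auto
    then obtain q where "fact N = (j - i) * q" by (elim dvdE)
    then show ?thesis using one by (simp add: power_mult)
  qed
  then show ?thesis unfolding torsion_character_def by (intro exI[of _ "fact N"]) simp
qed

text \<open>Density of the blocks reduces finitely many functions to one common basis. The tolerance
  \<open>\<eta>\<close> is scaled by \<open>K\<close>, the sum of the moduli of all
  coefficients.\<close>

lemma almost_central_for_functions:
  assumes \<gamma>: "character \<gamma>" and inf: "infinite (\<gamma> ` carrier G)" and s: "0 < s" "s \<le> 1/4"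
    and F: "finite F" "F \<subseteq> C_G" and e: "e > 0"
  obtains h where "h \<in> carrier G" "s / 2 \<le> cmod (\<gamma> h - 1)" "cmod (\<gamma> h - 1) \<le> 2 * s"
    "\<forall>f\<in>F. \<forall>x\<in>carrier G. cmod (f (x \<otimes> h) - f (h \<otimes> x)) \<le> e"
proof -
  have e3: "e / 3 > 0" using e by simp
  define near where "near f S \<longleftrightarrow> (\<exists>g\<in>fspan S. \<forall>x\<in>carrier G. cmod (f x - g x) \<le> e / 3)" for f S
  have "\<exists>S. finite S \<and> S \<subseteq> block_functions C_G \<and> near f S" if f: "f \<in> F" for f
  proof -
    have "f \<in> C_G" using f F(2) by blast
    then obtain g where g: "g \<in> block_span C_G" "\<forall>x\<in>carrier G. cmod (f x - g x) \<le> e / 3"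
      by (rule block_span_dense[OF translation_space_C_G _ e3])
    obtain S where S: "finite S" "S \<subseteq> block_functions C_G" "g \<in> fspan S" by (rule block_spanE[OF g(1)])
    have "near f S" unfolding near_def using g(2) S(3) by (intro bexI[of _ g])
    then show ?thesis using S(1,2) by blast
  qed
  then obtain S where S: "\<And>f. f \<in> F \<Longrightarrow> finite (S f)" "\<And>f. f \<in> F \<Longrightarrow> S f \<subseteq> block_functions C_G"
    "\<And>f. f \<in> F \<Longrightarrow> near f (S f)" by metis
  have US: "finite (\<Union>(S ` F))" "\<Union>(S ` F) \<subseteq> block_functions C_G" using S(1,2) F(1) by blast+
  obtain B where B: "invariant_basis B" "\<Union>(S ` F) \<subseteq> fspan B"
    by (rule block_functions_common_basis[OF US])
  define approx where "approx f c \<longleftrightarrow> (\<forall>x\<in>carrier G. cmod (f x - (\<Sum>b\<in>B. c b * b x)) \<le> e / 3)" for f c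
  have "\<exists>c. approx f c" if f: "f \<in> F" for f
  proof -
    obtain g where g: "g \<in> fspan (S f)" "\<forall>x\<in>carrier G. cmod (f x - g x) \<le> e / 3"
      using S(3)[OF f] unfolding near_def by (elim bexE)
    have "S f \<subseteq> fspan B" using B(2) f by blast
    then have "g \<in> fspan B" using fspan_subset[OF S(1)[OF f]] g(1) by blast
    then obtain c where c: "\<And>x. x \<in> carrier G \<Longrightarrow> g x = (\<Sum>b\<in>B. c b * b x)" by (elim fspanE) blast
    have "approx f c" unfolding approx_def using g(2) by (simp add: c)
    then show "\<exists>c. approx f c" by (rule exI[of "approx f" c])
  qed
  then obtain c where c: "\<And>f. f \<in> F \<Longrightarrow> approx f (c f)" by metis
  define K where "K = (\<Sum>f\<in>F. \<Sum>b\<in>B. cmod (c f b))"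
  have K: "K \<ge> 0" unfolding K_def by (intro sum_nonneg) simp
  define \<eta> where "\<eta> = e / 3 / (K + 1)"
  have \<eta>: "\<eta> > 0" using e K by (simp add: \<eta>_def)
  obtain h where h: "h \<in> carrier G" "s / 2 \<le> cmod (\<gamma> h - 1)" "cmod (\<gamma> h - 1) \<le> 2 * s"
    "\<forall>x\<in>carrier G. gap B (x \<otimes> h) (h \<otimes> x) \<le> \<eta>"
    by (rule almost_central_element[OF B(1) \<gamma> inf s \<eta>])
  have "cmod (f (x \<otimes> h) - f (h \<otimes> x)) \<le> e" if f: "f \<in> F" and x: "x \<in> carrier G" for f x
  proof -
    define g where "g y = (\<Sum>b\<in>B. c f b * b y)" for y
    have "g (x \<otimes> h) - g (h \<otimes> x) = (\<Sum>b\<in>B. c f b * (b (x \<otimes> h) - b (h \<otimes> x)))"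
      unfolding g_def by (simp add: right_diff_distrib sum_subtractf)
    then have "cmod (g (x \<otimes> h) - g (h \<otimes> x)) \<le> (\<Sum>b\<in>B. cmod (c f b * (b (x \<otimes> h) - b (h \<otimes> x))))"
      by (simp only: norm_sum)
    also have "\<dots> \<le> (\<Sum>b\<in>B. cmod (c f b) * \<eta>)"
    proof (rule sum_mono)
      fix b assume b: "b \<in> B"
      have "cmod (b (x \<otimes> h) - b (h \<otimes> x)) \<le> gap B (x \<otimes> h) (h \<otimes> x)"
        unfolding gap_def[OF B(1)] by (rule l2_member[OF invariant_basisD(2)[OF B(1)] b])
      then have "cmod (b (x \<otimes> h) - b (h \<otimes> x)) \<le> \<eta>" using h(4) x by fastforce
      then show "cmod (c f b * (b (x \<otimes> h) - b (h \<otimes> x))) \<le> cmod (c f b) * \<eta>"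
        unfolding norm_mult by (rule mult_left_mono) simp
    qed
    also have "\<dots> = (\<Sum>b\<in>B. cmod (c f b)) * \<eta>" by (rule sum_distrib_right[symmetric])
    also have "\<dots> \<le> K * \<eta>"
    proof (rule mult_right_mono)
      show "(\<Sum>b\<in>B. cmod (c f b)) \<le> K" unfolding K_def
        by (rule member_le_sum[OF f _ F(1), where f = "\<lambda>f. \<Sum>b\<in>B. cmod (c f b)"]) (simp add: sum_nonneg)
    qed (use \<eta> in simp)
    also have "\<dots> \<le> e / 3"
    proof -
      have K1: "K + 1 \<noteq> 0" using K by simp
      have "K * \<eta> \<le> (K + 1) * \<eta>" using \<eta> by (intro mult_right_mono) auto
      also have "\<dots> = e / 3" unfolding \<eta>_def using nonzero_mult_div_cancel_left[OF K1, of "e / 3"] by (simp only: times_divide_eq_right)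
      finally show ?thesis .
    qed
    finally have 1: "cmod (g (x \<otimes> h) - g (h \<otimes> x)) \<le> e / 3" .
    have 2: "cmod (f (x \<otimes> h) - g (x \<otimes> h)) \<le> e / 3" and 3: "cmod (f (h \<otimes> x) - g (h \<otimes> x)) \<le> e / 3"
      using c[OF f] x h(1) unfolding g_def approx_def by simp_all
    have "f (x \<otimes> h) - f (h \<otimes> x) = (f (x \<otimes> h) - g (x \<otimes> h)) + (g (x \<otimes> h) - g (h \<otimes> x)) - (f (h \<otimes> x) - g (h \<otimes> x))" by simp
    then have "cmod (f (x \<otimes> h) - f (h \<otimes> x)) =
      cmod ((f (x \<otimes> h) - g (x \<otimes> h)) + (g (x \<otimes> h) - g (h \<otimes> x)) - (f (h \<otimes> x) - g (h \<otimes> x)))" by (simp only:)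
    then show ?thesis using 1 2 3
      norm_triangle_ineq4[of "(f (x \<otimes> h) - g (x \<otimes> h)) + (g (x \<otimes> h) - g (h \<otimes> x))" "f (h \<otimes> x) - g (h \<otimes> x)"]
      norm_triangle_ineq[of "f (x \<otimes> h) - g (x \<otimes> h)" "g (x \<otimes> h) - g (h \<otimes> x)"] by linarith
  qed
  then show ?thesis by (intro that[OF h(1-3)] ballI)
qed

text \<open>Finite intersection property: for each function \<open>f\<close>, tolerance and
  \<open>x\<close>, almost commuting with \<open>x\<close> as seen by \<open>f\<close> is a closed
  condition, and \<open>almost_central_for_functions\<close> meets finitely many of them inside the
  annulus \<open>W\<close>. The lower bound \<open>s / 2\<close> is kept in the limit, so the
  central element is not in the kernel.\<close>

lemma infinite_on_centre:
  assumes \<gamma>: "character \<gamma>" and inf: "infinite (\<gamma> ` carrier G)" and s: "0 < s" "s \<le> 1/4"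
  obtains z where "z \<in> centre G" "s / 2 \<le> cmod (\<gamma> z - 1)" "cmod (\<gamma> z - 1) \<le> 2 * s"
proof -
  define W where "W = {h \<in> carrier G. \<gamma> h - 1 \<in> {w. s / 2 \<le> cmod w} \<inter> {w. cmod w \<le> 2 * s}}"
  define Z where "Z p = W \<inter> {h \<in> carrier G. fst p (snd (snd p) \<otimes> h) - fst p (h \<otimes> snd (snd p)) \<in> cball 0 (fst (snd p))}"
    for p :: "('a \<Rightarrow> complex) \<times> real \<times> 'a"
  let ?I = "C_G \<times> {0<..} \<times> carrier G"
  have clW: "closedin T W" unfolding W_def
    by (rule closedin_C_G_preimage[OF C_G_diff[OF characterD(1)[OF \<gamma>] C_G_const]])
      (intro closed_Int closed_Collect_le continuous_intros)
  have cl: "closedin T (Z p)" if p: "p \<in> ?I" for p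
  proof -
    have f: "fst p \<in> C_G" and x: "snd (snd p) \<in> carrier G" using p by auto
    show ?thesis unfolding Z_def
      by (rule closedin_Int[OF clW closedin_C_G_preimage[OF C_G_diff[OF C_G_left[OF f x] C_G_right[OF f x]] closed_cball]])
  qed
  have ne: "\<Inter>\<F> \<noteq> {}" if \<F>: "finite \<F>" "\<F> \<subseteq> Z ` ?I" for \<F>
  proof -
    obtain P where P: "finite P" "P \<subseteq> ?I" "\<F> = Z ` P" using finite_subset_image[OF \<F>] by blast
    define e where "e = Min (insert 1 ((fst \<circ> snd) ` P))"
    have fin: "finite (insert 1 ((fst \<circ> snd) ` P))" using P(1) by simp
    have e: "e > 0" unfolding e_def using fin P(2) by (subst Min_gr_iff) auto
    have el: "e \<le> fst (snd p)" if "p \<in> P" for p unfolding e_def using fin that by (intro Min_le) auto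
    have F: "finite (fst ` P)" "fst ` P \<subseteq> C_G" using P(1,2) by auto
    obtain h where h: "h \<in> carrier G" "s / 2 \<le> cmod (\<gamma> h - 1)" "cmod (\<gamma> h - 1) \<le> 2 * s"
      "\<forall>f\<in>fst ` P. \<forall>x\<in>carrier G. cmod (f (x \<otimes> h) - f (h \<otimes> x)) \<le> e"
      by (rule almost_central_for_functions[OF \<gamma> inf s F e])
    have "h \<in> Z p" if p: "p \<in> P" for p
    proof -
      have "snd (snd p) \<in> carrier G" using p P(2) by auto
      then have "cmod (fst p (snd (snd p) \<otimes> h) - fst p (h \<otimes> snd (snd p))) \<le> e" using h(4) p by blast
      then show ?thesis using el[OF p] h(1-3) by (simp add: Z_def W_def)
    qed
    then have "h \<in> \<Inter>\<F>" unfolding P(3) by (intro InterI) (elim imageE, simp)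
    then show ?thesis by (intro notI) simp
  qed
  have "(\<forall>C\<in>Z ` ?I. closedin T C) \<and> (\<forall>\<F>. finite \<F> \<and> \<F> \<subseteq> Z ` ?I \<longrightarrow> \<Inter>\<F> \<noteq> {})"
  proof (intro conjI ballI allI impI)
    fix C assume "C \<in> Z ` ?I"
    then show "closedin T C"
    proof (rule imageE)
      fix p assume "C = Z p" "p \<in> ?I"
      then show ?thesis using cl by simp
    qed
  next
    fix \<F> assume "finite \<F> \<and> \<F> \<subseteq> Z ` ?I"
    then show "\<Inter>\<F> \<noteq> {}" using ne by simp
  qed
  then have "\<Inter>(Z ` ?I) \<noteq> {}"
    by (rule compact[unfolded compact_space_fip, THEN spec, THEN mp])
  then obtain z where z0: "z \<in> \<Inter>(Z ` ?I)" unfolding ex_in_conv[symmetric] by (elim exE)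
  have z: "z \<in> Z p" if "p \<in> ?I" for p by (rule InterD[OF z0 imageI[OF that]])
  have "z \<in> Z (\<lambda>x. 1, 1, \<one>)" by (rule z) simp
  then have zW: "z \<in> carrier G" "s / 2 \<le> cmod (\<gamma> z - 1)" "cmod (\<gamma> z - 1) \<le> 2 * s"
    by (simp_all add: Z_def W_def)
  have "z \<otimes> x = x \<otimes> z" if x: "x \<in> carrier G" for x
  proof (rule ccontr)
    assume neq: "z \<otimes> x \<noteq> x \<otimes> z"
    have c: "closedin T {x \<otimes> z}"
      using closedin_Hausdorff_singleton[OF hausdorff] x zW(1) topspace_eq_carrier by simp
    have zx: "z \<otimes> x \<in> carrier G" "z \<otimes> x \<notin> {x \<otimes> z}" using x zW(1) neq by auto
    obtain f where f: "f \<in> C_G" "f (z \<otimes> x) = 0" "\<forall>y\<in>{x \<otimes> z}. f y = 1"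
      by (rule separating_function[OF c zx])
    \<comment> \<open>The function separates the two products by the values 0 and 1, against the
      tolerance 1/2.\<close>
    have "z \<in> Z (f, 1/2, x)" by (rule z) (use f(1) x in simp)
    then show False using f(2,3) by (simp add: Z_def)
  qed
  then have "z \<in> centre G" unfolding centre_def using zW(1) by simp
  then show ?thesis by (rule that[OF _ zW(2,3)])
qed

text \<open>Doubling: \<open>w ^ (2 * n) - 1\<close> is \<open>w ^ n - 1\<close> times
  \<open>w ^ n + 1\<close>, and the second factor has modulus at least 3/2 as long as the powers
  stay within distance 1 of 1. So the distance from 1 would grow without bound.\<close>

lemma near_one_subgroup:
  fixes w :: complex
  assumes w: "cmod w = 1" and k: "\<And>k::nat. cmod (w ^ k - 1) < 1"
  shows "w = 1"
proof (rule ccontr)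
  assume "w \<noteq> 1"
  then have a: "cmod (w - 1) > 0" by simp
  have plus: "cmod (w ^ n + 1) \<ge> 3 / 2" for n
  proof -
    have n1: "cmod (w ^ n) = 1" using w by (simp add: norm_power)
    have "(cmod (w ^ n - 1))^2 < 1^2" by (rule power_strict_mono[OF k]) simp_all
    then have "(Re (w ^ n) - 1)^2 + (Im (w ^ n))^2 < 1" unfolding cmod_power2 by simp
    moreover have "(Re (w ^ n))^2 + (Im (w ^ n))^2 = 1" using cmod_power2[of "w ^ n"] n1 by simp
    moreover have "(Re (w ^ n) - 1)^2 = (Re (w ^ n))^2 - 2 * Re (w ^ n) + 1" by (simp add: power2_diff)
    ultimately have "Re (w ^ n) > 1 / 2" by linarith
    then show ?thesis using complex_Re_le_cmod[of "w ^ n + 1"] by simp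
  qed
  have "cmod (w ^ (2 ^ n) - 1) \<ge> (3/2) ^ n * cmod (w - 1)" for n
  proof (induction n)
    case (Suc n)
    have "w ^ (2 ^ Suc n) - 1 = (w ^ (2 ^ n) - 1) * (w ^ (2 ^ n) + 1)"
    proof -
      have "w ^ (2 ^ Suc n) = w ^ (2 ^ n) * w ^ (2 ^ n)" by (simp add: power_add[symmetric] mult_2)
      then show ?thesis by (simp add: algebra_simps)
    qed
    then have "cmod (w ^ (2 ^ Suc n) - 1) = cmod (w ^ (2 ^ n) - 1) * cmod (w ^ (2 ^ n) + 1)" by (simp only: norm_mult)
    moreover have "((3/2) ^ n * cmod (w - 1)) * (3/2) \<le> cmod (w ^ (2 ^ n) - 1) * cmod (w ^ (2 ^ n) + 1)"
      by (intro mult_mono Suc plus) auto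
    ultimately show ?case by (simp add: mult_ac)
  qed simp
  moreover obtain n where "1 / cmod (w - 1) < (3/2 :: real) ^ n" using real_arch_pow[of "3/2"] by auto
  then have "1 < (3/2) ^ n * cmod (w - 1)" using a by (simp add: pos_divide_less_eq)
  ultimately show False using k[of "2 ^ n"] by (meson less_le_trans less_asym)
qed

section \<open>Invariant algebras\<close>

lemma restrict_mem_cfunspace:
  assumes "f \<in> C_G"
  shows "restrict f (carrier G) \<in> mspace (complex_cfunspace T)"
proof -
  define r where "r = restrict f (carrier G)"
  have c: "continuous_map T euclidean r"
    using C_G_cong[OF assms, of r] by (simp add: C_G_def r_def)
  then have "compactin euclidean (r ` topspace T)"
    using image_compactin[of T "topspace T"] compact unfolding compact_space_def by blast
  then have "bounded (r ` topspace T)" using compact_imp_bounded by simp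
  moreover have "r \<in> extensional (topspace T)" by (simp add: r_def topspace_eq_carrier)
  ultimately show ?thesis unfolding r_def[symmetric] using c by simp
qed

lemma cfunspace_C_G: "f \<in> mspace (complex_cfunspace T) \<Longrightarrow> f \<in> C_G \<and> f \<in> extensional (carrier G)"
  by (simp add: C_G_def topspace_eq_carrier)

lemma mdist_cfunspace_iff:
  assumes "f \<in> mspace (complex_cfunspace T)" "g \<in> mspace (complex_cfunspace T)" "e \<ge> 0"
  shows "mdist (complex_cfunspace T) f g \<le> e \<longleftrightarrow> (\<forall>x\<in>carrier G. cmod (f x - g x) \<le> e)"
proof -
  have "topspace T \<noteq> {}" using topspace_eq_carrier by auto
  from cfunspace_mdist_le[OF assms(1,2) this, of e] show ?thesis
    by (simp add: dist_norm topspace_eq_carrier)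
qed

lemma closedin_cfunspace_iff:
  "closedin (mtopology_of (complex_cfunspace T)) A \<longleftrightarrow> A \<subseteq> mspace (complex_cfunspace T) \<and>
    (\<forall>f\<in>mspace (complex_cfunspace T). (\<forall>e>0. \<exists>g\<in>A. \<forall>x\<in>carrier G. cmod (f x - g x) \<le> e) \<longrightarrow> f \<in> A)"
    (is "?L \<longleftrightarrow> A \<subseteq> ?M \<and> ?R")
proof -
  let ?d = "mdist (complex_cfunspace T)"
  interpret M: Metric_space ?M ?d by (rule Metric_space_mspace_mdist)
  have L: "?L \<longleftrightarrow> A \<subseteq> ?M \<and> (\<forall>f. f \<in> ?M - A \<longrightarrow> (\<exists>r>0. disjnt A (M.mball f r)))"
    unfolding mtopology_of_def by (rule M.closedin_metric)
  have "(\<exists>r>0. disjnt A (M.mball f r)) \<longleftrightarrow> \<not> (\<forall>e>0. \<exists>g\<in>A. \<forall>x\<in>carrier G. cmod (f x - g x) \<le> e)"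
    if AM: "A \<subseteq> ?M" and f: "f \<in> ?M" for f
  proof -
    have iff: "?d f g \<le> e \<longleftrightarrow> (\<forall>x\<in>carrier G. cmod (f x - g x) \<le> e)" if "g \<in> A" "e > 0" for g e
      by (rule mdist_cfunspace_iff[OF f]) (use AM that in auto)
    have "(\<forall>e>0. \<exists>g\<in>A. \<forall>x\<in>carrier G. cmod (f x - g x) \<le> e) \<longleftrightarrow> (\<forall>e>0. \<exists>g\<in>A. ?d f g \<le> e)"
      using iff by (intro all_cong bex_cong refl) simp
    also have "\<dots> \<longleftrightarrow> (\<forall>e>0. \<exists>g\<in>A. ?d f g < e)"
    proof
      assume R: "\<forall>e>0. \<exists>g\<in>A. ?d f g \<le> e"
      show "\<forall>e>0. \<exists>g\<in>A. ?d f g < e"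
      proof (intro allI impI)
        fix e :: real assume "e > 0"
        then have "e / 2 > 0" "e / 2 < e" by simp_all
        then obtain g where "g \<in> A" "?d f g \<le> e / 2" using R by blast
        then show "\<exists>g\<in>A. ?d f g < e" using \<open>e / 2 < e\<close> by (intro bexI[of _ g]) auto
      qed
    qed (use less_imp_le in blast)
    also have "\<dots> \<longleftrightarrow> (\<forall>e>0. \<not> disjnt A (M.mball f e))"
      using AM f unfolding disjnt_iff M.in_mball by blast
    finally show ?thesis by blast
  qed
  then show ?thesis unfolding L by blast
qed

text \<open>The algebras of the theorem consist of functions which are \<open>undefined\<close> off the carrier; we pass to
  the functions with arbitrary values there.\<close>

lemma multiplicative_space_of_invariant_algebra:
  assumes A: "invariant_algebra G T A"
  shows "multiplicative_space {f. restrict f (carrier G) \<in> A}" (is "multiplicative_space ?A")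
proof -
  note defs = A[unfolded invariant_algebra_def closed_unital_subalgebra_def topspace_eq_carrier]
  have cl: "closedin (mtopology_of (complex_cfunspace T)) A" using defs by blast
  have con: "(\<lambda>x\<in>carrier G. c) \<in> A" for c using defs by blast
  have add: "(\<lambda>x\<in>carrier G. f x + g x) \<in> A" if "f \<in> A" "g \<in> A" for f g using defs that by blast
  have mul: "(\<lambda>x\<in>carrier G. f x * g x) \<in> A" if "f \<in> A" "g \<in> A" for f g using defs that by blast
  have sca: "(\<lambda>x\<in>carrier G. c * f x) \<in> A" if "f \<in> A" for f c using defs that by blast
  have lef: "(\<lambda>x\<in>carrier G. f (a \<otimes> x)) \<in> A" if "f \<in> A" "a \<in> carrier G" for f a using defs that by blast
  have rig: "(\<lambda>x\<in>carrier G. f (x \<otimes> a)) \<in> A" if "f \<in> A" "a \<in> carrier G" for f a using defs that by blast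
  have AM: "A \<subseteq> mspace (complex_cfunspace T)" using cl closedin_cfunspace_iff by blast
  have eqI: "restrict f (carrier G) \<in> A" if "(\<lambda>x\<in>carrier G. g x) \<in> A" "\<And>x. x \<in> carrier G \<Longrightarrow> g x = f x" for f g
  proof -
    have "(\<lambda>x\<in>carrier G. g x) = restrict f (carrier G)" using that(2) by (intro restrict_ext) simp
    then show ?thesis using that(1) by simp
  qed
  have C: "f \<in> C_G" if f: "f \<in> ?A" for f
  proof -
    have "restrict f (carrier G) \<in> C_G" using f AM cfunspace_C_G by blast
    then show ?thesis by (rule C_G_cong) simp
  qed
  have sc: "sup_closed ?A"
    unfolding sup_closed_def
  proof (intro allI impI)
    fix f assume f: "\<forall>e>0. \<exists>g\<in>?A. \<forall>x\<in>carrier G. cmod (f x - g x) \<le> e"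
    have "f \<in> C_G"
    proof (rule sup_closedD[OF translation_spaceD(3)[OF translation_space_C_G]])
      fix e :: real assume "e > 0"
      then obtain g where "g \<in> ?A" "\<forall>x\<in>carrier G. cmod (f x - g x) \<le> e" using f by blast
      then show "\<exists>g\<in>C_G. \<forall>x\<in>carrier G. cmod (f x - g x) \<le> e" using C by (intro bexI[of _ g])
    qed
    then have fM: "restrict f (carrier G) \<in> mspace (complex_cfunspace T)" by (rule restrict_mem_cfunspace)
    have "\<exists>g\<in>A. \<forall>x\<in>carrier G. cmod (restrict f (carrier G) x - g x) \<le> e" if e: "e > 0" for e
    proof -
      obtain g where "g \<in> ?A" "\<forall>x\<in>carrier G. cmod (f x - g x) \<le> e" using f e by blast
      then show ?thesis by (intro bexI[of _ "restrict g (carrier G)"]) simp_all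
    qed
    then have "restrict f (carrier G) \<in> A" using cl fM unfolding closedin_cfunspace_iff by blast
    then show "f \<in> ?A" by simp
  qed
  have "translation_space ?A"
    unfolding translation_space_def
  proof (intro conjI ballI allI subsetI)
    show "(\<lambda>x. 0) \<in> ?A" using con by simp
    show "sup_closed ?A" by (rule sc)
  next
    fix f assume "f \<in> ?A" then show "f \<in> C_G" by (rule C)
  next
    fix f g assume "f \<in> ?A" "g \<in> ?A"
    then have "(\<lambda>x\<in>carrier G. restrict f (carrier G) x + restrict g (carrier G) x) \<in> A" unfolding mem_Collect_eq by (rule add)
    then show "(\<lambda>x. f x + g x) \<in> ?A" unfolding mem_Collect_eq by (rule eqI) simp
  next
    fix c f assume "f \<in> ?A"
    then have "(\<lambda>x\<in>carrier G. c * restrict f (carrier G) x) \<in> A" unfolding mem_Collect_eq by (rule sca)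
    then show "(\<lambda>x. c * f x) \<in> ?A" unfolding mem_Collect_eq by (rule eqI) simp
  next
    fix a f assume a: "a \<in> carrier G" and f: "f \<in> ?A"
    have "(\<lambda>x\<in>carrier G. restrict f (carrier G) (a \<otimes> x)) \<in> A" by (rule lef[OF CollectD[OF f] a])
    then show "(\<lambda>x. f (a \<otimes> x)) \<in> ?A" unfolding mem_Collect_eq by (rule eqI) (simp add: a)
  next
    fix a f assume a: "a \<in> carrier G" and f: "f \<in> ?A"
    have "(\<lambda>x\<in>carrier G. restrict f (carrier G) (x \<otimes> a)) \<in> A" by (rule rig[OF CollectD[OF f] a])
    then show "(\<lambda>x. f (x \<otimes> a)) \<in> ?A" unfolding mem_Collect_eq by (rule eqI) (simp add: a)
  qed
  moreover have "(\<lambda>x. c) \<in> ?A" for c using con by simp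
  moreover have "(\<lambda>x. f x * g x) \<in> ?A" if "f \<in> ?A" "g \<in> ?A" for f g
  proof -
    have "(\<lambda>x\<in>carrier G. restrict f (carrier G) x * restrict g (carrier G) x) \<in> A" using that unfolding mem_Collect_eq by (rule mul)
    then show ?thesis unfolding mem_Collect_eq by (rule eqI) simp
  qed
  ultimately show ?thesis unfolding multiplicative_space_def by blast
qed

text \<open>The passage back, by which the closure of the polynomials in a character becomes an
  algebra to which a hypothesis on invariant algebras applies.\<close>

lemma invariant_algebra_of_multiplicative_space:
  assumes A: "multiplicative_space A"
  shows "invariant_algebra G T ((\<lambda>f. restrict f (carrier G)) ` A)" (is "invariant_algebra G T ?A")
proof -
  note TA = multiplicative_spaceD(1)[OF A]
  have I: "(\<lambda>x\<in>carrier G. g x) \<in> ?A" if "g \<in> A" for g using that by blast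
  have E: "\<exists>g\<in>A. f = restrict g (carrier G)" if "f \<in> ?A" for f using that by blast
  have cong: "f \<in> A" if "g \<in> A" "\<And>x. x \<in> carrier G \<Longrightarrow> f x = g x" for f g
    by (rule sup_closed_cong[OF translation_spaceD(3)[OF TA] that])
  have EA: "f \<in> A" if f: "f \<in> ?A" for f
  proof -
    obtain g where g: "g \<in> A" "f = restrict g (carrier G)" using E[OF f] by blast
    show ?thesis by (rule cong[OF g(1)]) (simp add: g(2))
  qed
  have "closedin (mtopology_of (complex_cfunspace T)) ?A"
    unfolding closedin_cfunspace_iff
  proof (intro conjI subsetI ballI impI)
    fix f assume "f \<in> ?A"
    then obtain g where g: "g \<in> A" "f = restrict g (carrier G)" using E by blast
    show "f \<in> mspace (complex_cfunspace T)"
      unfolding g(2) by (rule restrict_mem_cfunspace[OF translation_spaceD(1)[OF TA g(1)]])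
  next
    fix f assume f: "f \<in> mspace (complex_cfunspace T)" "\<forall>e>0. \<exists>g\<in>?A. \<forall>x\<in>carrier G. cmod (f x - g x) \<le> e"
    have "f \<in> A"
    proof (rule sup_closedD[OF translation_spaceD(3)[OF TA]])
      fix e :: real assume "e > 0"
      then obtain g where "g \<in> ?A" "\<forall>x\<in>carrier G. cmod (f x - g x) \<le> e" using f(2) by blast
      then show "\<exists>g\<in>A. \<forall>x\<in>carrier G. cmod (f x - g x) \<le> e" using EA by (intro bexI[of _ g])
    qed
    moreover have "f = restrict f (carrier G)" using cfunspace_C_G[OF f(1)] by (simp add: extensional_restrict)
    ultimately show "f \<in> ?A" by (metis imageI)
  qed
  then show ?thesis
    unfolding invariant_algebra_def closed_unital_subalgebra_def topspace_eq_carrier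
  proof (intro conjI allI ballI)
    show "(\<lambda>x\<in>carrier G. c) \<in> ?A" for c by (rule I[OF multiplicative_spaceD(2)[OF A]])
    show "(\<lambda>x\<in>carrier G. f x + g x) \<in> ?A" if "f \<in> ?A" "g \<in> ?A" for f g
      by (rule I[OF translation_spaceD(4)[OF TA EA[OF that(1)] EA[OF that(2)]]])
    show "(\<lambda>x\<in>carrier G. f x * g x) \<in> ?A" if "f \<in> ?A" "g \<in> ?A" for f g
      by (rule I[OF multiplicative_spaceD(3)[OF A EA[OF that(1)] EA[OF that(2)]]])
    show "(\<lambda>x\<in>carrier G. c * f x) \<in> ?A" if "f \<in> ?A" for c f
      by (rule I[OF translation_spaceD(5)[OF TA EA[OF that]]])
    show "(\<lambda>x\<in>carrier G. f (a \<otimes> x)) \<in> ?A" if "a \<in> carrier G" "f \<in> ?A" for a f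
      by (rule I[OF translation_spaceD(6)[OF TA that(1) EA[OF that(2)]]])
    show "(\<lambda>x\<in>carrier G. f (x \<otimes> a)) \<in> ?A" if "a \<in> carrier G" "f \<in> ?A" for a f
      by (rule I[OF translation_spaceD(7)[OF TA that(1) EA[OF that(2)]]])
  qed
qed

definition character_polynomials :: "('a \<Rightarrow> complex) \<Rightarrow> ('a \<Rightarrow> complex) set" where
  "character_polynomials \<gamma> = {f. \<forall>e>0. \<exists>p. \<forall>x\<in>carrier G. cmod (f x - poly p (\<gamma> x)) \<le> e}"

lemma character_polynomialsD:
  assumes "f \<in> character_polynomials \<gamma>" "e > 0"
  obtains p where "\<forall>x\<in>carrier G. cmod (f x - poly p (\<gamma> x)) \<le> e"
  using assms unfolding character_polynomials_def by blast

lemma C_G_poly: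
  assumes "\<gamma> \<in> C_G"
  shows "(\<lambda>x. poly p (\<gamma> x)) \<in> C_G"
  unfolding poly_altdef by (intro C_G_sum C_G_mult C_G_const C_G_power assms finite_atMost)

lemma multiplicative_space_character_polynomials:
  assumes \<gamma>: "character \<gamma>"
  shows "multiplicative_space (character_polynomials \<gamma>)" (is "multiplicative_space ?A")
proof -
  note \<gamma>C = characterD(1)[OF \<gamma>]
  have I: "f \<in> ?A" if "\<And>e. e > 0 \<Longrightarrow> \<exists>p. \<forall>x\<in>carrier G. cmod (f x - poly p (\<gamma> x)) \<le> e" for f
    unfolding character_polynomials_def using that by simp
  have polyA: "(\<lambda>x. poly p (\<gamma> x)) \<in> ?A" for p
  proof (rule I)
    fix e :: real assume "e > 0"
    then show "\<exists>q. \<forall>x\<in>carrier G. cmod (poly p (\<gamma> x) - poly q (\<gamma> x)) \<le> e" by (intro exI[of _ p]) simp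
  qed
  have C: "f \<in> C_G" if f: "f \<in> ?A" for f
  proof (rule sup_closedD[OF translation_spaceD(3)[OF translation_space_C_G]])
    fix e :: real assume e: "e > 0"
    obtain p where "\<forall>x\<in>carrier G. cmod (f x - poly p (\<gamma> x)) \<le> e" by (rule character_polynomialsD[OF f e])
    then show "\<exists>g\<in>C_G. \<forall>x\<in>carrier G. cmod (f x - g x) \<le> e"
      by (intro bexI[of _ "\<lambda>x. poly p (\<gamma> x)"] C_G_poly \<gamma>C)
  qed
  have sc: "sup_closed ?A"
    unfolding sup_closed_def
  proof (intro allI impI)
    fix f assume f: "\<forall>e>0. \<exists>g\<in>?A. \<forall>x\<in>carrier G. cmod (f x - g x) \<le> e"
    show "f \<in> ?A"
    proof (rule I)
      fix e :: real assume "e > 0"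
      then have e2: "e / 2 > 0" by simp
      then obtain g where g: "g \<in> ?A" "\<forall>x\<in>carrier G. cmod (f x - g x) \<le> e / 2" using f by blast
      obtain p where p: "\<forall>x\<in>carrier G. cmod (g x - poly p (\<gamma> x)) \<le> e / 2" by (rule character_polynomialsD[OF g(1) e2])
      have "cmod (f x - poly p (\<gamma> x)) \<le> e" if x: "x \<in> carrier G" for x
      proof -
        have "cmod (f x - g x) \<le> e / 2" "cmod (g x - poly p (\<gamma> x)) \<le> e / 2" using g(2) p x by simp_all
        then show ?thesis using norm_triangle_ineq[of "f x - g x" "g x - poly p (\<gamma> x)"] by simp
      qed
      then show "\<exists>p. \<forall>x\<in>carrier G. cmod (f x - poly p (\<gamma> x)) \<le> e" by (intro exI[of _ p] ballI)
    qed
  qed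
  have add: "(\<lambda>x. f x + g x) \<in> ?A" if fg: "f \<in> ?A" "g \<in> ?A" for f g
  proof (rule I)
    fix e :: real assume "e > 0"
    then have e2: "e / 2 > 0" by simp
    obtain p where p: "\<forall>x\<in>carrier G. cmod (f x - poly p (\<gamma> x)) \<le> e / 2" by (rule character_polynomialsD[OF fg(1) e2])
    obtain q where q: "\<forall>x\<in>carrier G. cmod (g x - poly q (\<gamma> x)) \<le> e / 2" by (rule character_polynomialsD[OF fg(2) e2])
    have "cmod (f x + g x - poly (p + q) (\<gamma> x)) \<le> e" if x: "x \<in> carrier G" for x
    proof -
      have "cmod (f x - poly p (\<gamma> x)) \<le> e / 2" "cmod (g x - poly q (\<gamma> x)) \<le> e / 2" using p q x by simp_all
      moreover have "f x + g x - poly (p + q) (\<gamma> x) = (f x - poly p (\<gamma> x)) + (g x - poly q (\<gamma> x))" by simp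
      then have "cmod (f x + g x - poly (p + q) (\<gamma> x)) = cmod ((f x - poly p (\<gamma> x)) + (g x - poly q (\<gamma> x)))" by (simp only:)
      ultimately show ?thesis using norm_triangle_ineq[of "f x - poly p (\<gamma> x)" "g x - poly q (\<gamma> x)"] by linarith
    qed
    then show "\<exists>p. \<forall>x\<in>carrier G. cmod (f x + g x - poly p (\<gamma> x)) \<le> e" by (intro exI[of _ "p + q"] ballI)
  qed
  have mult: "(\<lambda>x. f x * g x) \<in> ?A" if fg: "f \<in> ?A" "g \<in> ?A" for f g
  proof (rule I)
    fix e :: real assume e: "e > 0"
    obtain b where b: "b > 0" "\<And>x. x \<in> carrier G \<Longrightarrow> cmod (g x) \<le> b" using C_G_bounded[OF C[OF fg(2)]] by blast
    have eb: "e / 2 / b > 0" using e b by simp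
    obtain p where p: "\<forall>x\<in>carrier G. cmod (f x - poly p (\<gamma> x)) \<le> e / 2 / b" by (rule character_polynomialsD[OF fg(1) eb])
    \<comment> \<open>The polynomial \<open>p\<close> is fixed before \<open>q\<close>, since the
      accuracy of \<open>q\<close> depends on a bound for \<open>p\<close>.\<close>
    obtain c where c: "c > 0" "\<And>x. x \<in> carrier G \<Longrightarrow> cmod (poly p (\<gamma> x)) \<le> c"
      using C_G_bounded[OF C_G_poly[OF \<gamma>C, of p]] by blast
    have ec: "e / 2 / c > 0" using e c by simp
    obtain q where q: "\<forall>x\<in>carrier G. cmod (g x - poly q (\<gamma> x)) \<le> e / 2 / c" by (rule character_polynomialsD[OF fg(2) ec])
    have "cmod (f x * g x - poly (p * q) (\<gamma> x)) \<le> e" if x: "x \<in> carrier G" for x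
    proof -
      have 1: "cmod ((f x - poly p (\<gamma> x)) * g x) \<le> (e / 2 / b) * b"
        unfolding norm_mult using p x b(2)[OF x] eb by (intro mult_mono) auto
      have 2: "cmod (poly p (\<gamma> x) * (g x - poly q (\<gamma> x))) \<le> c * (e / 2 / c)"
        unfolding norm_mult using q x c by (intro mult_mono) auto
      have "f x * g x - poly (p * q) (\<gamma> x) = (f x - poly p (\<gamma> x)) * g x + poly p (\<gamma> x) * (g x - poly q (\<gamma> x))"
        by (simp add: algebra_simps)
      then have "cmod (f x * g x - poly (p * q) (\<gamma> x)) \<le> (e / 2 / b) * b + c * (e / 2 / c)"
        using norm_triangle_le[OF add_mono[OF 1 2]] by simp
      then show ?thesis using b(1) c(1) by simp
    qed
    then show "\<exists>p. \<forall>x\<in>carrier G. cmod (f x * g x - poly p (\<gamma> x)) \<le> e" by (intro exI[of _ "p * q"] ballI)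
  qed
  have con: "(\<lambda>x. c) \<in> ?A" for c using polyA[of "[:c:]"] by simp
  \<comment> \<open>Translation by \<open>a\<close> multiplies \<open>\<gamma>\<close> by
    \<open>\<gamma> a\<close>; on polynomials this is the substitution of
    \<open>[:0, \<gamma> a:]\<close>. The map \<open>\<theta>\<close> covers translations from both
    sides.\<close>
  have tr: "(\<lambda>x. f (\<theta> x)) \<in> ?A"
    if f: "f \<in> ?A" and a: "a \<in> carrier G" and \<theta>: "\<And>x. x \<in> carrier G \<Longrightarrow> \<theta> x \<in> carrier G \<and> \<gamma> (\<theta> x) = \<gamma> a * \<gamma> x" for f a \<theta>
  proof (rule I)
    fix e :: real assume e: "e > 0"
    obtain p where p: "\<forall>x\<in>carrier G. cmod (f x - poly p (\<gamma> x)) \<le> e" by (rule character_polynomialsD[OF f e])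
    have "cmod (f (\<theta> x) - poly (pcompose p [:0, \<gamma> a:]) (\<gamma> x)) \<le> e" if x: "x \<in> carrier G" for x
      using bspec[OF p conjunct1[OF \<theta>[OF x]]] unfolding conjunct2[OF \<theta>[OF x]]
      by (simp add: poly_pcompose mult.commute)
    then show "\<exists>p. \<forall>x\<in>carrier G. cmod (f (\<theta> x) - poly p (\<gamma> x)) \<le> e" by (intro exI[of _ "pcompose p [:0, \<gamma> a:]"] ballI)
  qed
  have "translation_space ?A"
    unfolding translation_space_def
  proof (intro conjI ballI allI subsetI)
    show "sup_closed ?A" by (rule sc)
    show "(\<lambda>x. 0) \<in> ?A" by (rule con)
  next
    fix f assume "f \<in> ?A" then show "f \<in> C_G" by (rule C)
  next
    fix f g assume "f \<in> ?A" "g \<in> ?A" then show "(\<lambda>x. f x + g x) \<in> ?A" by (rule add)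
  next
    fix c f assume "f \<in> ?A" then show "(\<lambda>x. c * f x) \<in> ?A" by (rule mult[OF con])
  next
    fix a f assume a: "a \<in> carrier G" and f: "f \<in> ?A"
    show "(\<lambda>x. f (a \<otimes> x)) \<in> ?A" by (rule tr[OF f a]) (use a characterD(3)[OF \<gamma>] in simp)
  next
    fix a f assume a: "a \<in> carrier G" and f: "f \<in> ?A"
    show "(\<lambda>x. f (x \<otimes> a)) \<in> ?A" by (rule tr[OF f a]) (use a characterD(3)[OF \<gamma>] in \<open>simp add: mult.commute\<close>)
  qed
  then show ?thesis unfolding multiplicative_space_def using con mult by simp
qed

text \<open>Translation by an \<open>a\<close> with \<open>\<gamma> a ^ k \<noteq> 1\<close>
  multiplies the function by that number but leaves the mean unchanged.\<close>

lemma mean_character_power: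
  assumes \<gamma>: "character \<gamma>" and nt: "\<not> torsion_character \<gamma>" and k: "k > 0"
  shows "mean (\<lambda>x. \<gamma> x ^ k) = 0"
proof -
  obtain a where a: "a \<in> carrier G" "\<gamma> a ^ k \<noteq> 1" using nt k unfolding torsion_character_def by blast
  have C: "(\<lambda>x. \<gamma> x ^ k) \<in> C_G" by (rule C_G_power[OF characterD(1)[OF \<gamma>]])
  have "mean (\<lambda>x. \<gamma> x ^ k) = mean (\<lambda>x. \<gamma> (a \<otimes> x) ^ k)" by (rule mean_left[OF C a(1), symmetric])
  also have "\<dots> = mean (\<lambda>x. \<gamma> a ^ k * \<gamma> x ^ k)"
    by (rule mean_cong) (simp add: characterD(3)[OF \<gamma> a(1)] power_mult_distrib)
  also have "\<dots> = \<gamma> a ^ k * mean (\<lambda>x. \<gamma> x ^ k)" by (rule mean_mult_const[OF C])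
  finally show ?thesis using a(2) by simp
qed

text \<open>If \<open>p (\<gamma>)\<close> approximated the conjugate of \<open>\<gamma>\<close>
  within 1/2, multiplication by \<open>\<gamma>\<close> would approximate the constant 1 by a
  polynomial in \<open>\<gamma>\<close> without constant term. That polynomial has mean 0, so the
  error could not be below 1.\<close>

lemma torsion_if_all_self_adjoint:
  assumes sa: "\<And>A. invariant_algebra G T A \<Longrightarrow> self_adjoint T A" and \<gamma>: "character \<gamma>"
  shows "torsion_character \<gamma>"
proof (rule ccontr)
  assume nt: "\<not> torsion_character \<gamma>"
  note \<gamma>C = characterD(1)[OF \<gamma>]
  let ?A = "character_polynomials \<gamma>"
  have A: "multiplicative_space ?A" by (rule multiplicative_space_character_polynomials[OF \<gamma>])
  have "\<exists>p. \<forall>x\<in>carrier G. cmod (\<gamma> x - poly p (\<gamma> x)) \<le> e" if "e > 0" for e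
    using that by (intro exI[of _ "[:0, 1:]"]) simp
  then have "\<gamma> \<in> ?A" unfolding character_polynomials_def by simp
  then have "restrict \<gamma> (carrier G) \<in> (\<lambda>f. restrict f (carrier G)) ` ?A" by (rule imageI)
  then have "(\<lambda>x\<in>carrier G. cnj (restrict \<gamma> (carrier G) x)) \<in> (\<lambda>f. restrict f (carrier G)) ` ?A"
    using sa[OF invariant_algebra_of_multiplicative_space[OF A]]
    unfolding self_adjoint_def topspace_eq_carrier by blast
  then obtain f where f: "f \<in> ?A" "(\<lambda>x\<in>carrier G. cnj (restrict \<gamma> (carrier G) x)) = restrict f (carrier G)" by blast
  have fx: "f x = cnj (\<gamma> x)" if "x \<in> carrier G" for x using fun_cong[OF f(2), of x] that by simp
  have half: "(1 / 2 :: real) > 0" by simp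
  obtain p where p: "\<forall>x\<in>carrier G. cmod (f x - poly p (\<gamma> x)) \<le> 1 / 2" by (rule character_polynomialsD[OF f(1) half])
  let ?q = "\<lambda>x. \<Sum>i\<le>degree p. coeff p i * \<gamma> x ^ Suc i"
  have termC: "(\<lambda>x. \<gamma> x ^ Suc i) \<in> C_G" for i by (rule C_G_power[OF \<gamma>C])
  have qC: "?q \<in> C_G" by (intro C_G_sum finite_atMost C_G_mult_const termC)
  have "mean ?q = (\<Sum>i\<le>degree p. mean (\<lambda>x. coeff p i * \<gamma> x ^ Suc i))"
    by (rule mean_sum[OF finite_atMost C_G_mult_const[OF termC]])
  also have "\<dots> = 0"
    by (rule sum.neutral) (intro ballI, simp only: mean_mult_const[OF termC] mean_character_power[OF \<gamma> nt zero_less_Suc] mult_zero_right)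
  finally have "mean (\<lambda>x. 1 - ?q x) = 1" using mean_diff[OF C_G_const[of 1] qC] by simp
  moreover have "cmod (mean (\<lambda>x. 1 - ?q x)) \<le> 1 / 2"
  proof (rule mean_norm_le[OF C_G_diff[OF C_G_const qC]])
    fix x assume x: "x \<in> carrier G"
    have "\<gamma> x * cnj (\<gamma> x) = 1" using character_norm[OF \<gamma> x] complex_norm_square[of "\<gamma> x"] by simp
    moreover have "?q x = \<gamma> x * poly p (\<gamma> x)" unfolding poly_altdef sum_distrib_left by (simp add: mult_ac)
    ultimately have "1 - ?q x = \<gamma> x * (f x - poly p (\<gamma> x))" using fx[OF x] by (simp add: right_diff_distrib)
    then have "cmod (1 - ?q x) = cmod (f x - poly p (\<gamma> x))" using character_norm[OF \<gamma> x] by (simp add: norm_mult)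
    then show "cmod (1 - ?q x) \<le> 1 / 2" using p x by simp
  qed
  ultimately show False by simp
qed

section \<open>Profinite centres\<close>

lemma subgroup_centre: "subgroup (centre G) G"
proof (rule subgroup.intro)
  show "centre G \<subseteq> carrier G" using centreD(1) by blast
  show "\<one> \<in> centre G" unfolding centre_def by simp
  show "x \<otimes> y \<in> centre G" if "x \<in> centre G" "y \<in> centre G" for x y
  proof -
    have c: "x \<in> carrier G" "y \<in> carrier G" using that centreD(1) by blast+
    have "x \<otimes> y \<otimes> a = a \<otimes> (x \<otimes> y)" if a: "a \<in> carrier G" for a
    proof -
      have "x \<otimes> y \<otimes> a = x \<otimes> (a \<otimes> y)" using centreD(2)[OF \<open>y \<in> centre G\<close> a] m_assoc[OF c a] by simp
      also have "\<dots> = a \<otimes> x \<otimes> y" using centreD(2)[OF \<open>x \<in> centre G\<close> a] m_assoc[OF c(1) a c(2)] by simp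
      finally show ?thesis using m_assoc[OF a c] by simp
    qed
    then show ?thesis unfolding centre_def using c by simp
  qed
  show "inv x \<in> centre G" if x: "x \<in> centre G" for x
  proof -
    have c: "x \<in> carrier G" using x centreD(1) by blast
    have "inv x \<otimes> a = a \<otimes> inv x" if a: "a \<in> carrier G" for a
    proof -
      have "inv x \<otimes> a = inv x \<otimes> (a \<otimes> x \<otimes> inv x)" using a c by (simp add: m_assoc)
      also have "\<dots> = inv x \<otimes> (x \<otimes> a \<otimes> inv x)" using centreD(2)[OF x a] by simp
      also have "\<dots> = a \<otimes> inv x" using a c by (simp add: m_assoc[symmetric])
      finally show ?thesis .
    qed
    then show ?thesis unfolding centre_def using c by simp
  qed
qed

text \<open>Since \<open>C_G\<close> separates points, the centre is an intersection of zero sets of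
  continuous functions.\<close>

lemma closedin_centre: "closedin T (centre G)"
proof -
  have "centre G = (\<Inter>p\<in>C_G \<times> carrier G. {z \<in> carrier G. fst p (z \<otimes> snd p) - fst p (snd p \<otimes> z) \<in> {0}})" (is "_ = ?I")
  proof
    show "centre G \<subseteq> ?I"
    proof (rule subsetI, rule INT_I)
      fix z p assume z: "z \<in> centre G" and p: "p \<in> C_G \<times> carrier G"
      have "z \<otimes> snd p = snd p \<otimes> z" by (rule centreD(2)[OF z]) (use p in auto)
      then show "z \<in> {z \<in> carrier G. fst p (z \<otimes> snd p) - fst p (snd p \<otimes> z) \<in> {0}}" using centreD(1)[OF z] by simp
    qed
    show "?I \<subseteq> centre G"
    proof
      fix z assume z: "z \<in> ?I"
      have fz: "z \<in> carrier G \<and> f (z \<otimes> x) = f (x \<otimes> z)" if "f \<in> C_G" "x \<in> carrier G" for f x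
        using INT_D[OF z, of "(f, x)"] that by simp
      have zc: "z \<in> carrier G" using fz[OF C_G_const[of 0] one_closed] by simp
      have "z \<otimes> x = x \<otimes> z" if x: "x \<in> carrier G" for x
      proof (rule ccontr)
        assume "z \<otimes> x \<noteq> x \<otimes> z"
        moreover have "closedin T {x \<otimes> z}" using closedin_Hausdorff_singleton[OF hausdorff] x zc topspace_eq_carrier by simp
        ultimately obtain f where "f \<in> C_G" "f (z \<otimes> x) = 0" "\<forall>y\<in>{x \<otimes> z}. f y = 1"
          using separating_function[of "{x \<otimes> z}" "z \<otimes> x"] x zc by (metis m_closed singletonD)
        then show False using fz[of f x] x by simp
      qed
      then show "z \<in> centre G" unfolding centre_def using zc by simp
    qed
  qed
  also have "closedin T \<dots>"
  proof (rule closedin_INT)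
    show "C_G \<times> carrier G \<noteq> {}" using C_G_const one_closed by blast
    fix p assume "p \<in> C_G \<times> carrier G"
    then have p: "fst p \<in> C_G" "snd p \<in> carrier G" by auto
    show "closedin T {z \<in> carrier G. fst p (z \<otimes> snd p) - fst p (snd p \<otimes> z) \<in> {0}}"
      by (rule closedin_C_G_preimage[OF C_G_diff[OF C_G_right[OF p] C_G_left[OF p]]]) simp
  qed
  finally show ?thesis .
qed

lemma compact_hausdorff_group_centre:
  "compact_hausdorff_group (G\<lparr>carrier := centre G\<rparr>) (subtopology T (centre G))"
proof -
  let ?Z = "centre G" and ?S = "subtopology T (centre G)"
  have sub: "?Z \<subseteq> topspace T" using centreD(1) topspace_eq_carrier by blast
  have ts: "topspace ?S = ?Z" by (rule topspace_subtopology_subset[OF sub])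
  interpret Z: group "G\<lparr>carrier := centre G\<rparr>" by (rule subgroup.subgroup_is_group[OF subgroup_centre is_group])
  show ?thesis
  proof
    show "topspace ?S = carrier (G\<lparr>carrier := centre G\<rparr>)" using ts by simp
    have "continuous_map (prod_topology ?S ?S) T (\<lambda>(x, y). x \<otimes> y)"
      unfolding subtopology_Times[symmetric] by (rule continuous_map_from_subtopology[OF continuous_mult])
    moreover have "(\<lambda>(x, y). x \<otimes> y) \<in> topspace (prod_topology ?S ?S) \<rightarrow> ?Z"
      unfolding topspace_prod_topology ts using subgroup.m_closed[OF subgroup_centre] by auto
    ultimately show "continuous_map (prod_topology ?S ?S) ?S (\<lambda>(x, y). x \<otimes>\<^bsub>G\<lparr>carrier := centre G\<rparr>\<^esub> y)"
      by (simp add: continuous_map_in_subtopology)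
    have "continuous_map ?S ?S (\<lambda>x. inv x)"
      unfolding continuous_map_in_subtopology ts
      using continuous_map_from_subtopology[OF continuous_inv] subgroup.m_inv_closed[OF subgroup_centre] by auto
    then show "continuous_map ?S ?S (\<lambda>x. inv\<^bsub>G\<lparr>carrier := centre G\<rparr>\<^esub> x)"
      by (rule continuous_map_eq) (simp add: ts m_inv_consistent[OF subgroup_centre])
    show "compact_space ?S"
      using closedin_compact_space[OF compact closedin_centre] by (simp add: compact_space_subtopology)
    show "Hausdorff_space ?S" by (rule Hausdorff_space_subtopology[OF hausdorff])
  qed
qed

text \<open>A subgroup on which \<open>\<gamma>\<close> stays within distance 1 of 1 lies in the
  kernel by \<open>near_one_subgroup\<close>. Finite index then makes \<open>\<gamma>\<close> finite
  on the centre, whereas \<open>infinite_on_centre\<close> provides central values near 1 and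
  different from 1.\<close>

lemma torsion_if_centre_profinite:
  assumes P: "profinite_group (G\<lparr>carrier := centre G\<rparr>) (subtopology T (centre G))" and \<gamma>: "character \<gamma>"
  shows "torsion_character \<gamma>"
proof (rule ccontr)
  assume "\<not> torsion_character \<gamma>"
  then have inf: "infinite (\<gamma> ` carrier G)" using finite_image_torsion[OF \<gamma>] by blast
  let ?Z = "centre G" and ?S = "subtopology T (centre G)"
  let ?H = "G\<lparr>carrier := centre G\<rparr>"
  define U where "U = {z \<in> ?Z. cmod (\<gamma> z - 1) < 1}"
  have "closedin T {x \<in> carrier G. \<gamma> x - 1 \<in> {w. 1 \<le> cmod w}}"
    by (rule closedin_C_G_preimage[OF C_G_diff[OF characterD(1)[OF \<gamma>] C_G_const]])
      (intro closed_Collect_le continuous_intros)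
  then have "openin T (topspace T - {x \<in> carrier G. \<gamma> x - 1 \<in> {w. 1 \<le> cmod w}})" by blast
  moreover have "(topspace T - {x \<in> carrier G. \<gamma> x - 1 \<in> {w. 1 \<le> cmod w}}) \<inter> ?Z = U"
    unfolding U_def topspace_eq_carrier using centreD(1) by auto
  ultimately have "openin ?S U" using openin_subtopology_Int by metis
  moreover have "\<one> \<in> U" unfolding U_def using characterD(2)[OF \<gamma>] subgroup.one_closed[OF subgroup_centre] by simp
  ultimately have "\<one> \<in> ?S interior_of U" using interior_of_openin by blast
  then have "\<exists>N. N \<lhd> ?H \<and> finite (rcosets\<^bsub>?H\<^esub> N) \<and> N \<subseteq> U"
    using profinite_group.small_normal_subgroups[OF P] by simp
  then obtain N where N: "N \<lhd> ?H" "finite (rcosets\<^bsub>?H\<^esub> N)" "N \<subseteq> U" by blast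
  have sN: "subgroup N ?H" by (rule normal_imp_subgroup[OF N(1)])
  have NZ: "N \<subseteq> ?Z" using subgroup.subset[OF sN] by simp
  have g1: "\<gamma> n = 1" if n: "n \<in> N" for n
  proof (rule near_one_subgroup)
    have nc: "n \<in> carrier G" using n NZ centreD(1) by blast
    then show "cmod (\<gamma> n) = 1" by (rule character_norm[OF \<gamma>])
    fix k :: nat
    have "n [^] k \<in> N"
    proof (induction k)
      case 0 show ?case using subgroup.one_closed[OF sN] by simp
    next
      case (Suc k) then show ?case using subgroup.m_closed[OF sN Suc n] by simp
    qed
    then have "cmod (\<gamma> (n [^] k) - 1) < 1" using N(3) unfolding U_def by blast
    then show "cmod (\<gamma> n ^ k - 1) < 1" using character_pow[OF \<gamma> nc] by simp
  qed
  have coset: "\<gamma> y = \<gamma> z" if z: "z \<in> ?Z" and y: "y \<in> N #>\<^bsub>?H\<^esub> z" for y z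
  proof -
    obtain n where n: "n \<in> N" "y = n \<otimes> z" using y unfolding r_coset_def by auto
    then show ?thesis using characterD(3)[OF \<gamma>, of n z] g1 NZ centreD(1) z by (simp add: subset_iff)
  qed
  have "\<gamma> ` ?Z \<subseteq> (\<lambda>C. \<gamma> (SOME y. y \<in> C)) ` (rcosets\<^bsub>?H\<^esub> N)"
  proof
    fix w assume "w \<in> \<gamma> ` ?Z"
    then obtain z where z: "z \<in> ?Z" "w = \<gamma> z" by blast
    have "\<one> \<otimes> z \<in> N #>\<^bsub>?H\<^esub> z" unfolding r_coset_def using subgroup.one_closed[OF sN] by auto
    then have "(SOME y. y \<in> N #>\<^bsub>?H\<^esub> z) \<in> N #>\<^bsub>?H\<^esub> z" by (rule someI)
    then have "w = \<gamma> (SOME y. y \<in> N #>\<^bsub>?H\<^esub> z)" using coset[OF z(1)] z(2) by simp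
    moreover have "N #>\<^bsub>?H\<^esub> z \<in> rcosets\<^bsub>?H\<^esub> N" unfolding RCOSETS_def using z(1) by auto
    ultimately show "w \<in> (\<lambda>C. \<gamma> (SOME y. y \<in> C)) ` (rcosets\<^bsub>?H\<^esub> N)" by (rule image_eqI)
  qed
  then have fin: "finite (\<gamma> ` ?Z)" using N(2) finite_surj by blast
  \<comment> \<open>Distances from 1 of the nontrivial values on the centre. The inserted 1 makes
    the set nonempty and ensures \<open>s \<le> 1/4\<close>.\<close>
  define D where "D = insert 1 ((\<lambda>w. cmod (w - 1)) ` (\<gamma> ` ?Z - {1}))"
  have D: "finite D" "D \<noteq> {}" unfolding D_def using fin by simp_all
  have Dpos: "d > 0" if "d \<in> D" for d using that unfolding D_def by auto
  \<comment> \<open>A quarter of the minimum: the element found has distance at most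
    \<open>2 * s\<close>, half of the minimum, and at least \<open>s / 2 > 0\<close>.\<close>
  define s where "s = Min D / 4"
  have s0: "0 < s" unfolding s_def using Dpos[OF Min_in[OF D]] by simp
  have "Min D \<le> 1" by (rule Min_le[OF D(1)]) (simp add: D_def)
  then have s1: "s \<le> 1/4" unfolding s_def by simp
  obtain z where z: "z \<in> ?Z" "s / 2 \<le> cmod (\<gamma> z - 1)" "cmod (\<gamma> z - 1) \<le> 2 * s"
    by (rule infinite_on_centre[OF \<gamma> inf s0 s1])
  have "\<gamma> z \<noteq> 1" using z(2) s0 by auto
  then have "cmod (\<gamma> z - 1) \<in> D" unfolding D_def using z(1) by blast
  then have "Min D \<le> cmod (\<gamma> z - 1)" by (rule Min_le[OF D(1)])
  then show False using z(3) s0 unfolding s_def by simp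
qed

lemma block_function_central_translates_finite:
  assumes tors: "\<And>\<gamma>. character \<gamma> \<Longrightarrow> torsion_character \<gamma>" and e: "e \<in> block_functions C_G"
  obtains \<psi> where "finite (\<psi> ` centre G)" "\<forall>z\<in>centre G. \<forall>x\<in>carrier G. e (z \<otimes> x) = \<psi> z * e x"
proof -
  obtain B \<psi> where B: "invariant_basis B" "B \<noteq> {}" "central_scalars B \<psi>" "e \<in> B"
    using e unfolding block_functions_def block_def by blast
  obtain m where m: "m > 0" "\<forall>z\<in>centre G. \<psi> z ^ m = 1" using central_scalars_torsion[OF tors B(1-3)] by blast
  have "\<psi> ` centre G \<subseteq> {w. w ^ m = 1}" using m(2) by blast
  moreover have "finite {w::complex. w ^ m = 1}" using m(1) by (intro finite_roots_unity) simp
  ultimately have "finite (\<psi> ` centre G)" by (rule finite_subset)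
  then show ?thesis by (rule that) (use B(3,4) in \<open>simp add: central_scalars_def\<close>)
qed

text \<open>A neighbourhood of the identity is detected by one function, up to 1/3 by finitely many
  block functions, and on each of them the centre acts through finitely many scalars.\<close>

lemma centre_profinite_if_torsion:
  assumes tors: "\<And>\<gamma>. character \<gamma> \<Longrightarrow> torsion_character \<gamma>"
  shows "profinite_group (G\<lparr>carrier := centre G\<rparr>) (subtopology T (centre G))"
proof -
  let ?Z = "centre G" and ?S = "subtopology T (centre G)"
  let ?H = "G\<lparr>carrier := centre G\<rparr>"
  interpret Z: compact_hausdorff_group ?H ?S by (rule compact_hausdorff_group_centre)
  have Zc: "z \<in> carrier G" if "z \<in> ?Z" for z using centreD(1)[OF that] .
  have Zm: "x \<otimes> y \<in> ?Z" if "x \<in> ?Z" "y \<in> ?Z" for x y by (rule subgroup.m_closed[OF subgroup_centre that])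
  have Zi: "inv x \<in> ?Z" if "x \<in> ?Z" for x by (rule subgroup.m_inv_closed[OF subgroup_centre that])
  have Z1: "\<one> \<in> ?Z" by (rule subgroup.one_closed[OF subgroup_centre])
  have "\<exists>N. N \<lhd> ?H \<and> finite (rcosets\<^bsub>?H\<^esub> N) \<and> N \<subseteq> U" if U: "\<one>\<^bsub>?H\<^esub> \<in> ?S interior_of U" for U
  proof -
    obtain V where "openin ?S V" "\<one> \<in> V" "V \<subseteq> U" using U unfolding interior_of_def by auto
    then obtain W where W: "openin T W" "\<one> \<in> W" "W \<inter> ?Z \<subseteq> U" unfolding openin_subtopology by blast
    have "closedin T (topspace T - W)" using W(1) by blast
    moreover have "\<one> \<notin> topspace T - W" using W(2) by blast
    ultimately obtain f where f: "f \<in> C_G" "f \<one> = 0" "\<forall>x\<in>topspace T - W. f x = 1"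
      by (rule separating_function[OF _ one_closed])
    \<comment> \<open>\<open>f\<close> is 0 at the identity and 1 off \<open>W\<close>; two errors
      of 1/3 leave \<open>cmod (f z) \<le> 2/3\<close> for \<open>z\<close> in the stabiliser, which
      forces \<open>z\<close> into \<open>W\<close>.\<close>
    have third: "(1/3::real) > 0" by simp
    obtain g where g: "g \<in> block_span C_G" "\<forall>x\<in>carrier G. cmod (f x - g x) \<le> 1/3"
      by (rule block_span_dense[OF translation_space_C_G f(1) third])
    obtain S where S: "finite S" "S \<subseteq> block_functions C_G" "g \<in> fspan S" by (rule block_spanE[OF g(1)])
    obtain c where c: "\<And>x. x \<in> carrier G \<Longrightarrow> g x = (\<Sum>e\<in>S. c e * e x)" using S(3) by (elim fspanE) blast
    have "\<forall>e\<in>S. \<exists>\<psi>. finite (\<psi> ` ?Z) \<and> (\<forall>z\<in>?Z. \<forall>x\<in>carrier G. e (z \<otimes> x) = \<psi> z * e x)"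
    proof
      fix e assume "e \<in> S"
      then have "e \<in> block_functions C_G" using S(2) by blast
      from block_function_central_translates_finite[OF tors this]
      show "\<exists>\<psi>. finite (\<psi> ` ?Z) \<and> (\<forall>z\<in>?Z. \<forall>x\<in>carrier G. e (z \<otimes> x) = \<psi> z * e x)" by metis
    qed
    then obtain \<Psi> where "\<forall>e\<in>S. finite (\<Psi> e ` ?Z) \<and> (\<forall>z\<in>?Z. \<forall>x\<in>carrier G. e (z \<otimes> x) = \<Psi> e z * e x)"
      by (rule bchoice[THEN exE])
    then have \<Psi>: "\<And>e. e \<in> S \<Longrightarrow> finite (\<Psi> e ` ?Z)"
      "\<And>e z x. e \<in> S \<Longrightarrow> z \<in> ?Z \<Longrightarrow> x \<in> carrier G \<Longrightarrow> e (z \<otimes> x) = \<Psi> e z * e x" by simp_all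
    \<comment> \<open>Defined as a common stabiliser, not through the scalars, so that the subgroup
      axioms follow from the action alone.\<close>
    define N where "N = {z \<in> ?Z. \<forall>e\<in>S. \<forall>x\<in>carrier G. e (z \<otimes> x) = e x}"
    have NI: "z \<in> N" if "z \<in> ?Z" "\<And>e x. e \<in> S \<Longrightarrow> x \<in> carrier G \<Longrightarrow> e (z \<otimes> x) = e x" for z
      unfolding N_def using that by simp
    have ND: "z \<in> ?Z" "e \<in> S \<Longrightarrow> x \<in> carrier G \<Longrightarrow> e (z \<otimes> x) = e x" if "z \<in> N" for z e x
      using that unfolding N_def by simp_all
    have "subgroup N ?H"
    proof (rule Z.subgroupI)
      show "N \<subseteq> carrier ?H" using ND(1) by auto
      show "N \<noteq> {}" using NI[OF Z1] by auto
      fix y assume y: "y \<in> N"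
      have "inv y \<in> N"
      proof (rule NI[OF Zi[OF ND(1)[OF y]]])
        fix e x assume e: "e \<in> S" and x: "x \<in> carrier G"
        have yc: "y \<in> carrier G" by (rule Zc[OF ND(1)[OF y]])
        have "e (y \<otimes> (inv y \<otimes> x)) = e (inv y \<otimes> x)" using ND(2)[OF y e, of "inv y \<otimes> x"] x yc by simp
        moreover have "y \<otimes> (inv y \<otimes> x) = x" using yc x by (simp add: m_assoc[symmetric])
        ultimately show "e (inv y \<otimes> x) = e x" by simp
      qed
      then show "inv\<^bsub>?H\<^esub> y \<in> N" using m_inv_consistent[OF subgroup_centre ND(1)[OF y]] by simp
      fix z assume z: "z \<in> N"
      have "y \<otimes> z \<in> N"
      proof (rule NI[OF Zm[OF ND(1)[OF y] ND(1)[OF z]]])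
        fix e x assume e: "e \<in> S" and x: "x \<in> carrier G"
        have yz: "y \<in> carrier G" "z \<in> carrier G" using Zc ND(1) y z by blast+
        show "e (y \<otimes> z \<otimes> x) = e x"
          using ND(2)[OF y e, of "z \<otimes> x"] ND(2)[OF z e x] m_assoc[OF yz x] yz x by simp
      qed
      then show "y \<otimes>\<^bsub>?H\<^esub> z \<in> N" by simp
    qed
    moreover have "comm_group ?H"
      by (rule Z.group_comm_groupI) (use centreD in auto)
    ultimately have norm: "N \<lhd> ?H" using comm_group.subgroup_imp_normal by blast
    \<comment> \<open>The coset of \<open>z\<close> depends only on this tuple of scalars.
      Restriction to \<open>S\<close> places the tuples in a finite product, so the index is
      finite.\<close>
    define \<Phi> where "\<Phi> z = restrict (\<lambda>e. \<Psi> e z) S" for z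
    have "\<Phi> ` ?Z \<subseteq> (\<Pi>\<^sub>E e\<in>S. \<Psi> e ` ?Z)" unfolding \<Phi>_def by auto
    then have fin\<Phi>: "finite (\<Phi> ` ?Z)" using finite_PiE[OF S(1), of "\<lambda>e. \<Psi> e ` ?Z"] \<Psi>(1) finite_subset by blast
    have coset: "N #>\<^bsub>?H\<^esub> y = N #>\<^bsub>?H\<^esub> z" if y: "y \<in> ?Z" and z: "z \<in> ?Z" and eq: "\<Phi> y = \<Phi> z" for y z
    proof -
      have yz: "y \<in> carrier G" "z \<in> carrier G" using Zc y z by blast+
      have "y \<otimes> inv z \<in> N"
      proof (rule NI[OF Zm[OF y Zi[OF z]]])
        fix e x assume e: "e \<in> S" and x: "x \<in> carrier G"
        have "\<Psi> e y = \<Psi> e z" using fun_cong[OF eq, of e] e unfolding \<Phi>_def by simp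
        moreover have ix: "inv z \<otimes> x \<in> carrier G" using x yz by simp
        ultimately have "e (y \<otimes> (inv z \<otimes> x)) = e (z \<otimes> (inv z \<otimes> x))"
          using \<Psi>(2)[OF e y ix] \<Psi>(2)[OF e z ix] by simp
        moreover have "z \<otimes> (inv z \<otimes> x) = x" using yz x by (simp add: m_assoc[symmetric])
        ultimately show "e (y \<otimes> inv z \<otimes> x) = e x" using yz x by (simp add: m_assoc)
      qed
      moreover have "y = y \<otimes> inv z \<otimes> z" using yz by (simp add: m_assoc)
      ultimately have "y \<in> N #>\<^bsub>?H\<^esub> z" unfolding r_coset_def by auto
      then show ?thesis using Z.repr_independence[OF _ _ \<open>subgroup N ?H\<close>] z by simp
    qed
    have "rcosets\<^bsub>?H\<^esub> N \<subseteq> (\<lambda>w. N #>\<^bsub>?H\<^esub> (SOME y. y \<in> ?Z \<and> \<Phi> y = w)) ` (\<Phi> ` ?Z)"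
    proof
      fix C assume "C \<in> rcosets\<^bsub>?H\<^esub> N"
      then obtain z where z: "z \<in> ?Z" "C = N #>\<^bsub>?H\<^esub> z" unfolding RCOSETS_def by auto
      define y where "y = (SOME y. y \<in> ?Z \<and> \<Phi> y = \<Phi> z)"
      have "z \<in> ?Z \<and> \<Phi> z = \<Phi> z" using z(1) by simp
      then have "y \<in> ?Z \<and> \<Phi> y = \<Phi> z" unfolding y_def by (rule someI)
      then have "C = N #>\<^bsub>?H\<^esub> y" using coset[of y z] z by simp
      then show "C \<in> (\<lambda>w. N #>\<^bsub>?H\<^esub> (SOME y. y \<in> ?Z \<and> \<Phi> y = w)) ` (\<Phi> ` ?Z)"
        unfolding y_def using z(1) by (intro image_eqI[of _ _ "\<Phi> z"] imageI)
    qed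
    then have "finite (rcosets\<^bsub>?H\<^esub> N)" using finite_surj[OF fin\<Phi>] by blast
    moreover have "N \<subseteq> U"
    proof
      fix z assume z: "z \<in> N"
      have zc: "z \<in> carrier G" by (rule Zc[OF ND(1)[OF z]])
      have "g z = g \<one>" unfolding c[OF zc] c[OF one_closed]
      proof (rule sum.cong[OF refl])
        fix e assume "e \<in> S"
        then show "c e * e z = c e * e \<one>" using ND(2)[OF z _ one_closed] zc by simp
      qed
      moreover have "cmod (f z - g z) \<le> 1/3" "cmod (f \<one> - g \<one>) \<le> 1/3" using g(2) zc by simp_all
      ultimately have "cmod (f z) < 1"
        using norm_triangle_ineq4[of "f z - g z" "f \<one> - g \<one>"] f(2) by simp
      then have "z \<in> W" using f(3) zc unfolding topspace_eq_carrier by force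
      then show "z \<in> U" using W(3) ND(1)[OF z] by blast
    qed
    ultimately show ?thesis using norm by blast
  qed
  then show ?thesis by unfold_locales
qed

lemma self_adjoint_if_torsion:
  assumes tors: "\<And>\<gamma>. character \<gamma> \<Longrightarrow> torsion_character \<gamma>" and A: "invariant_algebra G T A"
  shows "self_adjoint T A"
  unfolding self_adjoint_def topspace_eq_carrier
proof
  fix f assume f: "f \<in> A"
  have "A \<subseteq> mspace (complex_cfunspace T)"
    using A unfolding invariant_algebra_def closed_unital_subalgebra_def closedin_cfunspace_iff by blast
  then have "restrict f (carrier G) = f" using cfunspace_C_G f extensional_restrict by blast
  then have "f \<in> {f. restrict f (carrier G) \<in> A}" using f by simp
  from self_adjoint_if_characters_torsion[OF tors multiplicative_space_of_invariant_algebra[OF A] this]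
  show "(\<lambda>x\<in>carrier G. cnj (f x)) \<in> A" by simp
qed

end

theorem theorem16:
  fixes G :: "('a, 'b) monoid_scheme" and T :: "'a topology"
  assumes "compact_hausdorff_group G T"
  shows "(\<forall>A. invariant_algebra G T A \<longrightarrow> self_adjoint T A) \<longleftrightarrow>
    profinite_group (G\<lparr>carrier := centre G\<rparr>) (subtopology T (centre G))"
proof
  interpret compact_hausdorff_group G T by fact
  show "profinite_group (G\<lparr>carrier := centre G\<rparr>) (subtopology T (centre G))"
    if "\<forall>A. invariant_algebra G T A \<longrightarrow> self_adjoint T A"
    using that torsion_if_all_self_adjoint by (intro centre_profinite_if_torsion) blast
  show "\<forall>A. invariant_algebra G T A \<longrightarrow> self_adjoint T A"
    if "profinite_group (G\<lparr>carrier := centre G\<rparr>) (subtopology T (centre G))"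
    using torsion_if_centre_profinite[OF that] self_adjoint_if_torsion by blast
qed

end
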